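(* The coverability problem for Recursive Petri Nets is EXPSPACE-complete: given a marked RPN $(\mathcal N,s_0)$ and a state $s_f$ of $\mathcal N$, deciding whether there exists a finite firing sequence $s_0\xrightarrow{\sigma}s$ with $s_f\preceq s$ is EXPSPACE-complete (with respect to the size of the encoding of $(\mathcal N,s_0,s_f)$).
   Context: A Recursive Petri Net (RPN) is a tuple $\mathcal N=\langle P,T,W^+,W^-,\Omega\rangle$ where $P$ is a finite set of places, $T=T_{el}\uplus T_{ab}\uplus T_{\tau}$ is a finite set of transitions disjoint from $P$ (elementary, abstract and cut transitions), $W^-\in\mathbb N^{P\times T}$, $W^+\in\mathbb N^{P\times(T_{el}\uplus T_{ab})}$, and $\Omega:T_{ab}\to\mathbb N^P$. Write $W^{\pm}(t)\in\mathbb N^P$ for the column of $t$; markings are compared componentwise. A (concrete) state is either the empty tree $\emptyset$ or a finite rooted tree whose vertices (threads) are taken from a fixed countably infinite set $\mathcal V$, each vertex $v$ labelled by a marking $M_s(v)\in\mathbb N^P$ and each edge labelled by a vector in $\{W^+(t):t\in T_{ab}\}$. Firing rule: a thread $v$ of a state $s\neq\emptyset$ can fire $t$ if $W^-(t)\le M_s(v)$, giving $s\xrightarrow{(v,t)}s'$ where: if $t\in T_{el}$, the marking of $v$ becomes $M_s(v)-W^-(t)+W^+(t)$; if $t\in T_{ab}$, the marking of $v$ becomes $M_s(v)-W^-(t)$ and a new child $w$ of $v$ (a vertex never used before) is created with marking $\Omega(t)$ and edge $v\to w$ labelled $W^+(t)$; if $t\in T_\tau$, the subtree rooted at $v$ is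 deleted, and if $v$ is the root the result is $\emptyset$, otherwise the marking of the parent $u$ of $v$ is increased by the label of the edge $u\to v$. A marked RPN $(\mathcal N,s_0)$ is an RPN with an initial state. Quasi-order on states: $\emptyset\preceq s$ for every state $s$; for $s\neq\emptyset$, $s\preceq s'$ iff there is an injective map $f$ from the vertices of $s$ to those of $s'$ such that $M_s(v)\le M_{s'}(f(v))$ for every vertex $v$ and for every edge $v\to w$ of $s$ labelled $m$ there is an edge $f(v)\to f(w)$ of $s'$ labelled $m'\ge m$. *)

theory Defs
  imports Main
begin

section \<open>Recursive Petri nets\<close>

type_synonym 'p marking = "'p \<Rightarrow> nat"

text \<open>
  Places and transitions have different types, so disjointness of the set of places from the
  set of transitions is automatic. Markings are total functions, but only their values on
  \<open>places N\<close> are ever compared or encoded. Likewise \<open>Wplus N t\<close> is only used for elementary and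
  abstract \<open>t\<close>, and \<open>Omega N t\<close> only for abstract \<open>t\<close>.
\<close>

record ('p, 't) rpn =
  places :: "'p set"
  elementary :: "'t set"
  abstract :: "'t set"
  cut :: "'t set"
  Wminus :: "'t \<Rightarrow> 'p marking"
  Wplus :: "'t \<Rightarrow> 'p marking"
  Omega :: "'t \<Rightarrow> 'p marking"

definition is_rpn :: "('p, 't) rpn \<Rightarrow> bool" where
  "is_rpn N \<longleftrightarrow>
     finite (places N) \<and> finite (elementary N) \<and> finite (abstract N) \<and> finite (cut N) \<and>
     elementary N \<inter> abstract N = {} \<and> elementary N \<inter> cut N = {} \<and> abstract N \<inter> cut N = {}"

definition marking_le :: "('p, 't) rpn \<Rightarrow> 'p marking \<Rightarrow> 'p marking \<Rightarrow> bool" where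
  "marking_le N m m' \<longleftrightarrow> (\<forall>p\<in>places N. m p \<le> m' p)"

text \<open>Threads are drawn from the countably infinite set of natural numbers.\<close>

type_synonym thread = nat

record 'p state =
  threads :: "thread set"
  edges :: "(thread \<times> thread) set"
  marking_of :: "thread \<Rightarrow> 'p marking"
  label :: "thread \<times> thread \<Rightarrow> 'p marking"

definition is_root :: "'p state \<Rightarrow> thread \<Rightarrow> bool" where
  "is_root s r \<longleftrightarrow> r \<in> threads s \<and> (\<forall>u. (u, r) \<notin> edges s)"

definition rooted_tree :: "'p state \<Rightarrow> bool" where
  "rooted_tree s \<longleftrightarrow>
     finite (threads s) \<and> edges s \<subseteq> threads s \<times> threads s \<and>
     (\<exists>r. is_root s r \<and>
        (\<forall>v\<in>threads s. (r, v) \<in> (edges s)\<^sup>* \<and> (v \<noteq> r \<longrightarrow> (\<exists>!u. (u, v) \<in> edges s))))"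

definition is_empty_tree :: "'p state \<Rightarrow> bool" where
  "is_empty_tree s \<longleftrightarrow> threads s = {} \<and> edges s = {}"

definition is_state :: "('p, 't) rpn \<Rightarrow> 'p state \<Rightarrow> bool" where
  "is_state N s \<longleftrightarrow> is_empty_tree s \<or>
     (rooted_tree s \<and>
      (\<forall>e\<in>edges s. \<exists>t\<in>abstract N. \<forall>p\<in>places N. label s e p = Wplus N t p))"

definition subtree_threads :: "'p state \<Rightarrow> thread \<Rightarrow> thread set" where
  "subtree_threads s v = {w. (v, w) \<in> (edges s)\<^sup>*}"

definition empty_tree :: "'p state" where
  "empty_tree = \<lparr>threads = {}, edges = {}, marking_of = (\<lambda>_ _. 0), label = (\<lambda>_ _. 0)\<rparr>"

definition enabled :: "('p, 't) rpn \<Rightarrow> 'p state \<Rightarrow> thread \<Rightarrow> 't \<Rightarrow> bool" where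
  "enabled N s v t \<longleftrightarrow> v \<in> threads s \<and> marking_le N (Wminus N t) (marking_of s v)"

text \<open>
  \<open>fires N U s (v, t) s'\<close>: thread \<open>v\<close> of \<open>s\<close> fires \<open>t\<close>, leading to \<open>s'\<close>; here \<open>U\<close> is the set of
  all threads used so far in the run, so that a created thread has never occurred before, even
  if it has been deleted in the meantime.
\<close>

inductive fires ::
  "('p, 't) rpn \<Rightarrow> thread set \<Rightarrow> 'p state \<Rightarrow> thread \<times> 't \<Rightarrow> 'p state \<Rightarrow> bool"
  for N :: "('p, 't) rpn" and U :: "thread set" and s :: "'p state" where
  fire_elementary:
    "\<lbrakk>t \<in> elementary N; enabled N s v t\<rbrakk> \<Longrightarrow>
     fires N U s (v, t)
       (s\<lparr>marking_of := (marking_of s)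
            (v := \<lambda>p. marking_of s v p - Wminus N t p + Wplus N t p)\<rparr>)"
| fire_abstract:
    "\<lbrakk>t \<in> abstract N; enabled N s v t; w \<notin> U; w \<notin> threads s\<rbrakk> \<Longrightarrow>
     fires N U s (v, t)
       \<lparr>threads = insert w (threads s),
        edges = insert (v, w) (edges s),
        marking_of = (marking_of s)
          (v := \<lambda>p. marking_of s v p - Wminus N t p,
           w := Omega N t),
        label = (label s)((v, w) := Wplus N t)\<rparr>"
| fire_cut_root:
    "\<lbrakk>t \<in> cut N; enabled N s v t; is_root s v\<rbrakk> \<Longrightarrow>
     fires N U s (v, t) empty_tree"
| fire_cut_child:
    "\<lbrakk>t \<in> cut N; enabled N s v t; (u, v) \<in> edges s\<rbrakk> \<Longrightarrow>
     fires N U s (v, t)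
       \<lparr>threads = threads s - subtree_threads s v,
        edges = {(x, y) \<in> edges s. x \<notin> subtree_threads s v \<and> y \<notin> subtree_threads s v},
        marking_of = (marking_of s)
          (u := \<lambda>p. marking_of s u p + label s (u, v) p),
        label = label s\<rparr>"

text \<open>\<open>firing_sequence N s0 \<sigma> U s\<close>: firing \<open>\<sigma>\<close> from \<open>s0\<close> leads to \<open>s\<close>, with \<open>U\<close> the threads used.\<close>

inductive firing_sequence ::
  "('p, 't) rpn \<Rightarrow> 'p state \<Rightarrow> (thread \<times> 't) list \<Rightarrow> thread set \<Rightarrow> 'p state \<Rightarrow> bool"
  for N :: "('p, 't) rpn" and s0 :: "'p state" where
  firing_Nil: "firing_sequence N s0 [] (threads s0) s0"
| firing_snoc:
    "\<lbrakk>firing_sequence N s0 \<sigma> U s; fires N U s a s'\<rbrakk> \<Longrightarrow>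
     firing_sequence N s0 (\<sigma> @ [a]) (U \<union> threads s') s'"

definition state_le :: "('p, 't) rpn \<Rightarrow> 'p state \<Rightarrow> 'p state \<Rightarrow> bool" where
  "state_le N s s' \<longleftrightarrow> is_empty_tree s \<or>
     (\<exists>f. inj_on f (threads s) \<and> f ` threads s \<subseteq> threads s' \<and>
        (\<forall>v\<in>threads s. marking_le N (marking_of s v) (marking_of s' (f v))) \<and>
        (\<forall>(v, w)\<in>edges s. (f v, f w) \<in> edges s' \<and>
           marking_le N (label s (v, w)) (label s' (f v, f w))))"

definition coverable :: "('p, 't) rpn \<Rightarrow> 'p state \<Rightarrow> 'p state \<Rightarrow> bool" where
  "coverable N s0 sf \<longleftrightarrow> (\<exists>\<sigma> U s. firing_sequence N s0 \<sigma> U s \<and> state_le N sf s)"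

section \<open>Encoding of instances as bit strings\<close>

text \<open>
  All codes are self-delimiting (no code word is a proper prefix of another one), hence
  concatenation of codes is uniquely decodable. Numbers are written in binary, least significant
  bit first and without leading zeros.
\<close>

fun bits :: "nat \<Rightarrow> bool list" where
  "bits n = (if n = 0 then [] else odd n # bits (n div 2))"

declare bits.simps [simp del]

definition enc_list :: "('a \<Rightarrow> bool list) \<Rightarrow> 'a list \<Rightarrow> bool list" where
  "enc_list e xs = concat (map (\<lambda>x. True # e x) xs) @ [False]"

definition enc_nat :: "nat \<Rightarrow> bool list" where
  "enc_nat n = enc_list (\<lambda>b. [b]) (bits n)"

definition enc_set :: "(nat \<Rightarrow> bool list) \<Rightarrow> nat set \<Rightarrow> bool list" where
  "enc_set e A = enc_list (\<lambda>a. enc_nat a @ e a) (sorted_list_of_set A)"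

definition enc_marking :: "(nat, 't) rpn \<Rightarrow> nat marking \<Rightarrow> bool list" where
  "enc_marking N m = enc_list (\<lambda>p. enc_nat (m p)) (sorted_list_of_set (places N))"

definition enc_rpn :: "(nat, nat) rpn \<Rightarrow> bool list" where
  "enc_rpn N =
     enc_set (\<lambda>_. []) (places N) @
     enc_set (\<lambda>t. enc_marking N (Wminus N t) @ enc_marking N (Wplus N t)) (elementary N) @
     enc_set (\<lambda>t. enc_marking N (Wminus N t) @ enc_marking N (Wplus N t) @
                  enc_marking N (Omega N t)) (abstract N) @
     enc_set (\<lambda>t. enc_marking N (Wminus N t)) (cut N)"

text \<open>For each thread, a state code lists its marking and its children with their edge labels.\<close>

definition enc_state :: "(nat, nat) rpn \<Rightarrow> nat state \<Rightarrow> bool list" where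
  "enc_state N s =
     enc_set
       (\<lambda>v. enc_marking N (marking_of s v) @
            enc_set (\<lambda>w. enc_marking N (label s (v, w))) {w. (v, w) \<in> edges s})
       (threads s)"

definition enc_instance :: "(nat, nat) rpn \<Rightarrow> nat state \<Rightarrow> nat state \<Rightarrow> bool list" where
  "enc_instance N s0 sf = enc_rpn N @ enc_state N s0 @ enc_state N sf"

definition coverability_problem :: "bool list set" where
  "coverability_problem =
     {enc_instance N s0 sf | N s0 sf.
        is_rpn N \<and> is_state N s0 \<and> is_state N sf \<and> coverable N s0 sf}"

section \<open>Deterministic multi-tape Turing machines and EXPSPACE\<close>

text \<open>
  Tapes are infinite in both directions. Symbols are natural numbers below \<open>num_symbols M\<close>:
  0 is the blank, and 1 and 2 are the input bits. States are natural numbers below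
  \<open>num_states M\<close>: 0 is initial, 1 accepting and 2 rejecting.
\<close>

datatype move = Left | Stay | Right

fun move_head :: "move \<Rightarrow> int \<Rightarrow> int" where
  "move_head Left h = h - 1"
| "move_head Stay h = h"
| "move_head Right h = h + 1"

record tm =
  num_tapes :: nat
  num_symbols :: nat
  num_states :: nat
  delta :: "nat \<Rightarrow> nat list \<Rightarrow> nat \<times> (nat \<times> move) list"

definition is_tm :: "tm \<Rightarrow> bool" where
  "is_tm M \<longleftrightarrow>
     1 \<le> num_tapes M \<and> 3 \<le> num_symbols M \<and> 3 \<le> num_states M \<and>
     (\<forall>q < num_states M. \<forall>as. length as = num_tapes M \<and> (\<forall>a\<in>set as. a < num_symbols M) \<longrightarrow>
        (case delta M q as of (q', acts) \<Rightarrow>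
           q' < num_states M \<and> length acts = num_tapes M \<and>
           (\<forall>(a, _)\<in>set acts. a < num_symbols M)))"

type_synonym tape = "(int \<Rightarrow> nat) \<times> int"
type_synonym config = "nat \<times> tape list"

definition contents :: "bool list \<Rightarrow> int \<Rightarrow> nat" where
  "contents x i =
     (if 0 \<le> i \<and> i < int (length x) then (if x ! nat i then 2 else 1) else 0)"

definition initial_config :: "tm \<Rightarrow> bool list \<Rightarrow> config" where
  "initial_config M x =
     (0, (contents x, 0) # replicate (num_tapes M - 1) (\<lambda>_. 0, 0))"

definition is_final :: "config \<Rightarrow> bool" where
  "is_final c \<longleftrightarrow> fst c = 1 \<or> fst c = 2"

fun act :: "nat \<times> move \<Rightarrow> tape \<Rightarrow> tape" where
  "act (a, d) (c, h) = (c(h := a), move_head d h)"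

definition step :: "tm \<Rightarrow> config \<Rightarrow> config" where
  "step M c =
     (if is_final c then c
      else case delta M (fst c) (map (\<lambda>(z, h). z h) (snd c)) of
        (q', acts) \<Rightarrow> (q', map2 act acts (snd c)))"

definition run :: "tm \<Rightarrow> bool list \<Rightarrow> nat \<Rightarrow> config" where
  "run M x n = (step M ^^ n) (initial_config M x)"

definition decides :: "tm \<Rightarrow> bool list set \<Rightarrow> bool" where
  "decides M L \<longleftrightarrow> (\<forall>x. \<exists>n. fst (run M x n) = (if x \<in> L then 1 else 2))"

text \<open>
  Space is measured by the distance of the heads from the origin, on all tapes. The number of
  visited cells differs from this by at most a constant factor (plus a constant), which is
  immaterial for exponential bounds.
\<close>

definition within_space :: "tm \<Rightarrow> bool list \<Rightarrow> nat \<Rightarrow> bool" where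
  "within_space M x b \<longleftrightarrow> (\<forall>n. \<forall>(_, h)\<in>set (snd (run M x n)). \<bar>h\<bar> \<le> int b)"

definition EXPSPACE :: "bool list set set" where
  "EXPSPACE =
     {L. \<exists>M k. is_tm M \<and> decides M L \<and>
           (\<forall>x. within_space M x (2 ^ (length x ^ k + k)))}"

text \<open>The output of a machine is the content of its last tape when it halts.\<close>

definition polytime_computable :: "(bool list \<Rightarrow> bool list) \<Rightarrow> bool" where
  "polytime_computable f \<longleftrightarrow>
     (\<exists>M k. is_tm M \<and>
        (\<forall>x. \<exists>n \<le> length x ^ k + k.
           is_final (run M x n) \<and> fst (last (snd (run M x n))) = contents (f x)))"

definition polytime_reducible :: "bool list set \<Rightarrow> bool list set \<Rightarrow> bool" where
  "polytime_reducible A B \<longleftrightarrow>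
     (\<exists>f. polytime_computable f \<and> (\<forall>x. x \<in> A \<longleftrightarrow> f x \<in> B))"

definition EXPSPACE_hard :: "bool list set \<Rightarrow> bool" where
  "EXPSPACE_hard L \<longleftrightarrow> (\<forall>A\<in>EXPSPACE. polytime_reducible A L)"

definition EXPSPACE_complete :: "bool list set \<Rightarrow> bool" where
  "EXPSPACE_complete L \<longleftrightarrow> L \<in> EXPSPACE \<and> EXPSPACE_hard L"

end

(*
  Membership. A thread interacts with the subtree of a child only when that child is cut, so it suffices to
  know, for each way to create a thread, which goals its subtree can achieve: be cut, match a given thread of
  the target together with the subtree below it, or contain a match of the whole target. For a fixed guess of
  the achievable goals, a single thread is a vector addition system in which a child is one token, and by
  Rackoff's argument its coverability questions have runs whose length is doubly exponential. The target is
  coverable iff every guess that is closed under these questions contains the goal for the initial root. All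
  quantifiers range over numbers with exponentially many bits and reachability is decided by recursive
  doubling, so exponential space suffices.

  Hardness. Nets without abstract transitions already suffice. A machine with exponential space is simulated by
  counters that are bounded by E = 2^2^m, and a counter is zero iff E tokens can be removed from its complement.
  As in the construction of Mayr and Meyer, a net of size polynomial in m adds exactly E tokens by repeated
  squaring. All its rules are reversible, so an invariant that is preserved in both directions excludes every
  other outcome, and the net run backwards removes exactly E tokens.
*)
theory Submission
 imports Defs "HOL-Library.FuncSet" "HOL-Library.Multiset"
begin

section \<open>Structured programs for Turing machines\<close>

text \<open>Machines are needed twice, for a decision procedure in exponential space and for a
  reduction in polynomial time. Both come from one class: functions computed by register programs in
  time polynomial in the numeric values of designated arguments. If these are the input length and
  positions, this is polynomial time. If a doubly exponential number is supplied as an argument,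
  binary registers with exponentially many digits suffice, and quantifiers over instances, guesses
  and vectors become bounded loops.

  Two obstacles shape the rest. Names in the input are binary, so index ranges are exponential, and
  Rackoff's exponent has to be bounded by the number of coordinates that really occur. And the
  generator net may run forwards or backwards or be left halfway; its invariant therefore lives in
  the integers and lets the nonnegativity of actual token counts exclude transfers that stop too
  early.\<close>

datatype com =
  Act "nat list => (nat*move) list"
 | Seq com com
 | If "nat list => bool" com com
 | While "nat list => bool" com

definition syms :: "tape list => nat list" where
 "syms ts = map (%(z, h). z h) ts"

fun cstep :: "com list*tape list => com list*tape list" where
 "cstep ([], ts) = ([], ts)"
| "cstep (Act f # k, ts) = (k, map2 act (f (syms ts)) ts)"
| "cstep (Seq c d # k, ts) = (c # d # k, ts)"
| "cstep (If p c d # k, ts) = ((if p (syms ts) then c else d) # k, ts)"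
| "cstep (While p c # k, ts) = (if p (syms ts) then c # While p c # k else k, ts)"

definition within :: "int => tape list => bool" where
 "within b ts = (ALL (z, h) : set ts. \<bar>h\<bar> <= b)"

text \<open>The quantifier over the continuation \<open>k\<close> makes the relation compositional:
  the run of \<open>c\<close> must not depend on what follows. All intermediate configurations are
  recorded because space has to be bounded, not only time.\<close>

definition go :: "int => com => tape list => nat => tape list => bool" where
 "go b c ts t ts' = (ALL k. (cstep ^^ t) (c # k, ts) = (k, ts') &
   (ALL i<=t. within b (snd ((cstep ^^ i) (c # k, ts)))))"

text \<open>Every compound command first takes one step that exposes a subcommand; the resulting
  case split at \<open>Suc t\<close> is done here once. \<open>kk k\<close> is the work that remains
  after the subcommand; for \<open>If\<close> it is \<open>k\<close> itself, with
  \<open>u = 0\<close>.\<close>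

lemma go_comp:
 assumes c: "go b c ts t ts1" and d: "!!k. (cstep ^^ u) (kk k, ts1) = (k, ts2) & (ALL i<=u. within b (snd ((cstep ^^ i) (kk k, ts1))))"
  and 1: "!!k. cstep (e # k, ts) = (c # kk k, ts)"
 shows "go b e ts (Suc (u+t)) ts2"
 unfolding go_def
proof (intro allI conjI impI)
 fix k i
 have A: "(cstep ^^ Suc (j+t)) (e # k, ts) = (cstep ^^ j) (kk k, ts1)" for j
  using c[unfolded go_def, THEN spec, of "kk k"] by (simp add: funpow_Suc_right funpow_add 1 del: funpow.simps)
 show "(cstep ^^ Suc (u+t)) (e # k, ts) = (k, ts2)"
  using d[of k] by (simp add: A del: funpow.simps)
 assume i: "i<=Suc (u+t)"
 show "within b (snd ((cstep ^^ i) (e # k, ts)))"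
 proof (cases "i<=Suc t")
  case True
  have "within b ts" using c[unfolded go_def, THEN spec, of "kk k"] by force
  moreover have "within b (snd ((cstep ^^ j) (c # kk k, ts)))" if "j<=t" for j
   using that c[unfolded go_def, THEN spec, of "kk k"] by blast
  ultimately show ?thesis using True
   by (cases i) (auto simp: funpow_Suc_right 1 simp del: funpow.simps(2))
 next
  case False
  then obtain j where "i = Suc (j+t)" by (metis add.commute add_Suc_right le_Suc_ex nle_le)
  thus ?thesis using i d[of k] by (simp add: A del: funpow.simps)
 qed
qed

lemma go_Act: "within b ts ==> within b ts' ==> ts' = map2 act (f (syms ts)) ts ==> go b (Act f) ts 1 ts'"
 by (auto simp: go_def le_Suc_eq)

lemma go_Seq: "go b c ts t ts1 ==> go b d ts1 u ts2 ==> go b (Seq c d) ts (Suc (u+t)) ts2"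
 by (rule go_comp[where kk = "%k. d # k"]) (auto simp: go_def)

lemma go_within:
 assumes "go b c ts t ts'"
 shows "within b ts" "within b ts'"
 using assms[unfolded go_def, THEN spec, of "[]", THEN conjunct2, THEN spec, of 0]
  assms[unfolded go_def, THEN spec, of "[]", THEN conjunct2, THEN spec, of t]
  assms[unfolded go_def, THEN spec, of "[]", THEN conjunct1] by auto

lemma go_If:
 "go b (if p (syms ts) then c else d) ts t ts' ==> go b (If p c d) ts (Suc t) ts'"
 using go_comp[where kk = "%k. k" and u = 0 and e = "If p c d"] go_within(2) by auto

lemma go_While_False: "within b ts ==> ~ p (syms ts) ==> go b (While p c) ts 1 ts"
 by (auto simp: go_def le_Suc_eq)

lemma go_While_True:
 "p (syms ts) ==> go b c ts t ts1 ==> go b (While p c) ts1 u ts2 ==> go b (While p c) ts (Suc (u+t)) ts2"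
 by (rule go_comp[where kk = "%k. While p c # k"]) (auto simp: go_def)

section \<open>From programs to Turing machines\<close>

fun wfc :: "nat => com => bool" where
 "wfc m (Act f) = (ALL as. length as = m & (ALL a:set as. a<3) --> length (f as) = m & (ALL (a, _):set (f as). a<3))"
| "wfc m (Seq c d) = (wfc m c & wfc m d)"
| "wfc m (If p c d) = (wfc m c & wfc m d)"
| "wfc m (While p c) = wfc m c"

text \<open>The continuations that can arise while \<open>c\<close> is executed with continuation \<open>k\<close>.\<close>

fun conts :: "com => com list => com list set" where
 "conts (Act f) k = {Act f # k}"
| "conts (Seq c d) k = insert (Seq c d # k) (conts c (d # k) Un conts d k)"
| "conts (If p c d) k = insert (If p c d # k) (conts c k Un conts d k)"
| "conts (While p c) k = insert (While p c # k) (conts c (While p c # k))"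

text \<open>A \<open>While\<close> body runs with the loop itself as continuation, so the recursion
  only follows subcommands. These finitely many continuations become the states of the
  machine.\<close>

lemma finite_conts: "finite (conts c k)"
 by (induct c arbitrary: k) auto

lemma conts_self: "c # k : conts c k"
 by (cases c) auto

lemma conts_closed: "k1 : conts c k ==> fst (cstep (k1, ts)) : insert k (conts c k)"
proof (induct c arbitrary: k1 k)
 case (Seq c d)
 show ?case using Seq(1)[of k1 "d # k"] Seq(2)[of k1 k] Seq(3) conts_self[of d k] conts_self[of c "d # k"] by auto
next
 case (If p c d)
 show ?case using If(1)[of k1 k] If(2)[of k1 k] If(3) conts_self[of d k] conts_self[of c k] by auto
next
 case (While p c)
 show ?case using While(1)[of k1 "While p c # k"] While(2) conts_self[of c "While p c # k"] by (auto split: if_splits)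
qed auto

lemma conts_wf: "k1 : conts c k ==> wfc m c ==> ALL d:set k. wfc m d ==> ALL d:set k1. wfc m d"
proof (induct c arbitrary: k1 k)
 case (Seq c d)
 show ?case using Seq(1)[of k1 "d # k"] Seq(2)[of k1 k] Seq(3-) by auto
next
 case (While p c)
 show ?case using While(1)[of k1 "While p c # k"] While(2-) by auto
qed auto

definition cont_set :: "com => com list set" where
 "cont_set c = insert [] (conts c [])"

text \<open>The whole program gets the initial state 0; the final states 1 and 2 are left free for
  the answer.\<close>

definition cont_idx :: "com => com list => nat" where
 "cont_idx c = (SOME g. g [c] = 0 & inj_on g (cont_set c) & (ALL k. g k ~= 1 & g k ~= 2))"

lemma cont_idx: "cont_idx c [c] = 0 & inj_on (cont_idx c) (cont_set c) & (ALL k. cont_idx c k ~= 1 & cont_idx c k ~= 2)"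
proof -
 have "finite (cont_set c)" by (simp add: cont_set_def finite_conts)
 then obtain g :: "com list => nat" where g: "inj_on g (cont_set c)"
  using finite_imp_inj_to_nat_seg by metis
 define h where "h k = (if k = [c] then 0 else g k+3)" for k
 have "h [c] = 0 & inj_on h (cont_set c) & (ALL k. h k ~= 1 & h k ~= 2)"
  using g by (auto simp: h_def inj_on_def)
 thus ?thesis unfolding cont_idx_def by (rule someI[where P = "%g. g [c] = 0 & inj_on g (cont_set c) & (ALL k. g k ~= 1 & g k ~= 2)"])
qed

text \<open>The value for states outside the image is not consulted in a run, it only serves
  \<open>is_tm\<close>. At the empty continuation the answer is read off tape 1, which will hold
  register 0 in binary: its first cell is blank exactly for the value 0.\<close>

definition mk_tm :: "nat => com => tm" where
 "mk_tm m c = \<lparr>num_tapes = m, num_symbols = 3,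
   num_states = Suc (Max (insert 2 (cont_idx c ` cont_set c))),
   delta = (%q as. let stay = map (%a. (a, Stay)) as; k = inv_into (cont_set c) (cont_idx c) q in
    if q ~: cont_idx c ` cont_set c then (1, stay) else
    case k of [] => (if as ! 1 = 0 then 2 else 1, stay)
    | Act f # k => (cont_idx c k, f as)
    | Seq d e # k => (cont_idx c (d # e # k), stay)
    | If p d e # k => (cont_idx c ((if p as then d else e) # k), stay)
    | While p d # k => (cont_idx c (if p as then d # While p d # k else k), stay))\<rparr>"

lemma cont_set_closed: "k : cont_set c ==> fst (cstep (k, ts)) : cont_set c"
 using conts_closed[of k c "[]" ts] by (auto simp: cont_set_def)

lemma cont_idx_bound: "k : cont_set c ==> cont_idx c k<num_states (mk_tm m c)"
proof -
 assume "k : cont_set c"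
 hence "cont_idx c k<=Max (insert 2 (cont_idx c ` cont_set c))"
  by (intro Max_ge) (auto simp: cont_set_def finite_conts)
 thus ?thesis by (simp add: mk_tm_def less_Suc_eq_le)
qed

lemma mk_tm_step:
 assumes "k : cont_set c" "k ~= []"
 shows "step (mk_tm m c) (cont_idx c k, ts) = apfst (cont_idx c) (cstep (k, ts))"
proof -
 have 1: "inv_into (cont_set c) (cont_idx c) (cont_idx c k) = k" "cont_idx c k : cont_idx c ` cont_set c"
  using cont_idx[of c] assms by auto
 have 2: "~ is_final (cont_idx c k, ts)" using cont_idx[of c] by (simp add: is_final_def)
 have 3: "map2 act (map (%a. (a, Stay)) (map (%(z, h). z h) ts)) ts = ts"
  by (auto simp: list_eq_iff_nth_eq split: prod.splits)
 obtain d k' where k: "k = d # k'" using assms(2) by (cases k) auto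
 show ?thesis
  using 1 2 3 by (cases d) (auto simp: step_def mk_tm_def k Let_def syms_def)
qed

lemma mk_tm_final_step:
 assumes "length ts = m" "1<m"
 shows "step (mk_tm m c) (cont_idx c [], ts) = (if syms ts ! 1 = 0 then 2 else 1, ts)"
proof -
 have 1: "inv_into (cont_set c) (cont_idx c) (cont_idx c []) = []" "cont_idx c [] : cont_idx c ` cont_set c"
  using cont_idx[of c] by (auto simp: cont_set_def)
 have 2: "~ is_final (cont_idx c [], ts)" using cont_idx[of c] by (simp add: is_final_def)
 have 3: "map2 act (map (%a. (a, Stay)) (map (%(z, h). z h) ts)) ts = ts"
  by (auto simp: list_eq_iff_nth_eq split: prod.splits)
 show ?thesis
  using 1 2 3 by (auto simp: step_def mk_tm_def Let_def syms_def)
qed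

lemma mk_tm_is_tm:
 assumes "wfc m c" "1<m"
 shows "is_tm (mk_tm m c)"
proof -
 have B: "cont_idx c k<num_states (mk_tm m c)" if "k : cont_set c" for k
  using cont_idx_bound that by blast
 have A: "case delta (mk_tm m c) q as of (q', acts) =>
      q'<num_states (mk_tm m c) & length acts = m & (ALL (a, _):set acts. a<3)"
  if q: "q<num_states (mk_tm m c)" and as: "length as = m" "ALL a:set as. a<3" for q as
 proof -
  have n: "2<num_states (mk_tm m c)" by (simp add: mk_tm_def finite_conts cont_set_def less_Suc_eq_le)
  show ?thesis
  proof (cases "q : cont_idx c ` cont_set c")
   case False
   thus ?thesis using n as by (auto simp: mk_tm_def Let_def)
  next
   case True
   define k where "k = inv_into (cont_set c) (cont_idx c) q"
   have k: "k : cont_set c" using True by (simp add: k_def inv_into_into)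
   have cl: "fst (cstep (k, [(%_. a, 0). a <- as])) : cont_set c"
    using k by (rule cont_set_closed)
   have sy: "syms [(%_. a, 0). a <- as] = as" by (auto simp: syms_def intro: nth_equalityI)
   have wf: "ALL d:set k. wfc m d"
    using k conts_wf[OF _ assms(1), of k "[]"] by (auto simp: cont_set_def)
   show ?thesis
   proof (cases k)
    case Nil
    thus ?thesis using True as n by (auto simp: mk_tm_def Let_def k_def[symmetric])
   next
    case (Cons d k')
    show ?thesis
     using B[OF cl] True as wf sy
     by (cases d) (auto simp: mk_tm_def Let_def k_def[symmetric] Cons split: if_splits)
   qed
  qed
 qed
 have s: "2<=Max (insert 2 (cont_idx c ` cont_set c))" by (simp add: finite_conts cont_set_def)
 thus ?thesis using A assms(2) s
  unfolding is_tm_def by (auto simp: mk_tm_def)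
qed

definition init_tapes :: "nat => bool list => tape list" where
 "init_tapes m x = (contents x, 0) # replicate (m-1) (%_. 0, 0)"

lemma within_mono: "within b ts ==> b<=b' ==> within b' ts"
 by (force simp: within_def)

theorem mk_tm_run:
 assumes go: "go b c (init_tapes m x) t ts'" and m: "1<m" "length ts' = m"
 shows "run (mk_tm m c) x (Suc t) = (if syms ts' ! 1 = 0 then 2 else 1, ts')"
  and "within b (snd (run (mk_tm m c) x n))"
proof -
 let ?M = "mk_tm m c"
 have init: "initial_config ?M x = (cont_idx c [c], init_tapes m x)"
  using cont_idx[of c] by (simp add: initial_config_def init_tapes_def mk_tm_def)
 define f where "f i = (cstep ^^ i) ([c], init_tapes m x)" for i
 have ft: "f t = ([], ts')" and fb: "!!i. i<=t ==> within b (snd (f i))"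
  using go[unfolded go_def, THEN spec, of "[]"] by (auto simp: f_def)
 have mem: "fst (f i) : cont_set c" for i
 proof (induct i)
  case (Suc i)
  thus ?case using cont_set_closed[of "fst (f i)" c "snd (f i)"] by (simp add: f_def)
 qed (simp add: f_def cont_set_def conts_self)
 \<comment> \<open>\<open>go\<close> promises the empty continuation after \<open>t\<close> steps,
   but it may be reached earlier. The machine leaves the simulation at the first such time
   \<open>t0\<close>, from which on \<open>cstep\<close> no longer moves.\<close>
 have "fst (f t) = []" using ft by simp
 then obtain t0 where t0: "fst (f t0) = []" "t0<=t" "!!i. i<t0 ==> fst (f i) ~= []"
  using LeastI[of "%i. fst (f i) = []" t] Least_le[of "%i. fst (f i) = []" t]
   not_less_Least[of _ "%i. fst (f i) = []"] by metis
 have st: "f (t0+j) = f t0" for j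
 proof (induct j)
  case (Suc j)
  thus ?case using t0(1) by (cases "f t0") (simp add: f_def)
 qed simp
 have ft0: "f t0 = ([], ts')" using st[of "t-t0"] t0(2) ft by simp
 have R: "run ?M x i = apfst (cont_idx c) (f i)" if "i<=t0" for i
  using that
 proof (induct i)
  case 0
  thus ?case by (simp add: run_def init f_def)
 next
  case (Suc i)
  thus ?case using mk_tm_step[OF mem[of i], of m "snd (f i)"] t0(3)[of i]
   by (cases "f i") (simp add: run_def f_def)
 qed
 have F: "run ?M x (Suc t0+j) = (if syms ts' ! 1 = 0 then 2 else 1, ts')" for j
 proof (induct j)
  case 0
  thus ?case using R[of t0] mk_tm_final_step[OF m(2,1)] by (simp add: run_def ft0)
 next
  case (Suc j)
  thus ?case by (simp add: run_def step_def is_final_def)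
 qed
 show "run (mk_tm m c) x (Suc t) = (if syms ts' ! 1 = 0 then 2 else 1, ts')"
  using F[of "t-t0"] t0(2) by simp
 show "within b (snd (run (mk_tm m c) x n))"
 proof (cases "n<=t0")
  case True
  thus ?thesis using R[of n] fb[of n] t0(2) by (cases "f n") simp
 next
  case False
  then obtain j where "n = Suc t0+j" by (metis add_Suc_shift le_iff_add not_less_eq_eq add_Suc)
  thus ?thesis using F[of j] fb[of t] ft by simp
 qed
qed

section \<open>Register programs\<close>

lemma within_upd: "within b ts ==> \<bar>h\<bar> <= b ==> within b (ts[r := (z, h)])"
 using set_update_subset_insert[of ts r "(z, h)"] by (force simp: within_def)

definition on :: "nat => (nat => nat*move) => com" where
 "on r g = Act (%as. (map (%a. (a, Stay)) as)[r := g (as ! r)])"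

lemma syms_upd [simp]: "r<length ts ==> syms (ts[r := (z, h)]) ! r = z h"
 by (simp add: syms_def)

lemma wfc_on: "(!!a. a<3 ==> fst (g a)<3) ==> r<m ==> wfc m (on r g)"
 unfolding on_def wfc.simps
proof (intro allI impI, elim conjE, intro conjI)
 fix as :: "nat list" assume g: "!!a. a<3 ==> fst (g a)<3" and r: "r<m" and l: "length as = m" and s: "ALL a:set as. a<3"
 show "ALL (a, _):set ((map (%a. (a, Stay)) as)[r := g (as ! r)]). a<3"
 proof
  fix y assume "y : set ((map (%a. (a, Stay)) as)[r := g (as ! r)])"
  hence "y = g (as ! r) \<or> y : set (map (%a. (a, Stay)) as)"
   using set_update_subset_insert by fastforce
  moreover have "fst (g (as ! r))<3" using g s r l by simp
  ultimately have "fst y<3" using s by auto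
  thus "case y of (a, _) => a<3" by (cases y) simp
 qed
qed simp

text \<open>Stated for an updated list, so that content and head of tape \<open>r\<close> are
  explicit while all other tapes stay arbitrary.\<close>

lemma go_on:
 assumes "within b ts" "r<length ts" "\<bar>h\<bar> <= b" "\<bar>move_head d h\<bar> <= b" "g (z h) = (a, d)"
 shows "go b (on r g) (ts[r := (z, h)]) 1 (ts[r := (z(h := a), move_head d h)])"
 unfolding on_def
proof (rule go_Act)
 show "within b (ts[r := (z, h)])" "within b (ts[r := (z(h := a), move_head d h)])"
  using assms by (auto intro: within_upd)
 show "ts[r := (z(h := a), move_head d h)] =
  map2 act ((map (%a. (a, Stay)) (syms (ts[r := (z, h)])))[r := g (syms (ts[r := (z, h)]) ! r)]) (ts[r := (z, h)])"
  using assms by (intro nth_equalityI) (auto simp: nth_list_update syms_def split: prod.splits)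
qed

lemma contents_write: "(contents (u@a # l))(int (length u) := (if b then 2 else 1)) = contents (u@b # l)"
 by (auto simp: contents_def fun_eq_iff nth_append nth_Cons' split: if_splits)

lemma contents_extend: "(contents u)(int (length u) := (if b then 2 else 1)) = contents (u@[b])"
 by (auto simp: contents_def fun_eq_iff nth_append split: if_splits)

lemma contents_erase: "(contents (u@[a]))(int (length u) := 0) = contents u"
 by (auto simp: contents_def fun_eq_iff nth_append split: if_splits)

lemma contents_at: "contents (u@a # l) (int (length u)) = (if a then 2 else 1)"
 by (simp add: contents_def)

lemma contents_end: "contents u (int (length u)) = 0"
 by (simp add: contents_def)

text \<open>Relies on the blank cell at position -1, left of every word; having found it, the head
  goes back by one cell.\<close>

definition rewind :: "nat => com" where
 "rewind r = Seq (While (%as. as ! r ~= 0) (on r (%a. (a, Left)))) (on r (%a. (a, Right)))"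

lemma go_rewind:
 assumes "within b ts" "r<length ts" "n<=length l" "int (length l)+1<=b"
 shows "EX t<=2*n+4. go b (rewind r) (ts[r := (contents l, int n-1)]) t (ts[r := (contents l, 0)])"
proof -
 let ?W = "While (%as. as ! r ~= 0) (on r (%a. (a, Left)))"
 have blank: "contents l (-1) = 0" by (simp add: contents_def)
 have "go b ?W (ts[r := (contents l, int n-1)]) (2*n+1) (ts[r := (contents l, -1)])"
  using assms(3)
 proof (induct n)
  case 0
  show ?case using assms blank by (auto intro!: go_While_False[unfolded One_nat_def] within_upd)
 next
  case (Suc n)
  have 1: "go b (on r (%a. (a, Left))) (ts[r := (contents l, int n)]) 1 (ts[r := (contents l, int n-1)])"
   using go_on[OF assms(1,2), of "int n" Left "%a. (a, Left)" "contents l" "contents l (int n)"] assms Suc.prems by simp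
  have "syms (ts[r := (contents l, int n)]) ! r ~= 0" using assms(2) Suc.prems by (simp add: contents_def)
  from go_While_True[where p = "%as. as ! r ~= 0", OF this 1 Suc.hyps] Suc.prems
  show ?case by simp
 qed
 moreover have "go b (on r (%a. (a, Right))) (ts[r := (contents l, -1)]) 1 (ts[r := (contents l, 0)])"
  using go_on[OF assms(1,2), of "-1" Right "%a. (a, Right)" "contents l" "contents l (-1)"] assms by simp
 ultimately have "go b (rewind r) (ts[r := (contents l, int n-1)]) (Suc (1+(2*n+1))) (ts[r := (contents l, 0)])"
  unfolding rewind_def by (rule go_Seq)
 thus ?thesis by (intro exI[of _ "Suc (1+(2*n+1))"]) simp
qed

section \<open>Binary increment and decrement\<close>

fun incl :: "bool list => bool list" where
 "incl [] = [True]"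
| "incl (True # l) = False # incl l"
| "incl (False # l) = True # l"

text \<open>Borrowing from a top digit 1 has to delete it, otherwise the result would have a leading
  zero and not be \<open>bits\<close> of a number.\<close>

fun decl :: "bool list => bool list" where
 "decl [] = []"
| "decl (True # l) = (if l = [] then [] else False # l)"
| "decl (False # l) = True # decl l"

lemma bits_0 [simp]: "bits 0 = []" by (simp add: bits.simps)

lemma bits_rec: "0<n ==> bits n = odd n # bits (n div 2)" by (simp add: bits.simps)

lemma bits_eq_Nil [simp]: "(bits n = []) = (n = 0)" by (simp add: bits.simps)

lemma incl_bits: "incl (bits n) = bits (Suc n)"
proof (induct n rule: less_induct)
 case (less n)
 show ?case
 proof (cases "n = 0")
  case True
  thus ?thesis by (simp add: bits_rec)
 next
  case False
  thus ?thesis using less[of "n div 2"] by (cases "even n") (auto simp: bits_rec[of n] bits_rec[of "Suc n"])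
 qed
qed

lemma decl_bits: "0<n ==> decl (bits n) = bits (n-1)"
proof (induct n rule: less_induct)
 case (less n)
 show ?case
 proof (cases "even n")
  case True
  then obtain j where j: "n = 2*j" by blast
  hence "(n-1) div 2 = j-1" "odd (n-1)" "0<j" using less.prems by auto
  thus ?thesis using less(1)[of j] less.prems j bits_rec[of n] bits_rec[of "n-1"] by simp
 next
  case False
  then obtain j where j: "n = 2*j+1" by (meson oddE)
  thus ?thesis using bits_rec[of n] bits_rec[of "n-1"] by (cases "j = 0") auto
 qed
qed

lemma length_bits: "n<2^k ==> length (bits n)<=k"
proof (induct k arbitrary: n)
 case (Suc k)
 thus ?case by (cases "n = 0") (auto simp: bits_rec)
qed simp

definition inc :: "nat => com" where
 "inc r = Seq (While (%as. as ! Suc r = 2) (on (Suc r) (%_. (1, Right)))) (Seq (on (Suc r) (%_. (2, Left))) (rewind (Suc r)))"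

text \<open>\<open>u\<close> is the part already scanned, in its new form. The loop stops at the
  first 0 (\<open>l0 = False # l'\<close>) or at the blank behind the number
  (\<open>l0 = []\<close>); writing 1 there gives the result in both cases.\<close>

lemma inc_loop:
 assumes "within b ts" "r<length ts" "int (length (u@l))+1<=b"
 shows "EX u' l0 l'. (l0 = [] & l' = [] \<or> l0 = False # l') & u@incl l = u'@True # l' & length (u'@l0)<=length (u@l) &
   (EX t<=2*length l+1. go b (While (%as. as ! r = 2) (on r (%_. (1, Right)))) (ts[r := (contents (u@l), int (length u))]) t
    (ts[r := (contents (u'@l0), int (length u'))]))"
 using assms(3)
proof (induct l arbitrary: u)
 case Nil
 have "go b (While (%as. as ! r = 2) (on r (%_. (1, Right)))) (ts[r := (contents u, int (length u))]) 1 (ts[r := (contents u, int (length u))])"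
  using assms Nil by (intro go_While_False within_upd) (auto simp: contents_end)
 thus ?case by (intro exI[of _ u] exI[of _ "[]"]) auto
next
 case (Cons a l)
 let ?W = "While (%as. as ! r = 2) (on r (%_. (1, Right)))"
 show ?case
 proof (cases a)
  case False
  have "go b ?W (ts[r := (contents (u@a # l), int (length u))]) 1 (ts[r := (contents (u@a # l), int (length u))])"
   using assms Cons(2) False by (intro go_While_False within_upd) (auto simp: contents_at)
  thus ?thesis using False by (intro exI[of _ u] exI[of _ "False # l"] exI[of _ l]) auto
 next
  case True
  have 1: "go b (on r (%_. (1, Right))) (ts[r := (contents (u@a # l), int (length u))]) 1 (ts[r := (contents ((u@[False])@l), int (length (u@[False])))])"
   using go_on[OF assms(1,2), of "int (length u)" Right "%_. (1, Right)" "contents (u@a # l)" 1] Cons(2) contents_write[of u a l False]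
   by (simp add: add.commute)
  from Cons(1)[of "u@[False]"] Cons(2) obtain u' l0 l' t where *:
   "l0 = [] & l' = [] \<or> l0 = False # l'" "(u@[False])@incl l = u'@True # l'" "length (u'@l0)<=length (u@a # l)"
   "t<=2*length l+1" "go b ?W (ts[r := (contents ((u@[False])@l), int (length (u@[False])))]) t
    (ts[r := (contents (u'@l0), int (length u'))])"
   by auto
  have "syms (ts[r := (contents (u@a # l), int (length u))]) ! r = 2" using assms(2) True by (simp add: contents_at)
  from go_While_True[where p = "%as. as ! r = 2", OF this 1 *(5)]
  have "go b ?W (ts[r := (contents (u@a # l), int (length u))]) (Suc (t+1)) (ts[r := (contents (u'@l0), int (length u'))])" .
  thus ?thesis using * True by (intro exI[of _ u'] exI[of _ l0] exI[of _ l'] conjI exI[of _ "Suc (t+1)"]) auto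
 qed
qed

lemma go_inc:
 assumes "within b ts" "Suc r<length ts" "int (length (bits n))+2<=b"
 shows "EX t<=4*length (bits n)+12. go b (inc r) (ts[Suc r := (contents (bits n), 0)]) t (ts[Suc r := (contents (bits (Suc n)), 0)])"
proof -
 from inc_loop[OF assms(1,2), of "[]" "bits n"] assms(3) obtain u' l0 l' t where *:
   "l0 = [] & l' = [] \<or> l0 = False # l'" "incl (bits n) = u'@True # l'" "length (u'@l0)<=length (bits n)"
   "t<=2*length (bits n)+1" "go b (While (%as. as ! Suc r = 2) (on (Suc r) (%_. (1, Right)))) (ts[Suc r := (contents (bits n), 0)]) t
    (ts[Suc r := (contents (u'@l0), int (length u'))])"
  by auto
 have c: "(contents (u'@l0))(int (length u') := 2) = contents (bits (Suc n))"
  using *(1,2) contents_write[of u' False l' True] contents_extend[of u' True] by (auto simp: incl_bits)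
 have 1: "go b (on (Suc r) (%_. (2, Left))) (ts[Suc r := (contents (u'@l0), int (length u'))]) 1 (ts[Suc r := (contents (bits (Suc n)), int (length u')-1)])"
  using go_on[OF assms(1,2), of "int (length u')" Left "%_. (2, Left)" "contents (u'@l0)" 2] *(3) assms(3) c by simp
 have le: "length u'<=length (bits (Suc n))" "length (bits (Suc n))<=Suc (length (bits n))"
  using *(1-3) by (auto simp: incl_bits)
 obtain t' where t': "t'<=2*length u'+4" "go b (rewind (Suc r)) (ts[Suc r := (contents (bits (Suc n)), int (length u')-1)]) t' (ts[Suc r := (contents (bits (Suc n)), 0)])"
  using go_rewind[OF assms(1,2) le(1)] le(2) assms(3) by auto
 have "go b (inc r) (ts[Suc r := (contents (bits n), 0)]) (Suc (Suc (t'+1)+t)) (ts[Suc r := (contents (bits (Suc n)), 0)])"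
  unfolding inc_def by (rule go_Seq[OF *(5) go_Seq[OF 1 t'(2)]])
 thus ?thesis using t'(1) *(3,4) by (intro exI[of _ "Suc (Suc (t'+1)+t)"]) auto
qed

text \<open>Zeros become ones up to the first 1, which becomes 0. A look at the next cell tells
  whether that digit was the top one; in that case it is erased.\<close>

definition dec :: "nat => com" where
 "dec r = Seq (While (%as. as ! Suc r = 1) (on (Suc r) (%_. (2, Right))))
   (Seq (on (Suc r) (%_. (1, Right)))
   (Seq (If (%as. as ! Suc r = 0) (Seq (on (Suc r) (%a. (a, Left))) (on (Suc r) (%_. (0, Left)))) (on (Suc r) (%a. (a, Left))))
    (rewind (Suc r))))"

lemma dec_loop:
 assumes "within b ts" "r<length ts" "int (length (u@l))+1<=b" "True : set l"
 shows "EX u' l'. u@decl l = u'@(if l' = [] then [] else False # l') & length (u'@True # l')<=length (u@l) &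
   (EX t<=2*length l+1. go b (While (%as. as ! r = 1) (on r (%_. (2, Right)))) (ts[r := (contents (u@l), int (length u))]) t
    (ts[r := (contents (u'@True # l'), int (length u'))]))"
 using assms(3,4)
proof (induct l arbitrary: u)
 case (Cons a l)
 let ?W = "While (%as. as ! r = 1) (on r (%_. (2, Right)))"
 show ?case
 proof (cases a)
  case True
  have "go b ?W (ts[r := (contents (u@a # l), int (length u))]) 1 (ts[r := (contents (u@a # l), int (length u))])"
   using assms(1,2) Cons(2) True by (intro go_While_False within_upd) (auto simp: contents_at)
  thus ?thesis using True by (intro exI[of _ u] exI[of _ l]) auto
 next
  case False
  have 1: "go b (on r (%_. (2, Right))) (ts[r := (contents (u@a # l), int (length u))]) 1 (ts[r := (contents ((u@[True])@l), int (length (u@[True])))])"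
   using go_on[OF assms(1,2), of "int (length u)" Right "%_. (2, Right)" "contents (u@a # l)" 2] Cons(2) contents_write[of u a l True]
   by (simp add: add.commute)
  from Cons(1)[of "u@[True]"] Cons(2,3) False obtain u' l' t where *:
   "(u@[True])@decl l = u'@(if l' = [] then [] else False # l')" "length (u'@True # l')<=length (u@a # l)"
   "t<=2*length l+1" "go b ?W (ts[r := (contents ((u@[True])@l), int (length (u@[True])))]) t
    (ts[r := (contents (u'@True # l'), int (length u'))])"
   by auto
  have "syms (ts[r := (contents (u@a # l), int (length u))]) ! r = 1" using assms(2) False by (simp add: contents_at)
  from go_While_True[where p = "%as. as ! r = 1", OF this 1 *(4)]
  have "go b ?W (ts[r := (contents (u@a # l), int (length u))]) (Suc (t+1)) (ts[r := (contents (u'@True # l'), int (length u'))])" .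
  thus ?thesis using * False by (intro exI[of _ u'] exI[of _ l'] conjI exI[of _ "Suc (t+1)"]) auto
 qed
qed simp

lemma True_in_bits: "0<n ==> True : set (bits n)"
proof (induct n rule: less_induct)
 case (less n)
 thus ?case using less(1)[of "n div 2"] bits_rec[of n] by (cases "n = 1") (auto elim: oddE)
qed

lemma go_dec:
 assumes "within b ts" "Suc r<length ts" "int (length (bits n))+2<=b" "0<n"
 shows "EX t<=4*length (bits n)+16. go b (dec r) (ts[Suc r := (contents (bits n), 0)]) t (ts[Suc r := (contents (bits (n-1)), 0)])"
proof -
 let ?r = "Suc r"
 let ?I = "If (%as. as ! ?r = 0) (Seq (on ?r (%a. (a, Left))) (on ?r (%_. (0, Left)))) (on ?r (%a. (a, Left)))"
 from dec_loop[OF assms(1,2), of "[]" "bits n"] assms(3) True_in_bits[OF assms(4)] obtain u' l' t where *: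
   "decl (bits n) = u'@(if l' = [] then [] else False # l')" "length (u'@True # l')<=length (bits n)"
   "t<=2*length (bits n)+1" "go b (While (%as. as ! ?r = 1) (on ?r (%_. (2, Right)))) (ts[?r := (contents (bits n), 0)]) t
    (ts[?r := (contents (u'@True # l'), int (length u'))])"
  by auto
 let ?c = "contents (u'@False # l')" and ?u = "int (length u')"
 let ?ts = "ts[?r := (?c, ?u+1)]" and ?d = "contents (bits (n-1))"
 have 1: "go b (on ?r (%_. (1, Right))) (ts[?r := (contents (u'@True # l'), ?u)]) 1 (?ts)"
  using go_on[OF assms(1,2), of ?u Right "%_. (1, Right)" "contents (u'@True # l')" 1] *(2) assms(3) contents_write[of u' True l' False] by simp
 have bk: "go b (on ?r (%a. (a, Left))) (?ts) 1 (ts[?r := (?c, ?u)])"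
  using go_on[OF assms(1,2), of "?u+1" Left "%a. (a, Left)" ?c "?c (?u+1)"] *(2) assms(3) by simp
 have er: "go b (on ?r (%_. (0, Left))) (ts[?r := (?c, ?u)]) 1 (ts[?r := (?c(?u := 0), ?u-1)])"
  using go_on[OF assms(1,2), of "?u" Left "%_. (0, Left)" ?c 0] *(2) assms(3) by simp
 define j where "j = (if l' = [] then length u' else Suc (length u'))"
 have j: "j<=length (bits (n-1))" "length (bits (n-1))<=length (bits n)" "j<=length (bits n)"
  using *(1,2) by (auto simp: decl_bits assms(4) j_def)
 have 2: "EX t<=4. go b ?I
   (?ts) t (ts[?r := (?d, int j-1)])"
 proof (cases "l' = []")
  case True
  have e: "?c(?u := 0) = ?d" using True *(1) contents_erase[of u' False] by (simp add: decl_bits assms(4))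
  have "syms (?ts) ! ?r = 0" using assms(2) True by (simp add: contents_def)
  moreover have "go b (Seq (on ?r (%a. (a, Left))) (on ?r (%_. (0, Left)))) (?ts) 3 (ts[?r := (?d, int j-1)])"
   using go_Seq[OF bk er] True e by (simp add: j_def eval_nat_numeral)
  ultimately have "go b ?I
   (?ts) (Suc 3) (ts[?r := (?d, int j-1)])" by (intro go_If) simp
  thus ?thesis by (intro exI[of _ "Suc 3"]) simp
 next
  case False
  have e: "?c = ?d" using False *(1) by (simp add: decl_bits assms(4))
  have "syms (?ts) ! ?r ~= 0" using assms(2) False by (simp add: contents_def)
  hence "go b ?I
   (?ts) (Suc 1) (ts[?r := (?d, int j-1)])"
   using bk False by (intro go_If) (simp add: e j_def)
  thus ?thesis by (intro exI[of _ "Suc 1"]) simp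
 qed
 then obtain t2 where t2: "t2<=4" "go b ?I
   (?ts) t2 (ts[?r := (?d, int j-1)])" by blast
 obtain t' where t': "t'<=2*j+4" "go b (rewind ?r) (ts[?r := (?d, int j-1)]) t' (ts[?r := (?d, 0)])"
  using go_rewind[OF assms(1,2) j(1)] j(2) assms(3) by auto
 have "go b (dec r) (ts[?r := (contents (bits n), 0)]) (Suc (Suc (Suc (t'+t2)+1)+t)) (ts[?r := (?d, 0)])"
  unfolding dec_def by (rule go_Seq[OF *(4) go_Seq[OF 1 go_Seq[OF t2(2) t'(2)]]])
 thus ?thesis using t'(1) t2(1) *(2,3) j by (intro exI[of _ "Suc (Suc (Suc (t'+t2)+1)+t)"]) auto
qed

section \<open>Register states and the cost of programs\<close>

type_synonym rstate = "nat*(nat => nat)*bool list"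

text \<open>Between operations the register heads rest on the lowest digit, so a register is zero
  iff the symbol under its head is blank, and zero tests need no auxiliary run.\<close>

definition tapes :: "nat => bool list => rstate => tape list" where
 "tapes m x = (%(i, v, w). (contents x, int i) # map (%r. (contents (bits (v r)), 0)) [0..<m]@[(contents w, int (length w))])"

abbreviation "room m x v k B b w == (ALL r<m. v r+k<2^B) & int B+2<=b & int (length x)+2<=b & int (length w)+2<=b"

text \<open>
 \<open>nx m x c s k s'\<close>: on input \<open>x\<close>, program \<open>c\<close> leads from \<open>s\<close> to \<open>s'\<close> in at most \<open>k\<close> register
 operations. Since an operation increments at most one register, and only by one, \<open>k\<close> also bounds
 the growth of the registers and hence the space used.
\<close>

definition nx :: "nat => bool list => com => rstate => nat => rstate => bool" where
 "nx m x c s k s' = (case s of (i, v, w) => case s' of (i', v', w') =>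
   i<=length x --> (i'<=length x & (ALL r. v' r<=v r+k) & length w<=length w' &
   (ALL B b. room m x v k B b w' -->
    (EX t<=k*(6*B+20). go b c (tapes m x s) t (tapes m x s')))))"

lemma length_tapes [simp]: "length (tapes m x s) = m+2"
 by (cases s) (simp add: tapes_def)

lemma tapes_reg: "r<m ==> tapes m x (i, v(r := n), w) = (tapes m x (i, v, w))[Suc r := (contents (bits n), 0)]"
 by (rule nth_equalityI) (auto simp: tapes_def nth_list_update nth_append nth_Cons')

lemma tapes_same: "r<m ==> (tapes m x (i, v, w))[Suc r := (contents (bits (v r)), 0)] = tapes m x (i, v, w)"
 using tapes_reg[of r m x i v "v r" w] by simp

lemma sym_reg [simp]: "r<m ==> (syms (tapes m x (i, v, w)) ! Suc r = 0) = (v r = 0)"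
 using bits_eq_Nil[of "v r"] by (cases "bits (v r)") (auto simp: tapes_def syms_def nth_append contents_def)

lemma sym_input [simp]: "syms (tapes m x (i, v, w)) ! 0 = (if i<length x then if x ! i then 2 else 1 else 0)"
 by (auto simp: tapes_def syms_def contents_def)

lemma within_tapes: "i<=length x ==> int (length x)<=b ==> int (length w)<=b ==> within b (tapes m x (i, v, w))"
 by (auto simp: tapes_def within_def)

lemma nxD:
 assumes "nx m x c (i, v, w) k (i', v', w')" "i<=length x"
 shows "i'<=length x" "v' r<=v r+k" "length w<=length w'"
  "(!!r. r<m ==> v r+k<2^B) ==> int B+2<=b ==> int (length x)+2<=b ==> int (length w')+2<=b ==>
   EX t<=k*(6*B+20). go b c (tapes m x (i, v, w)) t (tapes m x (i', v', w'))"
 using assms unfolding nx_def by auto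

lemma nx_mono: "nx m x c s k s' ==> k<=k' ==> nx m x c s k' s'"
proof (cases s; cases s')
 fix i v w i' v' w' assume *: "nx m x c s k s'" "k<=k'" "s = (i, v, w)" "s' = (i', v', w')"
 show "nx m x c s k' s'"
  unfolding nx_def *(3,4) prod.case
 proof (intro impI conjI allI)
  assume i: "i<=length x"
  note H = nxD[OF *(1)[unfolded *(3,4)] i]
  show "i'<=length x" "length w<=length w'" using H(1,3) *(2) by auto
  show "v' r<=v r+k'" for r using H(2)[of r] *(2) by simp
  fix B b assume b: "room m x v k' B b w'"
  hence "ALL r<m. v r+k<2^B" using *(2) by (meson add_left_mono le_less_trans)
  then obtain t where "t<=k*(6*B+20)" "go b c (tapes m x (i, v, w)) t (tapes m x (i', v', w'))"
   using H(4)[of B b] b *(2) by auto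
  moreover have "k*(6*B+20)<=k'*(6*B+20)" using *(2) by (rule mult_le_mono1)
  ultimately show "EX t<=k'*(6*B+20). go b c (tapes m x (i, v, w)) t (tapes m x (i', v', w'))"
   using le_trans by blast
 qed
qed

text \<open>With at most \<open>B\<close> digits an increment takes at most \<open>4*B+12\<close>
  steps and a decrement at most \<open>4*B+16\<close>; the factor \<open>6*B+20\<close> in
  \<open>nx\<close> covers both.\<close>

lemma nx_inc: "r<m ==> nx m x (inc r) (i, v, w) 1 (i, v(r := Suc (v r)), w)"
 unfolding nx_def prod.case
proof (intro impI conjI allI)
 fix B b assume r: "r<m" and i: "i<=length x"
  and b: "room m x v 1 B b w"
 have l: "length (bits (v r))<=B" using b r by (intro length_bits) (metis add_lessD1)
 have "EX t<=4*length (bits (v r))+12. go b (inc r) ((tapes m x (i, v, w))[Suc r := (contents (bits (v r)), 0)]) t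
   ((tapes m x (i, v, w))[Suc r := (contents (bits (Suc (v r))), 0)])"
  using r i b l by (intro go_inc within_tapes) auto
 then obtain t where t: "t<=4*length (bits (v r))+12" "go b (inc r) (tapes m x (i, v, w)) t (tapes m x (i, v(r := Suc (v r)), w))"
  unfolding tapes_same[OF r] tapes_reg[OF r, symmetric] by force
 have "t<=1*(6*B+20)" using t(1) l by simp
 thus "EX t<=1*(6*B+20). go b (inc r) (tapes m x (i, v, w)) t (tapes m x (i, v(r := Suc (v r)), w))"
  using t(2) by blast
qed auto

lemma nx_dec: "r<m ==> 0<v r ==> nx m x (dec r) (i, v, w) 1 (i, v(r := v r-1), w)"
 unfolding nx_def prod.case
proof (intro impI conjI allI)
 fix B b assume r: "r<m" "0<v r" and i: "i<=length x"
  and b: "room m x v 1 B b w"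
 have l: "length (bits (v r))<=B" using b r by (intro length_bits) (metis add_lessD1)
 have "EX t<=4*length (bits (v r))+16. go b (dec r) ((tapes m x (i, v, w))[Suc r := (contents (bits (v r)), 0)]) t
   ((tapes m x (i, v, w))[Suc r := (contents (bits (v r-1)), 0)])"
  using r i b l by (intro go_dec within_tapes) auto
 then obtain t where t: "t<=4*length (bits (v r))+16" "go b (dec r) (tapes m x (i, v, w)) t (tapes m x (i, v(r := v r-1), w))"
  unfolding tapes_same[OF r(1)] tapes_reg[OF r(1), symmetric] by force
 have "t<=1*(6*B+20)" using t(1) l by simp
 thus "EX t<=1*(6*B+20). go b (dec r) (tapes m x (i, v, w)) t (tapes m x (i, v(r := v r-1), w))"
  using t(2) by blast
qed auto

definition right :: com where "right = on 0 (%a. (a, Right))"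

lemma nx_right: "i<length x ==> nx m x right (i, v, w) 1 (Suc i, v, w)"
 unfolding nx_def prod.case
proof (intro impI conjI allI)
 fix B b assume i: "i<length x"
  and b: "room m x v 1 B b w"
 have e: "tapes m x (j, v, w) = (tapes m x (i, v, w))[0 := (contents x, int j)]" for j
  by (simp add: tapes_def)
 have "go b right ((tapes m x (i, v, w))[0 := (contents x, int i)]) 1 ((tapes m x (i, v, w))[0 := (contents x, int (Suc i))])"
  using i b go_on[of b "tapes m x (i, v, w)" 0 "int i" Right "%a. (a, Right)" "contents x" "contents x (int i)"]
  by (simp add: right_def within_tapes add.commute)
 thus "EX t<=1*(6*B+20). go b right (tapes m x (i, v, w)) t (tapes m x (Suc i, v, w))"
  unfolding e[symmetric] by (intro exI[of _ 1]) simp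
qed auto

definition left :: com where "left = on 0 (%a. (a, Left))"

lemma nx_left: "nx m x left (Suc i, v, w) 1 (i, v, w)"
 unfolding nx_def prod.case
proof (intro impI conjI allI)
 fix B b assume i: "Suc i<=length x"
  and b: "room m x v 1 B b w"
 have e: "tapes m x (j, v, w) = (tapes m x (i, v, w))[0 := (contents x, int j)]" for j
  by (simp add: tapes_def)
 have "go b left ((tapes m x (i, v, w))[0 := (contents x, int (Suc i))]) 1 ((tapes m x (i, v, w))[0 := (contents x, int i)])"
  using i b go_on[of b "tapes m x (i, v, w)" 0 "int (Suc i)" Left "%a. (a, Left)" "contents x" "contents x (int (Suc i))"]
  by (simp add: left_def within_tapes)
 thus "EX t<=1*(6*B+20). go b left (tapes m x (Suc i, v, w)) t (tapes m x (i, v, w))"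
  unfolding e[symmetric] by (intro exI[of _ 1]) simp
qed auto

definition out :: "nat => bool => com" where
 "out m a = on (Suc m) (%_. (if a then 2 else 1, Right))"

lemma nx_out: "nx m x (out m a) (i, v, w) 1 (i, v, w@[a])"
 unfolding nx_def prod.case
proof (intro impI conjI allI)
 fix B b assume i: "i<=length x"
  and b: "room m x v 1 B b (w@[a])"
 have e: "tapes m x (i, v, u) = (tapes m x (i, v, w))[Suc m := (contents u, int (length u))]" for u
  by (simp add: tapes_def list_update_append)
 have "go b (out m a) ((tapes m x (i, v, w))[Suc m := (contents w, int (length w))]) 1 ((tapes m x (i, v, w))[Suc m := (contents (w@[a]), int (length (w@[a])))])"
  using i b go_on[of b "tapes m x (i, v, w)" "Suc m" "int (length w)" Right "%_. (if a then 2 else 1, Right)" "contents w" "if a then 2 else 1"] contents_extend[of w a]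
  by (simp add: out_def within_tapes add.commute)
 thus "EX t<=1*(6*B+20). go b (out m a) (tapes m x (i, v, w)) t (tapes m x (i, v, w@[a]))"
  unfolding e[symmetric] by (intro exI[of _ 1]) simp
qed auto

text \<open>The single step of control overhead is charged as a full operation, hence
  \<open>Suc (k+l)\<close>. The registers have grown by at most \<open>k\<close> when the second
  part starts, so the room promised for the whole also suffices for that part.\<close>

lemma nx_compose:
 assumes c: "nx m x c s k s1" and d: "nx m x d s1 l s2"
  and go: "!!b t u. go b c (tapes m x s) t (tapes m x s1) ==> go b d (tapes m x s1) u (tapes m x s2) ==>
   go b e (tapes m x s) (Suc (u+t)) (tapes m x s2)"
 shows "nx m x e s (Suc (k+l)) s2"
proof (cases s; cases s1; cases s2)
 fix i v w i1 v1 w1 i2 v2 w2 assume s: "s = (i, v, w)" "s1 = (i1, v1, w1)" "s2 = (i2, v2, w2)"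
 show ?thesis unfolding nx_def s(1,3) prod.case
 proof (intro impI conjI allI)
  assume i: "i<=length x"
  note H = nxD[OF c[unfolded s] i]
  note H2 = nxD[OF d[unfolded s] H(1)]
  have v1: "v1 r<=v r+k" and v2: "v2 r<=v1 r+l" for r using H(2) H2(2) by auto
  show "i2<=length x" "length w<=length w2" using H(3) H2(1,3) by auto
  show "v2 r<=v r+Suc (k+l)" for r using v1[of r] v2[of r] by simp
  fix B b assume b: "room m x v (Suc (k+l)) B b w2"
  have b1: "ALL r<m. v r+k<2^B" and b2: "ALL r<m. v1 r+l<2^B"
  proof (safe)
   fix r assume "r<m"
   hence "v r+Suc (k+l)<2^B" using b by blast
   thus "v r+k<2^B" "v1 r+l<2^B" using v1[of r] by auto
  qed
  obtain t where t: "t<=k*(6*B+20)" "go b c (tapes m x s) t (tapes m x s1)"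
   using H(4)[of B b] H2(3) b b1 unfolding s by auto
  then obtain u where u: "u<=l*(6*B+20)" "go b d (tapes m x s1) u (tapes m x s2)"
   using H2(4)[of B b] b b2 unfolding s by auto
  have "Suc (u+t)<=Suc (k+l)*(6*B+20)" using t(1) u(1) by (simp add: algebra_simps)
  thus "EX t<=Suc (k+l)*(6*B+20). go b e (tapes m x (i, v, w)) t (tapes m x (i2, v2, w2))"
   using go[OF t(2) u(2)] unfolding s by blast
 qed
qed

lemma nx_Seq: "nx m x c s k s1 ==> nx m x d s1 l s2 ==> nx m x (Seq c d) s (Suc (k+l)) s2"
 by (erule nx_compose) (auto intro: go_Seq)

lemma nx_While_True:
 "p (syms (tapes m x s)) ==> nx m x c s k s1 ==> nx m x (While p c) s1 l s2 ==> nx m x (While p c) s (Suc (k+l)) s2"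
 by (erule nx_compose) (auto intro: go_While_True)

lemma nx_While_False:
 assumes "~ p (syms (tapes m x s))" shows "nx m x (While p c) s 1 s"
proof (cases s)
 fix i v w assume s: "s = (i, v, w)"
 show ?thesis unfolding nx_def s prod.case
 proof (intro impI conjI allI)
  fix B b assume "i<=length x" "room m x v 1 B b w"
  hence "go b (While p c) (tapes m x (i, v, w)) 1 (tapes m x (i, v, w))"
   using assms s by (intro go_While_False within_tapes) auto
  thus "EX t<=1*(6*B+20). go b (While p c) (tapes m x (i, v, w)) t (tapes m x (i, v, w))"
   by (intro exI[of _ 1]) simp
 qed auto
qed

lemma nx_If:
 assumes "nx m x (if p (syms (tapes m x s)) then c else d) s k s'"
 shows "nx m x (If p c d) s (Suc k) s'"
proof (cases s; cases s')
 fix i v w i' v' w' assume s: "s = (i, v, w)" "s' = (i', v', w')"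
 show ?thesis unfolding nx_def s prod.case
 proof (intro impI conjI allI)
  assume i: "i<=length x"
  note H = nxD[OF assms[unfolded s] i]
  show "i'<=length x" "length w<=length w'" using H(1,3) by auto
  show "v' r<=v r+Suc k" for r using H(2)[of r] by simp
  fix B b assume b: "room m x v (Suc k) B b w'"
  hence "ALL r<m. v r+k<2^B" by (simp add: Suc_lessD)
  then obtain t where t: "t<=k*(6*B+20)" "go b (if p (syms (tapes m x s)) then c else d) (tapes m x s) t (tapes m x s')"
   using H(4)[of B b] b unfolding s by auto
  from go_If[where p = p, OF t(2)] t(1)
  show "EX t<=Suc k*(6*B+20). go b (If p c d) (tapes m x (i, v, w)) t (tapes m x (i', v', w'))"
   unfolding s by (intro exI[of _ "Suc t"]) auto
 qed
qed

lemma nx_loop: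
 assumes "!!j. j<n ==> p (syms (tapes m x (s j))) & nx m x c (s j) k (s (Suc j))" "~ p (syms (tapes m x (s n)))"
 shows "nx m x (While p c) (s 0) (n*Suc k+1) (s n)"
 using assms
proof (induct n arbitrary: s)
 case 0
 thus ?case by (simp add: nx_While_False[simplified])
next
 case (Suc n)
 have "nx m x (While p c) (s (Suc 0)) (n*Suc k+1) (s (Suc n))"
  using Suc(1)[of "%j. s (Suc j)"] Suc(2)[of "Suc _"] Suc(3) by auto
 from nx_While_True[of p, OF _ _ this, of "s 0" k] Suc(2)[of 0] show ?case by (metis Suc_eq_plus1 add_Suc add_Suc_right mult_Suc zero_less_Suc)
qed

definition loop :: "nat => com => com" where
 "loop r c = While (%as. as ! Suc r ~= 0) c"

lemma wfc_arith [simp]: "r<m ==> wfc (Suc (Suc m)) (inc r)" "r<m ==> wfc (Suc (Suc m)) (dec r)"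
 "wfc (Suc (Suc m)) right" "wfc (Suc (Suc m)) left" "wfc (Suc (Suc m)) (out m a)" "wfc k (loop r c) = wfc k c"
 by (auto simp: inc_def dec_def rewind_def right_def left_def out_def loop_def intro!: wfc_on)

definition clear :: "nat => com" where
 "clear r = loop r (dec r)"

lemma nx_clear: "r<m ==> v r<=n ==> nx m x (clear r) (i, v, w) (2*n+1) (i, v(r := 0), w)"
proof -
 assume r: "r<m" and n: "v r<=n"
 have "nx m x (clear r) (i, v(r := v r-0), w) (v r*Suc 1+1) (i, v(r := v r-v r), w)"
  unfolding clear_def loop_def
 proof (rule nx_loop[where s = "%j. (i, v(r := v r-j), w)"])
  fix j assume "j<v r"
  thus "syms (tapes m x (i, v(r := v r-j), w)) ! Suc r ~= 0 &
     nx m x (dec r) (i, v(r := v r-j), w) 1 (i, v(r := v r-Suc j), w)"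
   using nx_dec[of r m "v(r := v r-j)" x i w] r by simp
 qed (use r in simp)
 thus ?thesis using n by (auto elim: nx_mono)
qed

definition move_reg :: "nat => nat => com" where
 "move_reg r q = loop r (Seq (dec r) (inc q))"

lemma nx_move: "r<m ==> q<m ==> r ~= q ==> v r<=n ==>
 nx m x (move_reg r q) (i, v, w) (4*n+1) (i, v(r := 0, q := v q+v r), w)"
proof -
 assume r: "r<m" "q<m" "r ~= q" and n: "v r<=n"
 let ?s = "%j. (i, v(r := v r-j, q := v q+j), w)"
 have "nx m x (move_reg r q) (?s 0) (v r*Suc (Suc (1+1))+1) (?s (v r))"
  unfolding move_reg_def loop_def
 proof (rule nx_loop[where s = ?s])
  fix j assume j: "j<v r"
  have "nx m x (Seq (dec r) (inc q)) (?s j) (Suc (1+1)) (?s (Suc j))"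
  proof (rule nx_Seq)
   show "nx m x (dec r) (?s j) 1 (i, v(r := v r-Suc j, q := v q+j), w)"
    using nx_dec[of r m "v(r := v r-j, q := v q+j)" x i w] r j by (simp add: fun_upd_twist)
   show "nx m x (inc q) (i, v(r := v r-Suc j, q := v q+j), w) 1 (?s (Suc j))"
    using nx_inc[of q m x i "v(r := v r-Suc j, q := v q+j)" w] r by simp
  qed
  thus "syms (tapes m x (?s j)) ! Suc r ~= 0 & nx m x (Seq (dec r) (inc q)) (?s j) (Suc (1+1)) (?s (Suc j))"
   using r j by simp
 qed (use r in simp)
 thus ?thesis using n by (auto elim!: nx_mono)
qed

text \<open>Moving destroys its source, so the value is drained into two registers and one of the
  copies is moved back.\<close>

definition copy_reg :: "nat => nat => nat => com" where
 "copy_reg r q z = Seq (loop r (Seq (dec r) (Seq (inc q) (inc z)))) (move_reg z r)"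

lemma nx_copy:
 assumes r: "r<m" "q<m" "z<m" "r ~= q" "r ~= z" "q ~= z" and v: "v q = 0" "v z = 0" "v r<=n"
 shows "nx m x (copy_reg r q z) (i, v, w) (10*n+3) (i, v(q := v r), w)"
proof -
 let ?s = "%j. (i, v(r := v r-j, q := j, z := j), w)"
 have 1: "nx m x (loop r (Seq (dec r) (Seq (inc q) (inc z)))) (?s 0) (v r*Suc (Suc (1+Suc (1+1)))+1) (?s (v r))"
  unfolding loop_def
 proof (rule nx_loop[where s = ?s])
  fix j assume j: "j<v r"
  have "nx m x (Seq (dec r) (Seq (inc q) (inc z))) (?s j) (Suc (1+Suc (1+1))) (?s (Suc j))"
  proof (intro nx_Seq)
   show "nx m x (dec r) (?s j) 1 (i, v(r := v r-Suc j, q := j, z := j), w)"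
    using nx_dec[of r m "v(r := v r-j, q := j, z := j)" x i w] r j by (simp add: fun_upd_twist)
   show "nx m x (inc q) (i, v(r := v r-Suc j, q := j, z := j), w) 1 (i, v(r := v r-Suc j, q := Suc j, z := j), w)"
    using nx_inc[of q m x i "v(r := v r-Suc j, q := j, z := j)" w] r by (simp add: fun_upd_twist)
   show "nx m x (inc z) (i, v(r := v r-Suc j, q := Suc j, z := j), w) 1 (?s (Suc j))"
    using nx_inc[of z m x i "v(r := v r-Suc j, q := Suc j, z := j)" w] r by (simp add: fun_upd_twist)
  qed
  thus "syms (tapes m x (?s j)) ! Suc r ~= 0 & nx m x (Seq (dec r) (Seq (inc q) (inc z))) (?s j) (Suc (1+Suc (1+1))) (?s (Suc j))"
   using r j by simp
 qed (use r in simp)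
 have s0: "?s 0 = (i, v, w)" using v by auto
 have "nx m x (move_reg z r) (?s (v r)) (4*n+1) (i, v(q := v r), w)"
  using nx_move[of z m r "v(r := 0, q := v r, z := v r)" n x i w] r v by (auto simp: fun_upd_twist fun_upd_idem)
 from nx_Seq[OF 1 this] have "nx m x (copy_reg r q z) (i, v, w) (Suc (v r*Suc (Suc (1+Suc (1+1)))+1+(4*n+1))) (i, v(q := v r), w)"
  unfolding copy_reg_def s0 .
 thus ?thesis by (rule nx_mono) (use v in simp)
qed

lemma wfc_move [simp]: "r<m ==> wfc (Suc (Suc m)) (clear r)" "r<m ==> q<m ==> wfc (Suc (Suc m)) (move_reg r q)"
 "r<m ==> q<m ==> z<m ==> wfc (Suc (Suc m)) (copy_reg r q z)"
 by (simp_all add: clear_def move_reg_def copy_reg_def)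

section \<open>Functions computable in polynomial time in the values of their arguments\<close>

definition total :: "('e => nat) list => 'e => nat" where
 "total rho e = sum_list (map (%f. f e) rho)"

lemma total_simps [simp]: "total [] e = 0" "total (f # rho) e = f e+total rho e" "total (rho@rho') e = total rho e+total rho' e"
 by (simp_all add: total_def)

lemma total_map [simp]: "total (map (%r. r o h) rho) e = total rho (h e)"
 by (simp add: total_def comp_def)

lemma le_total: "f : set rho ==> f e<=total rho e"
 unfolding total_def by (rule member_le_sum_list) auto

text \<open>Polynomial growth in the sum of the argument values. The base is at least 2, so
  constants and sums are absorbed by a larger exponent.\<close>

definition PB :: "('e => nat) list => ('e => nat) => bool" where
 "PB rho h = (EX k. ALL e. h e<=(total rho e+2)^k)"

lemma PB_le: "PB rho h ==> (!!e. g e<=h e) ==> PB rho g"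
 unfolding PB_def by (meson le_trans)

lemma PB_var: "f : set rho ==> PB rho f"
 unfolding PB_def by (rule exI[of _ 1]) (simp add: le_SucI le_total)

lemma PB_total: "PB rho (total rho)"
 unfolding PB_def by (rule exI[of _ 1]) simp

lemma PB_const: "PB rho (%_. c)"
 unfolding PB_def
proof (intro exI allI)
 fix e
 have "c<=2^c" by (simp add: less_imp_le)
 also have "... <= (total rho e+2)^c" by (rule power_mono) auto
 finally show "c<=(total rho e+2)^c" .
qed

lemma PB_add: assumes "PB rho f" "PB rho g" shows "PB rho (%e. f e+g e)"
proof -
 obtain k l where k: "!!e. f e<=(total rho e+2)^k" "!!e. g e<=(total rho e+2)^l" using assms unfolding PB_def by blast
 show ?thesis unfolding PB_def
 proof (intro exI allI)
  fix e
  have "(total rho e+2)^k<=(total rho e+2)^(k+l)" "(total rho e+2)^l<=(total rho e+2)^(k+l)"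
   by (auto intro: power_increasing)
  hence "f e+g e<=2*(total rho e+2)^(k+l)" using k[of e] by linarith
  also have "... <= (total rho e+2)^Suc (k+l)" by simp
  finally show "f e+g e<=(total rho e+2)^Suc (k+l)" .
 qed
qed

lemma PB_mult: assumes "PB rho f" "PB rho g" shows "PB rho (%e. f e*g e)"
proof -
 obtain k l where k: "!!e. f e<=(total rho e+2)^k" "!!e. g e<=(total rho e+2)^l" using assms unfolding PB_def by blast
 thus ?thesis unfolding PB_def by (intro exI[of _ "k+l"]) (auto simp: power_add mult_le_mono)
qed

lemma PB_power: "PB rho f ==> PB rho (%e. f e^n)"
 by (induct n) (auto intro: PB_const PB_mult)

lemma PB_Suc: "PB rho f ==> PB rho (%e. Suc (f e))"
 using PB_add[OF _ PB_const[of rho 1]] by simp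

lemma PB_trans:
 assumes "PB rho h" "PB sigma (%e. total rho (q e))" shows "PB sigma (%e. h (q e))"
proof -
 obtain k where "!!e. h e<=(total rho e+2)^k" using assms(1) unfolding PB_def by blast
 thus ?thesis
  by (intro PB_le[OF PB_power[OF PB_add[OF assms(2) PB_const[of sigma 2]], of k]]) auto
qed

lemmas PB_rules = PB_const PB_add PB_mult PB_power PB_Suc

definition regs :: "nat => nat => ('e => nat) list => 'e => (nat => nat) => bool" where
 "regs b m rho e v = ((ALL j<length rho. v (b+j) = (rho ! j) e) & (ALL q. b+length rho<=q --> q<m --> v q = 0))"

text \<open>The arguments \<open>rho\<close> are in the registers from \<open>b\<close> on; the registers above them serve as a stack.\<close>

definition impl :: "('e => nat) list => ('e => nat) => ('e => nat) => nat => (nat => nat => com) => bool" where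
 "impl rho f T d c = (ALL b m. b+length rho+d<m --> wfc (Suc (Suc m)) (c b m) &
   (ALL x i v w e. regs b m rho e v --> nx m x (c b m) (i, v, w) (T e) (i, v(b+length rho := f e), w)))"

lemma implD:
 assumes "impl rho f T d c" "b+length rho+d<m"
 shows "wfc (Suc (Suc m)) (c b m)"
  "regs b m rho e v ==> nx m x (c b m) (i, v, w) (T e) (i, v(b+length rho := f e), w)"
 using assms unfolding impl_def by auto

text \<open>Environments \<open>e\<close> are arbitrary objects; a program sees them only through
  the functions in \<open>rho\<close>, whose values are its argument registers. So \<open>f\<close>
  may speak of words or tuples while the program handles numbers.\<close>

definition "Compt rho f T = (EX d c. impl rho f T d c)"

lemma ComptI:
 assumes "!!b m. b+length rho+d<m ==> wfc (Suc (Suc m)) (c b m)"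
  "!!b m x i v w e. b+length rho+d<m ==> regs b m rho e v ==> nx m x (c b m) (i, v, w) (T e) (i, v(b+length rho := f e), w)"
 shows "Compt rho f T"
 unfolding Compt_def impl_def using assms by (intro exI[of _ d] allI impI exI[of _ c]) blast

lemma regs_ext: "regs b m rho e v ==> b+length rho<m ==> g e = y ==> regs b m (rho@[g]) e (v(b+length rho := y))"
 by (auto simp: regs_def nth_append less_Suc_eq)

lemma Compt_zero: "Compt rho (%_. 0) (%_. 1)"
proof (rule ComptI[where d = 0 and c = "%b m. clear (b+length rho)"])
 fix b m x i v w e assume "b+length rho+0<m" "regs b m rho e v"
 thus "nx m x (clear (b+length rho)) (i, v, w) 1 (i, v(b+length rho := 0), w)"
  using nx_clear[of "b+length rho" m v 0 x i w] by (simp add: regs_def)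
qed simp

lemma Compt_Suc: assumes "Compt rho f T" shows "Compt rho (%e. Suc (f e)) (%e. Suc (T e+1))"
proof -
 from assms obtain d c where "impl rho f T d c" unfolding Compt_def by blast
 note c = implD[OF this]
 show ?thesis
 proof (rule ComptI[where d = d and c = "%b m. Seq (c b m) (inc (b+length rho))"])
  fix b m x i v w e assume *: "b+length rho+d<m" "regs b m rho e v"
  show "nx m x (Seq (c b m) (inc (b+length rho))) (i, v, w) (Suc (T e+1)) (i, v(b+length rho := Suc (f e)), w)"
   using nx_Seq[OF c(2)[OF *] nx_inc[of "b+length rho"]] *(1) by simp
 qed (use c(1) in simp)
qed

lemma Compt_var: assumes "f : set rho" shows "Compt rho f (%e. 10*f e+3)"
proof -
 obtain j where j: "j<length rho" "rho ! j = f" using assms by (auto simp: in_set_conv_nth)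
 show ?thesis
 proof (rule ComptI[where d = 2 and c = "%b m. copy_reg (b+j) (b+length rho) (Suc (b+length rho))"])
  fix b m x i v w e assume *: "b+length rho+2<m" "regs b m rho e v"
  show "nx m x (copy_reg (b+j) (b+length rho) (Suc (b+length rho))) (i, v, w) (10*f e+3) (i, v(b+length rho := f e), w)"
   using nx_copy[of "b+j" m "b+length rho" "Suc (b+length rho)" v "f e" x i w] * j by (simp add: regs_def)
 qed (use j in simp)
qed

text \<open>The intermediate value \<open>g e\<close> occupies the place of the result; it is
  cleared afterwards and the result is moved down by one register.\<close>

lemma Compt_let:
 assumes "Compt rho g T" "Compt (rho@[g]) f U"
 shows "Compt rho f (%e. T e+U e+2*g e+4*f e+5)"
proof -
 from assms(1) obtain d c where "impl rho g T d c" unfolding Compt_def by blast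
 note c = implD[OF this]
 from assms(2) obtain d' c' where "impl (rho@[g]) f U d' c'" unfolding Compt_def by blast
 note c' = implD[OF this]
 let ?c = "%b m. Seq (c b m) (Seq (c' b m) (Seq (clear (b+length rho)) (move_reg (Suc (b+length rho)) (b+length rho))))"
 show ?thesis
 proof (rule ComptI[where d = "d+d'+1" and c = ?c])
  fix b m assume "b+length rho+(d+d'+1)<m"
  thus "wfc (Suc (Suc m)) (?c b m)" using c(1)[of b m] c'(1)[of b m] by simp
 next
  fix b m x i v w e assume *: "b+length rho+(d+d'+1)<m" "regs b m rho e v"
  let ?n = "b+length rho"
  have z: "v ?n = 0" "v (Suc ?n) = 0" using * by (auto simp: regs_def)
  have 1: "nx m x (c b m) (i, v, w) (T e) (i, v(?n := g e), w)" using * c(2) by simp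
  have 2: "nx m x (c' b m) (i, v(?n := g e), w) (U e) (i, v(?n := g e, Suc ?n := f e), w)"
   using c'(2)[of b m e "v(?n := g e)" x i w] * regs_ext[OF *(2), of g] by simp
  have 3: "nx m x (clear ?n) (i, v(?n := g e, Suc ?n := f e), w) (2*g e+1) (i, v(?n := 0, Suc ?n := f e), w)"
   using nx_clear[of ?n m "v(?n := g e, Suc ?n := f e)" "g e" x i w] * by (simp add: fun_upd_twist)
  have 4: "nx m x (move_reg (Suc ?n) ?n) (i, v(?n := 0, Suc ?n := f e), w) (4*f e+1) (i, v(?n := f e), w)"
   using nx_move[of "Suc ?n" m ?n "v(?n := 0, Suc ?n := f e)" "f e" x i w] * z by (simp add: fun_upd_twist fun_upd_idem)
  from nx_Seq[OF 1 nx_Seq[OF 2 nx_Seq[OF 3 4]]]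
  show "nx m x (?c b m) (i, v, w) (T e+U e+2*g e+4*f e+5) (i, v(?n := f e), w)"
   by (rule nx_mono) simp
 qed
qed

lemma Compt_prefix: assumes "Compt rho f T" shows "Compt (pre@rho) f T"
proof -
 from assms obtain d c where "impl rho f T d c" unfolding Compt_def by blast
 note c = implD[OF this]
 show ?thesis
 proof (rule ComptI[where d = d and c = "%b m. c (b+length pre) m"])
  fix b m x i v w e assume *: "b+length (pre@rho)+d<m" "regs b m (pre@rho) e v"
  have "regs (b+length pre) m rho e v" unfolding regs_def
  proof (intro conjI allI impI)
   fix j assume "j<length rho"
   hence "v (b+(length pre+j)) = ((pre@rho) ! (length pre+j)) e" using *(2) unfolding regs_def by (auto simp del: nth_append_length_plus)
   thus "v (b+length pre+j) = (rho ! j) e" by (simp add: add.assoc)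
  qed (use *(2) in \<open>auto simp: regs_def\<close>)
  thus "nx m x (c (b+length pre) m) (i, v, w) (T e) (i, v(b+length (pre@rho) := f e), w)"
   using c(2)[of "b+length pre" m e v x i w] *(1) by (simp add: add.assoc)
 qed (use c(1) in \<open>simp add: add.assoc\<close>)
qed

lemma Compt_env: assumes "Compt rho f T" shows "Compt (map (%r. r o h) rho) (f o h) (T o h)"
proof -
 have "regs b m (map (%r. r o h) rho) e v = regs b m rho (h e) v" for b m e v
  by (auto simp: regs_def)
 hence "impl rho f T d c ==> impl (map (%r. r o h) rho) (f o h) (T o h) d c" for d c
  unfolding impl_def by simp
 thus ?thesis using assms unfolding Compt_def by blast
qed

text \<open>No operation raises a register by more than one, so polynomial time also bounds the
  values polynomially (\<open>Comp_bound\<close>); this is what makes the class closed under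
  composition.\<close>

definition Comp :: "('e => nat) list => ('e => nat) => bool" where
 "Comp rho f = (EX T. PB rho T & Compt rho f T)"

lemma Compt_value: assumes "Compt rho f T" shows "f e<=T e"
proof -
 from assms obtain d c where "impl rho f T d c" unfolding Compt_def by blast
 note c = implD[OF this]
 let ?v = "%r. if r<length rho then (rho ! r) e else 0"
 have "regs 0 (Suc (length rho+d)) rho e ?v" by (simp add: regs_def)
 from nxD(2)[OF c(2)[OF _ this, of "[]" 0 "[]"], of "length rho"] show ?thesis by simp
qed

lemma Comp_bound: "Comp rho f ==> PB rho f"
 unfolding Comp_def using Compt_value PB_le by metis

lemma Comp_zero: "Comp rho (%_. 0)"
 unfolding Comp_def using Compt_zero PB_const by blast

lemma Comp_Suc: "Comp rho f ==> Comp rho (%e. Suc (f e))"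
 unfolding Comp_def using Compt_Suc PB_Suc[OF PB_add[OF _ PB_const[of rho 1]]] by blast

lemma Comp_const: "Comp rho (%_. c)"
 by (induct c) (auto intro: Comp_zero Comp_Suc)

lemma Comp_var: "f : set rho ==> Comp rho f"
 unfolding Comp_def using Compt_var PB_add[OF PB_mult[OF PB_const[of rho 10] PB_var] PB_const[of rho 3]] by blast

lemma Comp_let: assumes "Comp rho g" "Comp (rho@[g]) f" shows "Comp rho f"
proof -
 obtain T U where *: "PB rho T" "Compt rho g T" "PB (rho@[g]) U" "Compt (rho@[g]) f U" using assms unfolding Comp_def by blast
 have g: "PB rho g" using assms(1) by (rule Comp_bound)
 have s: "PB rho (%e. total (rho@[g]) e)" by (simp add: PB_add PB_total g PB_rules)
 have "PB rho U" "PB rho f" using PB_trans[OF *(3) s] PB_trans[OF Comp_bound[OF assms(2)] s] by simp_all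
 hence "PB rho (%e. T e+U e+2*g e+4*f e+5)" using * g by (intro PB_rules)
 thus ?thesis using Compt_let[OF *(2,4)] unfolding Comp_def by blast
qed

lemma Comp_prefix: "Comp rho f ==> Comp (pre@rho) f"
 unfolding Comp_def using Compt_prefix PB_trans[where q = "%e. e" and sigma = "pre@rho" and rho = rho] PB_le[OF PB_total[of "pre@rho"]]
 by (metis (no_types, lifting) le_add2 total_simps(3))

text \<open>Arguments must be contiguous with the result right above them, so \<open>gs\<close> is
  in the way. Copies of all of \<open>rho\<close> above \<open>gs\<close> make
  \<open>Comp_prefix\<close> applicable, and the copies are then discharged one at a time by
  \<open>Comp_let\<close>.\<close>

lemma Comp_weaken: assumes "Comp rho f" shows "Comp (rho@gs) f"
proof -
 have "Comp (rho@gs@take (length rho-j) rho) f" if "j<=length rho" for j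
  using that
 proof (induct j)
  case 0
  show ?case using Comp_prefix[OF assms, of "rho@gs"] by simp
 next
  case (Suc j)
  define k where "k = length rho-Suc j"
  have k: "length rho-j = Suc k" "k<length rho" using Suc.prems by (auto simp: k_def)
  have "Comp ((rho@gs@take k rho)@[rho ! k]) f" using Suc k by (simp add: take_Suc_conv_app_nth)
  thus ?case using Comp_let[OF Comp_var, of "rho ! k" "rho@gs@take k rho"] k by (simp add: k_def)
 qed
 from this[of "length rho"] show ?thesis by simp
qed

lemma Comp_trans: assumes "Comp sigma f" "!!g. g : set sigma ==> Comp rho g" shows "Comp rho f"
proof -
 have "Comp (rho@take (length sigma-j) sigma) f" if "j<=length sigma" for j
  using that
 proof (induct j)
  case 0
  show ?case using Comp_prefix[OF assms(1), of rho] by simp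
 next
  case (Suc j)
  define k where "k = length sigma-Suc j"
  have k: "length sigma-j = Suc k" "k<length sigma" using Suc.prems by (auto simp: k_def)
  have "Comp ((rho@take k sigma)@[sigma ! k]) f" using Suc k by (simp add: take_Suc_conv_app_nth)
  moreover have "Comp (rho@take k sigma) (sigma ! k)" using k by (intro Comp_weaken assms(2)) simp
  ultimately show ?case using Comp_let[of "rho@take k sigma" "sigma ! k"] by (simp add: k_def)
 qed
 from this[of "length sigma"] show ?thesis by simp
qed

lemma Comp_mono: "Comp sigma f ==> set sigma<=set rho ==> Comp rho f"
 by (rule Comp_trans) (auto intro: Comp_var)

lemma Comp_env: assumes "Comp rho f" shows "Comp (map (%r. r o h) rho) (f o h)"
proof -
 obtain T where T: "PB rho T" "Compt rho f T" using assms unfolding Comp_def by blast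
 have "PB (map (%r. r o h) rho) (T o h)"
  using T(1) unfolding PB_def by simp (metis)
 thus ?thesis using Compt_env[OF T(2)] unfolding Comp_def by blast
qed

lemma Comp_subst: assumes "Comp sigma f" "!!g. g : set sigma ==> Comp rho (%e. g (h e))" shows "Comp rho (%e. f (h e))"
proof -
 have "Comp (map (%r. r o h) sigma) (%e. f (h e))" using Comp_env[OF assms(1), of h] by (simp add: comp_def)
 thus ?thesis by (rule Comp_trans) (use assms(2) in \<open>auto simp: comp_def\<close>)
qed

text \<open>A bound variable is one more argument: the environment becomes a pair whose second
  component is the index.\<close>

definition ext :: "('e => nat) list => ('e*nat => nat) list" where
 "ext rho = map (%r. r o fst) rho@[snd]"

lemma total_ext [simp]: "total (ext rho) e = total rho (fst e)+snd e"
 by (simp add: ext_def)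

lemma Comp_lift: "Comp rho f ==> Comp (ext rho) (%e. f (fst e))"
 using Comp_weaken[OF Comp_env[of rho f fst]] by (simp add: ext_def comp_def)

lemma Comp_snd: "Comp (ext rho) (%e. snd e)"
 by (rule Comp_var) (simp add: ext_def)

lemma Comp_ext_subst:
 "Comp (ext sigma) f ==> (!!g. g : set sigma ==> Comp rho (%e. g (h e))) ==> Comp rho q ==> Comp rho (%e. f (h e, q e))"
 by (rule Comp_subst[where sigma = "ext sigma" and h = "%e. (h e, q e)"]) (auto simp: ext_def)

lemma PB_ext_bound:
 assumes "PB (ext rho) (%e. g (fst e) (snd e))" "PB rho N"
 obtains V where "PB rho V" "!!e i. i<=N e ==> g e i<=V e"
proof -
 obtain k where k: "!!e. g (fst e) (snd e)<=(total (ext rho) e+2)^k" using assms(1) unfolding PB_def by blast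
 show ?thesis
 proof
  show "PB rho (%e. (total rho e+N e+2)^k)" by (intro PB_rules PB_total assms(2))
  fix e i assume "i<=N e"
  have "g e i<=(total rho e+i+2)^k" using k[of "(e, i)"] by simp
  also have "... <= (total rho e+N e+2)^k" using \<open>i <= N e\<close> by (intro power_mono) auto
  finally show "g e i<=(total rho e+N e+2)^k" .
 qed
qed

text \<open>Three registers above the arguments hold the rounds left, the index and the accumulator.
  The program for \<open>F\<close> also sees the rounds left because that register lies between
  \<open>rho\<close> and the index. The bounds \<open>U\<close> and \<open>V\<close> need not be
  polynomial here.\<close>

lemma Compt_iter:
 fixes F :: "'e => nat => nat => nat"
 assumes N: "Compt rho N TN" and a: "Compt (rho@[N, %_. 0]) a Ta"
  and F: "Compt (map (%r. r o (fst o fst)) rho@[%e. N (fst (fst e))-Suc (snd (fst e)), %e. snd (fst e), %e. snd e])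
   (%e. F (fst (fst e)) (snd (fst e)) (snd e)) TF"
  and U: "!!e i. i<N e ==> TF ((e, i), rec_nat (a e) (F e) i)<=U e"
  and V: "!!e i. i<=N e ==> rec_nat (a e) (F e) i<=V e"
 shows "Compt rho (%e. rec_nat (a e) (F e) (N e)) (%e. TN e+Ta e+N e*(U e+6*V e+11)+2*N e+4*V e+10)"
proof -
 let ?F = "map (%r. r o (fst o fst)) rho@[%e. N (fst (fst e))-Suc (snd (fst e)), %e. snd (fst e), %e. snd e]"
 from N obtain d c where "impl rho N TN d c" unfolding Compt_def by blast
 note c = implD[OF this]
 from a obtain d1 c1 where "impl (rho@[N, %_. 0]) a Ta d1 c1" unfolding Compt_def by blast
 note c1 = implD[OF this]
 from F obtain d2 c2 where "impl ?F (%e. F (fst (fst e)) (snd (fst e)) (snd e)) TF d2 c2" unfolding Compt_def by blast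
 note c2 = implD[OF this]
 let ?n = "%b. b+length rho"
 let ?body = "%b m. Seq (dec (?n b)) (Seq (c2 b m) (Seq (clear (?n b+2)) (Seq (move_reg (?n b+3) (?n b+2)) (inc (?n b+1)))))"
 let ?c = "%b m. Seq (c b m) (Seq (c1 b m) (Seq (loop (?n b) (?body b m)) (Seq (clear (?n b+1)) (move_reg (?n b+2) (?n b)))))"
 show ?thesis
 proof (rule ComptI[where d = "d+d1+d2+3" and c = ?c])
  fix b m assume "b+length rho+(d+d1+d2+3)<m"
  thus "wfc (Suc (Suc m)) (?c b m)" using c(1)[of b m] c1(1)[of b m] c2(1)[of b m] by simp
 next
  fix b m :: nat and x :: "bool list" and i :: nat and v :: "nat => nat" and w :: "bool list" and e
  assume *: "b+length rho+(d+d1+d2+3)<m" "regs b m rho e v"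
  define n where "n = b+length rho"
  define R where "R = rec_nat (a e) (F e)"
  have n: "n+(d+d1+d2+3)<m" using * by (simp add: n_def)
  have z: "v q = 0" if "n<=q" "q<m" for q using *(2) that by (simp add: regs_def n_def)
  have vr: "v (b+j) = (rho ! j) e" if "j<length rho" for j using *(2) that by (simp add: regs_def)
  let ?s = "%j. (i, v(n := N e-j, n+1 := j, n+2 := R j), w)"
  have 1: "nx m x (c b m) (i, v, w) (TN e) (i, v(n := N e), w)" using * c(2) by (simp add: n_def)
  have r2: "regs b m (rho@[N, %_. 0]) e (v(n := N e))"
   unfolding regs_def using vr z n by (auto simp: n_def nth_append less_Suc_eq)
  have 2: "nx m x (c1 b m) (i, v(n := N e), w) (Ta e) (?s 0)"
  proof -
   have e: "v(n := N e, n+2 := a e) = v(n := N e-0, n+1 := 0, n+2 := R 0)"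
    using z[of "n+1"] n by (auto simp: R_def fun_eq_iff)
   show ?thesis unfolding e[symmetric] using c1(2)[of b m e "v(n := N e)" x i w] r2 n by (simp add: n_def)
  qed
  let ?K = "Suc (1+Suc (U e+Suc ((2*V e+1)+Suc ((4*V e+1)+1))))"
  have "nx m x (loop n (?body b m)) (?s 0) (N e*Suc ?K+1) (?s (N e))"
   unfolding loop_def
  proof (rule nx_loop[where s = ?s], rule conjI)
   fix j assume j: "j<N e"
   show "syms (tapes m x (?s j)) ! Suc n ~= 0" using n j by simp
   have b1: "nx m x (dec n) (?s j) 1 (i, v(n := N e-Suc j, n+1 := j, n+2 := R j), w)"
    using nx_dec[of n m "v(n := N e-j, n+1 := j, n+2 := R j)" x i w] n j by (simp add: fun_upd_twist)
   have r3: "regs b m ?F ((e, j), R j) (v(n := N e-Suc j, n+1 := j, n+2 := R j))"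
    unfolding regs_def using vr z n by (auto simp: n_def nth_append less_Suc_eq nth_Cons')
   have b2: "nx m x (c2 b m) (i, v(n := N e-Suc j, n+1 := j, n+2 := R j), w) (U e)
     (i, v(n := N e-Suc j, n+1 := j, n+2 := R j, n+3 := R (Suc j)), w)"
    by (rule nx_mono[OF _ U[OF j]], insert c2(2)[OF _ r3, of x i w] n) (simp add: n_def R_def eval_nat_numeral)
   have b3: "nx m x (clear (n+2)) (i, v(n := N e-Suc j, n+1 := j, n+2 := R j, n+3 := R (Suc j)), w) (2*V e+1)
     (i, v(n := N e-Suc j, n+1 := j, n+2 := 0, n+3 := R (Suc j)), w)"
    using nx_clear[of "n+2" m "v(n := N e-Suc j, n+1 := j, n+2 := R j, n+3 := R (Suc j))" "V e" x i w] n V[of j e] j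
    by (simp add: fun_upd_twist R_def)
   have b4: "nx m x (move_reg (n+3) (n+2)) (i, v(n := N e-Suc j, n+1 := j, n+2 := 0, n+3 := R (Suc j)), w) (4*V e+1)
     (i, v(n := N e-Suc j, n+1 := j, n+2 := R (Suc j)), w)"
   proof -
    have e: "v(n := N e-Suc j, n+1 := j, n+2 := 0, n+3 := R (Suc j), n+3 := 0, n+2 := R (Suc j)) = v(n := N e-Suc j, n+1 := j, n+2 := R (Suc j))"
     using z[of "n+3"] n by (auto simp: fun_eq_iff)
    show ?thesis
     using nx_move[of "n+3" m "n+2" "v(n := N e-Suc j, n+1 := j, n+2 := 0, n+3 := R (Suc j))" "V e" x i w] n V[of "Suc j" e] j e
     by (simp add: R_def)
   qed
   have b5: "nx m x (inc (n+1)) (i, v(n := N e-Suc j, n+1 := j, n+2 := R (Suc j)), w) 1 (?s (Suc j))"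
    using nx_inc[of "n+1" m x i "v(n := N e-Suc j, n+1 := j, n+2 := R (Suc j))" w] n by (simp add: fun_upd_twist)
   show "nx m x (?body b m) (?s j) ?K (?s (Suc j))"
    using nx_Seq[OF b1 nx_Seq[OF b2 nx_Seq[OF b3 nx_Seq[OF b4 b5]]]] by (simp add: n_def)
  qed (use n in simp)
  hence 3: "nx m x (loop (?n b) (?body b m)) (?s 0) (N e*Suc ?K+1) (?s (N e))" by (simp add: n_def)
  have 4: "nx m x (clear (?n b+1)) (?s (N e)) (2*N e+1) (i, v(n := 0, n+1 := 0, n+2 := R (N e)), w)"
   using nx_clear[of "n+1" m "v(n := 0, n+1 := N e, n+2 := R (N e))" "N e" x i w] n by (simp add: fun_upd_twist n_def)
  have 5: "nx m x (move_reg (?n b+2) (?n b)) (i, v(n := 0, n+1 := 0, n+2 := R (N e)), w) (4*V e+1) (i, v(n := R (N e)), w)"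
  proof -
   have e: "v(n := 0, n+1 := 0, n+2 := R (N e), n+2 := 0, n := R (N e)) = v(n := R (N e))"
    using z[of "n+1"] z[of "n+2"] n by (auto simp: fun_eq_iff)
   show ?thesis
    using nx_move[of "n+2" m "n" "v(n := 0, n+1 := 0, n+2 := R (N e))" "V e" x i w] n V[of "N e" e] e
    by (simp add: R_def n_def)
  qed
  from nx_Seq[OF 1 nx_Seq[OF 2 nx_Seq[OF 3 nx_Seq[OF 4 5]]]]
  show "nx m x (?c b m) (i, v, w) (TN e+Ta e+N e*(U e+6*V e+11)+2*N e+4*V e+10) (i, v(?n b := rec_nat (a e) (F e) (N e)), w)"
   unfolding n_def R_def by (rule nx_mono) (simp add: algebra_simps)
 qed
qed

text \<open>Without the polynomial bound \<open>V\<close> on all intermediate values, iterated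
  squaring would lead out of the class.\<close>

lemma Comp_rec:
 fixes F :: "'e => nat => nat => nat"
 assumes N: "Comp rho N" and a: "Comp rho a"
  and F: "Comp (ext (ext rho)) (%e. F (fst (fst e)) (snd (fst e)) (snd e))"
  and V: "PB rho V" "!!e i. i<=N e ==> rec_nat (a e) (F e) i<=V e"
 shows "Comp rho (%e. rec_nat (a e) (F e) (N e))"
proof -
 let ?F = "map (%r. r o (fst o fst)) rho@[%e. N (fst (fst e))-Suc (snd (fst e)), %e. snd (fst e), %e. snd e]"
 have "Comp ?F (%e. F (fst (fst e)) (snd (fst e)) (snd e))"
  by (rule Comp_mono[OF F]) (auto simp: ext_def comp_def)
 moreover have "Comp (rho@[N, %_. 0]) a" by (rule Comp_weaken[OF a])
 ultimately obtain TF Ta TN where T: "PB rho TN" "Compt rho N TN" "PB (rho@[N, %_. 0]) Ta" "Compt (rho@[N, %_. 0]) a Ta"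
  "PB ?F TF" "Compt ?F (%e. F (fst (fst e)) (snd (fst e)) (snd e)) TF"
  using N unfolding Comp_def by blast
 have PN: "PB rho N" using N by (rule Comp_bound)
 obtain k where k: "!!e. TF e<=(total ?F e+2)^k" using T(5) unfolding PB_def by blast
 define U where "U e = (total rho e+2*N e+V e+2)^k" for e
 have U: "TF ((e, i), rec_nat (a e) (F e) i)<=U e" if "i<N e" for e i
 proof -
  have "total (map (%r. r o (fst o fst)) rho) ((e, i), rec_nat (a e) (F e) i) = total rho e"
   by (simp add: total_def comp_def)
  hence "TF ((e, i), rec_nat (a e) (F e) i)<=(total rho e+((N e-Suc i)+(i+rec_nat (a e) (F e) i))+2)^k"
   using k[of "((e, i), rec_nat (a e) (F e) i)"] by simp
  also have "... <= U e" unfolding U_def using that V(2)[of i e] by (intro power_mono) auto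
  finally show ?thesis .
 qed
 have PU: "PB rho U" unfolding U_def by (intro PB_rules PB_total PN V(1))
 have Pa: "PB rho Ta"
  using PB_trans[OF T(3), of rho "%e. e"] by (simp add: PB_add PB_total PN PB_rules)
 show ?thesis
  unfolding Comp_def
 proof (intro exI conjI)
  show "Compt rho (%e. rec_nat (a e) (F e) (N e)) (%e. TN e+Ta e+N e*(U e+6*V e+11)+2*N e+4*V e+10)"
   by (rule Compt_iter[OF T(2,4,6) U V(2)])
  show "PB rho (%e. TN e+Ta e+N e*(U e+6*V e+11)+2*N e+4*V e+10)"
   by (intro PB_rules T PU Pa PN V(1))
 qed
qed

lemma Comp_add: assumes "Comp rho f" "Comp rho g" shows "Comp rho (%e. f e+g e)"
proof -
 have r: "rec_nat a (%_ y. Suc y) n = a+n" for a n :: nat by (induct n) auto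
 have "Comp rho (%e. rec_nat (f e) (%_ y. Suc y) (g e))"
 proof (rule Comp_rec)
  show "PB rho (%e. f e+g e)" by (intro PB_rules Comp_bound assms)
 qed (use assms in \<open>auto simp: r intro: Comp_Suc Comp_snd\<close>)
 thus ?thesis by (simp add: r)
qed

lemma Comp_mult: assumes "Comp rho f" "Comp rho g" shows "Comp rho (%e. f e*g e)"
proof -
 have r: "rec_nat 0 (%_ y. y+b) n = b*n" for b n :: nat by (induct n) auto
 have "Comp rho (%e. rec_nat 0 (%_ y. y+f e) (g e))"
 proof (rule Comp_rec)
  show "PB rho (%e. f e*g e)" by (intro PB_rules Comp_bound assms)
  show "Comp (ext (ext rho)) (%e. snd e+f (fst (fst e)))"
   by (intro Comp_add Comp_snd Comp_lift[of "ext rho" "%e. f (fst e)"] Comp_lift assms)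
 qed (use assms in \<open>auto simp: r intro: Comp_zero\<close>)
 thus ?thesis by (simp add: r)
qed

lemma Comp_pred: assumes "Comp rho f" shows "Comp rho (%e. f e-Suc 0)"
proof -
 have r: "rec_nat 0 (%i y. i) n = n-Suc 0" for n :: nat by (cases n) auto
 have "Comp rho (%e. rec_nat 0 (%i y. i) (f e))"
 proof (rule Comp_rec)
  show "PB rho f" by (intro Comp_bound assms)
  show "Comp (ext (ext rho)) (%e. snd (fst e))" by (intro Comp_lift[of "ext rho" snd] Comp_snd)
 qed (use assms in \<open>auto simp: r intro: Comp_zero\<close>)
 thus ?thesis by (simp add: r)
qed

lemma Comp_minus: assumes "Comp rho f" "Comp rho g" shows "Comp rho (%e. f e-g e)"
proof -
 have r: "rec_nat a (%_ y. y-Suc 0) n = a-n" for a n :: nat by (induct n) auto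
 have "Comp rho (%e. rec_nat (f e) (%_ y. y-Suc 0) (g e))"
 proof (rule Comp_rec)
  show "PB rho f" by (intro Comp_bound assms)
 qed (use assms in \<open>auto simp: r intro: Comp_pred Comp_snd\<close>)
 thus ?thesis by (simp add: r)
qed

definition CompB :: "('e => nat) list => ('e => bool) => bool" where
 "CompB rho P = Comp rho (%e. of_bool (P e))"

lemma CompB_not: assumes "CompB rho P" shows "CompB rho (%e. ~ P e)"
proof -
 have e: "of_bool (~ P e) = (1::nat)-of_bool (P e)" for e by simp
 show ?thesis unfolding CompB_def e by (intro Comp_minus Comp_const assms[unfolded CompB_def])
qed

lemma CompB_conj: assumes "CompB rho P" "CompB rho Q" shows "CompB rho (%e. P e & Q e)"
 using Comp_mult[of rho "%e. of_bool (P e)" "%e. of_bool (Q e)"] assms by (simp add: CompB_def of_bool_conj)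

lemma CompB_disj: assumes "CompB rho P" "CompB rho Q" shows "CompB rho (%e. P e \<or> Q e)"
 using CompB_not[OF CompB_conj[OF CompB_not[OF assms(1)] CompB_not[OF assms(2)]]] by simp

lemma CompB_imp: assumes "CompB rho P" "CompB rho Q" shows "CompB rho (%e. P e --> Q e)"
 using CompB_disj[OF CompB_not[OF assms(1)] assms(2)] by presburger

lemma CompB_const: "CompB rho (%_. P)"
 unfolding CompB_def by (rule Comp_const)

lemma CompB_le: assumes "Comp rho f" "Comp rho g" shows "CompB rho (%e. f e<=g e)"
proof -
 have e: "of_bool (f e<=g e) = (1::nat)-(f e-g e)" for e by simp
 show ?thesis unfolding CompB_def e by (intro Comp_minus Comp_const assms)
qed

lemma CompB_less: assumes "Comp rho f" "Comp rho g" shows "CompB rho (%e. f e<g e)"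
 using CompB_le[OF Comp_Suc[OF assms(1)] assms(2)] by (simp add: Suc_le_eq)

lemma CompB_eq: assumes "Comp rho f" "Comp rho g" shows "CompB rho (%e. f e = g e)"
 using CompB_conj[OF CompB_le[OF assms] CompB_le[OF assms(2,1)]] by (simp add: eq_iff)

lemma CompB_iff: assumes "CompB rho P" "CompB rho Q" shows "CompB rho (%e. P e = Q e)"
 using CompB_conj[OF CompB_imp[OF assms] CompB_imp[OF assms(2,1)]] by (simp add: iff_conv_conj_imp)

lemma Comp_if: assumes "CompB rho P" "Comp rho f" "Comp rho g" shows "Comp rho (%e. if P e then f e else g e)"
proof -
 have e: "(if P e then f e else g e) = of_bool (P e)*f e+of_bool (~ P e)*g e" for e by simp
 show ?thesis unfolding e by (intro Comp_add Comp_mult assms assms(1)[unfolded CompB_def] CompB_not[OF assms(1), unfolded CompB_def])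
qed

lemma CompB_if: assumes "CompB rho P" "CompB rho Q" "CompB rho R" shows "CompB rho (%e. if P e then Q e else R e)"
proof -
 have e: "(if P e then Q e else R e) = ((P e & Q e) \<or> (~ P e & R e))" for e by simp
 show ?thesis unfolding e by (intro CompB_conj CompB_disj CompB_not assms)
qed

lemma Comp_sum: assumes N: "Comp rho N" and g: "Comp (ext rho) (%e. g (fst e) (snd e))"
 shows "Comp rho (%e. \<Sum>i<N e. g e i)"
proof -
 have r: "rec_nat 0 (%i y. y+h i) n = (\<Sum>i<n. h i)" for n :: nat and h :: "nat => nat" by (induct n) auto
 obtain V where V: "PB rho V" "!!e i. i<=N e ==> g e i<=V e" using PB_ext_bound[OF Comp_bound[OF g] Comp_bound[OF N]] by blast
 have "Comp rho (%e. rec_nat 0 (%i y. y+g e i) (N e))"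
 proof (rule Comp_rec)
  show "PB rho (%e. N e*V e)" by (intro PB_rules Comp_bound N V)
  show "Comp (ext (ext rho)) (%e. snd e+g (fst (fst e)) (snd (fst e)))"
   by (intro Comp_add Comp_snd Comp_lift[of "ext rho" "%e. g (fst e) (snd e)"] g)
  fix e i assume i: "i<=N e"
  have "(\<Sum>i<i. g e i)<=(\<Sum>i<i. V e)" using V(2)[of _ e] i by (intro sum_mono) auto
  also have "... <= N e*V e" using i by simp
  finally show "rec_nat 0 (%i y. y+g e i) i<=N e*V e" by (simp add: r)
 qed (use N in \<open>auto intro: Comp_zero\<close>)
 thus ?thesis by (simp add: r)
qed

lemma CompB_ex: assumes "Comp rho N" "CompB (ext rho) (%e. P (fst e) (snd e))" shows "CompB rho (%e. EX i<N e. P e i)"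
proof -
 have e: "(EX i<N e. P e i) = (0<(\<Sum>i<N e. of_bool (P e i) :: nat))" for e by (auto simp: sum_pos2 neq0_conv[symmetric] simp del: neq0_conv)
 show ?thesis unfolding e by (intro CompB_less Comp_const Comp_sum assms assms(2)[unfolded CompB_def])
qed

lemma CompB_all: assumes "Comp rho N" "CompB (ext rho) (%e. P (fst e) (snd e))" shows "CompB rho (%e. ALL i<N e. P e i)"
 using CompB_not[OF CompB_ex[OF assms(1) CompB_not[OF assms(2)]]] by simp

text \<open>Counts the positive multiples of \<open>b\<close> up to \<open>a\<close>, which reduces
  division to a bounded sum.\<close>

lemma div_eq_sum: "a div b = (\<Sum>i<a. of_bool (0<b & Suc i*b<=a))" for a b :: nat
proof (cases "b = 0")
 case False
 have "{..<a} Int {i. 0<b & Suc i*b<=a} = {..<a div b}"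
 proof -
  have "(i<a & Suc i*b<=a) = (i<a div b)" for i
   using less_eq_div_iff_mult_less_eq[of b "Suc i" a] less_le_trans[OF _ div_le_dividend[of a b], of i] False by (auto simp del: mult_Suc)
  thus ?thesis using False by auto
 qed
 thus ?thesis by (simp add: sum.If_cases of_bool_def del: mult_Suc)
qed simp

lemma Comp_div: assumes "Comp rho f" "Comp rho g" shows "Comp rho (%e. f e div g e)"
 unfolding div_eq_sum
proof (rule Comp_sum[OF assms(1)], fold CompB_def)
 show "CompB (ext rho) (%e. 0<g (fst e) & Suc (snd e)*g (fst e)<=f (fst e))"
  by (intro CompB_conj CompB_less CompB_le Comp_const Comp_mult Comp_Suc Comp_snd Comp_lift assms)
qed

lemma Comp_mod: assumes "Comp rho f" "Comp rho g" shows "Comp rho (%e. f e mod g e)"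
 unfolding minus_div_mult_eq_mod[symmetric] by (intro Comp_minus Comp_mult Comp_div assms)

definition dg :: "nat => nat => nat => nat" where
 "dg B c i = c div B^i mod B"

text \<open>Divides by \<open>B\<close> again and again instead of forming \<open>B^i\<close>, which
  need not be polynomially bounded.\<close>

lemma Comp_shift: assumes "Comp rho B" "Comp rho c" "Comp rho i" shows "Comp rho (%e. c e div B e^i e)"
proof -
 have r: "rec_nat c (%_ y. y div B) n = c div B^n" for n :: nat and B c :: nat by (induct n) (auto simp: div_mult2_eq[symmetric] mult.commute)
 have "Comp rho (%e. rec_nat (c e) (%_ y. y div B e) (i e))"
 proof (rule Comp_rec)
  show "PB rho c" by (intro Comp_bound assms)
  show "Comp (ext (ext rho)) (%e. snd e div B (fst (fst e)))"
   by (intro Comp_div Comp_snd Comp_lift[of "ext rho" "%e. B (fst e)"] Comp_lift assms)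
 qed (use assms in \<open>auto simp: r\<close>)
 thus ?thesis unfolding r .
qed

lemma Comp_dg: "Comp rho B ==> Comp rho c ==> Comp rho i ==> Comp rho (%e. dg (B e) (c e) (i e))"
 unfolding dg_def by (intro Comp_mod Comp_shift)

lemma Comp_power: assumes "Comp rho f" "Comp rho g" "PB rho (%e. f e^g e)" shows "Comp rho (%e. f e^g e)"
proof -
 have r: "rec_nat 1 (%_ y. y*a) n = a^n" for n a :: nat by (induct n) auto
 have "Comp rho (%e. rec_nat 1 (%_ y. y*f e) (g e))"
 proof (rule Comp_rec)
  show "PB rho (%e. f e^g e+1)" using assms(3) by (intro PB_rules)
  show "Comp (ext (ext rho)) (%e. snd e*f (fst (fst e)))"
   by (intro Comp_mult Comp_snd Comp_lift[of "ext rho" "%e. f (fst e)"] Comp_lift assms)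
  fix e i assume "i<=g e"
  hence "f e^i<=f e^g e+1" using power_increasing[of i "g e" "f e"] by (cases "f e = 0") (auto simp: power_0_left)
  thus "rec_nat 1 (%_ y. y*f e) i<=f e^g e+1" unfolding r .
 qed (use assms Comp_const in auto)
 thus ?thesis unfolding r .
qed

lemma Comp_power_const: "Comp rho f ==> Comp rho (%e. f e^n)"
 by (induct n) (auto intro: Comp_const Comp_mult)

lemma Comp_of_bool: "CompB rho P ==> Comp rho (%e. of_bool (P e))"
 by (simp add: CompB_def)

lemmas Comp_rules = Comp_const CompB_const Comp_snd Comp_Suc Comp_add Comp_mult Comp_minus Comp_if CompB_if CompB_not CompB_conj CompB_disj
 CompB_imp CompB_iff CompB_le CompB_less CompB_eq CompB_ex CompB_all Comp_sum Comp_div Comp_mod Comp_dg Comp_of_bool Comp_power_const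

section \<open>Computable words\<close>

text \<open>Total, with \<open>False\<close> outside the word, so that the bits of a concatenation
  are a plain disjunction.\<close>

definition bit :: "bool list => nat => bool" where
 "bit w i = (i<length w & w ! i)"

definition CW :: "('e => nat) list => ('e => bool list) => bool" where
 "CW rho w = (Comp rho (%e. length (w e)) & CompB (ext rho) (%e. bit (w (fst e)) (snd e)))"

lemma CompB_bit: "CW sigma w ==> (!!g. g : set sigma ==> Comp rho (%e. g (h e))) ==> Comp rho i ==> CompB rho (%e. bit (w (h e)) (i e))"
 unfolding CW_def CompB_def using Comp_ext_subst[of sigma "%e. of_bool (bit (w (fst e)) (snd e))" rho h i] by simp

lemma Comp_base_ext: "g : set rho ==> Comp (ext rho) (%e. g (fst e))"
 by (rule Comp_lift[OF Comp_var])

lemma Comp_skip: "g : set (ext rho) ==> Comp (ext (ext rho)) (%e. g (fst (fst e), snd e))"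
 by (rule Comp_var) (auto simp: ext_def image_comp comp_def)

lemma CompB_lift: "CompB rho P ==> CompB (ext rho) (%e. P (fst e))"
 unfolding CompB_def by (rule Comp_lift)

lemma CW_Nil: "CW rho (%_. [])"
 unfolding CW_def bit_def by (auto intro!: Comp_rules)

lemma CW_bit: assumes "CompB rho P" shows "CW rho (%e. [P e])"
proof -
 have e: "bit [P (fst e)] (snd e) = (snd e = 0 & P (fst e))" for e by (cases "snd e") (auto simp: bit_def)
 show ?thesis unfolding CW_def e by (auto intro!: Comp_rules CompB_lift assms)
qed

lemma CW_append: assumes "CW rho u" "CW rho w" shows "CW rho (%e. u e@w e)"
proof -
 have e: "bit (u (fst e)@w (fst e)) (snd e) = (if snd e<length (u (fst e)) then bit (u (fst e)) (snd e) else bit (w (fst e)) (snd e-length (u (fst e))))" for e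
  by (auto simp: bit_def nth_append)
 have u: "Comp (ext rho) (%e. length (u (fst e)))" using assms(1) unfolding CW_def by (intro Comp_lift[of rho "%e. length (u e)"]) simp
 have "CompB (ext rho) (%e. bit (w (fst e)) (snd e-length (u (fst e))))"
  using CompB_bit[OF assms(2), of "ext rho" fst "%e. snd e-length (u (fst e))"] u by (simp add: Comp_base_ext Comp_minus Comp_snd)
 thus ?thesis unfolding CW_def e length_append using assms unfolding CW_def by (intro conjI Comp_rules u) auto
qed

lemma CW_if: assumes "CompB rho P" "CW rho u" "CW rho w" shows "CW rho (%e. if P e then u e else w e)"
proof -
 have e: "(%e. bit (if P (fst e) then u (fst e) else w (fst e)) (snd e)) = (%e. if P (fst e) then bit (u (fst e)) (snd e) else bit (w (fst e)) (snd e))"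
  "(%e. length (if P e then u e else w e)) = (%e. if P e then length (u e) else length (w e))" by auto
 show ?thesis using assms unfolding CW_def e by (intro conjI Comp_if CompB_if CompB_lift) auto
qed

lemma CW_Cons: "CompB rho P ==> CW rho w ==> CW rho (%e. P e # w e)"
 using CW_append[OF CW_bit, of rho P w] by simp

lemma bit_append: "bit (u@w) i = (bit u i \<or> length u<=i & bit w (i-length u))"
 by (auto simp: bit_def nth_append)

text \<open>A witness \<open>j\<close> is necessarily the block that contains position
  \<open>i\<close>, because \<open>bit (f j)\<close> is false beyond the end of its block.\<close>

lemma bit_concat: "bit (concat (map f [0..<N])) i = (EX j<N. (\<Sum>l<j. length (f l))<=i & bit (f j) (i-(\<Sum>l<j. length (f l))))"
proof (induct N)
 case (Suc N)
 have "length (concat (map f [0..<N])) = (\<Sum>l<N. length (f l))" by (induct N) auto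
 thus ?case using Suc by (auto simp: bit_append less_Suc_eq)
qed (simp add: bit_def)

lemma CW_concat: assumes "Comp rho N" "CW (ext rho) (%e. w (fst e) (snd e))" shows "CW rho (%e. concat (map (w e) [0..<N e]))"
proof -
 have l: "length (concat (map f [0..<N])) = (\<Sum>l<N. length (f l))" for f :: "nat => bool list" and N by (induct N) auto
 have w: "Comp (ext rho) (%e. length (w (fst e) (snd e)))" using assms(2) by (simp add: CW_def)
 have s: "Comp (ext (ext rho)) (%e. \<Sum>l<snd e. length (w (fst (fst e)) l))"
 proof (intro Comp_sum Comp_snd)
  show "Comp (ext (ext (ext rho))) (%e. length (w (fst (fst (fst e))) (snd e)))"
   using Comp_ext_subst[of rho "%e. length (w (fst e) (snd e))" "ext (ext (ext rho))" "%e. fst (fst (fst e))" snd] w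
   by (auto intro!: Comp_lift[of "ext rho" "%e. g (fst e)" for g] Comp_lift[of "ext (ext rho)" "%e. g (fst (fst e))" for g] Comp_base_ext Comp_snd)
 qed
 have "CompB (ext (ext rho)) (%e. bit (w (fst (fst e)) (snd e)) (snd (fst e)-(\<Sum>l<snd e. length (w (fst (fst e)) l))))"
  using CompB_bit[OF assms(2), of "ext (ext rho)" "%e. (fst (fst e), snd e)" "%e. snd (fst e)-(\<Sum>l<snd e. length (w (fst (fst e)) l))"] s
  by (simp add: Comp_skip Comp_minus Comp_lift[OF Comp_snd])
 moreover have "Comp (ext (ext rho)) (%e. snd (fst e))" by (rule Comp_lift[OF Comp_snd])
 ultimately show ?thesis unfolding CW_def bit_concat l
  using Comp_sum[OF assms(1) w] by (intro conjI CompB_ex CompB_conj CompB_le s Comp_lift[OF assms(1)])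
qed

lemma bits_eq: "bits n = map (%j. n div 2^j mod 2 = 1) [0..<length (bits n)]"
proof (induct n rule: less_induct)
 case (less n)
 show ?case
 proof (cases "n = 0")
  case False
  have "[0..<Suc k] = 0 # map Suc [0..<k]" for k by (simp add: map_Suc_upt upt_conv_Cons)
  thus ?thesis using less[of "n div 2"] False
   by (auto simp: bits_rec[of n] comp_def div_mult2_eq odd_iff_mod_2_eq_one simp del: upt_Suc)
 qed simp
qed

text \<open>A number is at least the number of its binary digits, so a sum over the positions below
  \<open>n\<close> misses none.\<close>

lemma length_bits_eq: "length (bits n) = (\<Sum>j<n. of_bool (n div 2^j ~= 0))"
proof -
 have *: "length (bits n) = card {j. 2^j<=n}" for n
 proof (induct n rule: less_induct)
  case (less n)
  show ?case
  proof (cases "n = 0")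
   case False
   have "{j. 2^j<=n} = insert 0 (Suc ` {j. 2^j<=n div 2})"
   proof (rule set_eqI)
    fix j show "(j : {j. 2^j<=n}) = (j : insert 0 (Suc ` {j. 2^j<=n div 2}))"
     using False by (cases j) (auto simp: less_eq_div_iff_mult_less_eq mult.commute)
   qed
   moreover have "finite {j. 2^j<=n div (2::nat)}"
    by (rule finite_subset[of _ "{..n}"]) (auto, metis div_le_dividend le_trans less_exp less_or_eq_imp_le)
   ultimately show ?thesis using less[of "n div 2"] False by (simp add: bits_rec[of n] card_image)
  qed simp
 qed
 have "{j. 2^j<=n} = {..<n} Int {j. n div 2^j ~= 0}"
  by (auto simp: div_eq_0_iff) (metis less_exp less_le_trans)
 thus ?thesis unfolding * by (simp add: sum.If_cases of_bool_def)
qed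

lemma Comp_length_bits: assumes "Comp rho f" shows "Comp rho (%e. length (bits (f e)))"
 unfolding length_bits_eq
 by (intro Comp_sum assms Comp_of_bool CompB_not CompB_eq Comp_shift Comp_const Comp_snd Comp_lift[OF assms])

lemma CW_enc_nat: assumes "Comp rho f" shows "CW rho (%e. enc_nat (f e))"
proof -
 have "enc_nat n = concat (map (%j. [True, n div 2^j mod 2 = 1]) [0..<length (bits n)])@[False]" for n
  unfolding enc_nat_def enc_list_def by (subst bits_eq) (simp add: comp_def)
 thus ?thesis
  by (simp only:) (intro CW_append CW_concat CW_bit CW_Cons CW_Nil Comp_length_bits assms CompB_eq CompB_const Comp_mod Comp_shift Comp_const Comp_snd Comp_lift)
qed

lemma sorted_list_filter: assumes "A<={..<N}" shows "sorted_list_of_set A = filter (%a. a : A) [0..<N]"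
proof (rule sorted_distinct_set_unique)
 show "set (sorted_list_of_set A) = set (filter (%a. a : A) [0..<N])"
  using assms finite_subset[OF assms] by auto
qed (auto intro: sorted_wrt_filter)

lemma enc_list_filter: "enc_list e (filter P [0..<N]) = concat (map (%a. if P a then True # e a else []) [0..<N])@[False]"
 unfolding enc_list_def by (induct N) auto

text \<open>With all names below \<open>N\<close>, a set code is a concatenation over all candidates
  to which absent ones contribute the empty word; this is the shape that \<open>CW_concat\<close>
  handles.\<close>

lemma enc_set_eq: "A<={..<N} ==> enc_set e A = concat (map (%a. if a : A then True # enc_nat a@e a else []) [0..<N])@[False]"
 unfolding enc_set_def by (simp add: sorted_list_filter enc_list_filter)

lemma enc_marking_eq: "places M<={..<N} ==> enc_marking M m = concat (map (%a. if a : places M then True # enc_nat (m a) else []) [0..<N])@[False]"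
 unfolding enc_marking_def by (simp add: sorted_list_filter enc_list_filter)

lemmas CW_rules = CW_Nil CW_bit CW_Cons CW_append CW_if CW_concat CW_enc_nat

text \<open>The leading 1 makes the word recoverable from the number.\<close>

definition num :: "bool list => nat" where
 "num x = fold (%b a. 2*a+of_bool b) x 1"

lemma num_snoc: "num (x@[b]) = 2*num x+of_bool b" by (simp add: num_def)

lemma num_bound: "num x<2^Suc (length x) & 2^length x<=num x"
 by (induct x rule: rev_induct) (auto simp: num_snoc num_def)

lemma num_bit: "i<length x ==> (num x div 2^(length x-Suc i) mod 2 = Suc 0) = x ! i"
proof (induct x rule: rev_induct)
 case (snoc b x)
 show ?case
 proof (cases "i<length x")
  case True
  then obtain d where d: "length x = Suc (i+d)" using less_iff_Suc_add by blast
  have "(2*num x+of_bool b) div 2 = num x" by (cases b) auto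
  thus ?thesis using snoc(1) True d by (simp add: num_snoc nth_append div_mult2_eq)
 qed (use snoc(2) in \<open>auto simp: num_snoc nth_append\<close>)
qed simp

text \<open>The word \<open>x\<close> is available only through the number \<open>num x\<close> and
  its length; \<open>num_bit\<close> recovers its letters.\<close>

lemma CompB_eq_word:
 assumes "CW rho w" "Comp rho (%e. num (x e))" "Comp rho (%e. length (x e))"
 shows "CompB rho (%e. w e = x e)"
proof -
 have e: "(w e = x e) = (length (w e) = length (x e) & (ALL i<length (x e). bit (w e) i = (num (x e) div 2^(length (x e)-Suc i) mod 2 = Suc 0)))" for e
  by (auto simp: list_eq_iff_nth_eq num_bit bit_def)
 show ?thesis unfolding e
  using assms(1) unfolding CW_def
  by (intro CompB_conj CompB_eq CompB_all CompB_iff Comp_mod Comp_shift Comp_minus Comp_Suc Comp_const Comp_snd Comp_lift[OF assms(2)] Comp_lift[OF assms(3)] assms(2,3)) auto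
qed

section \<open>Exponential space and polynomial time\<close>

lemma PB_value_bound:
 assumes "PB rho T" "!!e. total rho e<=W e"
 obtains k where "!!e. T e<=(W e+2)^k"
proof -
 obtain k where k: "!!e. T e<=(total rho e+2)^k" using assms(1) unfolding PB_def by blast
 have "T e<=(W e+2)^k" for e
  using k[of e] power_mono[of "total rho e+2" "W e+2" k] assms(2)[of e] by simp
 thus ?thesis by (rule that)
qed

lemma poly_simple: obtains k where "!!n. (n+2)^c<=n^k+(k::nat)"
proof (rule that[of "2*c+3^c"])
 fix n :: nat
 show "(n+2)^c<=n^(2*c+3^c)+(2*c+3^c)"
 proof (cases "n<2")
  case True
  hence "(n+2)^c<=3^c" by (intro power_mono) auto
  thus ?thesis by simp
 next
  case False
  hence "2*n<=n*n" by (intro mult_le_mono1) simp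
  hence "n+2<=n^2" using False unfolding power2_eq_square by linarith
  hence "(n+2)^c<=(n^2)^c" by (intro power_mono) auto
  also have "... <= n^(2*c+3^c)" unfolding power_mult[symmetric] using False by (intro power_increasing) auto
  finally show ?thesis by simp
 qed
qed

text \<open>The doubly exponential yardstick: once its value is an argument, polynomial time in the
  arguments means registers with exponentially many digits.\<close>

definition Zf :: "nat => bool list => nat" where
 "Zf k x = 2^2^(length x^k+k)"

lemma Zf_rec: "Zf k x = rec_nat 2 (%_ y. y*y) (length x^k+k)"
proof -
 have "rec_nat 2 (%_ y. y*y) n = (2::nat)^2^n" for n by (induct n) (auto simp: power_mult[symmetric] power2_eq_square[symmetric] mult.commute)
 thus ?thesis by (simp add: Zf_def)
qed

lemma Zf_large: assumes "0<k" shows "num x+length x+2<=2*Zf k x"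
proof -
 have "length x<=length x^k" using assms by (cases "length x") (auto simp: self_le_power)
 hence "(2::nat)^Suc (length x)<=2^(length x^k+k)" using assms by (intro power_increasing) auto
 moreover have "(2::nat)^(length x^k+k)<2^2^(length x^k+k)" by (rule less_exp)
 ultimately have "num x+1<=Zf k x" using num_bound[of x] unfolding Zf_def by linarith
 moreover have "length x<2^length x" by (rule less_exp)
 ultimately show ?thesis using num_bound[of x] by linarith
qed

text \<open>One scan of the input builds its length and \<open>num\<close>, repeated squaring yields
  \<open>Zf k\<close>, and then the given program decides.\<close>

theorem EXPSPACE_I:
 assumes P: "CompB [length, num, Zf k] (%x. x : L)" and k: "0<k"
 shows "L : EXPSPACE"
proof -
 have id: "Comp [%e::nat. e] (%e. 2*e+of_bool b)" for b by (intro Comp_rules Comp_var) auto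
 obtain T0 T1 where T: "PB [%e. e] T0" "Compt [%e. e] (%e. 2*e+of_bool False) T0" "PB [%e. e] T1" "Compt [%e. e] (%e. 2*e+of_bool True) T1"
  using id[of False] id[of True] unfolding Comp_def by blast
 have nk: "Comp [length, num] (%x. length x^k+k)" by (intro Comp_rules Comp_var) auto
 then obtain Tn where Tn: "PB [length, num] Tn" "Compt [length, num] (%x. length x^k+k) Tn" unfolding Comp_def by blast
 let ?rz = "[length, num, %x. length x^k+k, %_. 0]"
 obtain Ta where Ta: "PB ?rz Ta" "Compt ?rz (%_. 2) Ta" using Comp_const[of ?rz 2] unfolding Comp_def by blast
 let ?rf = "map (%r. r o (fst o fst)) [length, num]@[%e. (length (fst (fst e))^k+k)-Suc (snd (fst e)), %e. snd (fst e), %e. snd e]"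
 have "Comp ?rf (%e. snd e*snd e)" by (intro Comp_mult Comp_var) auto
 then obtain Tf where Tf: "PB ?rf Tf" "Compt ?rf (%e. snd e*snd e) Tf" unfolding Comp_def by blast
 obtain Tp where Tp: "PB [length, num, Zf k] Tp" "Compt [length, num, Zf k] (%x. of_bool (x : L)) Tp" using P unfolding CompB_def Comp_def by blast
 let ?Z = "Zf k"
 have Z2: "2<=?Z x" for x
 proof -
  have "(2::nat)^1<=2^2^(length x^k+k)" by (intro power_increasing) auto
  thus ?thesis by (simp add: Zf_def)
 qed
 have nkZ: "length x^k+k<=?Z x" for x
  unfolding Zf_def using less_exp[of "length x^k+k"] less_exp[of "2^(length x^k+k)"] by linarith
 have RZ: "rec_nat 2 (%_ y. y*y) i<=?Z x" if "i<=length x^k+k" for i x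
 proof -
  have "rec_nat 2 (%_ y. y*y) n = (2::nat)^2^n" for n by (induct n) (auto simp: power_mult[symmetric] power2_eq_square[symmetric] mult.commute)
  thus ?thesis using that by (simp add: Zf_def)
 qed
 obtain k0 where k0: "!!e. T0 e+T1 e<=(e+2)^k0"
  using PB_value_bound[OF PB_add[OF T(1,3)], of "%e. e"] by auto
 have large: "num x+length x<=2*?Z x" for x using Zf_large[OF k, of x] by simp
 have l1: "total [length, num] x<=2*?Z x" and l2: "total ?rz x<=3*?Z x" and l3: "total [length, num, ?Z] x<=3*?Z x" for x
  using large[of x] nkZ[of x] by simp_all
 obtain kn where kn: "!!x. Tn x<=(2*?Z x+2)^kn" using PB_value_bound[OF Tn(1) l1] by blast
 obtain ka where ka: "!!x. Ta x<=(3*?Z x+2)^ka" using PB_value_bound[OF Ta(1) l2] by blast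
 obtain kp where kp: "!!x. Tp x<=(3*?Z x+2)^kp" using PB_value_bound[OF Tp(1) l3] by blast
 obtain kf where kf: "!!e. Tf e<=(total ?rf e+2)^kf" using Tf(1) unfolding PB_def by blast
 have U: "Tf ((x, i), rec_nat 2 (%_ y. y*y) i)<=(5*?Z x+2)^kf" if "i<length x^k+k" for x i
 proof -
  have "total ?rf ((x, i), rec_nat 2 (%_ y. y*y) i)<=5*?Z x"
   using large[of x] nkZ[of x] RZ[of i x] that by simp
  thus ?thesis using kf[of "((x, i), rec_nat 2 (%_ y. y*y) i)"]
    power_mono[of "total ?rf ((x, i), rec_nat 2 (%_ y. y*y) i)+2" "5*?Z x+2" kf] by simp
 qed
 let ?TZ = "%x. Tn x+Ta x+(length x^k+k)*((5*?Z x+2)^kf+6*?Z x+11)+2*(length x^k+k)+4*?Z x+10"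
 \<comment> \<open>\<open>Comp_rec\<close> does not apply, since \<open>Zf k\<close> is not
   polynomially bounded in \<open>length\<close> and \<open>num\<close>. The time of its computation
   is bounded in terms of its own value instead.\<close>
 have CZ: "Compt [length, num] ?Z ?TZ"
  using Compt_iter[of "[length, num]" "%x. length x^k+k" Tn "%_. 2" Ta "%_ _ y. y*y" Tf, OF Tn(2) _ _ U RZ] Ta(2) Tf(2)
  unfolding Zf_rec[symmetric] by simp
 from CZ obtain dz cz where "impl [length, num] ?Z ?TZ dz cz" unfolding Compt_def by blast
 note cz = implD[OF this]
 from Tp(2) obtain dp cp where "impl [length, num, ?Z] (%e. of_bool (e : L)) Tp dp cp" unfolding Compt_def by blast
 note cp = implD[OF this]
 from T(2) obtain d0 c0 where "impl [%e. e] (%e. 2*e+of_bool False) T0 d0 c0" unfolding Compt_def by blast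
 note c0 = implD[OF this]
 from T(4) obtain d1 c1 where "impl [%e. e] (%e. 2*e+of_bool True) T1 d1 c1" unfolding Compt_def by blast
 note c1 = implD[OF this]
 define m where "m = 10+dz+dp+d0+d1"
 \<comment> \<open>Register 0 is kept for the answer, 1 receives the length and 2 the value of
   \<open>num\<close>. \<open>c0\<close> and \<open>c1\<close> have their argument in 2 and leave
   the result in 3. The \<open>inc 2\<close> before the loop provides the leading 1 of
   \<open>num\<close>.\<close>
 let ?body = "Seq (inc 1) (Seq (If (%as. as ! 0 = 2) (c1 2 m) (c0 2 m)) (Seq (clear 2) (Seq (move_reg 3 2) right)))"
 let ?c = "Seq (inc 2) (Seq (While (%as. as ! 0 ~= 0) ?body) (Seq (cz 1 m) (Seq (cp 1 m) (move_reg 4 0))))"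
 let ?Tt = "%x. 1+(1+length x*Suc (1+1+(1+(num x+2)^k0)+1+(2*num x+1)+1+(8*num x+9)+1+1)+1+1)+?TZ x+Tp x+10"
 have mg: "3+dz<m" "4+dp<m" "3+d0<m" "3+d1<m" "9<m" by (auto simp: m_def)
 have wf: "wfc (Suc (Suc m)) ?c" using cz(1)[of 1 m] cp(1)[of 1 m] c0(1)[of 2 m] c1(1)[of 2 m] mg by simp
 have run: "nx m x ?c (0, %_. 0, []) (?Tt x) (length x, (%_. 0)(0 := of_bool (x : L), 1 := length x, 2 := num x, 3 := ?Z x), [])" for x
 proof -
  let ?s = "%j. (j, (%_. 0)(1 := j, 2 := num (take j x)), [])"
  have 1: "nx m x (inc 2) (0, %_. 0, []) 1 (?s 0)"
   using nx_inc[of 2 m x 0 "%_. 0" "[]"] by (simp add: m_def num_def fun_upd_idem)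
  have "nx m x (While (%as. as ! 0 ~= 0) ?body) (?s 0) (length x*Suc (1+1+(1+(num x+2)^k0)+1+(2*num x+1)+1+(8*num x+9)+1+1)+1) (?s (length x))"
  proof (rule nx_loop[where s = ?s], rule conjI)
   fix j assume j: "j<length x"
   show "syms (tapes m x (?s j)) ! 0 ~= 0" using j by simp
   have tk: "num (take (Suc j) x) = 2*num (take j x)+of_bool (x ! j)" using j by (simp add: take_Suc_conv_app_nth num_snoc)
   have nm: "num (take j x)<=num x"
   proof -
    have "num u<=num (u@w)" for u w by (induct w rule: rev_induct) (auto simp: num_snoc simp flip: append_assoc)
    from this[of "take j x" "drop j x"] show ?thesis by simp
   qed
   have kk: "(num (take j x)+2)^k0<=(num x+2)^k0" using nm by (intro power_mono) auto
   let ?v = "(%_. 0)(1 := Suc j, 2 := num (take j x))"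
   have b1: "nx m x (inc 1) (?s j) 1 (j, ?v, [])"
    using nx_inc[of 1 m x j "(%_. 0)(1 := j, 2 := num (take j x))" "[]"] by (simp add: m_def fun_upd_twist)
   have r: "regs 2 m [%e. e] (num (take j x)) ?v" by (simp add: regs_def)
   have b2: "nx m x (If (%as. as ! 0 = 2) (c1 2 m) (c0 2 m)) (j, ?v, []) (Suc ((num x+2)^k0)) (j, ?v(3 := num (take (Suc j) x)), [])"
   proof (rule nx_If)
    show "nx m x (if syms (tapes m x (j, ?v, [])) ! 0 = 2 then c1 2 m else c0 2 m) (j, ?v, []) ((num x+2)^k0) (j, ?v(3 := num (take (Suc j) x)), [])"
     using nx_mono[OF c1(2)[of 2 m "num (take j x)" ?v x j "[]"], of "(num x+2)^k0"] nx_mono[OF c0(2)[of 2 m "num (take j x)" ?v x j "[]"], of "(num x+2)^k0"]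
      r k0[of "num (take j x)"] kk j tk by (simp add: m_def)
   qed
   have b3: "nx m x (clear 2) (j, ?v(3 := num (take (Suc j) x)), []) (2*num x+1) (j, (%_. 0)(1 := Suc j, 3 := num (take (Suc j) x)), [])"
    using nx_clear[of 2 m "?v(3 := num (take (Suc j) x))" "num x" x j "[]"] nm by (simp add: m_def fun_upd_twist fun_upd_idem)
   have b4: "nx m x (move_reg 3 2) (j, (%_. 0)(1 := Suc j, 3 := num (take (Suc j) x)), []) (8*num x+9) (j, (%_. 0)(1 := Suc j, 2 := num (take (Suc j) x)), [])"
    using nx_mono[OF nx_move[of 3 m 2 "(%_. 0)(1 := Suc j, 3 := num (take (Suc j) x))" "2*num x+1" x j "[]"], of "8*num x+9"] nm tk
    by (simp add: m_def fun_upd_twist fun_upd_idem)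
   have b5: "nx m x right (j, (%_. 0)(1 := Suc j, 2 := num (take (Suc j) x)), []) 1 (?s (Suc j))"
    using nx_right[OF j] by simp
   show "nx m x ?body (?s j) (1+1+(1+(num x+2)^k0)+1+(2*num x+1)+1+(8*num x+9)+1+1) (?s (Suc j))"
    by (rule nx_mono[OF nx_Seq[OF b1 nx_Seq[OF b2 nx_Seq[OF b3 nx_Seq[OF b4 b5]]]]]) simp
  qed simp
  hence 2: "nx m x (While (%as. as ! 0 ~= 0) ?body) (?s 0) (length x*Suc (1+1+(1+(num x+2)^k0)+1+(2*num x+1)+1+(8*num x+9)+1+1)+1)
   (length x, (%_. 0)(1 := length x, 2 := num x), [])" by simp
  have 3: "nx m x (cz 1 m) (length x, (%_. 0)(1 := length x, 2 := num x), []) (?TZ x) (length x, (%_. 0)(1 := length x, 2 := num x, 3 := ?Z x), [])"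
   using cz(2)[of 1 m x "(%_. 0)(1 := length x, 2 := num x)" x "length x" "[]"] mg by (simp add: regs_def less_Suc_eq nth_Cons' eval_nat_numeral)
  have 4: "nx m x (cp 1 m) (length x, (%_. 0)(1 := length x, 2 := num x, 3 := ?Z x), []) (Tp x) (length x, (%_. 0)(1 := length x, 2 := num x, 3 := ?Z x, 4 := of_bool (x : L)), [])"
   using cp(2)[of 1 m x "(%_. 0)(1 := length x, 2 := num x, 3 := ?Z x)" x "length x" "[]"] mg by (simp add: regs_def less_Suc_eq nth_Cons' eval_nat_numeral)
  have 5: "nx m x (move_reg 4 0) (length x, (%_. 0)(1 := length x, 2 := num x, 3 := ?Z x, 4 := of_bool (x : L)), []) 5
   (length x, (%_. 0)(0 := of_bool (x : L), 1 := length x, 2 := num x, 3 := ?Z x), [])"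
   using nx_move[of 4 m 0 "(%_. 0)(1 := length x, 2 := num x, 3 := ?Z x, 4 := of_bool (x : L))" 1 x "length x" "[]"] by (simp add: m_def fun_upd_twist fun_upd_idem)
  show ?thesis by (rule nx_mono[OF nx_Seq[OF 1 nx_Seq[OF 2 nx_Seq[OF 3 nx_Seq[OF 4 5]]]]]) simp
 qed
 have PT: "PB [?Z] ?Tt"
 proof -
  have z: "PB [?Z] ?Z" by (rule PB_var) simp
  have n: "PB [?Z] num" "PB [?Z] length" "PB [?Z] (%x. length x^k+k)"
   using PB_le[OF PB_mult[OF PB_const[of _ 2] z]] large nkZ PB_le[OF z] by (meson add_leD1 add_leD2)+
  have "PB [?Z] Tn" "PB [?Z] Ta" "PB [?Z] Tp"
   by (rule PB_le[OF _ kn] PB_le[OF _ ka] PB_le[OF _ kp]; intro PB_rules z)+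
  thus ?thesis by (intro PB_rules z n)
 qed
 then obtain K where K: "!!x. ?Tt x<=(?Z x+2)^K" unfolding PB_def by auto
 \<comment> \<open>Time, and with it every register, stays below \<open>2^B x\<close>, so
   \<open>B x\<close> bounds the digits. It is exponential in the length of the input, although
   \<open>?Z x\<close> is doubly exponential.\<close>
 define B where "B x = 2*K*2^(length x^k+k)+2" for x :: "bool list"
 have TB: "?Tt x<2^B x" for x
 proof -
  have "?Z x+2<=?Z x^2" using mult_le_mono1[OF Z2[of x], of "?Z x"] Z2[of x] unfolding power2_eq_square by linarith
  hence "?Tt x<=(?Z x^2)^K" using K[of x] power_mono[of "?Z x+2" "?Z x^2" K] by linarith
  also have "... = 2^(2*K*2^(length x^k+k))" unfolding Zf_def by (simp add: power_mult[symmetric] mult.commute mult.left_commute)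
  also have "... < 2^B x" unfolding B_def by (intro power_strict_increasing) auto
  finally show ?thesis .
 qed
 have go: "EX t ts'. go (int (B x+length x+4)) ?c (init_tapes (Suc (Suc m)) x) t ts' & length ts' = Suc (Suc m) & (syms ts' ! 1 = 0) = (x ~: L)" for x
 proof -
  have e: "tapes m x (0, %_. 0, []) = init_tapes (Suc (Suc m)) x"
   by (rule nth_equalityI) (auto simp: tapes_def init_tapes_def nth_append nth_Cons' contents_def)
  obtain t where "go (int (B x+length x+4)) ?c (tapes m x (0, %_. 0, [])) t (tapes m x (length x, (%_. 0)(0 := of_bool (x : L), 1 := length x, 2 := num x, 3 := ?Z x), []))"
   using nxD(4)[OF run, of x "B x" "int (B x+length x+4)"] TB[of x] by auto
  thus ?thesis unfolding e by (intro exI conjI, assumption) (auto simp: m_def)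
 qed
 let ?M = "mk_tm (Suc (Suc m)) ?c"
 have tm: "is_tm ?M" using mk_tm_is_tm[OF wf] by simp
 have dec: "decides ?M L" unfolding decides_def
 proof
  fix x
  obtain t ts' where "go (int (B x+length x+4)) ?c (init_tapes (Suc (Suc m)) x) t ts'" "length ts' = Suc (Suc m)" "(syms ts' ! 1 = 0) = (x ~: L)"
   using go[of x] by force
  thus "EX n. fst (run ?M x n) = (if x : L then 1 else 2)" using mk_tm_run(1)[of _ ?c "Suc (Suc m)" x t ts'] by (intro exI[of _ "Suc t"]) auto
 qed
 obtain c where c: "!!n. (n+2)^(k+2*K+2*k+6)<=n^c+(c::nat)" using poly_simple by blast
 have sp: "within_space ?M x (2^(length x^c+c))" for x
 proof -
  let ?n = "length x"
  have a: "B x+?n+4<=2^(?n^c+c)"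
  proof -
   have k1: "2*K+1<=2^(2*K)" using less_exp[of "2*K"] by presburger
   have "?n<=2^(?n^k+k)" using less_exp[of ?n] power_increasing[of ?n "?n^k+k" "2::nat"] k by (cases ?n) (auto simp: self_le_power trans_le_add1 intro: order.trans less_imp_le)
   hence "B x+?n+4<=(2*K+1)*2^(?n^k+k)+6" unfolding B_def by (simp add: algebra_simps)
   also have "... <= 2^(2*K)*2^(?n^k+k)+2^3" using k1 by (intro add_mono mult_le_mono1) auto
   also have "... <= 2^(2*K+(?n^k+k)+3)+2^(2*K+(?n^k+k)+3)" unfolding power_add[symmetric] by (meson add_mono_thms_linordered_semiring(1) le_add1 le_add2 one_le_numeral power_increasing)
   also have "... = 2^Suc (2*K+(?n^k+k)+3)" by (metis mult_2 power_Suc)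
   also have "... <= 2^(?n^c+c)"
   proof (intro power_increasing)
    have "Suc (2*K+(?n^k+k)+3)<=(?n+2)^k+(?n+2)^(2*K+k+4)"
     using less_exp[of "2*K+k+4"] power_mono[of 2 "?n+2" "2*K+k+4"] power_mono[of ?n "?n+2" k] by linarith
    also have "... <= (?n+2)^(k+2*K+k+4)+(?n+2)^(k+2*K+k+4)" by (intro add_mono power_increasing) auto
    also have "... = 2*(?n+2)^(k+2*K+k+4)" by (rule mult_2[symmetric])
    also have "... <= (?n+2)^Suc (k+2*K+k+4)" unfolding power_Suc by (rule mult_le_mono1) simp
    also have "... <= (?n+2)^(k+2*K+2*k+6)" by (intro power_increasing) auto
    also have "... <= ?n^c+c" by (rule c)
    finally show "Suc (2*K+(?n^k+k)+3)<=?n^c+c" .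
   qed auto
   finally show ?thesis .
  qed
  obtain t ts' where "go (int (B x+length x+4)) ?c (init_tapes (Suc (Suc m)) x) t ts'" "length ts' = Suc (Suc m)"
   using go[of x] by blast
  hence "within (int (B x+length x+4)) (snd (run ?M x n))" for n using mk_tm_run(2)[of _ ?c "Suc (Suc m)" x t ts'] by auto
  moreover have "int (B x+length x+4)<=int (2^(length x^c+c))" using a by (simp only: of_nat_le_iff)
  ultimately have "within (int (2^(length x^c+c))) (snd (run ?M x n))" for n using within_mono by blast
  thus ?thesis unfolding within_space_def within_def by blast
 qed
 show ?thesis unfolding EXPSPACE_def using tm dec sp by blast
qed

definition "emits rho w T d c = (PB rho T & (ALL b m. b+length rho+d<m --> wfc (Suc (Suc m)) (c b m) &
  (ALL x i v u e. regs b m rho e v --> nx m x (c b m) (i, v, u) (T e) (i, v, u@w e))))"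

lemma emitsD:
 assumes "emits rho w T d c"
 shows "PB rho T" "b+length rho+d<m ==> wfc (Suc (Suc m)) (c b m)"
  "b+length rho+d<m ==> regs b m rho e v ==> nx m x (c b m) (i, v, u) (T e) (i, v, u@w e)"
 using assms unfolding emits_def by auto

text \<open>A counter runs through the positions; each bit is computed, written and cleared, so the
  word itself is never stored.\<close>

lemma CW_emit:
 assumes "CW rho w"
 obtains T d c where "emits rho w T d c"
proof -
 let ?F = "map (%r. r o fst) rho@[%e. length (w (fst e))-Suc (snd e), %e. snd e]"
 have "Comp ?F (%e. of_bool (bit (w (fst e)) (snd e)))"
  using assms unfolding CW_def CompB_def by (elim conjE Comp_mono) (auto simp: ext_def)
 then obtain TF TL where T: "PB rho TL" "Compt rho (%e. length (w e)) TL" "PB ?F TF" "Compt ?F (%e. of_bool (bit (w (fst e)) (snd e))) TF"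
  using assms unfolding CW_def Comp_def by blast
 from T(2) obtain d c where "impl rho (%e. length (w e)) TL d c" unfolding Compt_def by blast
 note c = implD[OF this]
 from T(4) obtain d2 c2 where "impl ?F (%e. of_bool (bit (w (fst e)) (snd e))) TF d2 c2" unfolding Compt_def by blast
 note c2 = implD[OF this]
 obtain k where k: "!!e. TF e<=(total ?F e+2)^k" using T(3) unfolding PB_def by blast
 define U where "U e = (total rho e+length (w e)+2)^k" for e
 have PL: "PB rho (%e. length (w e))" using assms unfolding CW_def by (blast intro: Comp_bound)
 have U: "TF (e, i)<=U e" if "i<length (w e)" for e i
 proof -
  have "total (map (%r. r o fst) rho) (e, i) = total rho e" by (simp add: total_def comp_def)
  hence "TF (e, i)<=(total rho e+((length (w e)-Suc i)+i)+2)^k" using k[of "(e, i)"] by simp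
  also have "... <= U e" unfolding U_def using that by (intro power_mono) auto
  finally show ?thesis .
 qed
 let ?n = "%b. b+length rho"
 let ?body = "%b m. Seq (dec (?n b)) (Seq (c2 b m) (Seq (If (%as. as ! Suc (?n b+2) = 0) (out m False) (out m True)) (Seq (clear (?n b+2)) (inc (?n b+1)))))"
 let ?c = "%b m. Seq (c b m) (Seq (loop (?n b) (?body b m)) (clear (?n b+1)))"
 let ?T = "%e. TL e+length (w e)*(U e+12)+2*length (w e)+10"
 show ?thesis
 proof (rule that[of ?T "d+d2+3" ?c], unfold emits_def, intro conjI allI impI)
  show "PB rho ?T" unfolding U_def by (intro PB_rules PB_total T PL)
 next
  fix b m assume "b+length rho+(d+d2+3)<m"
  thus "wfc (Suc (Suc m)) (?c b m)" using c(1)[of b m] c2(1)[of b m] by simp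
 next
  fix b m :: nat and x :: "bool list" and i :: nat and v :: "nat => nat" and u :: "bool list" and e
  assume *: "b+length rho+(d+d2+3)<m" "regs b m rho e v"
  define n where "n = b+length rho"
  have n: "n+(d+d2+3)<m" using * by (simp add: n_def)
  have z: "v q = 0" if "n<=q" "q<m" for q using *(2) that by (simp add: regs_def n_def)
  have vr: "v (b+j) = (rho ! j) e" if "j<length rho" for j using *(2) that by (simp add: regs_def)
  let ?L = "length (w e)"
  let ?s = "%j. (i, v(n := ?L-j, n+1 := j), u@take j (w e))"
  have s0: "?s 0 = (i, v(n := ?L), u)" using z[of "n+1"] n by (auto simp: fun_eq_iff)
  have 1: "nx m x (c b m) (i, v, u) (TL e) (?s 0)" unfolding s0 using * c(2) by (simp add: n_def)
  let ?K = "Suc (1+Suc (U e+Suc (Suc 1+Suc (3+1))))"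
  have "nx m x (loop n (?body b m)) (?s 0) (?L*Suc ?K+1) (?s ?L)"
   unfolding loop_def
  proof (rule nx_loop[where s = ?s], rule conjI)
   fix j assume j: "j<?L"
   let ?b = "of_bool (w e ! j) :: nat"
   let ?v = "v(n := ?L-Suc j, n+1 := j)"
   show "syms (tapes m x (?s j)) ! Suc n ~= 0" using n j by simp
   have b1: "nx m x (dec n) (?s j) 1 (i, ?v, u@take j (w e))"
    using nx_dec[of n m "v(n := ?L-j, n+1 := j)" x i] n j by (simp add: fun_upd_twist)
   have r3: "regs b m ?F (e, j) ?v"
    unfolding regs_def using vr z n by (auto simp: n_def nth_append less_Suc_eq nth_Cons')
   have b2: "nx m x (c2 b m) (i, ?v, u@take j (w e)) (U e) (i, ?v(n+2 := ?b), u@take j (w e))"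
    by (rule nx_mono[OF _ U[OF j]], insert c2(2)[OF _ r3, of x i "u@take j (w e)"] n j) (simp add: n_def bit_def)
   have b3: "nx m x (If (%as. as ! Suc (n+2) = 0) (out m False) (out m True)) (i, ?v(n+2 := ?b), u@take j (w e)) (Suc 1) (i, ?v(n+2 := ?b), u@take (Suc j) (w e))"
    using nx_out[of m x "w e ! j" i "?v(n+2 := ?b)" "u@take j (w e)"] n j by (intro nx_If) (cases "w e ! j"; simp add: take_Suc_conv_app_nth)
   have b4: "nx m x (clear (n+2)) (i, ?v(n+2 := ?b), u@take (Suc j) (w e)) 3 (i, ?v, u@take (Suc j) (w e))"
    using nx_clear[of "n+2" m "?v(n+2 := ?b)" 1 x i] n z[of "n+2"] by (simp add: fun_upd_idem eval_nat_numeral)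
   have b5: "nx m x (inc (n+1)) (i, ?v, u@take (Suc j) (w e)) 1 (?s (Suc j))"
    using nx_inc[of "n+1" m x i ?v] n by simp
   show "nx m x (?body b m) (?s j) ?K (?s (Suc j))"
    using nx_Seq[OF b1 nx_Seq[OF b2 nx_Seq[OF b3 nx_Seq[OF b4 b5]]]] by (simp add: n_def)
  qed (use n in simp)
  hence 2: "nx m x (loop (?n b) (?body b m)) (?s 0) (?L*Suc ?K+1) (i, v(n+1 := ?L), u@w e)"
   using z[of n] n by (simp add: n_def fun_upd_idem)
  have 3: "nx m x (clear (?n b+1)) (i, v(n+1 := ?L), u@w e) (2*?L+1) (i, v, u@w e)"
   using nx_clear[of "n+1" m "v(n+1 := ?L)" ?L x i] n z[of "n+1"] by (simp add: n_def fun_upd_idem)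
  show "nx m x (?c b m) (i, v, u) (?T e) (i, v, u@w e)"
   by (rule nx_mono[OF nx_Seq[OF 1 nx_Seq[OF 2 3]]]) (simp add: algebra_simps)
 qed
qed

text \<open>\<open>T\<close> register operations on numbers of at most \<open>Suc (n+T)\<close>
  digits, plus the final step of the machine.\<close>

lemma time_bound: assumes "T<=(n+2)^K" shows "Suc (T*(6*Suc (n+T)+20))<=(n+2 :: nat)^(2*K+7)"
proof -
 define z y where zy: "z = (n+2)^K" "y = (n+2)^Suc K"
 have z: "1<=z" "z<=y" "T<=z" using assms by (auto simp: zy)
 have "n<=y" using self_le_power[of "n+2" "Suc K"] by (simp add: zy del: power_Suc)
 hence "6*Suc (n+T)+20<=38*y" using z by simp
 hence "T*(6*Suc (n+T)+20)<=z*(38*y)" using z by (intro mult_le_mono) auto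
 moreover have "1<=z*y" using mult_le_mono[OF z(1), of 1 y] z by simp
 ultimately have "Suc (T*(6*Suc (n+T)+20))<=39*(z*y)" by linarith
 also have "... <= (n+2)^6*(z*y)" using power_mono[of 2 "n+2" 6] by (intro mult_le_mono) auto
 also have "... = (n+2)^(2*K+7)" unfolding zy by (simp add: power_add[symmetric] del: power_Suc)
 finally show ?thesis .
qed

text \<open>The value \<open>num x\<close> is exponential and hence out of reach in polynomial time.
  So letters may influence the output only one at a time: each position contributes one of two words
  computed from the length and the position. Positions run from right to left because the head
  stands at the right end after counting the length.\<close>

theorem polytime_I:
 assumes F: "CW [%n. n] F1" "CW [%n. n] F2" and G: "CW [fst, snd] G0" "CW [fst, snd] G1"
  and f: "!!x. f x = F1 (length x)@concat (map (%j. if x ! j then G1 (length x, j) else G0 (length x, j)) (rev [0..<length x]))@F2 (length x)"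
 shows "polytime_computable f"
proof -
 obtain TF1 d1 c1 where "emits [%n. n] F1 TF1 d1 c1" using CW_emit[OF F(1)] .
 note F1 = emitsD[OF this]
 obtain TF2 d2 c2 where "emits [%n. n] F2 TF2 d2 c2" using CW_emit[OF F(2)] .
 note F2 = emitsD[OF this]
 obtain TG0 d3 c3 where "emits [fst, snd] G0 TG0 d3 c3" using CW_emit[OF G(1)] .
 note G0 = emitsD[OF this]
 obtain TG1 d4 c4 where "emits [fst, snd] G1 TG1 d4 c4" using CW_emit[OF G(2)] .
 note G1 = emitsD[OF this]
 obtain k where k: "!!e. TG0 e+TG1 e<=(total [fst, snd] e+2)^k" using PB_add[OF G0(1) G1(1)] unfolding PB_def by blast
 define V where "V n = (2*n+2)^k" for n :: nat
 define m where "m = 5+d1+d2+d3+d4"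
 have mg: "1+d1<m" "1+d2<m" "2+d3<m" "2+d4<m" "4<m" by (auto simp: m_def)
 let ?body = "Seq (dec 1) (Seq left (If (%as. as ! 0 = 2) (c4 0 m) (c3 0 m)))"
 let ?c = "Seq (While (%as. as ! 0 ~= 0) (Seq (inc 0) right)) (Seq (c1 0 m) (Seq (copy_reg 0 1 2) (Seq (loop 1 ?body) (c2 0 m))))"
 let ?T = "%n. (n*4+1)+TF1 n+(10*n+3)+(n*(V n+6)+1)+TF2 n+4"
 have wf: "wfc (Suc (Suc m)) ?c" using F1(2)[of 0 m] F2(2)[of 0 m] G0(2)[of 0 m] G1(2)[of 0 m] mg by simp
 have run: "nx m x ?c (0, %_. 0, []) (?T (length x)) (0, (%_. 0)(0 := length x), f x)" for x
 proof -
  let ?n = "length x" and ?v = "(%_. 0)(0 := length x) :: nat => nat"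
  let ?s = "%j. (j, (%_. 0)(0 := j), [] :: bool list)"
  have "nx m x (While (%as. as ! 0 ~= 0) (Seq (inc 0) right)) (?s 0) (?n*Suc (Suc (1+1))+1) (?s ?n)"
  proof (rule nx_loop[where s = ?s], rule conjI)
   fix j assume j: "j<?n"
   show "syms (tapes m x (?s j)) ! 0 ~= 0" using j by simp
   show "nx m x (Seq (inc 0) right) (?s j) (Suc (1+1)) (?s (Suc j))"
    using nx_Seq[OF nx_inc[of 0 m x j "(%_. 0)(0 := j)" "[]"] nx_right[OF j]] mg by simp
  qed simp
  hence 1: "nx m x (While (%as. as ! 0 ~= 0) (Seq (inc 0) right)) (0, %_. 0, []) (?n*4+1) (?n, ?v, [])"
   by (auto simp: fun_upd_idem elim!: nx_mono)
  have r: "regs 0 m [%n. n] ?n ?v" by (simp add: regs_def)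
  have 2: "nx m x (c1 0 m) (?n, ?v, []) (TF1 ?n) (?n, ?v, F1 ?n)" using F1(3)[OF _ r, of x ?n "[]"] mg by simp
  have 3: "nx m x (copy_reg 0 1 2) (?n, ?v, F1 ?n) (10*?n+3) (?n, ?v(1 := ?n), F1 ?n)"
   using nx_copy[of 0 m 1 2 ?v ?n x ?n] mg by simp
  let ?w = "%j. concat (map (%j. if x ! j then G1 (?n, j) else G0 (?n, j)) (rev [j..<?n]))"
  let ?t = "%j. (?n-j, ?v(1 := ?n-j), F1 ?n@?w (?n-j))"
  have "nx m x (loop 1 ?body) (?t 0) (?n*Suc (Suc (1+Suc (1+Suc (V ?n))))+1) (?t ?n)"
   unfolding loop_def
  proof (rule nx_loop[where s = ?t], rule conjI)
   fix j' assume "j'<?n"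
   then obtain j where j: "?n-j' = Suc j" "?n-Suc j' = j" "j<?n" by (metis Suc_diff_Suc diff_le_self Suc_le_lessD)
   show "syms (tapes m x (?t j')) ! Suc 1 ~= 0" using j mg by simp
   have b1: "nx m x (dec 1) (?t j') 1 (Suc j, ?v(1 := j), F1 ?n@?w (Suc j))"
    unfolding j using nx_dec[of 1 m "?v(1 := Suc j)" x "Suc j"] mg by simp
   have b2: "nx m x left (Suc j, ?v(1 := j), F1 ?n@?w (Suc j)) 1 (j, ?v(1 := j), F1 ?n@?w (Suc j))"
    by (rule nx_left)
   have r: "regs 0 m [fst, snd] (?n, j) (?v(1 := j))" by (auto simp: regs_def less_Suc_eq)
   have VV: "TG0 (?n, j)<=V ?n" "TG1 (?n, j)<=V ?n"
    using k[of "(?n, j)"] j power_mono[of "?n+j+2" "2*?n+2" k] by (auto simp: V_def)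
   have e: "?w j = ?w (Suc j)@(if x ! j then G1 (?n, j) else G0 (?n, j))" using j by (simp add: upt_conv_Cons)
   have b3: "nx m x (If (%as. as ! 0 = 2) (c4 0 m) (c3 0 m)) (j, ?v(1 := j), F1 ?n@?w (Suc j)) (Suc (V ?n)) (?t (Suc j'))"
    unfolding j e using nx_mono[OF G1(3)[OF _ r, of x j "F1 ?n@?w (Suc j)"] VV(2)] nx_mono[OF G0(3)[OF _ r, of x j "F1 ?n@?w (Suc j)"] VV(1)] mg j
    by (intro nx_If) simp
   show "nx m x ?body (?t j') (Suc (1+Suc (1+Suc (V ?n)))) (?t (Suc j'))"
    by (rule nx_Seq[OF b1 nx_Seq[OF b2 b3]])
  qed (use mg in simp)
  hence 4: "nx m x (loop 1 ?body) (?n, ?v(1 := ?n), F1 ?n) (?n*(V ?n+6)+1) (0, ?v, F1 ?n@?w 0)"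
   by (auto simp: fun_upd_idem algebra_simps elim!: nx_mono)
  have 5: "nx m x (c2 0 m) (0, ?v, F1 ?n@?w 0) (TF2 ?n) (0, ?v, f x)" using F2(3)[OF _ r, of x 0 "F1 ?n@?w 0"] mg by (simp add: f)
  show ?thesis by (rule nx_mono[OF nx_Seq[OF 1 nx_Seq[OF 2 nx_Seq[OF 3 nx_Seq[OF 4 5]]]]]) simp
 qed
 have id: "PB [%n::nat. n] (%n. n)" by (rule PB_var) simp
 have "PB [%n. n] ?T" unfolding V_def by (intro PB_rules id F1 F2)
 then obtain K where K: "!!n. ?T n<=(n+2)^K" unfolding PB_def by auto
 have time: "Suc (?T n*(6*Suc (n+?T n)+20))<=(n+2)^(2*K+7)" for n
  by (rule time_bound[OF K])
 obtain c where c: "!!n. (n+2)^(2*K+7)<=n^c+(c::nat)" using poly_simple by blast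
 have go: "EX b t. go b ?c (init_tapes (Suc (Suc m)) x) t (tapes m x (0, (%_. 0)(0 := length x), f x)) & Suc t<=length x^c+c" for x
 proof -
  let ?n = "length x"
  have e: "tapes m x (0, %_. 0, []) = init_tapes (Suc (Suc m)) x"
   by (rule nth_equalityI) (auto simp: tapes_def init_tapes_def nth_append nth_Cons' contents_def)
  define B where "B = Suc (?n+?T ?n)"
  have "?T ?n<B" unfolding B_def by linarith
  hence "?T ?n<2^B" using less_exp[of B] by (rule less_trans)
  then obtain t where t: "t<=?T ?n*(6*B+20)" "go (int (B+?n+length (f x)+4)) ?c (tapes m x (0, %_. 0, [])) t (tapes m x (0, (%_. 0)(0 := ?n), f x))"
   using nxD(4)[OF run, of x B "int (B+?n+length (f x)+4)"] by auto
  have "Suc t<=?n^c+c" using t(1) time[of ?n] c[of ?n] unfolding B_def by (meson Suc_le_mono le_trans)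
  thus ?thesis using t(2) unfolding e by blast
 qed
 let ?M = "mk_tm (Suc (Suc m)) ?c"
 have "EX n<=length x^c+c. is_final (run ?M x n) & fst (last (snd (run ?M x n))) = contents (f x)" for x
 proof -
  obtain b t where "go b ?c (init_tapes (Suc (Suc m)) x) t (tapes m x (0, (%_. 0)(0 := length x), f x))" "Suc t<=length x^c+c"
   using go[of x] by blast
  thus ?thesis using mk_tm_run(1)[of b ?c "Suc (Suc m)" x t]
   by (intro exI[of _ "Suc t"]) (auto simp: is_final_def tapes_def)
 qed
 moreover have "is_tm ?M" using mk_tm_is_tm[OF wf] by simp
 ultimately show ?thesis unfolding polytime_computable_def by blast
qed

section \<open>Reachability by recursive doubling\<close>

text \<open>Savitch's recursion on a midpoint, for paths of length at most \<open>2^j\<close> among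
  the numbers below \<open>Z\<close>.\<close>

fun sav :: "nat => (nat => nat => bool) => nat => nat => nat => bool" where
 "sav Z E 0 p q = (p = q \<or> E p q)"
| "sav Z E (Suc j) p q = (EX c<Z. sav Z E j p c & sav Z E j c q)"

lemma sav_sound: "sav Z E j p q ==> p<Z ==> q<Z ==> (p, q) : {(a, b). a<Z & b<Z & E a b}^*"
 by (induct j arbitrary: p q) (auto, meson rtrancl_trans)

lemma sav_complete: "l<=2^j ==> p<Z ==> q<Z ==> (p, q) : {(a, b). a<Z & b<Z & E a b} ^^ l ==> sav Z E j p q"
proof (induct j arbitrary: p q l)
 case 0
 hence "l = 0 \<or> l = 1" by auto
 thus ?case using 0 by auto
next
 case (Suc j)
 let ?R = "{(a, b). a<Z & b<Z & E a b}"
 define l1 where "l1 = l div 2"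
 have l: "l = l1+(l-l1)" "l1<=2^j" "l-l1<=2^j" using Suc(2) by (auto simp: l1_def)
 hence "(p, q) : ?R ^^ l1 O ?R ^^ (l-l1)" using Suc(5) by (metis relpow_add)
 then obtain c where c: "(p, c) : ?R ^^ l1" "(c, q) : ?R ^^ (l-l1)" by auto
 have "c<Z"
 proof (cases l1)
  case 0
  thus ?thesis using c(1) Suc(3) by simp
 next
  case (Suc n)
  thus ?thesis using c(1) by auto
 qed
 thus ?case using Suc(1)[OF l(2) Suc(3) _ c(1)] Suc(1)[OF l(3) _ Suc(4) c(2)] by auto
qed

type_synonym frame = "nat*nat*nat*nat*nat"

text \<open>A frame \<open>(j, p, q, c, h)\<close> evaluates \<open>sav j p q\<close>: the candidates below \<open>c\<close> for the midpoint have been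
 refuted, and \<open>h\<close> tells whether the first half has succeeded for \<open>c\<close>. The second component of the
 state is 0 for a call and \<open>Suc b\<close> for a return with value \<open>b\<close>.\<close>

fun sstep :: "nat => (nat => nat => bool) => frame list*nat => frame list*nat" where
 "sstep Z E ([], r) = ([], r)"
| "sstep Z E ((j, p, q, c, h) # st, r) =
  (if r = 0 then
    if j = 0 then (st, Suc (of_bool (p = q \<or> E p q)))
    else if Z<=c then (st, 1)
    else if h = 0 then ((j-1, p, c, 0, 0) # (j, p, q, c, 0) # st, 0)
    else ((j-1, c, q, 0, 0) # (j, p, q, c, 1) # st, 0)
   else if r = 2 then if h = 0 then ((j, p, q, c, 1) # st, 0) else (st, 2)
   else ((j, p, q, c+1, 0) # st, 0))"

definition ev :: "nat => (nat => nat => bool) => nat => frame list*nat => frame list*nat => bool" where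
 "ev Z E t a b = ((sstep Z E ^^ t) a = b)"

lemma ev_step: "ev Z E t b c ==> sstep Z E a = b ==> ev Z E (Suc t) a c"
 by (simp add: ev_def funpow_Suc_right del: funpow.simps)

lemma ev_trans: "ev Z E t a b ==> ev Z E u b c ==> ev Z E (t+u) a c"
 by (simp add: ev_def add.commute[of t] funpow_add)

text \<open>Each of the at most \<open>Z\<close> midpoints costs two subcalls and at most four
  further steps, and \<open>Z*(2*T+4)+1 <= (6*Z+1)*T\<close> for the time \<open>T >= 1\<close> of a
  subcall.\<close>

lemma sstep_frame:
 "EX t. t<=(6*Z+1)^j & ev Z E t ((j, p, q, 0, 0) # st, 0) (st, Suc (of_bool (sav Z E j p q)))"
proof (induct j arbitrary: p q st)
 case 0
 show ?case by (intro exI[of _ 1]) (simp add: ev_def)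
next
 case (Suc j)
 let ?T = "(6*Z+1)^j" and ?f = "%c. (Suc j, p, q, c, 0)"
 have "EX t. t<=(Z-c)*(2*?T+4)+1 &
   ev Z E t (?f c # st, 0) (st, Suc (of_bool (EX d<Z. c<=d & sav Z E j p d & sav Z E j d q)))" if "c<=Z" for c
  using that
 proof (induct "Z-c" arbitrary: c)
  case 0
  thus ?case by (intro exI[of _ 1]) (auto simp: ev_def)
 next
  case (Suc n)
  hence c: "c<Z" by simp
  have n: "n = Z-Suc c" using Suc(2) by simp
  have z: "(Z-c)*(2*?T+4) = (Z-Suc c)*(2*?T+4)+(2*?T+4)" using c by (metis Suc_diff_Suc mult_Suc add.commute)
  have ex: "(EX d<Z. c<=d & P d) = (P c \<or> (EX d<Z. Suc c<=d & P d))" for P using c by (auto simp: Suc_le_eq le_less)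
  obtain u where u: "u<=(Z-Suc c)*(2*?T+4)+1" "ev Z E u (?f (Suc c) # st, 0) (st, Suc (of_bool (EX d<Z. Suc c<=d & sav Z E j p d & sav Z E j d q)))"
   using Suc(1)[OF n Suc_leI[OF c]] by blast
  obtain t1 where t1: "t1<=?T" "ev Z E t1 ((j, p, c, 0, 0) # ?f c # st, 0) (?f c # st, Suc (of_bool (sav Z E j p c)))"
   using \<open>\<And>p q st. EX t. t <= ?T \<and> ev Z E t ((j, p, q, 0, 0) # st, 0) (st, Suc (of_bool (sav Z E j p q)))\<close>[of p c "?f c # st"] by auto
  obtain t2 where t2: "t2<=?T" "ev Z E t2 ((j, c, q, 0, 0) # (Suc j, p, q, c, 1) # st, 0) ((Suc j, p, q, c, 1) # st, Suc (of_bool (sav Z E j c q)))"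
   using \<open>\<And>p q st. EX t. t <= ?T \<and> ev Z E t ((j, p, q, 0, 0) # st, 0) (st, Suc (of_bool (sav Z E j p q)))\<close>[of c q "(Suc j, p, q, c, 1) # st"] by auto
  show ?case
  proof (cases "sav Z E j p c")
   case False
   have "ev Z E (Suc (t1+Suc u)) (?f c # st, 0) (st, Suc (of_bool (EX d<Z. Suc c<=d & sav Z E j p d & sav Z E j d q)))"
    by (rule ev_step[OF ev_trans[OF t1(2) ev_step[OF u(2)]]]) (use c False in auto)
   thus ?thesis using t1(1) u(1) False unfolding ex z by (intro exI[of _ "Suc (t1+Suc u)"]) simp
  next
   case True
   show ?thesis
   proof (cases "sav Z E j c q")
    case False
    have "ev Z E (Suc (t1+Suc (Suc (t2+Suc u)))) (?f c # st, 0) (st, Suc (of_bool (EX d<Z. Suc c<=d & sav Z E j p d & sav Z E j d q)))"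
     by (rule ev_step[OF ev_trans[OF t1(2) ev_step[OF ev_step[OF ev_trans[OF t2(2) ev_step[OF u(2)]]]]]]) (use c False True in auto)
    thus ?thesis using t1(1) t2(1) u(1) False unfolding ex z by (intro exI[of _ "Suc (t1+Suc (Suc (t2+Suc u)))"]) simp
   next
    case T: True
    have e: "Suc (of_bool (EX d<Z. c<=d & sav Z E j p d & sav Z E j d q)) = 2" using T True c by auto
    have "ev Z E 0 (st, 2) (st, 2)" by (simp add: ev_def)
    hence "ev Z E (Suc (t1+Suc (Suc (t2+Suc 0)))) (?f c # st, 0) (st, Suc (of_bool (EX d<Z. c<=d & sav Z E j p d & sav Z E j d q)))"
     unfolding e by (intro ev_step[OF ev_trans[OF t1(2) ev_step[OF ev_step[OF ev_trans[OF t2(2) ev_step]]]]]) (use c T True in \<open>auto simp: numeral_2_eq_2\<close>)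
    moreover have "Suc (t1+Suc (Suc (t2+Suc 0)))<=(Z-c)*(2*?T+4)+1" using t1(1) t2(1) unfolding z by simp
    ultimately show ?thesis by blast
   qed
  qed
 qed
 from this[of 0] obtain t where t: "t<=Z*(2*?T+4)+1" "ev Z E t (?f 0 # st, 0) (st, Suc (of_bool (sav Z E (Suc j) p q)))" by auto
 have "1<=?T" by simp
 hence "Z*(2*?T+4)+1<=Z*(6*?T)+?T" by (intro add_mono mult_le_mono) auto
 hence "t<=(6*Z+1)^Suc j" using t(1) by (simp add: algebra_simps)
 thus ?case using t(2) by blast
qed

text \<open>A frame is a number with five digits in base \<open>B\<close>. Stacks use base
  \<open>B^5+1\<close> with digits shifted by one, so that the empty stack is 0 and differs from a
  stack of zero frames; the call or return flag is a last digit in base 3.\<close>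

definition fcode :: "nat => frame => nat" where
 "fcode B = (%(j, p, q, c, h). (((j*B+p)*B+q)*B+c)*B+h)"

fun scode :: "nat => frame list => nat" where
 "scode B [] = 0"
| "scode B (f # st) = scode B st*(B^5+1)+Suc (fcode B f)"

definition fstep :: "nat => nat => (nat => nat => bool) => nat => nat" where
 "fstep B Z E y = (let r = y mod 3; s = y div 3; D = B^5+1; f = s mod D-1; st = s div D;
   h = f mod B; c = f div B mod B; q = f div B^2 mod B; p = f div B^3 mod B; j = f div B^4 in
  if s = 0 then y
  else if r = 0 then
    if j = 0 then st*3+Suc (of_bool (p = q \<or> E p q))
    else if Z<=c then st*3+1
    else if h = 0 then ((st*D+Suc f)*D+Suc (((((j-1)*B+p)*B+c)*B)*B))*3
    else ((st*D+Suc f)*D+Suc (((((j-1)*B+c)*B+q)*B)*B))*3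
   else if r = 2 then if h = 0 then (st*D+Suc (f+1))*3 else st*3+2
   else (st*D+Suc (f-h+B))*3)"

text \<open>A frame that waits for a result has a current midpoint \<open>c < Z\<close>; only a
  frame about to be called may have exhausted its candidates.\<close>

fun okf :: "nat => nat => bool => frame => bool" where
 "okf B Z b (j, p, q, c, h) = (j<B & p<Z & q<Z & c<=Z & (b --> c<Z) & h<=1)"

fun oks :: "nat => nat => frame list*nat => bool" where
 "oks B Z ([], r) = (r<=2)"
| "oks B Z (f # st, r) = (r<=2 & okf B Z (r ~= 0) f & (ALL g:set st. okf B Z True g))"

lemma fcode_digits:
 assumes "p<B" "q<B" "c<B" "h<(B::nat)"
 shows "fcode B (j, p, q, c, h) mod B = h" "fcode B (j, p, q, c, h) div B mod B = c"
  "fcode B (j, p, q, c, h) div B^2 mod B = q" "fcode B (j, p, q, c, h) div B^3 mod B = p" "fcode B (j, p, q, c, h) div B^4 = j"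
 using assms by (simp_all add: fcode_def power2_eq_square power3_eq_cube power4_eq_xxxx div_mult2_eq)

lemma fcode_bound: "j<B ==> p<B ==> q<B ==> c<B ==> h<(B::nat) ==> fcode B (j, p, q, c, h)<B^5"
proof -
 have *: "x<B^n ==> y<B ==> x*B+y<B^Suc n" for x y n
  using mult_le_mono1[of "Suc x" "B^n" B] by (simp add: mult.commute)
 assume "j<B" "p<B" "q<B" "c<B" "h<B"
 hence "(((j*B+p)*B+q)*B+c)*B+h<B^Suc (Suc (Suc (Suc 1)))" by (intro *) auto
 thus ?thesis by (simp add: fcode_def eval_nat_numeral)
qed

lemma okf_mono: "okf B Z b f ==> b' --> b ==> okf B Z b' f"
 by (cases f) auto

lemma oks_pop: "r<=2 ==> ALL g:set st. okf B Z True g ==> oks B Z (st, r)"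
 by (cases st) (auto simp del: okf.simps intro: okf_mono)

lemma fstep_sstep:
 assumes ok: "oks B Z s" and B: "Z+2<=B"
 shows "fstep B Z E (scode B (fst s)*3+snd s) = (case sstep Z E s of (st, r) => scode B st*3+r) & oks B Z (sstep Z E s)"
proof (cases s)
 case (Pair st0 r)
 show ?thesis
 proof (cases st0)
  case Nil
  thus ?thesis using ok by (simp add: Pair fstep_def)
 next
  case (Cons f st)
  obtain j p q c h where f: "f = (j, p, q, c, h)" by (cases f)
  have b: "j<B" "p<B" "q<B" "c<B" "h<B" "r<=2" "p<Z" "q<Z" "h<=1" "c<=Z"
   using ok B by (auto simp: Pair Cons f)
  define D where "D = B^5+1"
  have fb: "Suc (fcode B f)<D" using fcode_bound[OF b(1-5)] by (simp add: f D_def)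
  define S where "S = scode B st*D+Suc (fcode B f)"
  have S: "scode B (f # st) = S" by (simp add: S_def D_def)
  have d: "S mod D-1 = fcode B f" "S div D = scode B st" "S ~= 0"
   using fb by (simp_all only: S_def mod_mult_self3 div_mult_self3 mod_less div_less)
  have r: "(S*3+r) mod 3 = r" "(S*3+r) div 3 = S" using b(6) by presburger+
  note dd = fcode_digits[OF b(2-5), of j]
  have n1: "fcode B (j, p, q, c, Suc 0) = Suc (fcode B (j, p, q, c, 0))" for j by (simp add: fcode_def)
  have n: "fcode B (j, p, q, c, h)-h+B = fcode B (j, p, q, Suc c, 0)"
   "((((j-1)*B+p)*B+c)*B)*B = fcode B (j-1, p, c, 0, 0)" "((((j-1)*B+c)*B+q)*B)*B = fcode B (j-1, c, q, 0, 0)"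
   by (simp_all add: fcode_def algebra_simps)
  have h: "h = 0 \<or> h = 1" using b by auto
  have sc: "scode B (g # u) = scode B u*D+Suc (fcode B g)" for g u by (simp add: D_def)
  have "fstep B Z E (scode B (fst s)*3+snd s) = (case sstep Z E s of (st, r) => scode B st*3+r)"
   unfolding fstep_def Let_def Pair Cons fst_conv snd_conv S r d D_def[symmetric]
   using h d(3) unfolding f dd n by (auto simp: n1 sc simp del: scode.simps)
  moreover have "oks B Z (sstep Z E s)"
   using ok h B by (auto simp: Pair Cons f intro!: oks_pop)
  ultimately show ?thesis ..
 qed
qed

lemma fstep_funpow:
 assumes "oks B Z s" "Z+2<=B"
 shows "(fstep B Z E ^^ n) (scode B (fst s)*3+snd s) = (case (sstep Z E ^^ n) s of (st, r) => scode B st*3+r) & oks B Z ((sstep Z E ^^ n) s)"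
proof (induct n)
 case (Suc n)
 thus ?case using fstep_sstep[of B Z "(sstep Z E ^^ n) s"] assms(2) by (simp add: case_prod_unfold)
qed (use assms in \<open>simp add: case_prod_unfold\<close>)

lemma sstep_Nil: "(sstep Z E ^^ n) ([], r) = ([], r)"
 by (induct n) auto

lemma fstep_sav:
 assumes "p<Z" "q<Z" "j<B" "Z+2<=B"
 shows "((fstep B Z E ^^ ((6*Z+1)^j)) (Suc (fcode B (j, p, q, 0, 0))*3) = 2) = sav Z E j p q"
proof -
 let ?s = "([(j, p, q, 0, 0)], 0)"
 obtain t where t: "t<=(6*Z+1)^j" "ev Z E t ?s ([], Suc (of_bool (sav Z E j p q)))" using sstep_frame by blast
 have "(sstep Z E ^^ ((6*Z+1)^j)) ?s = ([], Suc (of_bool (sav Z E j p q)))"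
  using t(2) funpow_add[of "(6*Z+1)^j-t" t "sstep Z E"] t(1) by (simp add: ev_def sstep_Nil)
 moreover have "oks B Z ?s" using assms by simp
 ultimately show ?thesis using fstep_funpow[where s = ?s and E = E and n = "(6*Z+1)^j", of B Z] assms(4) by (simp add: split: if_splits)
qed

text \<open>Level plus number of frames below never exceeds \<open>J\<close>; hence at most
  \<open>Suc J\<close> frames are on the stack, which bounds its code.\<close>

fun hts :: "nat => frame list => bool" where
 "hts J [] = True"
| "hts J (f # st) = (fst f+length st<=J & hts J st)"

lemma hts_sstep: "hts J (fst s) ==> hts J (fst (sstep Z E s))"
proof (cases s)
 case (Pair st r)
 thus "hts J (fst s) ==> ?thesis" by (cases st) auto
qed

lemma scode_bound: "ALL f:set st. fcode B f<B^5 ==> scode B st<(B^5+1)^length st"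
proof (induct st)
 case (Cons f st)
 hence "scode B st*(B^5+1)+Suc (fcode B f)<=scode B st*(B^5+1)+B^5" by simp
 also have "... < Suc (scode B st)*(B^5+1)" by simp
 also have "... <= (B^5+1)^length st*(B^5+1)" using Cons by (intro mult_le_mono1) (simp add: Suc_le_eq)
 finally show ?case by (simp add: mult.commute)
qed simp

lemma fstep_bound:
 assumes "p<Z" "q<Z" "j<B" "Z+2<=B"
 shows "(fstep B Z E ^^ n) (Suc (fcode B (j, p, q, 0, 0))*3)<=3*(B^5+1)^Suc j+2"
proof -
 let ?s = "([(j, p, q, 0, 0)], 0)"
 obtain st r where st: "(sstep Z E ^^ n) ?s = (st, r)" by fastforce
 have "oks B Z ?s" using assms by simp
 hence y: "(fstep B Z E ^^ n) (Suc (fcode B (j, p, q, 0, 0))*3) = scode B st*3+r" and ok: "oks B Z (st, r)"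
  using fstep_funpow[where s = ?s and E = E and n = n, of B Z] assms(4) st by auto
 have "hts j (fst ((sstep Z E ^^ n) ?s))" by (induct n) (auto simp: hts_sstep)
 hence l: "length st<=Suc j" unfolding st by (cases st) auto
 have "okf B Z False f" if "f : set st" for f using ok that by (cases st) (auto simp del: okf.simps intro: okf_mono)
 hence "fcode B f<B^5" if "f : set st" for f using that assms(4) by (cases f) (force intro: fcode_bound)
 hence "scode B st<(B^5+1)^length st" by (intro scode_bound) auto
 also have "... <= (B^5+1)^Suc j" using l by (intro power_increasing) auto
 finally show ?thesis unfolding y using ok by (cases st) auto
qed

lemma CompB_subst2:
 assumes "CompB (ext (ext rho)) (%e. E (fst (fst e)) (snd (fst e)) (snd e))" "!!g. g : set rho ==> Comp sigma (%e. g (h e))" "Comp sigma a" "Comp sigma b"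
 shows "CompB sigma (%e. E (h e) (a e) (b e))"
 using assms Comp_subst[of "ext (ext rho)" "%e. of_bool (E (fst (fst e)) (snd (fst e)) (snd e))" sigma "%e. ((h e, a e), b e)"]
 by (force simp: CompB_def ext_def)

text \<open>The growth hypothesis covers both the number of rounds \<open>(6*Z+1)^J\<close> and the
  largest code of a stack in base \<open>B = Z+J+2\<close>.\<close>

theorem CompB_sav:
 assumes Z: "Comp rho Z" and J: "Comp rho J" and p: "Comp rho p" and q: "Comp rho q" and lt: "!!e. p e<Z e" "!!e. q e<Z e"
  and E: "CompB (ext (ext rho)) (%e. E (fst (fst e)) (snd (fst e)) (snd e))"
  and PB: "PB rho (%e. (Z e+J e+3)^(5*J e+5))"
 shows "CompB rho (%e. sav (Z e) (E e) (J e) (p e) (q e))"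
proof -
 define B where "B e = Z e+J e+2" for e
 have B: "Comp rho B" unfolding B_def by (intro Comp_rules assms)
 let ?K = "%e. (6*Z e+1)^J e"
 have K: "?K e<=(Z e+J e+3)^(5*J e+5)" for e
 proof -
  have "6*Z e+1<=(Z e+J e+3)^3" by (simp add: power3_eq_cube algebra_simps)
  hence "?K e<=((Z e+J e+3)^3)^J e" by (intro power_mono) auto
  also have "... <= (Z e+J e+3)^(5*J e+5)" unfolding power_mult[symmetric] by (intro power_increasing) auto
  finally show ?thesis .
 qed
 have D: "3*(B e^5+1)^Suc (J e)+2<=3*(Z e+J e+3)^(5*J e+5)+2" for e
 proof -
  have "x^5+1<=(x+1)^5" for x :: nat by (simp add: eval_nat_numeral algebra_simps)
  hence "(B e^5+1)^Suc (J e)<=((B e+1)^5)^Suc (J e)" by (intro power_mono) auto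
  moreover have "5*Suc (J e) = 5*J e+5" "B e+1 = Z e+J e+3" by (simp_all add: B_def)
  ultimately show ?thesis unfolding power_mult[symmetric] by (metis add_le_mono1 mult.commute mult_le_mono1)
 qed
 have KC: "Comp rho ?K" by (intro Comp_power Comp_rules assms PB_le[OF PB K])
 let ?a = "%e. Suc (fcode (B e) (J e, p e, q e, 0, 0))*3"
 have a: "Comp rho ?a" unfolding fcode_def prod.case by (intro Comp_rules assms B)
 have r: "rec_nat x (%_. f) n = (f ^^ n) x" for x n and f :: "nat => nat" by (induct n) auto
 let ?R = "ext (ext rho)"
 have L: "Comp ?R (%e. g (fst (fst e)))" if "Comp rho g" for g using that by (intro Comp_lift[of "ext rho" "%e. g (fst e)"] Comp_lift)
 have S: "CompB ?R (%e. E (fst (fst e)) (u e) (v e))" if "Comp ?R u" "Comp ?R v" for u v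
  by (rule CompB_subst2[OF E _ that]) (intro L Comp_var)
 have "Comp rho (%e. rec_nat (?a e) (%_. fstep (B e) (Z e) (E e)) (?K e))"
 proof (rule Comp_rec[OF KC a])
  show "PB rho (%e. 3*(Z e+J e+3)^(5*J e+5)+2)" by (intro PB_add PB_mult PB_const PB)
  show "rec_nat (?a e) (%_. fstep (B e) (Z e) (E e)) i<=3*(Z e+J e+3)^(5*J e+5)+2" for e i
   unfolding r using fstep_bound[where E = "E e" and n = i, OF lt, of "J e" "B e" e] D[of e] by (auto simp: B_def)
  note BL = L[OF B] and ZL = L[OF Z]
  show "Comp ?R (%e. fstep (B (fst (fst e))) (Z (fst (fst e))) (E (fst (fst e))) (snd e))"
   unfolding fstep_def Let_def by (intro Comp_rules BL ZL S)
 qed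
 hence "CompB rho (%e. (fstep (B e) (Z e) (E e) ^^ ?K e) (?a e) = 2)" unfolding r by (intro CompB_eq Comp_const)
 thus ?thesis using fstep_sav[OF lt, of "J _" "B _"] by (simp add: B_def)
qed

section \<open>Vector addition systems and Rackoff's bound\<close>

type_synonym vec = "nat => nat"

definition vle :: "nat set => vec => vec => bool" where
 "vle I a m = (ALL c:I. a c<=m c)"

text \<open>Steps of a vector addition system restricted to the coordinates in \<open>I\<close>; the others are set to 0.\<close>

definition vst :: "(vec*vec) set => nat set => (vec*vec) set" where
 "vst T I = {(m, m'). EX (a, b):T. vle I a m & m' = (%c. if c : I then m c-a c+b c else 0)}"

definition proj :: "nat set => vec => vec" where
 "proj I m = (%c. if c : I then m c else 0)"

fun ell :: "nat => nat => nat" where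
 "ell W 0 = 0"
| "ell W (Suc i) = (W*(ell W i+1)+1)^(2*Suc i)+ell W i+1"

lemma vst_proj: assumes "(m, m') : vst T I" "I'<=I" shows "(proj I' m, proj I' m') : vst T I'"
proof -
 obtain a b where ab: "(a, b) : T" "vle I a m" "m' = (%c. if c : I then m c-a c+b c else 0)" using assms(1) by (auto simp: vst_def)
 have "vle I' a (proj I' m)" "proj I' m' = (%c. if c : I' then proj I' m c-a c+b c else 0)"
  using ab(2,3) assms(2) by (auto simp: vle_def proj_def fun_eq_iff)
 thus ?thesis using ab(1) unfolding vst_def by blast
qed

lemma relpow_mono: "R<=(S :: ('a * 'a) set) ==> R ^^ n<=S ^^ n"
 by (induct n) auto

lemma vst_relpow_proj: "(m, m') : vst T I ^^ n ==> I'<=I ==> (proj I' m, proj I' m') : vst T I' ^^ n"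
proof (induct n arbitrary: m')
 case (Suc n)
 then obtain z where z: "(m, z) : vst T I ^^ n" "(z, m') : vst T I" by auto
 show ?case using Suc(1)[OF z(1) Suc(3)] vst_proj[OF z(2) Suc(3)] by auto
qed simp

lemma vst_supp: "(m, m') : vst T I ==> proj I m' = m'"
 by (auto simp: vst_def proj_def fun_eq_iff)

text \<open>Each of the \<open>n\<close> steps takes at most \<open>W\<close> from the coordinate
  \<open>c\<close>, so with \<open>W*n+w\<close> it never blocks and keeps at least
  \<open>w\<close>.\<close>

lemma vst_add_coord:
 assumes T: "!!a b. (a, b) : T ==> a c<=W" and m: "proj (insert c I) m = m"
  and r: "(proj I m, z) : vst T I ^^ n" and c: "W*n+w<=m c"
 shows "EX m'. (m, m') : vst T (insert c I) ^^ n & (ALL d:I-{c}. m' d = z d) & w<=m' c"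
 using r c
proof (induct n arbitrary: z w)
 case 0
 thus ?case by (intro exI[of _ m]) (auto simp: proj_def)
next
 case (Suc n)
 then obtain y where y: "(proj I m, y) : vst T I ^^ n" "(y, z) : vst T I" by auto
 obtain a b where ab: "(a, b) : T" "vle I a y" "z = (%d. if d : I then y d-a d+b d else 0)" using y(2) by (auto simp: vst_def)
 obtain m1 where m1: "(m, m1) : vst T (insert c I) ^^ n" "ALL d:I-{c}. m1 d = y d" "W+w<=m1 c"
  using Suc(1)[OF y(1), of "W+w"] Suc(3) by (auto simp: algebra_simps)
 let ?m = "%d. if d : insert c I then m1 d-a d+b d else 0"
 have "vle (insert c I) a m1" using ab(2) m1(2,3) T[OF ab(1)] unfolding vle_def by (metis DiffI add_leD1 insert_iff le_trans singletonD)
 hence "(m1, ?m) : vst T (insert c I)" unfolding vst_def using ab(1) by blast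
 moreover have "w<=?m c" using m1(3) T[OF ab(1)] by simp
 ultimately show ?case using m1(1,2) ab(3) by (intro exI[of _ ?m]) auto
qed

definition bvecs :: "nat set => nat => vec set" where
 "bvecs I B = {m. proj I m = m & (ALL c:I. m c<B)}"

lemma bvecs: "finite I ==> finite (bvecs I B) & card (bvecs I B) = B^card I"
proof -
 assume I: "finite I"
 have bj: "bij_betw (%m. restrict m I) (bvecs I B) (PiE I (%_. {..<B}))"
  unfolding bij_betw_def
 proof
  show "inj_on (%m. restrict m I) (bvecs I B)"
   by (rule inj_onI) (auto simp: bvecs_def proj_def fun_eq_iff restrict_def, metis)
  show "(%m. restrict m I) ` bvecs I B = (PiE I (%_. {..<B}))"
  proof (intro equalityI subsetI)
   fix f assume f: "f : (PiE I (%_. {..<B}))"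
   hence "f = restrict (proj I f) I" "proj I f : bvecs I B" by (auto simp: bvecs_def proj_def fun_eq_iff PiE_def extensional_def Pi_def)
   thus "f : (%m. restrict m I) ` bvecs I B" by blast
  qed (auto simp: bvecs_def)
 qed
 thus ?thesis using I bij_betw_finite[OF bj] bij_betw_same_card[OF bj]
  by (simp add: card_PiE finite_PiE)
qed

theorem rackoff:
 assumes "finite I" "proj I m = m" "(m, m') : (vst T I)^*" "vle I f m'"
  "!!a b c. (a, b) : T ==> c : I ==> a c<=W" "!!c. c : I ==> f c<=W"
 shows "EX n m'. n<=ell W (card I) & (m, m') : vst T I ^^ n & vle I f m'"
 using assms
proof (induct "card I" arbitrary: I m m')
 case 0
 hence I: "I = {}" by simp
 thus ?case by (intro exI[of _ 0] exI[of _ m]) (auto simp: vle_def)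
next
 case (Suc i)
 define B where "B = W*(ell W i+1)+1"
 \<comment> \<open>Counting steps between small vectors rather than small vectors costs a factor 2
   in the exponent, but the bound on path lengths in a finite relation then applies
   directly.\<close>
 define R where "R = vst T I Int (bvecs I B \<times> bvecs I B)"
 have fin: "finite R" and card: "card R<=B^(2*Suc i)"
 proof -
  have "R<=bvecs I B \<times> bvecs I B" by (auto simp: R_def)
  moreover have "finite (bvecs I B \<times> bvecs I B)" "card (bvecs I B \<times> bvecs I B) = B^(2*Suc i)"
   using bvecs[OF Suc(3), of B] Suc(2) by (auto simp: card_cartesian_product power_mult_distrib mult_2 power_add)
  ultimately show "finite R" "card R<=B^(2*Suc i)" using finite_subset card_mono by (blast, metis)
 qed
 have ellI: "ell W (card I) = B^(2*Suc i)+ell W i+1" "B = W*ell W i+W+1" using Suc(2) by (simp_all flip: Suc(2) add: B_def)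
 have small: "EX n<=card R. (x, y) : R ^^ n" if "(x, y) : R^*" for x y
  using that rtrancl_finite_eq_relpow[OF fin] by auto
 show ?case
 proof (cases "(m, m') : R^*")
  case True
  then obtain n where n: "n<=card R" "(m, m') : R ^^ n" using small by blast
  have "R ^^ n<=vst T I ^^ n" by (rule relpow_mono) (auto simp: R_def)
  thus ?thesis using n card Suc(6) ellI(1) by (intro exI[of _ n] exI[of _ m']) auto
 next
  case False
  text \<open>The run leaves the small vectors; take the last small vector before it does so.\<close>
  have "EX x. (m, x) : R^* & x ~: bvecs I B & (x, m') : (vst T I)^* \<or>
    (EX y. (m, y) : R^* & (y, x) : vst T I & x ~: bvecs I B & (x, m') : (vst T I)^*)"
   using Suc(5) False
  proof (induct rule: converse_rtrancl_induct)
   case (step y z)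
   show ?case
   proof (cases "y : bvecs I B & z : bvecs I B")
    case True
    hence yz: "(y, z) : R" using step(1) by (simp add: R_def)
    hence "(z, m') ~: R^*" using step(4) by (meson converse_rtrancl_into_rtrancl)
    thus ?thesis using step(3) yz by (meson converse_rtrancl_into_rtrancl)
   qed (use step in \<open>meson converse_rtrancl_into_rtrancl rtrancl.rtrancl_refl\<close>)
  qed simp
  then obtain x n where x: "x ~: bvecs I B" "(x, m') : (vst T I)^*" "(m, x) : vst T I ^^ n" "n<=Suc (card R)"
  proof (elim exE disjE conjE)
   fix x assume "(m, x) : R^*" and *: "x ~: bvecs I B" "(x, m') : (vst T I)^*"
   then obtain n where "n<=card R" "(m, x) : R ^^ n" using small by blast
   moreover have "R ^^ n<=vst T I ^^ n" by (rule relpow_mono) (auto simp: R_def)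
   ultimately show ?thesis using * by (intro that) auto
  next
   fix x y assume "(m, y) : R^*" and *: "(y, x) : vst T I" "x ~: bvecs I B" "(x, m') : (vst T I)^*"
   then obtain n where "n<=card R" "(m, y) : R ^^ n" using small by blast
   moreover have "R ^^ n<=vst T I ^^ n" by (rule relpow_mono) (auto simp: R_def)
   ultimately have "n<=card R" "(m, y) : vst T I ^^ n" by auto
   thus ?thesis using * by (intro that[of x "Suc n"]) auto
  qed
  have px: "proj I x = x"
  proof (cases n)
   case (Suc k)
   thus ?thesis using x(3) vst_supp by fastforce
  qed (use x(3) Suc(4) in auto)
  then obtain c where c: "c : I" "B<=x c" using x(1) by (auto simp: bvecs_def not_less)
  define I' where "I' = I-{c}"
  have I': "card I' = i" "finite I'" "insert c I' = I" "I'<=I" "c ~: I'" using Suc(2,3) c by (auto simp: I'_def)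
  \<comment> \<open>Without the large coordinate \<open>c\<close> the rest of the run has lower
    dimension. The short run found there is lifted back by \<open>vst_add_coord\<close>, and the
    \<open>W\<close> left over in \<open>c\<close> covers \<open>f c\<close>.\<close>
  have "(proj I' x, proj I' m') : (vst T I')^*"
   using x(2) vst_relpow_proj[OF _ I'(4)] by (meson rtrancl_imp_relpow relpow_imp_rtrancl)
  moreover have "proj I' (proj I' x) = proj I' x" "vle I' f (proj I' m')" using Suc(6) I'(4) by (auto simp: proj_def vle_def fun_eq_iff)
  ultimately obtain k y where y: "k<=ell W (card I')" "(proj I' x, y) : vst T I' ^^ k" "vle I' f y"
   using Suc(1)[of I' "proj I' x" "proj I' m'"] I' Suc(7,8) by blast
  have Wk: "W*k+W<=x c"
  proof -
   have "W*k<=W*ell W i" using y(1) I'(1) by simp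
   thus ?thesis using c(2) ellI(2) by linarith
  qed
  obtain z where z: "(x, z) : vst T (insert c I') ^^ k" "ALL d:I'-{c}. z d = y d" "W<=z c"
   using vst_add_coord[where T = T and W = W and c = c and I = I' and m = x and z = y and n = k and w = W] Suc(7) c(1) y(2) Wk px I'(3) by auto
  have "vle I f z" using y(3) z(2,3) Suc(8)[OF c(1)] I'(3,5) unfolding vle_def by (metis DiffI insertE le_trans singletonD)
  moreover have "(m, z) : vst T I ^^ (n+k)" using x(3) z(1) I'(3) by (auto simp: relpow_add)
  moreover have "n+k<=ell W (card I)" using x(4) card y(1) I'(1) ellI(1) by simp
  ultimately show ?thesis by blast
 qed
qed

text \<open>With \<open>d\<close> bounding the dimension, each level multiplies the exponent by at
  most \<open>4*d+8\<close>.\<close>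

lemma ell_bound: "i<=d ==> ell W i+1<=(W+3)^((4*d+8)^Suc i)"
proof (induct i)
 case (Suc i)
 define E X where "E = (4*d+8)^Suc i" and "X = W+3"
 have E: "4*d+8<=E" unfolding E_def using power_increasing[of 1 "Suc i" "4*d+8"] by simp
 have IH: "ell W i+1<=X^E" using Suc by (simp add: E_def X_def)
 have "W*(ell W i+1)+1<=W*X^E+X^E" using IH by (intro add_mono mult_le_mono2) (auto simp: X_def)
 also have "... <= X*X^E" by (simp add: X_def algebra_simps)
 finally have "(W*(ell W i+1)+1)^(2*Suc i)<=(X^Suc E)^(2*Suc i)" by (intro power_mono) auto
 also have "... = X^(Suc E*(2*Suc i))" by (rule power_mult[symmetric])
 also have "... <= X^(Suc E*(2*d))" using Suc(2) by (intro power_increasing mult_le_mono) (auto simp: X_def)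
 finally have "ell W (Suc i)+1<=X^(Suc E*(2*d))+X^E+1" using IH by simp
 also have "... <= X^(Suc E*(2*d)+E)+X^(Suc E*(2*d)+E)+X^(Suc E*(2*d)+E)"
  by (intro add_mono power_increasing) (auto simp: X_def)
 also have "... <= X*X^(Suc E*(2*d)+E)" by (simp add: X_def algebra_simps)
 also have "... = X^Suc (Suc E*(2*d)+E)" by simp
 also have "... <= X^((4*d+8)*E)"
 proof (intro power_increasing)
  have "Suc E*(2*d)+E+1 = 2*d*E+(2*d+1)+E" by (simp add: algebra_simps)
  also have "... <= 2*d*E+E+E" using E by simp
  also have "... <= (4*d+8)*E" by (simp add: algebra_simps)
  finally show "Suc (Suc E*(2*d)+E)<=(4*d+8)*E" by simp
 qed (simp add: X_def)
 finally show ?case by (simp add: E_def X_def)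
qed simp

section \<open>Summaries of threads\<close>

definition tree :: "nat state => thread => bool" where
 "tree s r = (finite (threads s) & edges s<=threads s \<times> threads s & r : threads s & (ALL u. (u, r) ~: edges s) &
  (ALL v:threads s. (r, v) : (edges s)^*) & (ALL u u' v. (u, v) : edges s --> (u', v) : edges s --> u = u'))"

lemma rooted_tree_iff: "rooted_tree s = (EX r. tree s r)"
proof
 assume "rooted_tree s"
 then obtain r where r: "finite (threads s)" "edges s<=threads s \<times> threads s" "is_root s r"
  "ALL v:threads s. (r, v) : (edges s)^* & (v ~= r --> (EX!u. (u, v) : edges s))" unfolding rooted_tree_def by blast
 have "u = u'" if "(u, v) : edges s" "(u', v) : edges s" for u u' v
  using r(2,3,4) that unfolding is_root_def by (metis SigmaD2 subsetD)
 thus "EX r. tree s r" using r unfolding tree_def is_root_def by blast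
next
 assume "EX r. tree s r"
 then obtain r where r: "tree s r" by blast
 have "EX!u. (u, v) : edges s" if "v : threads s" "v ~= r" for v
  using r that unfolding tree_def by (metis rtranclE)
 thus "rooted_tree s" using r unfolding rooted_tree_def tree_def is_root_def by meson
qed

lemma tree_acyclic: assumes "tree s r" shows "acyclic (edges s)"
proof -
 have "(v, v) ~: (edges s)^+" if "(r, v) : (edges s)^*" for v
  using that
 proof (induct rule: rtrancl_induct)
  case base
  show ?case using assms by (auto simp: tree_def elim: tranclE)
 next
  case (step u v)
  thus ?case using assms unfolding tree_def by (metis rtrancl_into_trancl2 tranclD2)
 qed
 thus ?thesis unfolding acyclic_def using assms unfolding tree_def by (metis SigmaD2 subsetD tranclD2)
qed

lemma tree_wf: assumes "tree s r" shows "wf ((edges s)\<inverse>)"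
proof (rule finite_acyclic_wf_converse[OF _ tree_acyclic[OF assms]])
 show "finite (edges s)" using assms unfolding tree_def by (metis finite_SigmaI finite_subset)
qed

text \<open>Local vectors of a thread: coordinate \<open>4 p\<close> is the place \<open>p\<close>, \<open>4 v + 1\<close> the existing child \<open>v\<close>,
 \<open>4 w + 2\<close> records that the thread \<open>w\<close> of the target is matched by a child, and 3 that the whole target is
 matched below a child.\<close>

definition emb :: "(nat, nat) rpn => nat marking => vec" where
 "emb N m c = (if c mod 4 = 0 & c div 4 : places N then m (c div 4) else 0)"

definition unit :: "nat => vec" where
 "unit d c = of_bool (c = d)"

definition om :: "(nat, nat) rpn => nat state => thread => vec" where
 "om N s v c = emb N (marking_of s v) c+of_bool (c mod 4 = 1 & (v, c div 4) : edges s)"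

definition sb :: "vec => vec => vec => vec" where
 "sb m a b c = m c-a c+b c"

text \<open>A thread can be cut, have the target matched in its subtree, or match the target thread \<open>w\<close>.\<close>

datatype goal = Ret | Sub | Cov thread

text \<open>A return stands for one firing, that of the cut transition; a match costs none.\<close>

fun cst :: "goal => nat" where
 "cst Ret = 1" | "cst _ = 0"

fun base :: "thread => goal => thread" where
 "base rf (Cov w) = w" | "base rf _ = rf"

text \<open>\<open>wt\<close> is the label of the edge to the child; it has to dominate the label in
  the target if the child matches the target thread \<open>w\<close>. A thread that is only going to
  be cut has no use for matched children.\<close>

fun gok :: "(nat, nat) rpn => nat state => thread => goal => goal => nat marking => bool" where
 "gok N sf rf g Ret wt = True"
| "gok N sf rf g Sub wt = (g = Sub)"
| "gok N sf rf g (Cov w) wt = (g ~= Ret & (base rf g, w) : edges sf & marking_le N (label sf (base rf g, w)) wt)"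

fun gv :: "(nat, nat) rpn => goal => nat marking => vec" where
 "gv N Ret wt = emb N wt"
| "gv N Sub wt = unit 3"
| "gv N (Cov w) wt = unit (4*w+2)"

fun Fin :: "(nat, nat) rpn => nat state => thread => goal => vec => bool" where
 "Fin N sf rf Ret m = (EX t:cut N. emb N (Wminus N t)<=m)"
| "Fin N sf rf (Cov w) m = (emb N (marking_of sf w)<=m & (ALL x. (w, x) : edges sf --> 1<=m (4*x+2)))"
| "Fin N sf rf Sub m = (1<=m 3 \<or> emb N (marking_of sf rf)<=m & (ALL x. (rf, x) : edges sf --> 1<=m (4*x+2)))"

text \<open>The last argument bounds the number of firings that are still to be done.\<close>

inductive R :: "(nat, nat) rpn => nat state => thread => nat state => goal => vec => nat => bool"
 for N :: "(nat, nat) rpn" and sf :: "nat state" and rf :: thread and s :: "nat state" where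
 R_fin: "Fin N sf rf g m ==> R N sf rf s g m 0"
| R_el: "t : elementary N ==> emb N (Wminus N t)<=m ==> R N sf rf s g (sb m (emb N (Wminus N t)) (emb N (Wplus N t))) k ==>
  R N sf rf s g m (Suc k)"
| R_ab: "t : abstract N ==> emb N (Wminus N t)<=m ==> gok N sf rf g h (Wplus N t) ==> R N sf rf s h (emb N (Omega N t)) k' ==>
  R N sf rf s g (sb m (emb N (Wminus N t)) (gv N h (Wplus N t))) k ==> R N sf rf s g m (Suc (k+k'+cst h))"
| R_ch: "(u, v) : edges s ==> 1<=m (4*v+1) ==> gok N sf rf g h (label s (u, v)) ==> R N sf rf s h (om N s v) k' ==>
  R N sf rf s g (sb m (unit (4*v+1)) (gv N h (label s (u, v)))) k ==> R N sf rf s g m (k+k'+cst h)"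

definition Rx :: "(nat, nat) rpn => nat state => thread => nat state => goal => vec => bool" where
 "Rx N sf rf s g m = (EX k. R N sf rf s g m k)"

lemma Rx_fin: "Fin N sf rf g m ==> Rx N sf rf s g m"
 unfolding Rx_def by (blast intro: R_fin)

lemma Rx_el: "t : elementary N ==> emb N (Wminus N t)<=m ==> Rx N sf rf s g (sb m (emb N (Wminus N t)) (emb N (Wplus N t))) ==> Rx N sf rf s g m"
 unfolding Rx_def by (blast intro: R_el)

lemma Rx_ab: "t : abstract N ==> emb N (Wminus N t)<=m ==> gok N sf rf g h (Wplus N t) ==> Rx N sf rf s h (emb N (Omega N t)) ==>
  Rx N sf rf s g (sb m (emb N (Wminus N t)) (gv N h (Wplus N t))) ==> Rx N sf rf s g m"
 unfolding Rx_def by (blast intro: R_ab)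

lemma Rx_ch: "(u, v) : edges s ==> 1<=m (4*v+1) ==> gok N sf rf g h (label s (u, v)) ==> Rx N sf rf s h (om N s v) ==>
  Rx N sf rf s g (sb m (unit (4*v+1)) (gv N h (label s (u, v)))) ==> Rx N sf rf s g m"
 unfolding Rx_def by (blast intro: R_ch)

section \<open>Every covering run has a summary\<close>

lemma emb_1 [simp]: "c mod 4 ~= 0 ==> emb N m c = 0" "emb N m (4*x+1) = 0" "emb N m (4*x+2) = 0" "emb N m 3 = 0" "emb N m (Suc (4*x)) = 0" "emb N m (Suc (Suc (4*x))) = 0"
 by (auto simp: emb_def) presburger+

lemma dm [simp]: "Suc (4*y) div 4 = y" "Suc (4*y) mod 4 = Suc 0" "Suc (Suc (4*y)) mod 4 = 2" "Suc (Suc (4*y)) div 4 = y" by presburger+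

lemma Suc_le_of_bool [simp]: "(Suc 0<=of_bool P) = P"
 by simp

lemma emb_le: "(emb N a<=m) = (ALL p:places N. a p<=m (4*p))"
proof (intro iffI ballI)
 fix p assume "emb N a<=m" "p : places N"
 thus "a p<=m (4*p)" using le_funD[of "emb N a" m "4*p"] by (simp add: emb_def)
next
 assume a: "ALL p:places N. a p<=m (4*p)"
 show "emb N a<=m"
 proof (rule le_funI)
  fix c show "emb N a c<=m c"
  proof (cases "c mod 4 = 0")
   case True
   hence "4*(c div 4) = c" by presburger
   thus ?thesis using a by (metis emb_def le0)
  qed simp
 qed
qed

lemma gv_1 [simp]: "gv N h wt (4*x+1) = 0" "gv N h wt (Suc (4*x)) = 0"
 by (cases h; simp add: unit_def; presburger)+

lemma Fin_mono: "Fin N sf rf g m ==> (!!c. c mod 4 ~= 1 ==> m c<=m' c) ==> Fin N sf rf g m'"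
proof -
 assume f: "Fin N sf rf g m" and m: "!!c. c mod 4 ~= 1 ==> m c<=m' c"
 have 1: "m (4*x)<=m' (4*x)" "m (4*x+2)<=m' (4*x+2)" "m 3<=m' 3" for x by (rule m, presburger)+
 show ?thesis
  using f 1 by (cases g) (simp_all add: emb_le, (meson le_trans)+)
qed

text \<open>Shared by all kinds of firing: \<open>phi\<close> translates a summary after the firing
  into one before it. Only the treatment of existing children (\<open>C\<close>) depends on the
  firing.\<close>

lemma R_sim:
 assumes A: "!!m c. c mod 4 ~= 1 ==> m c<=phi m c"
  and B: "!!m a b. a<=m ==> (!!x. a (4*x+1) = 0 & b (4*x+1) = 0) ==> phi (sb m a b) = sb (phi m) a b"
  and C: "!!u v g h m. (u, v) : edges s1 ==> 1<=m (4*v+1) ==> gok N sf rf g h (label s1 (u, v)) ==> Rx N sf rf s h (phi (om N s1 v)) ==>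
   Rx N sf rf s g (phi (sb m (unit (4*v+1)) (gv N h (label s1 (u, v))))) ==> Rx N sf rf s g (phi m)"
  and D: "!!f. phi (emb N f) = emb N f"
 shows "R N sf rf s1 g m k ==> Rx N sf rf s g (phi m)"
proof (induct rule: R.induct)
 case (R_fin g m)
 thus ?case by (intro Rx_fin Fin_mono[OF _ A])
next
 have le: "emb N a<=phi m" if "emb N a<=m" for a m
 proof -
  have "m (4*p)<=phi m (4*p)" for p by (rule A) simp
  thus ?thesis using that unfolding emb_le by (meson le_trans)
 qed
 {
  case (R_el t m g k)
  thus ?case using B[of "emb N (Wminus N t)" m "emb N (Wplus N t)"] by (simp add: Rx_el le)
 next
  case (R_ab t m g h k' k)
  thus ?case using B[of "emb N (Wminus N t)" m "gv N h (Wplus N t)"] D by (simp add: Rx_ab le)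
 }
qed (use C in blast)

text \<open>Only the vector of the firing thread \<open>x\<close> changes, so the firing is
  prepended wherever the summary starts from \<open>x\<close>.\<close>

lemma R_back_el:
 assumes t: "t : elementary N" "enabled N s x t"
  and s1: "s1 = s\<lparr>marking_of := (marking_of s)(x := %p. marking_of s x p-Wminus N t p+Wplus N t p)\<rparr>"
  and R: "Rx N sf rf s1 g (om N s1 v)"
 shows "Rx N sf rf s g (om N s v)"
proof -
 have en: "emb N (Wminus N t)<=om N s x" using t(2) by (auto simp: emb_le om_def emb_def enabled_def marking_le_def)
 have e: "om N s1 x = sb (om N s x) (emb N (Wminus N t)) (emb N (Wplus N t))"
 proof
  fix c show "om N s1 x c = sb (om N s x) (emb N (Wminus N t)) (emb N (Wplus N t)) c"
   using le_funD[OF en, of c] by (auto simp: s1 sb_def om_def emb_def)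
 qed
 have fix_up: "Rx N sf rf s h (om N s v)" if "Rx N sf rf s h (om N s1 v)" for h v
 proof (cases "v = x")
  case True
  thus ?thesis using Rx_el[OF t(1) en] that e by simp
 next
  case False
  hence "om N s1 v = om N s v" by (auto simp: s1 om_def fun_eq_iff)
  thus ?thesis using that by simp
 qed
 obtain k where "R N sf rf s1 g (om N s1 v) k" using R by (auto simp: Rx_def)
 hence "Rx N sf rf s g (om N s1 v)"
 proof (rule R_sim[where phi = "%m. m", rotated -1])
  fix u v g h m assume "(u, v) : edges s1" "1<=m (4*v+1)" "gok N sf rf g h (label s1 (u, v))" "Rx N sf rf s h (om N s1 v)"
   "Rx N sf rf s g (sb m (unit (4*v+1)) (gv N h (label s1 (u, v))))"
  thus "Rx N sf rf s g m" using Rx_ch[of u v s m N sf rf g h] fix_up[of h v] by (simp add: s1)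
 qed auto
 thus ?thesis by (rule fix_up)
qed

lemma R_back_ab:
 assumes t: "t : abstract N" "enabled N s x t" and y: "y ~: threads s" and s: "edges s<=threads s \<times> threads s" and v: "v : threads s"
  and s1: "s1 = \<lparr>threads = insert y (threads s), edges = insert (x, y) (edges s),
    marking_of = (marking_of s)(x := %p. marking_of s x p-Wminus N t p, y := Omega N t), label = (label s)((x, y) := Wplus N t)\<rparr>"
  and R: "Rx N sf rf s1 g (om N s1 v)"
 shows "Rx N sf rf s g (om N s v)"
proof -
 let ?a = "emb N (Wminus N t)"
 define phi where "phi m c = (if c = 4*y+1 then 0 else m c+m (4*y+1)*?a c)" for m :: vec and c
 have x: "x : threads s" "x ~= y" using t(2) y by (auto simp: enabled_def)
 have ny: "(u, y) ~: edges s" "(y, u) ~: edges s" for u using s y by auto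
 have en: "?a<=om N s x" using t(2) by (auto simp: emb_le om_def emb_def enabled_def marking_le_def)
 have y1: "(4*y+1) mod 4 = (1::nat)" "(4*y+1) div 4 = y" by auto
 have c1: "(c div 4 = y & c mod 4 = 1) = (c = 4*y+1)" for c by (metis mult_div_mod_eq y1(1,2))
 have oth: "phi (om N s1 v) = om N s v" if "v : threads s" for v
 proof
  fix c
  have e: "(v, c div 4) : edges s1 = ((v, c div 4) : edges s \<or> v = x & c div 4 = y)" by (auto simp: s1)
  have l: "om N s1 v (4*y+1) = of_bool (v = x)" using that y ny by (auto simp: om_def s1)
  have "om N s1 v c = (if c = 4*y+1 then of_bool (v = x) else if v = x then om N s v c-?a c else om N s v c)"
   using that y ny c1[of c] l x en unfolding le_fun_def by (auto simp: om_def s1 emb_def)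
  thus "phi (om N s1 v) c = om N s v c"
   using l ny le_funD[OF en, of c] by (auto simp: phi_def om_def)
 qed
 have new: "phi (om N s1 y) = emb N (Omega N t)"
  using ny x by (auto simp: fun_eq_iff phi_def om_def s1)
 obtain k where "R N sf rf s1 g (om N s1 v) k" using R by (auto simp: Rx_def)
 hence "Rx N sf rf s g (phi (om N s1 v))"
 proof (rule R_sim[where phi = phi, rotated -1])
  fix m :: vec and c :: nat assume "c mod 4 ~= 1"
  thus "m c<=phi m c" by (auto simp: phi_def)
 next
  fix m a b :: vec assume a: "a<=m" "!!x. a (4*x+1) = 0 & b (4*x+1) = 0"
  show "phi (sb m a b) = sb (phi m) a b"
  proof
   fix c show "phi (sb m a b) c = sb (phi m) a b c"
    using a(2)[of y] le_funD[OF a(1), of c] by (auto simp: phi_def sb_def)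
  qed
 next
  fix f show "phi (emb N f) = emb N f" by (auto simp: phi_def fun_eq_iff)
 next
  fix u v g h m assume *: "(u, v) : edges s1" "1<=m (4*v+1)" "gok N sf rf g h (label s1 (u, v))" "Rx N sf rf s h (phi (om N s1 v))"
   "Rx N sf rf s g (phi (sb m (unit (4*v+1)) (gv N h (label s1 (u, v)))))"
  show "Rx N sf rf s g (phi m)"
  proof (cases "v = y")
   case True
   hence u: "u = x" "label s1 (u, v) = Wplus N t" using *(1) ny by (auto simp: s1)
   obtain j where j: "m (4*y+1) = Suc j" using *(2) True by (cases "m (4*y+1)") auto
   have "?a<=phi m" using j by (auto simp: le_fun_def phi_def)
   moreover have "phi (sb m (unit (4*v+1)) (gv N h (Wplus N t))) = sb (phi m) ?a (gv N h (Wplus N t))"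
    using j True by (auto simp: fun_eq_iff phi_def sb_def unit_def)
   ultimately show ?thesis using Rx_ab[OF t(1), of "phi m" sf rf g h s] * True new u by simp
  next
   case False
   hence e: "(u, v) : edges s" "label s1 (u, v) = label s (u, v)" using *(1) by (auto simp: s1)
   have "phi (sb m (unit (4*v+1)) w) = sb (phi m) (unit (4*v+1)) w" if "w (4*y+1) = 0" for w
    using False *(2) that by (auto simp: fun_eq_iff phi_def sb_def unit_def)
   hence "phi (sb m (unit (4*v+1)) (gv N h (label s (u, v)))) = sb (phi m) (unit (4*v+1)) (gv N h (label s (u, v)))" by simp
   moreover have "1<=phi m (4*v+1)" using *(2) False by (simp add: phi_def)
   moreover have "phi (om N s1 v) = om N s v" using e(1) s by (intro oth) auto
   ultimately show ?thesis using Rx_ch[OF e(1), of "phi m" N sf rf g h] * e by simp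
  qed
 qed
 thus ?thesis using oth[OF v] by simp
qed

text \<open>Deleting the subtree of \<open>x\<close> acts on the vector of the parent exactly like
  the use of \<open>x\<close> with goal \<open>Ret\<close>.\<close>

lemma cut_om:
 assumes u: "(u, x) : edges s" and s: "tree s r" and v: "v ~: subtree_threads s x"
  and s1: "s1 = \<lparr>threads = threads s-subtree_threads s x,
    edges = {(a, b) : edges s. a ~: subtree_threads s x & b ~: subtree_threads s x},
    marking_of = (marking_of s)(u := %p. marking_of s u p+label s (u, x) p), label = label s\<rparr>"
 shows "om N s1 v = (if v = u then sb (om N s u) (unit (4*x+1)) (emb N (label s (u, x))) else om N s v)"
proof -
 have up: "a = u" if "(a, x) : edges s" for a using s u that unfolding tree_def by blast
 have sub: "b = x" if "(a, b) : edges s" "a ~: subtree_threads s x" "b : subtree_threads s x" for a b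
  using that s unfolding subtree_threads_def tree_def mem_Collect_eq by (metis rtranclE)
 have xs: "x : subtree_threads s x" by (simp add: subtree_threads_def)
 show ?thesis
 proof (cases "v = u")
  case True
  have "om N s1 u = sb (om N s u) (unit (4*x+1)) (emb N (label s (u, x)))"
  proof
   fix c
   have "((u, c div 4) : edges s1) = ((u, c div 4) : edges s & c div 4 ~= x)"
    using sub[of u "c div 4"] v True xs by (auto simp: s1)
   moreover have "c ~= 4*x+1 ==> c mod 4 = 1 ==> c div 4 ~= x" by (metis mult_div_mod_eq)
   ultimately show "om N s1 u c = sb (om N s u) (unit (4*x+1)) (emb N (label s (u, x))) c"
    using u by (cases "c = 4*x+1") (auto simp: om_def sb_def unit_def s1 emb_def)
  qed
  thus ?thesis using True by simp
 next
  case False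
  have "((v, b) : edges s1) = ((v, b) : edges s)" for b using sub[of v b] up[of v] v False by (auto simp: s1)
  thus ?thesis using False by (auto simp: om_def fun_eq_iff s1)
 qed
qed

lemma R_back_cut:
 assumes t: "t : cut N" "enabled N s x t" and u: "(u, x) : edges s" and s: "tree s r"
  and v: "v ~: subtree_threads s x"
  and s1: "s1 = \<lparr>threads = threads s-subtree_threads s x,
    edges = {(a, b) : edges s. a ~: subtree_threads s x & b ~: subtree_threads s x},
    marking_of = (marking_of s)(u := %p. marking_of s u p+label s (u, x) p), label = label s\<rparr>"
  and R: "Rx N sf rf s1 g (om N s1 v)"
 shows "Rx N sf rf s g (om N s v)"
proof -
 have Rt: "Rx N sf rf s Ret (om N s x)"
  using t by (intro Rx_fin) (auto simp: emb_le om_def emb_def enabled_def marking_le_def)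
 have fix_up: "Rx N sf rf s h (om N s v)" if "Rx N sf rf s h (om N s1 v)" "v ~: subtree_threads s x" for h v
  using Rx_ch[OF u, of "om N s u" N sf rf h Ret] Rt that u cut_om[OF u s that(2) s1, of N] by (simp add: om_def[of N s u "Suc (4*x)"] split: if_splits)
 obtain k where "R N sf rf s1 g (om N s1 v) k" using R by (auto simp: Rx_def)
 hence "Rx N sf rf s g (om N s1 v)"
 proof (rule R_sim[where phi = "%m. m", rotated -1])
  fix u v g h m assume "(u, v) : edges s1" "1<=m (4*v+1)" "gok N sf rf g h (label s1 (u, v))" "Rx N sf rf s h (om N s1 v)"
   "Rx N sf rf s g (sb m (unit (4*v+1)) (gv N h (label s1 (u, v))))"
  thus "Rx N sf rf s g m" using Rx_ch[of u v s m N sf rf g h] fix_up[of h v] by (simp add: s1)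
 qed auto
 thus ?thesis using v by (rule fix_up)
qed

lemma tree_fires:
 assumes s: "tree s r" and f: "fires N U s a s1"
 shows "s1 = empty_tree \<or> tree s1 r & (Rx N sf rf s1 g (om N s1 r) --> Rx N sf rf s g (om N s r))"
 using f
proof cases
 case (fire_elementary t v)
 thus ?thesis using s R_back_el[of t N s v s1 sf rf g r] by (auto simp: tree_def)
next
 case (fire_abstract t v w)
 have w: "w ~: threads s" "v : threads s" using fire_abstract by (auto simp: enabled_def)
 have e: "edges s1 = insert (v, w) (edges s)" "threads s1 = insert w (threads s)" using fire_abstract by auto
 have mono: "(edges s)^* <= (edges s1)^*" by (rule rtrancl_mono) (auto simp: e)
 have "(r, v) : (edges s1)^*" using s w mono unfolding tree_def by blast
 hence "(r, w) : (edges s1)^*" by (rule rtrancl_into_rtrancl) (simp add: e)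
 hence "ALL z:threads s1. (r, z) : (edges s1)^*" using s mono unfolding tree_def e(2) by blast
 moreover have "ALL u. (u, r) ~: edges s1" using s w unfolding tree_def e by auto
 moreover have "ALL u u' z. (u, z) : edges s1 --> (u', z) : edges s1 --> u = u'" using s w unfolding tree_def e by blast
 moreover have "edges s1<=threads s1 \<times> threads s1" "finite (threads s1)" "r : threads s1" using s w unfolding tree_def e by auto
 ultimately have "tree s1 r" unfolding tree_def by blast
 moreover have "edges s<=threads s \<times> threads s" "r : threads s" using s by (auto simp: tree_def)
 ultimately show ?thesis using R_back_ab[of t N s v w r s1 sf rf g] fire_abstract by blast
next
 case (fire_cut_child t v u)
 let ?S = "subtree_threads s v"
 have e: "edges s1 = {(a, b) : edges s. a ~: ?S & b ~: ?S}" "threads s1 = threads s-?S" using fire_cut_child by auto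
 have r: "r ~: ?S"
  using s fire_cut_child(5) unfolding subtree_threads_def tree_def mem_Collect_eq by (metis rtranclE)
 have "(r, z) : (edges s1)^*" if "(r, z) : (edges s)^*" "z ~: ?S" for z
  using that
 proof (induct rule: rtrancl_induct)
  case (step y z)
  hence "y ~: ?S" by (auto simp: subtree_threads_def intro: rtrancl_into_rtrancl)
  thus ?case using step by (auto simp: e intro: rtrancl_into_rtrancl)
 qed simp
 hence "tree s1 r" using s r unfolding tree_def e by auto
 thus ?thesis using R_back_cut[of t N s v u r r s1 sf rf g] fire_cut_child s r by blast
qed simp

lemma gok_Sub: "gok N sf rf (Cov rf) h w ==> gok N sf rf Sub h w"
 by (cases h) auto

lemma Cov_Sub: "R N sf rf s g m k ==> g = Cov rf ==> R N sf rf s Sub m k"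
proof (induct rule: R.induct)
 case (R_ab t m g h k' k)
 thus ?case by (intro R.R_ab[of t _ _ _ _ _ h]) (auto intro: gok_Sub)
next
 case (R_ch u v m g h k' k)
 thus ?case by (intro R.R_ch[of u v _ _ _ _ _ _ h]) (auto intro: gok_Sub)
qed (auto intro: R.R_fin R.R_el)

lemma Rx_Cov_children:
 assumes "finite X" "emb N (marking_of sf w)<=m" "inj_on f (threads sf)" "edges sf<=threads sf \<times> threads sf"
  "!!x. (w, x) : edges sf ==> (f w, f x) : edges s & marking_le N (label sf (w, x)) (label s (f w, f x)) & Rx N sf rf s (Cov x) (om N s (f x))"
  "!!x. (w, x) : edges sf ==> if x : X then 1<=m (4*f x+1) else 1<=m (4*x+2)"
 shows "Rx N sf rf s (Cov w) m"
 using assms(1,2,6)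
proof (induct X arbitrary: m)
 case empty
 thus ?case by (intro Rx_fin) auto
next
 case (insert x X)
 show ?case
 proof (cases "(w, x) : edges sf")
  case False
  show ?thesis
  proof (rule insert(3)[OF insert(4)])
   fix x' assume x': "(w, x') : edges sf"
   hence "x' ~= x" using False by blast
   thus "if x' : X then 1<=m (4*f x'+1) else 1<=m (4*x'+2)" using insert(5)[OF x'] by simp
  qed
 next
  case True
  let ?m = "sb m (unit (4*f x+1)) (unit (4*x+2))"
  have ne: "f x' ~= f x" if "(w, x') : edges sf" "x' ~= x" for x' using assms(3,4) that True by (metis inj_onD mem_Sigma_iff subsetD)
  have "Rx N sf rf s (Cov w) ?m"
  proof (rule insert(3))
   show "emb N (marking_of sf w)<=?m" using insert(4) unfolding emb_le by (auto simp: sb_def unit_def) presburger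
   fix x' assume x': "(w, x') : edges sf"
   show "if x' : X then 1<=?m (4*f x'+1) else 1<=?m (4*x'+2)"
    using insert(5)[OF x'] ne[OF x'] insert(2) by (auto simp: sb_def unit_def split: if_splits) presburger+
  qed
  thus ?thesis using Rx_ch[of "f w" "f x" s m N sf rf "Cov w" "Cov x"] assms(5)[OF True] insert(5)[OF True] True by auto
 qed
qed

text \<open>Bottom-up over the target for the goals \<open>Cov\<close>, then upwards from the image
  of the target root to the root of \<open>s\<close> for \<open>Sub\<close>.\<close>

lemma state_le_Rx:
 assumes s: "tree s r" and sf: "tree sf rf" and le: "state_le N sf s"
 shows "Rx N sf rf s Sub (om N s r)"
proof -
 have ne: "threads sf ~= {}" using sf by (auto simp: tree_def)
 then obtain f where f0: "inj_on f (threads sf)" "f ` threads sf<=threads s"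
  "ALL v:threads sf. marking_le N (marking_of sf v) (marking_of s (f v))"
  "ALL (v, w):edges sf. (f v, f w) : edges s & marking_le N (label sf (v, w)) (label s (f v, f w))"
  using le unfolding state_le_def is_empty_tree_def by (elim disjE exE conjE) simp_all
 have f: "inj_on f (threads sf)" "f ` threads sf<=threads s"
  "!!v. v : threads sf ==> marking_le N (marking_of sf v) (marking_of s (f v))"
  "!!v w. (v, w) : edges sf ==> (f v, f w) : edges s & marking_le N (label sf (v, w)) (label s (f v, f w))"
  using f0 by auto
 have esf: "edges sf<=threads sf \<times> threads sf" "rf : threads sf" using sf by (auto simp: tree_def)
 have "w : threads sf --> Rx N sf rf s (Cov w) (om N s (f w))" for w
  using tree_wf[OF sf]
 proof (induct w rule: wf_induct_rule)
  case (less w)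
  show ?case
  proof
   assume w: "w : threads sf"
   show "Rx N sf rf s (Cov w) (om N s (f w))"
   proof (rule Rx_Cov_children[where X = "threads sf" and f = f])
    show "finite (threads sf)" using sf by (simp add: tree_def)
    show "emb N (marking_of sf w)<=om N s (f w)" using f(3)[OF w] by (auto simp: emb_le om_def emb_def marking_le_def)
    fix x assume x: "(w, x) : edges sf"
    thus "(f w, f x) : edges s & marking_le N (label sf (w, x)) (label s (f w, f x)) & Rx N sf rf s (Cov x) (om N s (f x))"
     using f(4)[OF x] less[of x] esf by blast
    show "if x : threads sf then 1<=om N s (f w) (4*f x+1) else 1<=om N s (f w) (4*x+2)"
     using x f(4)[OF x] esf by (auto simp: om_def)
   qed (use f esf in auto)
  qed
 qed
 hence b: "Rx N sf rf s Sub (om N s (f rf))" using esf Cov_Sub unfolding Rx_def by blast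
 have "Rx N sf rf s Sub (om N s y)" if "(y, f rf) : (edges s)^*" for y
  using that
 proof (induct rule: converse_rtrancl_induct)
  case (step y z)
  have "Rx N sf rf s Sub (sb (om N s y) (unit (4*z+1)) (unit 3))" by (intro Rx_fin) (simp add: sb_def unit_def)
  moreover have "1<=om N s y (4*z+1)" using step(1) by (simp add: om_def)
  ultimately show ?case using Rx_ch[OF step(1), of "om N s y" N sf rf Sub Sub] step(3) by simp
 qed (rule b)
 thus ?thesis using s f(2) esf unfolding tree_def by blast
qed

theorem coverable_Rx:
 assumes s: "tree s0 r" and sf: "tree sf rf" and c: "coverable N s0 sf"
 shows "Rx N sf rf s0 Sub (om N s0 r)"
proof -
 obtain sg U s where run: "firing_sequence N s0 sg U s" and le: "state_le N sf s" using c unfolding coverable_def by blast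
 have dead: "firing_sequence N s0 sg U s ==> s = empty_tree \<or> tree s r & (Rx N sf rf s Sub (om N s r) --> Rx N sf rf s0 Sub (om N s0 r))" for sg U s
 proof (induct rule: firing_sequence.induct)
  case (firing_snoc sg U s a s')
  have "~ fires N U empty_tree a s'" by (auto simp: empty_tree_def enabled_def elim: fires.cases)
  thus ?case using firing_snoc tree_fires[of s r N U a s' sf rf Sub] by auto
 qed (use s in simp)
 have "~ state_le N sf empty_tree" using sf unfolding state_le_def is_empty_tree_def empty_tree_def tree_def by auto
 thus ?thesis using dead[OF run] state_le_Rx[OF _ sf le] le by blast
qed

section \<open>Every summary is realised by a run\<close>

lemma sb_commute: "a c+a' c<=m c ==> sb (sb m a b) a' b' c = sb (sb m a' b') a b (c::nat)"
 by (simp add: sb_def)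

text \<open>Matches by subtrees that are already complete commute with all other steps, hence some step that
 corresponds to a firing comes first.\<close>

lemma R_active:
 assumes "R N sf rf s g m k" "0<k"
 shows "(EX t k1. t : elementary N & emb N (Wminus N t)<=m & R N sf rf s g (sb m (emb N (Wminus N t)) (emb N (Wplus N t))) k1 & k1<k)
  \<or> (EX t h k1 k2. t : abstract N & emb N (Wminus N t)<=m & gok N sf rf g h (Wplus N t) & R N sf rf s h (emb N (Omega N t)) k1 &
    R N sf rf s g (sb m (emb N (Wminus N t)) (gv N h (Wplus N t))) k2 & k = Suc (k2+k1+cst h))
  \<or> (EX u v h k1 k2. (u, v) : edges s & 1<=m (4*v+1) & gok N sf rf g h (label s (u, v)) & R N sf rf s h (om N s v) k1 &
    R N sf rf s g (sb m (unit (4*v+1)) (gv N h (label s (u, v)))) k2 & k = k2+k1+cst h & 0<k1+cst h)"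
 using assms
proof (induct rule: R.induct)
 case (R_el t m g k)
 thus ?case by (intro disjI1 exI[of _ t] exI[of _ k]) simp
next
 case (R_ab t m g h k' k)
 thus ?case by metis
next
 case (R_ch u v m g h k' k)
 show ?case
 proof (cases "0<k'+cst h")
  case True
  thus ?thesis using R_ch(1-4,6) by blast
 next
  case False
  hence 0: "k' = 0" "cst h = 0" "0<k" using R_ch(8) by auto
  let ?d = "unit (4*v+1)" and ?w = "gv N h (label s (u, v))"
  let ?m = "sb m ?d ?w"
  have w0: "?w c = 0" if "c mod 4<2" for c
  proof (cases h)
   case Sub
   have "c ~= 3" using that by auto
   thus ?thesis using Sub by (simp add: unit_def)
  next
   case (Cov w)
   have "c ~= 4*w+2" using that by presburger
   thus ?thesis using Cov by (simp add: unit_def)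
  qed (use 0 in simp)
  have low: "?m c<=m c & (c ~= 4*v+1 --> ?m c = m c)" if "c mod 4<2" for c
   using w0[OF that] by (simp add: sb_def unit_def)
  \<comment> \<open>The steps commute because the postponed one takes a child token and adds only
    match tokens, and the step moved in front of it consumes no match tokens.\<close>
  have redo: "R N sf rf s g (sb m a b) j" if "a<=?m" "!!c. 2<=c mod 4 ==> a c = 0" "R N sf rf s g (sb ?m a b) j" for a b j
  proof -
   have le: "?d c+a c<=m c" for c
   proof (cases "c mod 4<2")
    case True
    thus ?thesis using le_funD[OF that(1), of c] w0[OF True] R_ch(2) by (auto simp: sb_def unit_def)
   next
    case False
    hence "c ~= 4*v+1" by auto
    thus ?thesis using False that(2)[of c] by (simp add: unit_def)
   qed
   have "sb ?m a b = sb (sb m a b) ?d ?w" using le sb_commute by (auto simp: fun_eq_iff)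
   hence "R N sf rf s g (sb (sb m a b) ?d ?w) j" using that(3) by simp
   moreover have "1<=sb m a b (4*v+1)" using le[of "4*v+1"] by (simp add: sb_def unit_def)
   ultimately have "R N sf rf s g (sb m a b) (j+k'+cst h)"
    using R.R_ch[OF R_ch(1) _ R_ch(3,4), of "sb m a b" j] by blast
   thus ?thesis using 0 by simp
  qed
  have em: "emb N f<=m" "2<=c mod 4 ==> emb N f c = 0" if "emb N f<=?m" for f c
  proof -
   have "?m (4*p)<=m (4*p)" for p using low[of "4*p"] by simp
   thus "emb N f<=m" using that unfolding emb_le by (meson le_trans)
  qed simp
  have un: "2<=c mod 4 ==> unit (4*z+1) c = 0" for c z by (auto simp: unit_def)
  show ?thesis
   using R_ch(7)[OF 0(3)]
  proof (elim disjE exE conjE)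
   fix t k1 assume "t : elementary N" "emb N (Wminus N t)<=?m" "R N sf rf s g (sb ?m (emb N (Wminus N t)) (emb N (Wplus N t))) k1" "k1<k"
   thus ?thesis using redo em 0 by (intro disjI1 exI[of _ t] exI[of _ k1]) auto
  next
   fix t h1 k1 k2 assume *: "t : abstract N" "emb N (Wminus N t)<=?m" "gok N sf rf g h1 (Wplus N t)" "R N sf rf s h1 (emb N (Omega N t)) k1"
    "R N sf rf s g (sb ?m (emb N (Wminus N t)) (gv N h1 (Wplus N t))) k2" "k = Suc (k2+k1+cst h1)"
   have "R N sf rf s g (sb m (emb N (Wminus N t)) (gv N h1 (Wplus N t))) k2" by (rule redo[OF *(2) _ *(5)]) simp
   thus ?thesis using *(1,3,4,6) em(1)[OF *(2)] 0(1,2) by (simp only: add_0_right) blast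
  next
   fix u1 v1 h1 k1 k2 assume *: "(u1, v1) : edges s" "1<=?m (4*v1+1)" "gok N sf rf g h1 (label s (u1, v1))" "R N sf rf s h1 (om N s v1) k1"
    "R N sf rf s g (sb ?m (unit (4*v1+1)) (gv N h1 (label s (u1, v1)))) k2" "k = k2+k1+cst h1" "0<k1+cst h1"
   have "1<=m (4*v1+1)" using *(2) low[of "4*v1+1"] by simp
   moreover have "unit (4*v1+1)<=?m" using *(2) by (auto simp: le_fun_def unit_def)
   ultimately show ?thesis using *(1,3,4,6,7) redo[OF _ un *(5)] 0(1,2) by (simp only: add_0_right) blast
  qed
 qed
qed simp

text \<open>\<open>same N s s1 K\<close>: the threads in \<open>K\<close> and their subtrees are unaffected.\<close>

definition same :: "(nat, nat) rpn => nat state => nat state => thread set => bool" where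
 "same N s s1 K = (ALL u z. z : K --> (u, z) : edges s --> (u, z) : edges s1 & label s1 (u, z) = label s (u, z) & om N s1 z = om N s z &
  (ALL y. (z, y) : edges s --> y : K))"

text \<open>A summary inspects \<open>s\<close> only through the children whose tokens it holds and
  through their descendants.\<close>

lemma R_same:
 "R N sf rf s g m k ==> same N s s1 K ==> (!!z. 1<=m (4*z+1) ==> (EX u. (u, z) : edges s) ==> z : K) ==> R N sf rf s1 g m k"
proof (induct rule: R.induct)
 case (R_fin g m)
 thus ?case by (intro R.R_fin)
next
 case (R_el t m g k)
 show ?case by (rule R.R_el[OF R_el(1,2) R_el(4)[OF R_el(5)]]) (use R_el(6) in \<open>auto simp: sb_def\<close>)
next
 case (R_ab t m g h k' k)
 show ?case by (rule R.R_ab[OF R_ab(1-3) R_ab(5)[OF R_ab(8)] R_ab(7)[OF R_ab(8)]]) (use R_ab(9) in \<open>auto simp: sb_def\<close>)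
next
 case (R_ch u v m g h k' k)
 have v: "v : K" using R_ch(2,9) R_ch(1) by auto
 hence e: "(u, v) : edges s1" "label s1 (u, v) = label s (u, v)" "om N s1 v = om N s v" "!!y. (v, y) : edges s ==> y : K"
  using R_ch(1,8) unfolding same_def by blast+
 have "R N sf rf s1 h (om N s1 v) k'" unfolding e(3)
  by (rule R_ch(5)[OF R_ch(8)]) (auto simp: om_def e(4) split: if_splits)
 moreover have "R N sf rf s1 g (sb m (unit (4*v+1)) (gv N h (label s1 (u, v)))) k" unfolding e(2)
  by (rule R_ch(7)[OF R_ch(8)]) (use R_ch(9) in \<open>auto simp: sb_def\<close>)
 ultimately show ?case using R_ch(2,3) e by (intro R.R_ch[OF e(1)]) auto
qed

lemma R_Ret_0: "R N sf rf s g m k ==> g = Ret ==> k = 0 ==> Fin N sf rf Ret m"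
 by (induct rule: R.induct) (auto elim: gok.elims)

definition anc :: "nat state => thread => thread set" where
 "anc s v = {z. (z, v) : (edges s)^*}"

text \<open>A firing below \<open>v\<close> leaves everything outside the subtree of \<open>v\<close> unaffected.\<close>

definition loc :: "(nat, nat) rpn => nat state => nat state => thread => bool" where
 "loc N s s1 v = ((ALL z:threads s. z ~: subtree_threads s v --> om N s1 z = om N s z) &
  (ALL u z. (u, z) : edges s --> z ~: subtree_threads s v \<or> z = v --> (u, z) : edges s1 & label s1 (u, z) = label s (u, z)))"

lemma tree_child:
 assumes s: "tree s r" and e: "(v, c) : edges s"
 shows "v ~: subtree_threads s c" "c ~: anc s v" "v : threads s" "c : threads s"
  "(v, z) : edges s ==> z ~= c ==> z ~: subtree_threads s c & z ~: anc s c"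
  "subtree_threads s c<=subtree_threads s v"
proof -
 have ac: "acyclic (edges s)" using s by (rule tree_acyclic)
 show "v ~: subtree_threads s c" "c ~: anc s v"
  using e ac unfolding subtree_threads_def anc_def acyclic_def by (auto dest: rtrancl_into_trancl2)
 show "v : threads s" "c : threads s" using s e by (auto simp: tree_def)
 show "subtree_threads s c<=subtree_threads s v" using e by (auto simp: subtree_threads_def intro: converse_rtrancl_into_rtrancl)
 assume z: "(v, z) : edges s" "z ~= c"
 have "x = y" if "(x, y) : (edges s)^*" "(v, x) : edges s" "(v, y) : edges s" for x y
 proof (rule ccontr)
  assume "x ~= y"
  then obtain y' where "(x, y') : (edges s)^*" "(y', y) : edges s" using that(1) by (meson \<open>(x, y) \<in> (edges s)\<^sup>*\<close> rtranclE)
  hence "(x, v) : (edges s)^*" using s that(3) unfolding tree_def by blast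
  thus False using ac that(2) unfolding acyclic_def by (meson rtrancl_into_trancl2)
 qed
 thus "z ~: subtree_threads s c & z ~: anc s c" using z e unfolding subtree_threads_def anc_def by blast
qed

text \<open>The threads neither above nor below \<open>c\<close> are closed under children, so
  summaries that use only them survive a firing below \<open>c\<close> by
  \<open>R_same\<close>.\<close>

lemma loc_same:
 assumes s: "tree s r" and l: "loc N s s1 c"
 shows "same N s s1 (- anc s c-subtree_threads s c)"
 unfolding same_def
proof (intro allI impI conjI)
 fix u z assume z: "z : - anc s c-subtree_threads s c" and e: "(u, z) : edges s"
 show "(u, z) : edges s1" "label s1 (u, z) = label s (u, z)" using l z e unfolding loc_def by blast+
 show "om N s1 z = om N s z" using l z tree_child(4)[OF s e] unfolding loc_def by blast
 fix y assume y: "(z, y) : edges s"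
 have "(y, c) ~: (edges s)^*" using z y by (auto simp: anc_def intro: converse_rtrancl_into_rtrancl)
 moreover have "(c, y) ~: (edges s)^*"
 proof
  assume "(c, y) : (edges s)^*"
  thus False
  proof (cases rule: rtranclE)
   case base
   thus ?thesis using z y by (auto simp: anc_def)
  next
   case (step w)
   hence "w = z" using s y unfolding tree_def by blast
   thus ?thesis using step(1) z by (simp add: subtree_threads_def)
  qed
 qed
 ultimately show "y : - anc s c-subtree_threads s c" by (simp add: anc_def subtree_threads_def)
qed

lemma emb_enabled: "v : threads s ==> emb N (Wminus N t)<=om N s v ==> enabled N s v t"
 by (auto simp: emb_le om_def emb_def enabled_def marking_le_def)

lemma lock_child: "1<=om N s v (4*z+1) ==> (v, z) : edges s"
 by (auto simp: om_def split: if_splits)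

lemma gv_lock: "1<=sb m a (gv N h w) (4*z+1) ==> 1<=m (4*z+1)"
 by (auto simp: sb_def)

text \<open>Some firing of the summary can be done first; if it belongs to a child, induction down
  the tree finds it there. What remains of the summary uses other subtrees and is therefore
  unaffected.\<close>

lemma R_progress:
 assumes s: "tree s r" and U: "finite U"
 shows "v : threads s ==> R N sf rf s g (om N s v) k ==> 0<k ==>
  EX a s1 k1. fires N U s a s1 & R N sf rf s1 g (om N s1 v) k1 & k1<k & loc N s s1 v & threads s1 ~= {}"
 using tree_wf[OF s]
proof (induct v arbitrary: g k rule: wf_induct_rule)
 case (less v)
 have nc: "z ~= v" if "(v, z) : edges s" for z using tree_child(1)[OF s that] by (auto simp: subtree_threads_def)
 have vv: "v : subtree_threads s v" by (simp add: subtree_threads_def)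
 have sameI: "same N s s1 (- anc s v)" if "!!u z. (u, z) : edges s ==> (u, z) : edges s1 & label s1 (u, z) = label s (u, z)"
  "!!z. z : threads s ==> z ~= v ==> om N s1 z = om N s z" for s1
  using that tree_child(4)[OF s] unfolding same_def anc_def by (blast intro: converse_rtrancl_into_rtrancl rtrancl_refl)
 have na: "z ~: anc s v" if "(v, z) : edges s" for z using tree_child(2)[OF s that] .
 show ?case
  using R_active[OF less(3,4)]
 proof (elim disjE exE conjE)
  fix t k1 assume t: "t : elementary N" "emb N (Wminus N t)<=om N s v" "R N sf rf s g (sb (om N s v) (emb N (Wminus N t)) (emb N (Wplus N t))) k1" "k1<k"
  let ?s = "s\<lparr>marking_of := (marking_of s)(v := %p. marking_of s v p-Wminus N t p+Wplus N t p)\<rparr>"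
  have o: "om N ?s z = om N s z" if "z ~= v" for z using that by (auto simp: om_def fun_eq_iff)
  have e: "om N ?s v = sb (om N s v) (emb N (Wminus N t)) (emb N (Wplus N t))"
  proof
   fix c show "om N ?s v c = sb (om N s v) (emb N (Wminus N t)) (emb N (Wplus N t)) c"
    using le_funD[OF t(2), of c] by (auto simp: sb_def om_def emb_def)
  qed
  have "R N sf rf ?s g (om N ?s v) k1" unfolding e
  proof (rule R_same[OF t(3)])
   show "same N s ?s (- anc s v)" by (rule sameI) (auto simp: o)
  qed (use na lock_child in \<open>auto simp: sb_def\<close>)
  moreover have "fires N U s (v, t) ?s" by (rule fires.fire_elementary[OF t(1) emb_enabled[OF less(2) t(2)]])
  moreover have "om N ?s z = om N s z" if "z ~: subtree_threads s v" for z using o vv that by fast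
  hence "loc N s ?s v" by (simp add: loc_def)
  moreover have "threads ?s ~= {}" using less(2) by auto
  ultimately show ?thesis using t(4) by blast
 next
  fix t h k1 k2 assume t: "t : abstract N" "emb N (Wminus N t)<=om N s v" "gok N sf rf g h (Wplus N t)" "R N sf rf s h (emb N (Omega N t)) k1"
   "R N sf rf s g (sb (om N s v) (emb N (Wminus N t)) (gv N h (Wplus N t))) k2" "k = Suc (k2+k1+cst h)"
  have "finite (U Un threads s)" using U s by (simp add: tree_def)
  then obtain y where y: "y ~: U" "y ~: threads s" using ex_new_if_finite[OF infinite_UNIV_nat] by blast
  let ?s = "\<lparr>threads = insert y (threads s), edges = insert (v, y) (edges s),
    marking_of = (marking_of s)(v := %p. marking_of s v p-Wminus N t p, y := Omega N t), label = (label s)((v, y) := Wplus N t)\<rparr>"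
  have ny: "(u, y) ~: edges s" "(y, u) ~: edges s" "v ~= y" for u using s y less(2) by (auto simp: tree_def)
  have o: "om N ?s z = om N s z" if "z : threads s" "z ~= v" for z using that y by (auto simp: om_def fun_eq_iff)
  have oy: "om N ?s y = emb N (Omega N t)" using ny by (auto simp: om_def fun_eq_iff)
  have sm: "same N s ?s (- anc s v)" by (rule sameI) (use o ny in auto)
  have e: "sb (om N ?s v) (unit (4*y+1)) (gv N h (Wplus N t)) = sb (om N s v) (emb N (Wminus N t)) (gv N h (Wplus N t))"
  proof
   fix c
   have "c ~= 4*y+1 ==> c mod 4 = 1 ==> c div 4 ~= y" by (metis mult_div_mod_eq)
   thus "sb (om N ?s v) (unit (4*y+1)) (gv N h (Wplus N t)) c = sb (om N s v) (emb N (Wminus N t)) (gv N h (Wplus N t)) c"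
    using le_funD[OF t(2), of c] ny by (cases "c = 4*y+1") (auto simp: sb_def om_def emb_def unit_def)
  qed
  have "R N sf rf ?s g (om N ?s v) (k2+k1+cst h)"
  proof (rule R.R_ch[of v y])
   show "R N sf rf ?s h (om N ?s y) k1" unfolding oy by (rule R_same[OF t(4) sm]) auto
   show "R N sf rf ?s g (sb (om N ?s v) (unit (4*y+1)) (gv N h (label ?s (v, y)))) k2"
    using R_same[OF t(5) sm] na lock_child e by (auto simp: sb_def)
  qed (use t(3) in \<open>auto simp: om_def\<close>)
  moreover have "fires N U s (v, t) ?s" by (rule fires.fire_abstract[OF t(1) emb_enabled[OF less(2) t(2)] y])
  moreover have "loc N s ?s v" using o ny vv by (auto simp: loc_def)
  moreover have "k2+k1+cst h<k" "threads ?s ~= {}" using t(6) by simp_all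
  ultimately show ?thesis by blast
 next
  fix u c h k1 k2 assume c: "(u, c) : edges s" "1<=om N s v (4*c+1)" "gok N sf rf g h (label s (u, c))" "R N sf rf s h (om N s c) k1"
    "R N sf rf s g (sb (om N s v) (unit (4*c+1)) (gv N h (label s (u, c)))) k2" "k = k2+k1+cst h" "0<k1+cst h"
  have vc: "(v, c) : edges s" using lock_child[OF c(2)] .
  hence u: "u = v" using c(1) s unfolding tree_def by blast
  note tc = tree_child[OF s vc]
  have lock: "z : - anc s c-subtree_threads s c" if "1<=sb (om N s v) (unit (4*c+1)) (gv N h w) (4*z+1)" for z h w
  proof -
   have "z ~= c" using that by (auto simp: sb_def unit_def om_def split: if_splits)
   thus ?thesis using tc(5)[of z] lock_child[OF gv_lock[OF that]] by auto
  qed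
  have lv: "loc N s s1 v" if "loc N s s1 c" for s1
   using that tc(1,6) unfolding loc_def by blast
  show ?thesis
  proof (cases "0<k1")
   case True
   obtain a s1 k3 where s1: "fires N U s a s1" "R N sf rf s1 h (om N s1 c) k3" "k3<k1" "loc N s s1 c" "threads s1 ~= {}"
    using less(1)[of c h k1] vc tc(4) c(4) True by blast
   have ov: "om N s1 v = om N s v" and ed: "(v, c) : edges s1" "label s1 (v, c) = label s (v, c)"
    using s1(4) tc(1,3) vc unfolding loc_def by blast+
   have "R N sf rf s1 g (om N s1 v) (k2+k3+cst h)"
   proof (rule R.R_ch[OF ed(1)])
    show "R N sf rf s1 g (sb (om N s1 v) (unit (4*c+1)) (gv N h (label s1 (v, c)))) k2"
     unfolding ov ed(2) using R_same[OF c(5) loc_same[OF s s1(4)]] lock u by simp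
   qed (use c(2,3) s1(2) ov ed u in auto)
   moreover have "k2+k3+cst h<k" using c(6) s1(3) by simp
   ultimately show ?thesis using s1(1,5) lv[OF s1(4)] by blast
  next
   case False
   \<comment> \<open>A child with positive total cost but no firings of its own left can only be
     cut.\<close>
   hence h: "h = Ret" "k1 = 0" using c(7) by (cases h; simp)+
   then obtain t where t: "t : cut N" "emb N (Wminus N t)<=om N s c" using R_Ret_0[OF c(4)] by auto
   let ?s = "\<lparr>threads = threads s-subtree_threads s c,
    edges = {(a, b) : edges s. a ~: subtree_threads s c & b ~: subtree_threads s c},
    marking_of = (marking_of s)(v := %p. marking_of s v p+label s (v, c) p), label = label s\<rparr>"
   note o = cut_om[OF vc s _ refl, of _ N]
   have f: "fires N U s (c, t) ?s" by (rule fires.fire_cut_child[OF t(1) emb_enabled[OF tc(4) t(2)] vc])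
   have ed: "(u, z) : edges ?s" if "(u, z) : edges s" "z ~: subtree_threads s c" for u z
    using that by (auto simp: subtree_threads_def intro: rtrancl_into_rtrancl)
   have sm: "same N s ?s (- anc s c-subtree_threads s c)"
    unfolding same_def
   proof (intro allI impI conjI)
    fix u z assume z: "z : - anc s c-subtree_threads s c" and e: "(u, z) : edges s"
    have "z ~= v" using z vc by (auto simp: anc_def)
    thus "om N ?s z = om N s z" using o z by simp
    show "(u, z) : edges ?s" using ed e z by blast
    have "loc N s s c" by (simp add: loc_def)
    thus "y : - anc s c-subtree_threads s c" if "(z, y) : edges s" for y
     using loc_same[OF s] z e that unfolding same_def by blast
   qed simp
   have "R N sf rf ?s g (om N ?s v) k2"
    using R_same[OF c(5) sm] lock o[of v] tc(1) u h by fastforce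
   moreover have "loc N s ?s v" unfolding loc_def
   proof (intro conjI ballI allI impI)
    fix z assume "z ~: subtree_threads s v"
    hence "z ~: subtree_threads s c" "z ~= v" using tc(6) vv by auto
    thus "om N ?s z = om N s z" using o by simp
   next
    fix u z assume "(u, z) : edges s" "z ~: subtree_threads s v \<or> z = v"
    thus "(u, z) : edges ?s" using ed tc(1,6) by blast
   qed simp
   moreover have "threads ?s ~= {}" using tc(1,3) by auto
   ultimately show ?thesis using f c(6) h by (intro exI[of _ "(c, t)"] exI[of _ ?s] exI[of _ k2]) simp
  qed
 qed
qed

definition match :: "(nat, nat) rpn => nat state => nat state => thread => thread => (thread => thread) => bool" where
 "match N sf s w v f = (f w = v & inj_on f (subtree_threads sf w) & (ALL x:subtree_threads sf w.
   f x : threads s & marking_le N (marking_of sf x) (marking_of s (f x)) &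
   (ALL y. (x, y) : edges sf --> (f x, f y) : edges s & marking_le N (label sf (x, y)) (label s (f x, f y)))))"

lemma match_path:
 assumes m: "match N sf s w v f" and p: "(w, x) : (edges sf)^*"
 shows "(v, f x) : (edges s)^*"
 using p
proof (induct rule: rtrancl_induct)
 case (step x y)
 thus ?case using m unfolding match_def subtree_threads_def by (auto intro: rtrancl_into_rtrancl)
qed (use m in \<open>simp add: match_def\<close>)

lemma tree_disjoint:
 assumes s: "tree s r" and ab: "(v, a) : edges s" "(v, b) : edges s" and y: "(a, y) : (edges s)^*" "(b, y) : (edges s)^*"
 shows "a = b"
proof (rule ccontr)
 assume ne: "a ~= b"
 have "(a, b) : (edges s)^* \<or> (b, a) : (edges s)^*"
  using y
 proof (induct rule: rtrancl_induct)
  case (step x y)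
  show ?case
  proof (cases "b = y")
   case True
   thus ?thesis using step(1,2) by (meson rtrancl_into_rtrancl)
  next
   case False
   then obtain x' where "(b, x') : (edges s)^*" "(x', y) : edges s" using step(4) by (metis rtranclE)
   thus ?thesis using step s unfolding tree_def by blast
  qed
 qed simp
 thus False using tree_child(5)[OF s ab(1,2)] tree_child(5)[OF s ab(2,1)] ne by (auto simp: subtree_threads_def)
qed

text \<open>The matches of the children are glued along \<open>pa\<close>, the child of
  \<open>w\<close> above a given descendant. They cannot collide because the subtrees of different
  children of \<open>v\<close> are disjoint.\<close>

lemma match_children:
 assumes s: "tree s r" and sf: "tree sf rf" and v: "v : threads s" and m: "marking_le N (marking_of sf w) (marking_of s v)"
  and h: "inj_on h {x. (w, x) : edges sf}"
   "!!x. (w, x) : edges sf ==> (v, h x) : edges s & marking_le N (label sf (w, x)) (label s (v, h x)) & (EX f. match N sf s x (h x) f)"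
 shows "EX f. match N sf s w v f"
proof -
 obtain F where F: "!!x. (w, x) : edges sf ==> match N sf s x (h x) (F x)" using h(2) by metis
 define pa where "pa y = (THE x. (w, x) : edges sf & (x, y) : (edges sf)^*)" for y
 have acw: "(w, w) ~: (edges sf)^+" using tree_acyclic[OF sf] by (simp add: acyclic_def)
 have pa: "pa y = x" if "(w, x) : edges sf" "(x, y) : (edges sf)^*" for x y
  unfolding pa_def using that tree_disjoint[OF sf] by (intro the_equality) blast+
 define f where "f y = (if y = w then v else F (pa y) y)" for y
 have nw: "y ~= w" if "(w, x) : edges sf" "(x, y) : (edges sf)^*" for x y using acw that by (auto dest: rtrancl_into_trancl2)
 have fF: "f y = F x y" if "(w, x) : edges sf" "(x, y) : (edges sf)^*" for x y using pa[OF that] nw[OF that] by (simp add: f_def)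
 have sub: "EX x. (w, x) : edges sf & (x, y) : (edges sf)^*" if "y : subtree_threads sf w" "y ~= w" for y
  using that unfolding subtree_threads_def by (metis mem_Collect_eq converse_rtranclE)
 have below: "(h x, f y) : (edges s)^*" if "(w, x) : edges sf" "(x, y) : (edges sf)^*" for x y
  using match_path[OF F[OF that(1)] that(2)] fF[OF that] by simp
 have fx: "f x = h x" if "(w, x) : edges sf" for x using fF[OF that] F[OF that] by (simp add: match_def)
 have nv: "f y ~= v" if "(w, x) : edges sf" "(x, y) : (edges sf)^*" for x y
  using below[OF that] h(2)[OF that(1)] tree_child(1)[OF s, of v "h x"] by (auto simp: subtree_threads_def)
 have inj: "inj_on f (subtree_threads sf w)"
 proof (rule inj_onI)
  fix y y' assume y: "y : subtree_threads sf w" "y' : subtree_threads sf w" "f y = f y'"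
  show "y = y'"
  proof (cases "y = w \<or> y' = w")
   case True
   thus ?thesis using y sub nv by (metis f_def)
  next
   case False
   then obtain x x' where x: "(w, x) : edges sf" "(x, y) : (edges sf)^*" "(w, x') : edges sf" "(x', y') : (edges sf)^*" using sub y by meson
   have "(h x, f y) : (edges s)^*" "(h x', f y) : (edges s)^*" using below[OF x(1,2)] below[OF x(3,4)] y(3) by simp_all
   hence "h x = h x'" using tree_disjoint[OF s, of v "h x" "h x'"] h(2)[OF x(1)] h(2)[OF x(3)] by blast
   hence "x = x'" using h(1) x by (auto dest: inj_onD)
   thus ?thesis using x y(3) fF F[of x] unfolding match_def inj_on_def subtree_threads_def by auto
  qed
 qed
 have "f y : threads s & marking_le N (marking_of sf y) (marking_of s (f y)) &
   (ALL z. (y, z) : edges sf --> (f y, f z) : edges s & marking_le N (label sf (y, z)) (label s (f y, f z)))" if y: "y : subtree_threads sf w" for y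
 proof (cases "y = w")
  case True
  thus ?thesis using v m h(2) fx by (auto simp: f_def)
 next
  case False
  then obtain x where x: "(w, x) : edges sf" "(x, y) : (edges sf)^*" using sub y by blast
  have "f z = F x z" if "(y, z) : edges sf" for z using fF[OF x(1)] x(2) that by (auto intro: rtrancl_into_rtrancl)
  thus ?thesis using F[OF x(1)] x fF[OF x] unfolding match_def subtree_threads_def by auto
 qed
 thus ?thesis using inj unfolding match_def by (intro exI[of _ f]) (auto simp: f_def)
qed

lemma om_match:
 assumes s: "tree s r" and sf: "tree sf rf" and v: "v : threads s"
  and e: "emb N (marking_of sf w)<=om N s v" and i: "inj_on h0 {x. (w, x) : edges sf & om N s v (4*x+2) = 0}"
  and *: "ALL x. (w, x) : edges sf --> om N s v (4*x+2) = 0 --> 1<=om N s v (4*h0 x+1) &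
    (EX u. (u, h0 x) : edges s & marking_le N (label sf (w, x)) (label s (u, h0 x))) & (EX f. match N sf s x (h0 x) f)"
 shows "EX f. match N sf s w v f"
proof (rule match_children[OF s sf v, where h = h0])
 have 0: "om N s v (4*x+2) = 0" for x by (simp add: om_def)
 show "marking_le N (marking_of sf w) (marking_of s v)" using e by (auto simp: emb_le om_def emb_def marking_le_def)
 show "inj_on h0 {x. (w, x) : edges sf}" using i 0 by simp
 fix x assume "(w, x) : edges sf"
 hence "1<=om N s v (4*h0 x+1)" and ex: "EX u. (u, h0 x) : edges s & marking_le N (label sf (w, x)) (label s (u, h0 x))" "EX f. match N sf s x (h0 x) f"
  using * 0 by auto
 hence "(v, h0 x) : edges s" using lock_child by blast
 thus "(v, h0 x) : edges s & marking_le N (label sf (w, x)) (label s (v, h0 x)) & (EX f. match N sf s x (h0 x) f)"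
  using ex s unfolding tree_def by metis
qed

text \<open>A summary without firings is a matching that is already present in \<open>s\<close>.
  Child tokens are at most 1, so different uses concern different children, which makes
  \<open>h\<close> injective where match tokens are missing.\<close>

lemma R_Cov_0:
 assumes s: "tree s r" and sf: "tree sf rf"
 shows "R N sf rf s g m k ==> k = 0 ==> (!!z. m (4*z+1)<=1) ==> g ~= Ret ==>
  (g = Sub & (1<=m 3 \<or> (EX z f. match N sf s rf z f))) \<or>
  emb N (marking_of sf (base rf g))<=m & (EX h. inj_on h {x. (base rf g, x) : edges sf & m (4*x+2) = 0} &
   (ALL x. (base rf g, x) : edges sf --> m (4*x+2) = 0 --> 1<=m (4*h x+1) &
    (EX u. (u, h x) : edges s & marking_le N (label sf (base rf g, x)) (label s (u, h x))) & (EX f. match N sf s x (h x) f)))"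
proof (induct rule: R.induct)
 case (R_fin g m)
 thus ?case by (cases g) (force simp: inj_on_def)+
next
 case (R_ch u v m g h k' k)
 have k: "k = 0" "k' = 0" "h ~= Ret" using R_ch(8) by auto
 let ?m = "sb m (unit (4*v+1)) (gv N h (label s (u, v)))"
 have v: "v : threads s" using tree_child(4)[OF s R_ch(1)] .
 have l: "om N s v (4*z+1)<=1" for z by (simp add: om_def)
 have "h = Sub & (EX z f. match N sf s rf z f) \<or> (EX f. match N sf s (base rf h) v f)"
  using R_ch(5)[OF k(2) l k(3)]
 proof (elim disjE exE conjE)
  fix h0 assume e: "emb N (marking_of sf (base rf h))<=om N s v" and i: "inj_on h0 {x. (base rf h, x) : edges sf & om N s v (4*x+2) = 0}"
   and *: "ALL x. (base rf h, x) : edges sf --> om N s v (4*x+2) = 0 --> 1<=om N s v (4*h0 x+1) &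
    (EX u. (u, h0 x) : edges s & marking_le N (label sf (base rf h, x)) (label s (u, h0 x))) & (EX f. match N sf s x (h0 x) f)"
  have "EX f. match N sf s (base rf h) v f" using om_match[OF s sf v e i *] .
  thus ?thesis by blast
 qed (auto simp: om_def)
 thus ?case
 proof (cases h)
  case Sub
  hence "g = Sub" using R_ch(3) by simp
  thus ?thesis using Sub \<open>h = Sub \<and> _ \<or> _\<close> by auto
 next
  case (Cov x)
  obtain f where f: "match N sf s x v f" using Cov \<open>h = Sub \<and> _ \<or> _\<close> by auto
  have ok: "(base rf g, x) : edges sf" "marking_le N (label sf (base rf g, x)) (label s (u, v))" using R_ch(3) Cov by auto
  define M where "M = sb m (unit (4*v+1)) (gv N h (label s (u, v)))"
  have m: "M 3 = m 3" "M (4*y+1) = m (4*y+1)-of_bool (y = v)" "M (4*y+2) = m (4*y+2)+of_bool (y = x)" "M (4*y) = m (4*y)" for y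
   using Cov by (auto simp: M_def sb_def unit_def) presburger+
  note ms = m m[simplified]
  have 1: "M (4*z+1)<=1" for z using R_ch(9)[of z] by (simp add: ms)
  show ?thesis
   using R_ch(7)[folded M_def, OF k(1) 1 R_ch(10)]
  proof (elim disjE exE conjE)
   fix h0 assume e: "emb N (marking_of sf (base rf g))<=M" and i: "inj_on h0 {x. (base rf g, x) : edges sf & M (4*x+2) = 0}"
    and *: "ALL x. (base rf g, x) : edges sf --> M (4*x+2) = 0 --> 1<=M (4*h0 x+1) &
    (EX u. (u, h0 x) : edges s & marking_le N (label sf (base rf g, x)) (label s (u, h0 x))) & (EX f. match N sf s x (h0 x) f)"
   have z: "M (4*y+2) = 0" if "m (4*y+2) = 0" "y ~= x" for y using that by (simp add: ms)
   have hv: "h0 y ~= v" "1<=m (4*h0 y+1)" if "(base rf g, y) : edges sf" "m (4*y+2) = 0" "y ~= x" for y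
    using *[rule_format, OF that(1) z[OF that(2,3)]] R_ch(9)[of v] by (auto simp: ms split: if_splits)
   have "inj_on (h0(x := v)) {y. (base rf g, y) : edges sf & m (4*y+2) = 0}"
   proof (rule inj_onI)
    fix y y' assume y: "y : {y. (base rf g, y) : edges sf & m (4*y+2) = 0}" "y' : {y. (base rf g, y) : edges sf & m (4*y+2) = 0}"
     "(h0(x := v)) y = (h0(x := v)) y'"
    thus "y = y'" using hv(1)[of y] hv(1)[of y'] z[of y] z[of y'] inj_onD[OF i, of y y'] by (cases "y = x"; cases "y' = x") auto
   qed
   moreover have "emb N (marking_of sf (base rf g))<=m" using e by (simp add: emb_le ms)
   moreover have "1<=m (4*(h0(x := v)) y+1) & (EX u. (u, (h0(x := v)) y) : edges s & marking_le N (label sf (base rf g, y)) (label s (u, (h0(x := v)) y))) & (EX f. match N sf s y ((h0(x := v)) y) f)"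
    if "(base rf g, y) : edges sf" "m (4*y+2) = 0" for y
    using that *[rule_format, OF that(1) z[OF that(2)]] hv(2)[OF that] R_ch(1,2) ok f by auto
   ultimately show ?thesis by blast
  qed (auto simp: ms)
 qed (use k in simp)
qed auto

lemma R_Sub_cover:
 assumes s: "tree s r" and sf: "tree sf rf" and R: "R N sf rf s Sub (om N s r) 0"
 shows "state_le N sf s"
proof -
 have l: "om N s r (4*z+1)<=1" for z by (simp add: om_def)
 have 0: "om N s r 3 = 0" by (simp add: om_def)
 have r: "r : threads s" and ne: "Sub ~= Ret" using s by (auto simp: tree_def)
 have "EX z f. match N sf s rf z f"
  using R_Cov_0[OF s sf R refl l ne]
 proof (elim disjE exE conjE)
  fix h0 assume "emb N (marking_of sf (base rf Sub))<=om N s r" "inj_on h0 {x. (base rf Sub, x) : edges sf & om N s r (4*x+2) = 0}"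
   "ALL x. (base rf Sub, x) : edges sf --> om N s r (4*x+2) = 0 --> 1<=om N s r (4*h0 x+1) &
    (EX u. (u, h0 x) : edges s & marking_le N (label sf (base rf Sub, x)) (label s (u, h0 x))) & (EX f. match N sf s x (h0 x) f)"
  from om_match[OF s sf r this] show ?thesis by auto
 qed (use 0 in auto)
 then obtain z f where m: "match N sf s rf z f" by blast
 have "threads sf<=subtree_threads sf rf" using sf by (auto simp: tree_def subtree_threads_def)
 thus ?thesis
  using m sf unfolding state_le_def match_def tree_def
  by (intro disjI2 exI[of _ f]) (auto intro: inj_on_subset)
qed

theorem R_coverable:
 assumes s: "tree s0 r" and sf: "tree sf rf" and R: "R N sf rf s0 Sub (om N s0 r) k"
 shows "coverable N s0 sf"
proof -
 have "coverable N s0 sf" if "firing_sequence N s0 sg U s" "tree s r" "finite U" "R N sf rf s Sub (om N s r) k" for sg U s k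
  using that
 proof (induct k arbitrary: sg U s rule: less_induct)
  case (less k)
  show ?case
  proof (cases "k = 0")
   case True
   thus ?thesis using R_Sub_cover[OF less(3) sf] less(2,5) unfolding coverable_def by blast
  next
   case False
   have "r : threads s" using less(3) by (simp add: tree_def)
   then obtain a s1 k1 where s1: "fires N U s a s1" "R N sf rf s1 Sub (om N s1 r) k1" "k1<k" "threads s1 ~= {}"
    using R_progress[OF less(3,4) _ less(5)] False by blast
   hence "tree s1 r" using tree_fires[OF less(3) s1(1), of sf rf Sub] by (auto simp: empty_tree_def)
   moreover have "finite (U Un threads s1)" using less(4) \<open>tree s1 r\<close> by (simp add: tree_def)
   ultimately show ?thesis using less(1)[OF s1(3) firing_snoc[OF less(2) s1(1)]] s1(2) by blast
  qed
 qed
 from this[OF firing_Nil s _ R] show ?thesis using s by (simp add: tree_def)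
qed

section \<open>Summaries as a fixed point over vector addition systems\<close>

fun gd :: "nat => goal" where
 "gd 0 = Ret" | "gd (Suc 0) = Sub" | "gd (Suc (Suc w)) = Cov w"

fun gc :: "goal => nat" where
 "gc Ret = 0" | "gc Sub = 1" | "gc (Cov w) = w+2"

lemma gd_gc [simp]: "gd (gc g) = g"
 by (cases g) auto

locale inst =
 fixes N :: "(nat, nat) rpn" and s sf :: "nat state" and r rf A :: nat
 assumes s: "tree s r" and sf: "tree sf rf"
  and bounds: "places N<={..<A}" "elementary N<={..<A}" "abstract N<={..<A}" "cut N<={..<A}" "threads s<={..<A}" "threads sf<={..<A}"
begin

text \<open>A relation \<open>D\<close> is a guess of which goals can be reached by a new thread of an abstract transition \<open>t\<close>
 (key \<open>2 t\<close>) and by the initial thread \<open>v\<close> (key \<open>2 v + 1\<close>). Given the guess, a single thread is a vector addition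
 system, since whole children count as single steps. The true relation is the least closed one.\<close>

definition Tr :: "(nat => nat => bool) => nat => (vec*vec) set" where
 "Tr D g = {(emb N (Wminus N t), emb N (Wplus N t)) | t. t : elementary N}
  Un {(emb N (Wminus N t), gv N (gd h) (Wplus N t)) | t h. t : abstract N & h<A+2 & D (2*t) h & gok N sf rf (gd g) (gd h) (Wplus N t)}
  Un {(unit (4*v+1), gv N (gd h) (label s (u, v))) | u v h. (u, v) : edges s & h<A+2 & D (2*v+1) h & gok N sf rf (gd g) (gd h) (label s (u, v))}"

definition covb :: "(nat => nat => bool) => nat => vec => bool" where
 "covb D g m = (EX m'. (m, m') : (vst (Tr D g) {..<4*A})^* & Fin N sf rf (gd g) m')"

definition valid :: "nat => bool" where
 "valid k = (if even k then k div 2 : abstract N else k div 2 : threads s)"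

definition keyv :: "nat => vec" where
 "keyv k = (if even k then emb N (Omega N (k div 2)) else om N s (k div 2))"

text \<open>Keys have to be valid and goals have to name target threads, because only for these the
  data involved are determined by the code of the instance.\<close>

definition closed :: "(nat => nat => bool) => bool" where
 "closed D = (ALL k<2*A. ALL g<A+2. base rf (gd g) : threads sf --> valid k --> covb D g (keyv k) --> D k g)"

text \<open>The coordinates that can be nonzero. There are at most as many as places and threads
  plus one, while the indices below \<open>4*A\<close> are exponentially many in the length of the
  input.\<close>

definition spt :: "nat set" where
 "spt = (%p. 4*p) ` places N Un (%v. 4*v+1) ` threads s Un (%w. 4*w+2) ` threads sf Un {3}"

definition ons :: "vec => bool" where
 "ons m = (ALL c. c ~: spt --> m c = 0)"

lemma A_pos: "0<A"
 using s bounds(5) by (auto simp: tree_def)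

lemma spt_less: "c : spt ==> c<4*A"
 using A_pos bounds by (auto simp: spt_def)

lemma finite_spt: "finite spt"
 by (rule finite_subset[of _ "{..<4*A}"]) (auto dest: spt_less)

lemma ons_emb: "ons (emb N f)"
 unfolding ons_def
proof (intro allI impI)
 fix c assume "c ~: spt"
 moreover have "c = 4*(c div 4)" if "c mod 4 = 0" using that by presburger
 ultimately show "emb N f c = 0" by (auto simp: spt_def emb_def)
qed

lemma edge_threads: "(u, v) : edges s ==> v : threads s" "(w, x) : edges sf ==> x : threads sf"
 using s sf by (auto simp: tree_def)

lemma ons_om: "ons (om N s v)"
 unfolding ons_def
proof (intro allI impI)
 fix c assume c: "c ~: spt"
 have "c = 4*(c div 4)+1" if "c mod 4 = 1" using that by presburger
 hence "~ (c mod 4 = 1 & (v, c div 4) : edges s)" using c edge_threads(1) unfolding spt_def by (metis UnCI image_eqI)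
 thus "om N s v c = 0" using ons_emb c by (auto simp: om_def ons_def)
qed

lemma ons_unit: "(u, v) : edges s ==> ons (unit (4*v+1))"
 using edge_threads(1) by (auto simp: ons_def unit_def spt_def)

lemma ons_gv: "gok N sf rf g h w ==> ons (gv N h w)"
 by (cases h) (auto simp: ons_emb, auto simp: ons_def unit_def spt_def dest: edge_threads(2))

lemma ons_Tr: "(a, b) : Tr D g ==> ons a & ons b"
 unfolding Tr_def using ons_emb ons_gv ons_unit by auto

lemma ons_sb: "ons m ==> ons a ==> ons b ==> ons (sb m a b)"
 by (simp add: ons_def sb_def)

lemma vst_Tr: "ons m ==> spt<=I ==> (m, m') : vst (Tr D g) I = (EX a b. (a, b) : Tr D g & a<=m & m' = sb m a b)"
proof -
 assume m: "ons m" and I: "spt<=I"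
 have e: "vle I a m = (a<=m)" "(%c. if c : I then m c-a c+b c else 0) = sb m a b" if "(a, b) : Tr D g" for a b
  using ons_Tr[OF that] m I by (auto simp: vle_def le_fun_def ons_def sb_def fun_eq_iff; metis le0 subsetD)+
 have "((m, m') : vst (Tr D g) I) = (EX a b. (a, b) : Tr D g & vle I a m & m' = (%c. if c : I then m c-a c+b c else 0))"
  by (auto simp: vst_def)
 also have "... = (EX a b. (a, b) : Tr D g & a<=m & m' = sb m a b)" by (intro iff_exI conj_cong refl) (simp_all add: e)
 finally show ?thesis .
qed

lemma Tr_mono_I: "ons m ==> spt<=I ==> (m, m') : vst (Tr D g) I ^^ n = ((m, m') : vst (Tr D g) spt ^^ n) & ((m, m') : vst (Tr D g) I ^^ n --> ons m')"
proof (induct n arbitrary: m')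
 case (Suc n)
 have "(z, m') : vst (Tr D g) I = ((z, m') : vst (Tr D g) spt) & ((z, m') : vst (Tr D g) I --> ons m')" if "ons z" for z
  using vst_Tr[OF that Suc(3)] vst_Tr[OF that, of spt] ons_Tr ons_sb[OF that] by auto
 thus ?case using Suc by auto
qed auto

lemma covb_step: "ons m ==> (a, b) : Tr D g ==> a<=m ==> covb D g (sb m a b) ==> covb D g m"
proof -
 assume *: "ons m" "(a, b) : Tr D g" "a<=m" "covb D g (sb m a b)"
 hence "(m, sb m a b) : vst (Tr D g) {..<4*A}" using vst_Tr[of m "{..<4*A}" "sb m a b" D g] spt_less by auto
 thus ?thesis using *(4) unfolding covb_def by (meson converse_rtrancl_into_rtrancl)
qed

lemma gok_bound: "gok N sf rf g h w ==> base rf h : threads sf & gc h<A+2"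
 using bounds(6) edge_threads(2) sf by (cases h) (auto simp: tree_def)

lemma R_closed:
 assumes D: "closed D"
 shows "R N sf rf s g m k ==> ons m ==> covb D (gc g) m"
proof (induct rule: R.induct)
 case (R_fin g m)
 thus ?case unfolding covb_def by auto
next
 case (R_el t m g k)
 thus ?case using ons_emb ons_sb by (intro covb_step[of m "emb N (Wminus N t)" "emb N (Wplus N t)"]) (auto simp: Tr_def)
next
 case (R_ab t m g h k' k)
 have h: "base rf h : threads sf" "gc h<A+2" using gok_bound R_ab(3) by auto
 have "covb D (gc h) (keyv (2*t))" using R_ab(5)[OF ons_emb] by (simp add: keyv_def)
 hence "D (2*t) (gc h)" using D R_ab(1) bounds(3) h unfolding closed_def valid_def by auto
 hence "(emb N (Wminus N t), gv N h (Wplus N t)) : Tr D (gc g)" unfolding Tr_def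
  by (intro UnI1 UnI2 CollectI exI[of _ t] exI[of _ "gc h"]) (use R_ab(1,3) h in simp)
 thus ?case using R_ab ons_emb ons_sb ons_gv using covb_step by presburger
next
 case (R_ch u v m g h k' k)
 have h: "base rf h : threads sf" "gc h<A+2" using gok_bound R_ch(3) by auto
 have "covb D (gc h) (keyv (2*v+1))" using R_ch(5)[OF ons_om] by (simp add: keyv_def)
 hence "D (2*v+1) (gc h)" using D edge_threads(1)[OF R_ch(1)] bounds(5) h unfolding closed_def valid_def by auto
 hence "(unit (4*v+1), gv N h (label s (u, v))) : Tr D (gc g)" unfolding Tr_def
  by (intro UnI2 CollectI exI[of _ u] exI[of _ v] exI[of _ "gc h"]) (use R_ch(1,3) h in simp)
 moreover have "unit (4*v+1)<=m" using R_ch(2) by (auto simp: unit_def le_fun_def)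
 ultimately show ?case using R_ch ons_unit[OF R_ch(1)] ons_sb ons_gv using covb_step by presburger
qed

text \<open>As in the Knaster-Tarski theorem: summaries lie in every closed relation, and the
  relation of actual summaries is closed itself. The quantifier over \<open>D\<close> spares the
  computation of the fixed point.\<close>

theorem Rx_iff_closed: "Rx N sf rf s Sub (om N s r) = (ALL D. closed D --> D (2*r+1) 1)"
proof (intro iffI allI impI)
 fix D assume "Rx N sf rf s Sub (om N s r)" and D: "closed D"
 then obtain k where "R N sf rf s Sub (om N s r) k" by (auto simp: Rx_def)
 from R_closed[OF D this ons_om] have "covb D 1 (keyv (2*r+1))" by (simp add: keyv_def)
 moreover have "r<A" "r : threads s" "rf : threads sf" using s sf bounds(5) by (auto simp: tree_def)
 ultimately show "D (2*r+1) 1" using D[unfolded closed_def, THEN spec, of "2*r+1", THEN mp, THEN spec, of 1] by (auto simp: valid_def)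
next
 assume a: "ALL D. closed D --> D (2*r+1) 1"
 define D where "D k g = Rx N sf rf s (gd g) (keyv k)" for k g
 have "Rx N sf rf s (gd g) m" if c: "covb D g m" "ons m" for g m
 proof -
  obtain m' where m': "(m, m') : (vst (Tr D g) {..<4*A})^*" "Fin N sf rf (gd g) m'" using c(1) by (auto simp: covb_def)
  show ?thesis
   using m'(1) c(2)
  proof (induct rule: converse_rtrancl_induct)
   case base
   thus ?case using m'(2) by (intro Rx_fin)
  next
   case (step y z)
   then obtain a b where ab: "(a, b) : Tr D g" "a<=y" "z = sb y a b" using vst_Tr[of y "{..<4*A}" z D g] spt_less by auto
   hence z: "Rx N sf rf s (gd g) (sb y a b)" using step(3,4) ons_Tr[OF ab(1)] ons_sb by auto
   show ?case
    using ab(1) unfolding Tr_def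
   proof (elim UnE CollectE exE conjE)
    fix t assume "(a, b) = (emb N (Wminus N t), emb N (Wplus N t))" "t : elementary N"
    thus ?thesis using Rx_el[of t N y] ab(2) z by simp
   next
    fix t h assume "(a, b) = (emb N (Wminus N t), gv N (gd h) (Wplus N t))" "t : abstract N" "D (2*t) h" "gok N sf rf (gd g) (gd h) (Wplus N t)"
    thus ?thesis using Rx_ab[of t N y sf rf "gd g" "gd h" s] ab(2) z by (simp add: D_def keyv_def)
   next
    fix u v h assume "(a, b) = (unit (4*v+1), gv N (gd h) (label s (u, v)))" "(u, v) : edges s" "D (2*v+1) h" "gok N sf rf (gd g) (gd h) (label s (u, v))"
    thus ?thesis using Rx_ch[of u v s y N sf rf "gd g" "gd h"] ab(2) z le_funD[of "unit (4*v+1)" y "4*v+1"] by (simp add: D_def keyv_def unit_def)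
   qed
  qed
 qed
 moreover have "ons (keyv k)" for k by (simp add: keyv_def ons_emb ons_om)
 ultimately have "closed D" unfolding closed_def by (auto simp: D_def)
 hence "D (2*r+1) 1" using a by blast
 thus "Rx N sf rf s Sub (om N s r)" by (simp add: D_def keyv_def)
qed

definition small :: "nat => bool" where
 "small W = ((ALL t. t : elementary N Un abstract N Un cut N --> (ALL p:places N. Wminus N t p<=W)) &
  (ALL t:elementary N Un abstract N. ALL p:places N. Wplus N t p<=W) & (ALL t:abstract N. ALL p:places N. Omega N t p<=W) &
  (ALL v:threads s. ALL p:places N. marking_of s v p<=W) & (ALL e:edges s. ALL p:places N. label s e p<=W) &
  (ALL v:threads sf. ALL p:places N. marking_of sf v p<=W) & 1<=W)"

lemma small_emb: "(ALL p:places N. f p<=W) ==> emb N f c<=W"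
 by (simp add: emb_def)

lemma small_Tr: "small W ==> (a, b) : Tr D g ==> a c<=W & b c<=W"
proof -
 assume W: "small W" and ab: "(a, b) : Tr D g"
 have g: "gv N h w c<=W" if "ALL p:places N. w p<=W" for h w
  using that W by (cases h) (auto simp: small_emb unit_def small_def)
 show ?thesis using ab W unfolding Tr_def small_def by (auto intro!: small_emb g simp: unit_def)
qed

lemma small_keyv: "small W ==> valid k ==> keyv k c<=W"
 by (auto simp: small_def valid_def keyv_def om_def emb_def split: if_splits)

text \<open>A goal is reached iff one of these vectors is covered; Rackoff's bound is about a single
  target vector.\<close>

definition Fv :: "nat => vec set" where
 "Fv g = (if g = 0 then {emb N (Wminus N t) | t. t : cut N} else
  (if g = 1 then {unit 3} else {}) Un {%c. emb N (marking_of sf (base rf (gd g))) c+of_bool (c mod 4 = 2 & (base rf (gd g), c div 4) : edges sf)})"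

lemma mod4_2: "(c mod 4 = (2::nat)) = (EX x. c = 4*x+2)" by presburger

lemma Fin_Fv: "Fin N sf rf (gd g) m = (EX f:Fv g. f<=m)"
proof -
 have e: "((%c. emb N M c+of_bool (c mod 4 = 2 & (w, c div 4) : edges sf))<=m) = (emb N M<=m & (ALL x. (w, x) : edges sf --> 1<=m (4*x+2)))" for w M
 proof (intro iffI conjI allI impI le_funI)
  assume a: "(%c. emb N M c+of_bool (c mod 4 = 2 & (w, c div 4) : edges sf))<=m"
  show "emb N M c<=m c" for c using le_funD[OF a, of c] by simp
  show "1<=m (4*x+2)" if "(w, x) : edges sf" for x using le_funD[OF a, of "4*x+2"] that by simp
 next
  fix c assume a: "emb N M<=m & (ALL x. (w, x) : edges sf --> 1<=m (4*x+2))"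
  show "emb N M c+of_bool (c mod 4 = 2 & (w, c div 4) : edges sf)<=m c"
  proof (cases "c mod 4 = 2")
   case True
   then obtain x where "c = 4*x+2" by (auto simp: mod4_2)
   thus ?thesis using a by auto
  qed (use a in \<open>auto simp: le_fun_def\<close>)
 qed
 have u: "(unit 3<=m) = (1<=m 3)" by (auto simp: unit_def le_fun_def)
 show ?thesis by (cases g rule: gd.cases) (auto simp: Fv_def e[simplified] u[simplified])
qed

text \<open>Rackoff's bound is applied on \<open>spt\<close>, so that its exponent depends on
  \<open>card spt\<close> only; the short run is then read on all \<open>4*A\<close> coordinates
  again.\<close>

theorem covb_short:
 assumes W: "small W" and m: "ons m" and c: "covb D g m" and g: "base rf (gd g) : threads sf"
 shows "EX n m'. n<=ell W (card spt) & (m, m') : vst (Tr D g) {..<4*A} ^^ n & Fin N sf rf (gd g) m'"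
proof -
 obtain m' where m': "(m, m') : (vst (Tr D g) {..<4*A})^*" "Fin N sf rf (gd g) m'" using c by (auto simp: covb_def)
 obtain f where f: "f : Fv g" "f<=m'" using m'(2) Fin_Fv by blast
 have fW: "f c<=W" for c
  using f(1) W g by (auto simp: Fv_def small_def unit_def emb_def split: if_splits)
 have fs: "ons f"
 proof -
  have "ons (%c. emb N M c+of_bool (c mod 4 = 2 & (w, c div 4) : edges sf))" for M w
   unfolding ons_def using ons_emb[of M] edge_threads(2) by (auto simp: ons_def mod4_2 spt_def)
  thus ?thesis using f(1) ons_emb by (auto simp: Fv_def split: if_splits) (simp_all add: ons_def unit_def spt_def)
 qed
 have I: "spt<={..<4*A}" using spt_less by auto
 have "(m, m') : (vst (Tr D g) spt)^*" using m'(1) Tr_mono_I[OF m I] by (metis relpow_imp_rtrancl rtrancl_imp_relpow)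
 moreover have "proj spt m = m" using m by (auto simp: ons_def proj_def fun_eq_iff)
 moreover have "vle spt f m'" using f(2) by (auto simp: vle_def le_fun_def)
 ultimately obtain n z where z: "n<=ell W (card spt)" "(m, z) : vst (Tr D g) spt ^^ n" "vle spt f z"
  using rackoff[OF finite_spt, of m m' "Tr D g" f W] small_Tr[OF W] fW by blast
 have "f<=z" using z(3) fs unfolding vle_def ons_def le_fun_def by (metis le0)
 thus ?thesis using z(1,2) f(1) Tr_mono_I[OF m I, of z] Fin_Fv[of g z] by blast
qed

text \<open>Short runs have small entries, which determines the base \<open>H\<close> in which
  vectors are coded.\<close>

lemma vst_grow: "small W ==> (m, m') : vst (Tr D g) I ^^ n ==> (!!c. m c<=W) ==> m' c<=W*Suc n"
proof (induct n arbitrary: m')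
 case (Suc n)
 then obtain z where z: "(m, z) : vst (Tr D g) I ^^ n" "(z, m') : vst (Tr D g) I" by auto
 obtain a b where ab: "(a, b) : Tr D g" "m' = (%c. if c : I then z c-a c+b c else 0)" using z(2) by (auto simp: vst_def)
 have "m' c<=z c+b c" using ab(2) by simp
 thus ?case using Suc(1)[OF Suc(2) z(1) Suc(4)] small_Tr[OF Suc(2) ab(1), of c] by simp
qed simp

end

section \<open>Instances as numbers\<close>

lemma dg_less: "0<B ==> dg B y i<B"
 by (simp add: dg_def)

definition nv :: "nat => nat => (nat => nat) => nat" where
 "nv B n f = (\<Sum>i<n. f i*B^i)"

lemma nv: "(!!i. i<n ==> f i<B) ==> nv B n f<B^n & (ALL i<n. dg B (nv B n f) i = f i)"
proof (induct n)
 case (Suc n)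
 let ?a = "nv B n f"
 have B: "0<B" using Suc(2)[of 0] by simp
 have a: "?a<B^n" "ALL i<n. dg B ?a i = f i" using Suc by auto
 have e: "nv B (Suc n) f = ?a+f n*B^n" by (simp add: nv_def)
 have "?a+f n*B^n<(f n+1)*B^n" using a(1) by simp
 also have "... <= B*B^n" using Suc(2)[of n] by (intro mult_le_mono1) simp
 finally have 1: "nv B (Suc n) f<B^Suc n" by (simp add: e)
 have "dg B (nv B (Suc n) f) i = f i" if i: "i<Suc n" for i
 proof (cases "i = n")
  case True
  thus ?thesis using a(1) Suc(2)[of n] B by (simp add: e dg_def)
 next
  case False
  hence "i<n" using i by simp
  then obtain k where k: "n = Suc (i+k)" using less_imp_Suc_add by blast
  have "f n*B^n = (f n*B^k*B)*B^i" by (simp add: k power_add)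
  hence "(?a+f n*B^n) div B^i = f n*B^k*B+?a div B^i" using B by (metis div_mult_self1 nat_neq_iff power_not_zero)
  thus ?thesis using a(2) \<open>i < n\<close> by (simp add: e dg_def)
 qed
 thus ?case using 1 by blast
qed (simp add: nv_def)

text \<open>Row \<open>I\<close> of table \<open>f\<close> of the instance \<open>y\<close> consists of the entries \<open>I * A + p\<close>. The tables 0 to 3 are the
 sets of places, elementary, abstract and cut transitions, 4 to 6 are \<open>Wminus\<close>, \<open>Wplus\<close> and \<open>Omega\<close>,
 and \<open>7 + 4 j\<close> to \<open>10 + 4 j\<close> are the threads, edges, markings and labels of the states \<open>j = 0, 1\<close>.\<close>

definition "fl A y f i = dg A y (f*A^3+i)"

definition "ed A y j u v = (fl A y (8+4*j) (u*A+v) = 1)"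

definition srep :: "nat => nat => nat => (nat, nat) rpn => nat state => bool" where
 "srep A y j N s = (threads s<={..<A} & edges s<={..<A} \<times> {..<A} & (ALL v<A. (fl A y (7+4*j) v = 1) = (v : threads s)) &
  (ALL u<A. ALL v<A. ed A y j u v = ((u, v) : edges s)) &
  (ALL v:threads s. ALL p:places N. fl A y (9+4*j) (v*A+p) = marking_of s v p) &
  (ALL (u, v):edges s. ALL p:places N. fl A y (10+4*j) ((u*A+v)*A+p) = label s (u, v) p))"

definition nrep :: "nat => nat => (nat, nat) rpn => bool" where
 "nrep A y N = (places N<={..<A} & elementary N<={..<A} & abstract N<={..<A} & cut N<={..<A} &
  (ALL p<A. (fl A y 0 p = 1) = (p : places N) & (fl A y 1 p = 1) = (p : elementary N) & (fl A y 2 p = 1) = (p : abstract N) & (fl A y 3 p = 1) = (p : cut N)) &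
  (ALL p:places N. (ALL t:elementary N Un abstract N Un cut N. fl A y 4 (t*A+p) = Wminus N t p) &
   (ALL t:elementary N Un abstract N. fl A y 5 (t*A+p) = Wplus N t p) & (ALL t:abstract N. fl A y 6 (t*A+p) = Omega N t p)))"

text \<open>From here on the notions around \<open>covb\<close> are repeated as arithmetic on the
  code \<open>y\<close>, with all quantifiers bounded so that the rules for \<open>Comp\<close>
  apply. The prefix \<open>n\<close> marks these numeric versions.\<close>

definition "ne A y f I c = (if c mod 4 = 0 & c div 4<A & fl A y 0 (c div 4) = 1 then fl A y f (I*A+c div 4) else 0)"

definition "ngv A y h f I c = (if h = 0 then ne A y f I c else if h = 1 then of_bool (c = 3) else of_bool (c = 4*(h-2)+2))"

definition nbs :: "nat => nat => nat" where
 "nbs rf g = (if g<=1 then rf else g-2)"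

definition "ngok A y rf g h f I = (h = 0 \<or> h = 1 & g = 1 \<or> 2<=h & g ~= 0 & ed A y 1 (nbs rf g) (h-2) &
  (ALL p<A. fl A y 0 p = 1 --> fl A y 14 ((nbs rf g*A+(h-2))*A+p)<=fl A y f (I*A+p)))"

definition "nD A d k g = (dg 2 d (k*(A+2)+g) = 1)"

definition "nE A y rf H d g y1 y2 =
  ((EX t<A. fl A y 1 t = 1 & (ALL c<4*A. ne A y 4 t c<=dg H y1 c & dg H y2 c = dg H y1 c-ne A y 4 t c+ne A y 5 t c)) \<or>
   (EX t<A. EX h<A+2. fl A y 2 t = 1 & nD A d (2*t) h & ngok A y rf g h 5 t &
    (ALL c<4*A. ne A y 4 t c<=dg H y1 c & dg H y2 c = dg H y1 c-ne A y 4 t c+ngv A y h 5 t c)) \<or>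
   (EX u<A. EX v<A. EX h<A+2. ed A y 0 u v & nD A d (2*v+1) h & ngok A y rf g h 10 (u*A+v) &
    (ALL c<4*A. of_bool (c = 4*v+1)<=dg H y1 c & dg H y2 c = dg H y1 c-of_bool (c = 4*v+1)+ngv A y h 10 (u*A+v) c)))"

definition "nFin A y rf H g m = (if g = 0 then EX t<A. fl A y 3 t = 1 & (ALL p<A. fl A y 0 p = 1 --> fl A y 4 (t*A+p)<=dg H m (4*p)) else
  g = 1 & 1<=dg H m 3 \<or> (ALL p<A. fl A y 0 p = 1 --> fl A y 13 (nbs rf g*A+p)<=dg H m (4*p)) &
   (ALL x<A. ed A y 1 (nbs rf g) x --> 1<=dg H m (4*x+2)))"

definition "nkey A y k c = (if k mod 2 = 0 then ne A y 6 (k div 2) c else ne A y 9 (k div 2) c+of_bool (c mod 4 = 1 & ed A y 0 (k div 2) (c div 4)))"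

definition "ncov A y rf H J d g k = (EX m0<H^(4*A). EX m1<H^(4*A). (ALL c<4*A. dg H m0 c = nkey A y k c) &
   sav (H^(4*A)) (nE A y rf H d g) J m0 m1 & nFin A y rf H g m1)"

definition "nclosed A y rf H J d = (ALL k<2*A. ALL g<A+2. fl A y 11 (nbs rf g) = 1 --> (if k mod 2 = 0 then fl A y 2 (k div 2) = 1 else fl A y 7 (k div 2) = 1) -->
   ncov A y rf H J d g k --> nD A d k g)"

lemma nbs: "nbs rf g = base rf (gd g)"
 by (cases g rule: gd.cases) (auto simp: nbs_def)

text \<open>\<open>H\<close> exceeds every entry on runs of length at most \<open>ell W S\<close>,
  and \<open>2^J\<close> bounds that length, so \<open>J\<close> levels of recursive doubling
  suffice.\<close>

locale rinst = inst +
 fixes y H J W S :: nat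
 assumes rep: "nrep A y N" "srep A y 0 N s" "srep A y 1 N sf" and W: "small W" and H: "W*ell W S+W<H" "ell W S<=2^J"
  and S: "card (places N)+card (threads s)+card (threads sf)+1<=S"
begin

definition "row f I w = (ALL p:places N. fl A y f (I*A+p) = w p)"

lemma rows: "t : elementary N Un abstract N Un cut N ==> row 4 t (Wminus N t)" "t : elementary N Un abstract N ==> row 5 t (Wplus N t)"
 "t : abstract N ==> row 6 t (Omega N t)" "v : threads s ==> row 9 v (marking_of s v)" "(u, v) : edges s ==> row 10 (u*A+v) (label s (u, v))"
 "v : threads sf ==> row 13 v (marking_of sf v)" "(u, v) : edges sf ==> row 14 (u*A+v) (label sf (u, v))"
 using rep unfolding row_def nrep_def srep_def by auto

lemma pl: "p<A ==> (fl A y 0 p = 1) = (p : places N)" "t<A ==> (fl A y 1 t = 1) = (t : elementary N)"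
 "t<A ==> (fl A y 2 t = 1) = (t : abstract N)" "t<A ==> (fl A y 3 t = 1) = (t : cut N)"
 "v<A ==> (fl A y 7 v = 1) = (v : threads s)" "v<A ==> (fl A y 11 v = 1) = (v : threads sf)"
 "u<A ==> v<A ==> ed A y 0 u v = ((u, v) : edges s)" "u<A ==> v<A ==> ed A y 1 u v = ((u, v) : edges sf)"
 using rep unfolding nrep_def srep_def by auto

lemma ne: "row f I w ==> ne A y f I c = emb N w c"
 using bounds(1) pl(1) by (auto simp: ne_def emb_def row_def)

lemma ngv: "row f I w ==> ngv A y h f I c = gv N (gd h) w c"
 by (cases h rule: gd.cases) (auto simp: ngv_def ne unit_def)

lemma nef: "row f I w ==> ne A y f I = emb N w"
 by (rule ext) (rule ne)

lemma ngvf: "row f I w ==> ngv A y h f I = gv N (gd h) w"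
 by (rule ext) (rule ngv)

lemma lt_edge: "(u, v) : edges sf ==> u<A & v<A" "(u, v) : edges s ==> u<A & v<A"
 using rep unfolding srep_def by auto

lemma ngok: assumes "row f I w" "h<A+2" "base rf (gd g) : threads sf" shows "ngok A y rf g h f I = gok N sf rf (gd g) (gd h) w"
proof (cases h rule: gd.cases)
 case (3 x)
 have b: "base rf (gd g)<A" "x<A" using assms(2,3) bounds(6) 3 by auto
 have "(gd g = Ret) = (g = 0)" by (cases g rule: gd.cases) auto
 moreover have "(ALL p<A. fl A y 0 p = 1 --> fl A y 14 ((base rf (gd g)*A+x)*A+p)<=fl A y f (I*A+p)) = marking_le N (label sf (base rf (gd g), x)) w"
  if "(base rf (gd g), x) : edges sf"
  using rows(7)[OF that] assms(1) pl(1) bounds(1) unfolding row_def marking_le_def by auto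
 ultimately show ?thesis using pl(8)[OF b] 3 by (auto simp: ngok_def nbs)
qed (cases g rule: gd.cases; auto simp: ngok_def)+

definition "vec m c = (if c<4*A then dg H m c else 0)"

lemma nE: assumes g: "base rf (gd g) : threads sf"
 shows "nE A y rf H d g y1 y2 = ((vec y1, vec y2) : vst (Tr (nD A d) g) {..<4*A})"
proof -
 define S where "S a b = (ALL c<4*A. a c<=dg H y1 c & dg H y2 c = dg H y1 c-a c+b c)" for a b
 have st: "S a b = (vle {..<4*A} a (vec y1) & vec y2 = (%c. if c : {..<4*A} then vec y1 c-a c+b c else 0))" for a b
  by (auto simp: S_def vle_def vec_def fun_eq_iff)
 have V: "((vec y1, vec y2) : vst T {..<4*A}) = (EX a b. (a, b) : T & S a b)" for T
  unfolding vst_def st by auto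
 have 1: "(t<A & fl A y 1 t = 1 & S (ne A y 4 t) (ne A y 5 t)) = (t : elementary N & S (emb N (Wminus N t)) (emb N (Wplus N t)))" for t
  using bounds(2) pl(2)[of t] nef[OF rows(1)[of t]] nef[OF rows(2)[of t]] by auto
 have 2: "(t<A & h<A+2 & fl A y 2 t = 1 & nD A d (2*t) h & ngok A y rf g h 5 t & S (ne A y 4 t) (ngv A y h 5 t)) =
  (t : abstract N & h<A+2 & nD A d (2*t) h & gok N sf rf (gd g) (gd h) (Wplus N t) & S (emb N (Wminus N t)) (gv N (gd h) (Wplus N t)))" for t h
  using bounds(3) pl(3)[of t] nef[OF rows(1)[of t]] ngvf[OF rows(2)[of t]] ngok[OF rows(2)[of t] _ g, of h] by auto
 have 3: "(u<A & v<A & h<A+2 & ed A y 0 u v & nD A d (2*v+1) h & ngok A y rf g h 10 (u*A+v) & S (unit (4*v+1)) (ngv A y h 10 (u*A+v))) =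
  ((u, v) : edges s & h<A+2 & nD A d (2*v+1) h & gok N sf rf (gd g) (gd h) (label s (u, v)) & S (unit (4*v+1)) (gv N (gd h) (label s (u, v))))" for u v h
  using pl(7)[of u v] lt_edge(2)[of u v] ngvf[OF rows(5)[of u v]] ngok[OF rows(5)[of u v] _ g, of h] by auto
 have "nE A y rf H d g y1 y2 = ((EX t. t<A & fl A y 1 t = 1 & S (ne A y 4 t) (ne A y 5 t)) \<or>
  (EX t h. t<A & h<A+2 & fl A y 2 t = 1 & nD A d (2*t) h & ngok A y rf g h 5 t & S (ne A y 4 t) (ngv A y h 5 t)) \<or>
  (EX u v h. u<A & v<A & h<A+2 & ed A y 0 u v & nD A d (2*v+1) h & ngok A y rf g h 10 (u*A+v) & S (unit (4*v+1)) (ngv A y h 10 (u*A+v))))"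
  unfolding nE_def S_def unit_def by blast
 thus ?thesis unfolding V 1 2 3 Tr_def by blast
qed

lemma nFin: assumes g: "base rf (gd g) : threads sf" shows "nFin A y rf H g m = Fin N sf rf (gd g) (vec m)"
proof -
 have v: "vec m (4*p) = dg H m (4*p)" "vec m (4*p+2) = dg H m (4*p+2)" "vec m 3 = dg H m 3" if "p<A" for p
  using that by (auto simp: vec_def)
 have e: "(ALL p<A. fl A y 0 p = 1 --> fl A y f (I*A+p)<=dg H m (4*p)) = (emb N w<=vec m)" if "row f I w" for f I w
  using that pl(1) bounds(1) v(1) unfolding emb_le row_def by auto
 have x: "(ALL x<A. ed A y 1 (base rf (gd g)) x --> 1<=dg H m (4*x+2)) = (ALL x. (base rf (gd g), x) : edges sf --> 1<=vec m (4*x+2))"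
  using pl(8)[of "base rf (gd g)"] lt_edge(1) v(2) g bounds(6) by auto
 have c: "(EX t<A. fl A y 3 t = 1 & (ALL p<A. fl A y 0 p = 1 --> fl A y 4 (t*A+p)<=dg H m (4*p))) = (EX t:cut N. emb N (Wminus N t)<=vec m)"
  using bounds(4) pl(4) e[OF rows(1)] by blast
 show ?thesis unfolding nFin_def nbs x c e[OF rows(6)[OF g]]
  using v(3)[OF A_pos] by (cases g rule: gd.cases) auto
qed

lemma nkey: "k<2*A ==> valid k ==> c<4*A ==> nkey A y k c = keyv k c"
 using ne[OF rows(3)] ne[OF rows(4)] pl(7)[of "k div 2" "c div 4"]
 by (auto simp: nkey_def keyv_def valid_def om_def even_iff_mod_2_eq_zero less_mult_imp_div_less mult.commute)

text \<open>Soundness is immediate, since every path found by \<open>sav\<close> is a run. For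
  completeness the short run from \<open>covb_short\<close> is coded in base \<open>H\<close>, which
  its entries never reach.\<close>

theorem ncov: assumes g: "base rf (gd g) : threads sf" and k: "k<2*A" "valid k"
 shows "ncov A y rf H J d g k = covb (nD A d) g (keyv k)"
proof
 let ?Z = "H^(4*A)" and ?T = "vst (Tr (nD A d) g) {..<4*A}"
 have C: "4*A<=c ==> keyv k c = 0" for c using ons_emb ons_om spt_less[of c] unfolding keyv_def ons_def by (auto simp: not_less[symmetric])
 {
  assume "ncov A y rf H J d g k"
  then obtain m0 m1 where m: "m0<?Z" "m1<?Z" "ALL c<4*A. dg H m0 c = nkey A y k c" "sav ?Z (nE A y rf H d g) J m0 m1" "nFin A y rf H g m1"
   unfolding ncov_def by blast
  have "vec m0 = keyv k" using m(3) nkey[OF k] C by (auto simp: vec_def fun_eq_iff)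
  moreover have "(vec m0, vec m1) : ?T^*" using sav_sound[OF m(4,1,2)]
   by (induct rule: rtrancl_induct) (auto simp: nE[OF g] intro: rtrancl_into_rtrancl)
  ultimately show "covb (nD A d) g (keyv k)" using m(5) nFin[OF g] unfolding covb_def by auto
 }
 assume "covb (nD A d) g (keyv k)"
 moreover have "ons (keyv k)" using ons_emb ons_om by (simp add: keyv_def)
 ultimately obtain n m' where n: "n<=ell W (card spt)" "(keyv k, m') : ?T ^^ n" "Fin N sf rf (gd g) m'"
  using covb_short[OF W _ _ g] by blast
 have "card spt<=S"
 proof -
  have "finite (places N)" "finite (threads s)" "finite (threads sf)" using bounds finite_subset by blast+
  hence "card ((%p. 4*p) ` places N)<=card (places N)" "card ((%v. 4*v+1) ` threads s)<=card (threads s)"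
   "card ((%w. 4*w+2) ` threads sf)<=card (threads sf)" by (auto intro: card_image_le)
  thus ?thesis using S card_Un_le[of "(%p. 4*p) ` places N" "(%v. 4*v+1) ` threads s"] card_Un_le[of "(%p. 4*p) ` places N Un (%v. 4*v+1) ` threads s" "(%w. 4*w+2) ` threads sf"]
    card_Un_le[of "(%p. 4*p) ` places N Un (%v. 4*v+1) ` threads s Un (%w. 4*w+2) ` threads sf" "{3}"]
   unfolding spt_def by simp
 qed
 moreover have "ell W i<=ell W (i+j)" for i j by (induct j) auto
 ultimately have ell: "n<=ell W S" using n(1) by (metis le_add_diff_inverse le_trans)
 have small: "m c<H" if "(keyv k, m) : ?T ^^ i" "i<=n" for m i c
 proof -
  have "m c<=W*Suc i" using vst_grow[OF W that(1)] small_keyv[OF W k(2)] by blast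
  also have "... <= W*Suc (ell W S)" using that(2) ell by (intro mult_le_mono2) simp
  finally show ?thesis using H(1) by simp
 qed
 have z: "m c = 0" if "(keyv k, m) : ?T ^^ i" "4*A<=c" for m i c
  using that C by (cases i) (auto simp: vst_def)
 define q where "q m = nv H (4*A) m" for m
 have q: "vec (q m) = m" "q m<?Z" if "(keyv k, m) : ?T ^^ i" "i<=n" for m i
  using nv[of "4*A" m H] small[OF that] z[OF that(1)] by (auto simp: vec_def q_def fun_eq_iff)
 let ?R = "{(a, b). a<?Z & b<?Z & nE A y rf H d g a b}"
 have path: "(keyv k, m) : ?T ^^ i ==> i<=n ==> (q (keyv k), q m) : ?R ^^ i" for m i
 proof (induct i arbitrary: m)
  case (Suc i)
  then obtain z where z: "(keyv k, z) : ?T ^^ i" "(z, m) : ?T" by auto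
  have "i<=n" using Suc(3) by simp
  have "(q z, q m) : ?R" using q[OF z(1) \<open>i <= n\<close>] q[OF Suc(2,3)] z(2) nE[OF g] by simp
  thus ?case using Suc(1)[OF z(1) \<open>i <= n\<close>] by auto
 qed simp
 have "n<=2^J" using ell H(2) by simp
 moreover have q0: "vec (q (keyv k)) = keyv k" "q (keyv k)<?Z" using q[of "keyv k" 0] by auto
 ultimately have "sav ?Z (nE A y rf H d g) J (q (keyv k)) (q m')"
  using sav_complete[OF _ q0(2) _ path[OF n(2)]] q(2)[OF n(2)] by simp
 moreover have "dg H (q (keyv k)) c = nkey A y k c" if "c<4*A" for c using fun_cong[OF q0(1), of c] that nkey[OF k that] by (simp add: vec_def)
 ultimately show "ncov A y rf H J d g k" unfolding ncov_def
  using q0(2) q[OF n(2)] n(3) nFin[OF g, of "q m'"] by (intro exI[of _ "q (keyv k)"] conjI exI[of _ "q m'"]) auto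
qed

theorem Rx_iff_nclosed: "Rx N sf rf s Sub (om N s r) = (ALL d<2^(2*A*(A+2)). nclosed A y rf H J d --> nD A d (2*r+1) 1)"
proof -
 have v: "(if k mod 2 = 0 then fl A y 2 (k div 2) = 1 else fl A y 7 (k div 2) = 1) = valid k" if "k<2*A" for k
  using pl(3)[of "k div 2"] pl(5)[of "k div 2"] that by (auto simp: valid_def even_iff_mod_2_eq_zero)
 have b: "(fl A y 11 (nbs rf g) = 1) = (base rf (gd g) : threads sf)" if "g<A+2" for g
 proof -
  have "rf : threads sf" using sf by (simp add: tree_def)
  hence "rf<A" using bounds(6) by blast
  thus ?thesis using that \<open>rf : threads sf\<close> by (cases g rule: gd.cases) (simp_all add: nbs pl(6)[unfolded One_nat_def])
 qed
 have cl: "nclosed A y rf H J d = closed (nD A d)" for d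
  unfolding nclosed_def closed_def using v b ncov by blast
 \<comment> \<open>Only keys below \<open>2*A\<close> and goals below \<open>A+2\<close> are ever
   consulted, so a guess is a bit string of length \<open>2*A*(A+2)\<close>.\<close>
 have "EX d<2^(2*A*(A+2)). ALL k<2*A. ALL g<A+2. nD A d k g = D k g" for D
 proof (intro exI conjI allI impI)
  define B where "B = A+2"
  let ?f = "%i. of_bool (D (i div B) (i mod B)) :: nat"
  note n = nv[of "2*A*B" ?f 2]
  show "nv 2 (2*A*B) ?f<2^(2*A*(A+2))" using n by (simp add: B_def)
  fix k g assume "k<2*A" and g: "g<A+2"
  hence "Suc k*B<=2*A*B" by (intro mult_le_mono1) simp
  hence "k*B+g<2*A*B" using g by (simp add: B_def)
  moreover have "(k*B+g) div B = k" "(k*B+g) mod B = g" using g by (simp_all add: B_def del: add_2_eq_Suc')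
  ultimately have "dg 2 (nv 2 (2*A*B) ?f) (k*B+g) = of_bool (D k g)" using n by simp
  thus "nD A (nv 2 (2*A*B) ?f) k g = D k g" unfolding nD_def B_def by simp
 qed
 then obtain q where q: "!!D. q D<2^(2*A*(A+2)) & (ALL k<2*A. ALL g<A+2. nD A (q D) k g = D k g)" by metis
 have "closed (nD A (q D)) = closed D" for D
 proof -
  have "D (2*t) h = nD A (q D) (2*t) h" "D (2*t+1) h = nD A (q D) (2*t+1) h" if "t<A" "h<A+2" for t h using q[of D] that by auto
  hence "Tr (nD A (q D)) g = Tr D g" for g unfolding Tr_def using bounds(3) lt_edge(2) by blast
  thus ?thesis unfolding closed_def covb_def using q[of D] by auto
 qed
 moreover have "D (2*r+1) 1 = nD A (q D) (2*r+1) 1" for D using q[of D] s bounds(5) by (auto simp: tree_def)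
 ultimately show ?thesis unfolding Rx_iff_closed cl using q by metis
qed

end

section \<open>The coverability problem is in EXPSPACE\<close>

lemma PB_lift: "PB rho f ==> PB (ext rho) (%e. f (fst e))"
 by (rule PB_trans[of rho f "ext rho" fst]) (auto intro: PB_le[OF PB_total])

lemma Comp_fl: "Comp rho A ==> Comp rho y ==> Comp rho f ==> Comp rho i ==> Comp rho (%e. fl (A e) (y e) (f e) (i e))"
 unfolding fl_def by (rule Comp_rules | assumption)+

lemma Comp_ed: "Comp rho A ==> Comp rho y ==> Comp rho u ==> Comp rho v ==> CompB rho (%e. ed (A e) (y e) j (u e) (v e))"
 unfolding ed_def by (rule Comp_rules Comp_fl | assumption)+

lemma Comp_ne: "Comp rho A ==> Comp rho y ==> Comp rho f ==> Comp rho i ==> Comp rho c ==> Comp rho (%e. ne (A e) (y e) (f e) (i e) (c e))"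
 unfolding ne_def by (rule Comp_rules Comp_fl | assumption)+

lemma Comp_ngv: "Comp rho A ==> Comp rho y ==> Comp rho h ==> Comp rho f ==> Comp rho i ==> Comp rho c ==>
  Comp rho (%e. ngv (A e) (y e) (h e) (f e) (i e) (c e))"
 unfolding ngv_def by (rule Comp_rules Comp_ne | assumption)+

lemma Comp_nbs: "Comp rho r ==> Comp rho g ==> Comp rho (%e. nbs (r e) (g e))"
 unfolding nbs_def by (rule Comp_rules | assumption)+

lemma Comp_ngok: "Comp rho A ==> Comp rho y ==> Comp rho r ==> Comp rho g ==> Comp rho h ==> Comp rho f ==> Comp rho i ==>
  CompB rho (%e. ngok (A e) (y e) (r e) (g e) (h e) (f e) (i e))"
 unfolding ngok_def by (rule Comp_rules Comp_fl Comp_ed Comp_nbs | assumption | rule Comp_lift)+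

lemma Comp_nD: "Comp rho A ==> Comp rho d ==> Comp rho k ==> Comp rho g ==> CompB rho (%e. nD (A e) (d e) (k e) (g e))"
 unfolding nD_def by (rule Comp_rules | assumption)+

lemma Comp_nE: "Comp rho A ==> Comp rho y ==> Comp rho r ==> Comp rho H ==> Comp rho d ==> Comp rho g ==> Comp rho y1 ==> Comp rho y2 ==>
  CompB rho (%e. nE (A e) (y e) (r e) (H e) (d e) (g e) (y1 e) (y2 e))"
 unfolding nE_def by (rule Comp_rules Comp_fl Comp_ed Comp_ne Comp_ngv Comp_ngok Comp_nD | assumption | rule Comp_lift)+

lemma Comp_nFin: "Comp rho A ==> Comp rho y ==> Comp rho r ==> Comp rho H ==> Comp rho g ==> Comp rho m ==>
  CompB rho (%e. nFin (A e) (y e) (r e) (H e) (g e) (m e))"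
 unfolding nFin_def by (rule Comp_rules Comp_fl Comp_ed Comp_nbs | assumption | rule Comp_lift)+

lemma Comp_nkey: "Comp rho A ==> Comp rho y ==> Comp rho k ==> Comp rho c ==> Comp rho (%e. nkey (A e) (y e) (k e) (c e))"
 unfolding nkey_def by (rule Comp_rules Comp_ed Comp_ne | assumption)+

lemma Comp_ncov:
 assumes "Comp rho A" "Comp rho y" "Comp rho r" "Comp rho H" "Comp rho J" "Comp rho d" "Comp rho g" "Comp rho k"
  "Comp rho (%e. H e^(4*A e))" "!!e. 0<H e" "PB rho (%e. (H e^(4*A e)+J e+3)^(5*J e+5))"
 shows "CompB rho (%e. ncov (A e) (y e) (r e) (H e) (J e) (d e) (g e) (k e))"
proof -
 define Z where "Z e = H e^(4*A e)" for e
 \<comment> \<open>\<open>CompB_sav\<close> wants its end points below \<open>Z\<close> in every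
   environment. The reductions modulo \<open>Z\<close> achieve this and change nothing under the
   bounded quantifiers.\<close>
 have eq: "ncov (A e) (y e) (r e) (H e) (J e) (d e) (g e) (k e) = (EX m0<Z e. EX m1<Z e. (ALL c<4*A e. dg (H e) m0 c = nkey (A e) (y e) (k e) c) &
   sav (Z e) (nE (A e) (y e) (r e) (H e) (d e) (g e)) (J e) (m0 mod Z e) (m1 mod Z e) & nFin (A e) (y e) (r e) (H e) (g e) m1)" for e
  unfolding ncov_def Z_def by (rule ex_cong1, rule conj_cong[OF refl], rule ex_cong1, rule conj_cong[OF refl]) simp
 have Z: "Comp rho Z" "!!e. 0<Z e" using assms by (simp_all add: Z_def[abs_def])
 have s: "CompB (ext (ext rho)) (%e. sav (Z (fst (fst e))) (nE (A (fst (fst e))) (y (fst (fst e))) (r (fst (fst e))) (H (fst (fst e))) (d (fst (fst e))) (g (fst (fst e)))) (J (fst (fst e)))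
  (snd (fst e) mod Z (fst (fst e))) (snd e mod Z (fst (fst e))))"
  by (rule CompB_sav Comp_rules Comp_nE | rule assms Z | rule Comp_lift | simp add: Z)+
   (use PB_lift[OF PB_lift[OF assms(11)]] in \<open>simp add: Z_def\<close>)
 show ?thesis unfolding eq
  by (rule Comp_rules Comp_nkey Comp_nFin | rule assms Z s | rule Comp_lift)+
qed

lemma Comp_nclosed:
 assumes "Comp rho A" "Comp rho y" "Comp rho r" "Comp rho H" "Comp rho J" "Comp rho d"
  "Comp rho (%e. H e^(4*A e))" "!!e. 0<H e" "PB rho (%e. (H e^(4*A e)+J e+3)^(5*J e+5))"
 shows "CompB rho (%e. nclosed (A e) (y e) (r e) (H e) (J e) (d e))"
 unfolding nclosed_def
 by (rule Comp_rules Comp_fl Comp_nbs Comp_nD Comp_ncov | rule assms | rule Comp_lift PB_lift)+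

section \<open>Numeric recognition of instances\<close>

definition "thr A y j v = (fl A y (7+4*j) v = 1)"

definition "nrpn A y = (ALL t<A. ~ (fl A y 1 t = 1 & fl A y 2 t = 1) & ~ (fl A y 1 t = 1 & fl A y 3 t = 1) & ~ (fl A y 2 t = 1 & fl A y 3 t = 1))"

text \<open>Reachability from \<open>r\<close> as a quantifier over bit sets: every set that
  contains \<open>r\<close> and is closed under edges contains all threads. \<open>B\<close> will be
  \<open>2^A\<close>.\<close>

definition "ntree A B y j r = (thr A y j r & (ALL u<A. ~ ed A y j u r & (ALL v<A. ed A y j u v --> thr A y j u & thr A y j v & (ALL w<A. ed A y j w v --> u = w))) &
  (ALL X<B. dg 2 X r = 1 --> (ALL u<A. ALL v<A. ed A y j u v --> dg 2 X u = 1 --> dg 2 X v = 1) --> (ALL v<A. thr A y j v --> dg 2 X v = 1)))"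

definition "nemp A y j = (ALL u<A. ~ thr A y j u & (ALL v<A. ~ ed A y j u v))"

definition "nlab A y j = (ALL u<A. ALL v<A. ed A y j u v --> (EX t<A. fl A y 2 t = 1 & (ALL p<A. fl A y 0 p = 1 --> fl A y (10+4*j) ((u*A+v)*A+p) = fl A y 5 (t*A+p))))"

definition "nmark A y f I = concat (map (%p. if fl A y 0 p = 1 then True # enc_nat (fl A y f (I*A+p)) else []) [0..<A])@[False]"

definition "nset A y f I e = concat (map (%a. if fl A y f (I*A+a) = 1 then True # enc_nat a@e a else []) [0..<A])@[False]"

definition "nword A y = nset A y 0 0 (%_. [])@nset A y 1 0 (%t. nmark A y 4 t@nmark A y 5 t)@nset A y 2 0 (%t. nmark A y 4 t@nmark A y 5 t@nmark A y 6 t) @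
  nset A y 3 0 (nmark A y 4)@nset A y 7 0 (%v. nmark A y 9 v@nset A y 8 v (%w. nmark A y 10 (v*A+w))) @
  nset A y 11 0 (%v. nmark A y 13 v@nset A y 12 v (%w. nmark A y 14 (v*A+w)))"

lemma Comp_thr: "Comp rho A ==> Comp rho y ==> Comp rho v ==> CompB rho (%e. thr (A e) (y e) j (v e))"
 unfolding thr_def by (rule Comp_rules Comp_fl | assumption)+

lemma Comp_nrpn: "Comp rho A ==> Comp rho y ==> CompB rho (%e. nrpn (A e) (y e))"
 unfolding nrpn_def by (rule Comp_rules Comp_fl | assumption | rule Comp_lift)+

lemma Comp_ntree: "Comp rho A ==> Comp rho B ==> Comp rho y ==> Comp rho r ==> CompB rho (%e. ntree (A e) (B e) (y e) j (r e))"
 unfolding ntree_def by (rule Comp_rules Comp_ed Comp_thr | assumption | rule Comp_lift)+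

lemma Comp_nemp: "Comp rho A ==> Comp rho y ==> CompB rho (%e. nemp (A e) (y e) j)"
 unfolding nemp_def by (rule Comp_rules Comp_ed Comp_thr | assumption | rule Comp_lift)+

lemma Comp_nlab: "Comp rho A ==> Comp rho y ==> CompB rho (%e. nlab (A e) (y e) j)"
 unfolding nlab_def by (rule Comp_rules Comp_ed Comp_fl | assumption | rule Comp_lift)+

lemma CW_nmark: "Comp rho A ==> Comp rho y ==> Comp rho i ==> CW rho (%e. nmark (A e) (y e) f (i e))"
 unfolding nmark_def by (rule CW_rules Comp_rules Comp_fl | assumption | rule Comp_lift)+

lemma CW_nset: "Comp rho A ==> Comp rho y ==> Comp rho i ==> CW (ext rho) (%e. w (fst e) (snd e)) ==> CW rho (%e. nset (A e) (y e) f (i e) (w e))"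
 unfolding nset_def by (rule CW_rules Comp_rules Comp_fl | assumption | rule Comp_lift)+

lemma CW_nword: "Comp rho A ==> Comp rho y ==> CW rho (%e. nword (A e) (y e))"
 unfolding nword_def by (rule CW_append CW_nset CW_nmark CW_Nil Comp_rules | assumption | rule Comp_lift)+

lemma enc_list_length: "length xs<length (enc_list e xs)" "a : set xs ==> length (e a)<length (enc_list e xs)"
proof -
 show "length xs<length (enc_list e xs)" unfolding enc_list_def by (induct xs) auto
 show "a : set xs ==> length (e a)<length (enc_list e xs)" unfolding enc_list_def by (induct xs) auto
qed

lemma less_enc_nat: "n<2^length (enc_nat n)"
proof -
 have "n<2^length (bits n)"
 proof (induct n rule: less_induct)
  case (less n)
  show ?case
  proof (cases "n = 0")
   case False
   hence "n div 2<2^length (bits (n div 2))" using less[of "n div 2"] by simp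
   hence "n<2*2^length (bits (n div 2))" by linarith
   thus ?thesis using False by (simp add: bits_rec[of n])
  qed simp
 qed
 also have "... <= 2^length (enc_nat n)" using enc_list_length(1)[of "bits n" "%b. [b]"] by (intro power_increasing) (auto simp: enc_nat_def)
 finally show ?thesis .
qed

lemma enc_set_length: "finite S ==> card S<length (enc_set e S)" "finite S ==> a : S ==> length (enc_nat a@e a)<length (enc_set e S)"
 unfolding enc_set_def using enc_list_length(1)[of "sorted_list_of_set S"] enc_list_length(2)[of a "sorted_list_of_set S" "%a. enc_nat a@e a"] by auto

lemma enc_marking_length: "finite (places N) ==> p : places N ==> length (enc_nat (m p))<length (enc_marking N m)"
 unfolding enc_marking_def using enc_list_length(2)[of p "sorted_list_of_set (places N)" "%p. enc_nat (m p)"] by auto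

lemma nmark: assumes "nrep A y N" "ALL p:places N. fl A y f (I*A+p) = m p" shows "nmark A y f I = enc_marking N m"
proof -
 have "places N<={..<A}" "ALL p<A. (fl A y 0 p = 1) = (p : places N)" using assms(1) by (auto simp: nrep_def)
 thus ?thesis using assms(2) unfolding nmark_def enc_marking_eq[OF \<open>places N \<subseteq> {..<A}\<close>] by (auto intro!: arg_cong[where f = concat])
qed

lemma nset: assumes "S<={..<A}" "!!a. a<A ==> (fl A y f (I*A+a) = 1) = (a : S)" "!!a. a : S ==> e a = e' a" shows "nset A y f I e = enc_set e' S"
 using assms(2,3) unfolding nset_def enc_set_eq[OF assms(1)] by (auto intro!: arg_cong[where f = concat])

lemma nword: assumes N: "nrep A y N" and s: "srep A y 0 N s" "srep A y 1 N sf" shows "nword A y = enc_instance N s sf"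
proof -
 have st: "nset A y (7+4*j) 0 (%v. nmark A y (9+4*j) v@nset A y (8+4*j) v (%w. nmark A y (10+4*j) (v*A+w))) = enc_state N s"
  if "srep A y j N s" for j s
  unfolding enc_state_def using that unfolding srep_def ed_def
  by (intro nset arg_cong2[where f = append] nmark[OF N]) auto
 note p = N[unfolded nrep_def]
 have "nset A y 0 0 (%_. []) = enc_set (%_. []) (places N)" by (rule nset) (use p in auto)
 moreover have "nset A y 1 0 (%t. nmark A y 4 t@nmark A y 5 t) = enc_set (%t. enc_marking N (Wminus N t)@enc_marking N (Wplus N t)) (elementary N)"
  by (intro nset arg_cong2[where f = append] nmark[OF N]) (use p in auto)
 moreover have "nset A y 2 0 (%t. nmark A y 4 t@nmark A y 5 t@nmark A y 6 t) =
  enc_set (%t. enc_marking N (Wminus N t)@enc_marking N (Wplus N t)@enc_marking N (Omega N t)) (abstract N)"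
  by (intro nset arg_cong2[where f = append] nmark[OF N]) (use p in auto)
 moreover have "nset A y 3 0 (nmark A y 4) = enc_set (%t. enc_marking N (Wminus N t)) (cut N)"
  by (intro nset nmark[OF N]) (use p in auto)
 ultimately show ?thesis unfolding nword_def enc_instance_def enc_rpn_def using st[OF s(1)] st[OF s(2)] by simp
qed

lemma nrpn: assumes "nrep A y N" shows "nrpn A y = is_rpn N"
proof -
 have s: "places N<={..<A}" "elementary N<={..<A}" "abstract N<={..<A}" "cut N<={..<A}"
  and e: "!!t. t<A ==> (fl A y 1 t = 1) = (t : elementary N) & (fl A y 2 t = 1) = (t : abstract N) & (fl A y 3 t = 1) = (t : cut N)"
  using assms unfolding nrep_def by blast+
 have "finite (places N)" "finite (elementary N)" "finite (abstract N)" "finite (cut N)" using s finite_subset by blast+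
 moreover have "nrpn A y = (ALL t<A. ~ (t : elementary N & t : abstract N) & ~ (t : elementary N & t : cut N) & ~ (t : abstract N & t : cut N))"
  unfolding nrpn_def using e by (intro all_cong) simp
 ultimately show ?thesis unfolding is_rpn_def using s by blast
qed

lemma thr: "srep A y j N s ==> v<A ==> thr A y j v = (v : threads s)" "srep A y j N s ==> u<A ==> v<A ==> ed A y j u v = ((u, v) : edges s)"
 by (auto simp: srep_def thr_def)

lemma nemp: "srep A y j N s ==> nemp A y j = is_empty_tree s"
 unfolding nemp_def is_empty_tree_def using thr[of A y j N s] unfolding srep_def by auto

lemma ntree: assumes s: "srep A y j N s" and r: "r<A" shows "ntree A (2^A) y j r = tree s r"
proof -
 have b: "threads s<={..<A}" "edges s<={..<A} \<times> {..<A}" using s by (auto simp: srep_def)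
 have "(ALL v:threads s. (r, v) : (edges s)^*) =
  (ALL X<2^A. dg 2 X r = 1 --> (ALL u<A. ALL v<A. ed A y j u v --> dg 2 X u = 1 --> dg 2 X v = 1) --> (ALL v<A. thr A y j v --> dg 2 X v = 1))" (is "?l = ?r")
 proof
  assume l: ?l
  show ?r
  proof (intro allI impI)
   fix X v assume X: "dg 2 X r = 1" "ALL u<A. ALL v<A. ed A y j u v --> dg 2 X u = 1 --> dg 2 X v = 1" "v<A" "thr A y j v"
   hence "(r, v) : (edges s)^*" using l thr(1)[OF s] by blast
   thus "dg 2 X v = 1" by (induct rule: rtrancl_induct) (use X thr(2)[OF s] b in auto)
  qed
 next
  assume ?r
  define X where "X = nv 2 A (%v. of_bool ((r, v) : (edges s)^*))"
  have X: "X<2^A" "v<A ==> (dg 2 X v = 1) = ((r, v) : (edges s)^*)" for v using nv[of A "%v. of_bool ((r, v) : (edges s)^*)" 2] by (auto simp: X_def)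
  have "dg 2 X v = 1" if "ed A y j u v" "dg 2 X u = 1" "u<A" "v<A" for u v
   using that X(2) thr(2)[OF s] by (auto intro: rtrancl_into_rtrancl)
  moreover have "dg 2 X r = 1" using X(2)[OF r] by simp
  ultimately have "dg 2 X v = 1" if "v<A" "thr A y j v" for v using \<open>?r\<close> X(1) that by blast
  thus ?l using X(2) b(1) thr(1)[OF s] by auto
 qed
 moreover have "finite (threads s)" using b(1) finite_subset by blast
 moreover have "(thr A y j r & (ALL u<A. ~ ed A y j u r & (ALL v<A. ed A y j u v --> thr A y j u & thr A y j v & (ALL w<A. ed A y j w v --> u = w)))) =
  (r : threads s & (ALL u. (u, r) ~: edges s) & edges s<=threads s \<times> threads s & (ALL u u' v. (u, v) : edges s --> (u', v) : edges s --> u = u'))" (is "?l = ?r")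
 proof
  assume l: ?l
  have bd: "u<A & v<A" if "(u, v) : edges s" for u v using b(2) that by auto
  have l': "r : threads s" "ALL u<A. (u, r) ~: edges s & (ALL v<A. (u, v) : edges s --> u : threads s & v : threads s & (ALL w<A. (w, v) : edges s --> u = w))"
   using l r by (auto simp: thr[OF s])
  show ?r
  proof (intro conjI l'(1))
   show "ALL u. (u, r) ~: edges s" using l'(2) bd by blast
   show "edges s<=threads s \<times> threads s" using l'(2) bd by (intro subrelI) blast
   show "ALL u u' v. (u, v) : edges s --> (u', v) : edges s --> u = u'" using l'(2) bd by blast
  qed
 qed (use r thr[OF s] in auto)
 ultimately show ?thesis unfolding ntree_def tree_def by blast
qed

lemma nlab: assumes N: "nrep A y N" and s: "srep A y j N s"
 shows "nlab A y j = (ALL e:edges s. EX t:abstract N. ALL p:places N. label s e p = Wplus N t p)"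
proof -
 have b: "places N<={..<A}" "abstract N<={..<A}" "edges s<={..<A} \<times> {..<A}" using N s unfolding nrep_def srep_def by blast+
 have f: "fl A y 0 p = 1 \<longleftrightarrow> p : places N" "fl A y 2 p = 1 \<longleftrightarrow> p : abstract N" if "p<A" for p using N that unfolding nrep_def by blast+
 have w: "fl A y 5 (t*A+p) = Wplus N t p" if "t : abstract N" "p : places N" for t p using N that unfolding nrep_def by blast
 have l: "fl A y (10+4*j) ((u*A+v)*A+p) = label s (u, v) p" if "(u, v) : edges s" "p : places N" for u v p using s that unfolding srep_def by blast
 have e: "(EX t<A. fl A y 2 t = 1 & (ALL p<A. fl A y 0 p = 1 --> fl A y (10+4*j) ((u*A+v)*A+p) = fl A y 5 (t*A+p))) =
  (EX t:abstract N. ALL p:places N. label s (u, v) p = Wplus N t p)" if "(u, v) : edges s" for u v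
 proof -
  have "(ALL p<A. fl A y 0 p = 1 --> fl A y (10+4*j) ((u*A+v)*A+p) = fl A y 5 (t*A+p)) = (ALL p:places N. label s (u, v) p = Wplus N t p)"
   if "t : abstract N" for t using f(1) w[OF that] l[OF \<open>(u, v) : edges s\<close>] b(1) by auto
  thus ?thesis using f(2) b(2) by blast
 qed
 have "nlab A y j = (ALL u<A. ALL v<A. (u, v) : edges s --> (EX t:abstract N. ALL p:places N. label s (u, v) p = Wplus N t p))"
  unfolding nlab_def using thr(2)[OF s] e by (intro all_cong) auto
 thus ?thesis using b(3) by auto
qed

definition "nst A B y j = (nemp A y j \<or> (EX r<A. ntree A B y j r) & nlab A y j)"

lemma nst: assumes "nrep A y N" "srep A y j N s" shows "nst A (2^A) y j = is_state N s"
proof -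
 have "r<A" if "tree s r" for r using that assms(2) unfolding tree_def srep_def by blast
 hence "(EX r<A. ntree A (2^A) y j r) = rooted_tree s" unfolding rooted_tree_iff using ntree[OF assms(2)] by blast
 thus ?thesis unfolding nst_def is_state_def nemp[OF assms(2)] nlab[OF assms] by simp
qed

text \<open>Fifteen tables of \<open>A^3\<close> entries; edge labels need all three indices. The
  reduction modulo \<open>A\<close> keeps entries without meaning within the range of a
  digit.\<close>

definition tab :: "nat => (nat, nat) rpn => nat state => nat state => nat => nat => nat" where
 "tab A N s sf f i = (let a = i div A; b = i mod A; S = (if f<11 then s else sf); g = (if f<11 then f else f-4) in
  (if f = 0 then of_bool (i : places N) else if f = 1 then of_bool (i : elementary N) else if f = 2 then of_bool (i : abstract N) else
   if f = 3 then of_bool (i : cut N) else if f = 4 then Wminus N a b else if f = 5 then Wplus N a b else if f = 6 then Omega N a b else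
   if g = 7 then of_bool (i : threads S) else if g = 8 then of_bool ((a, b) : edges S) else if g = 9 then marking_of S a b
   else label S (a div A, a mod A) b) mod A)"

lemma tab_simps:
 "tab A N s sf 0 i = of_bool (i : places N) mod A" "tab A N s sf 1 i = of_bool (i : elementary N) mod A" "tab A N s sf 2 i = of_bool (i : abstract N) mod A"
 "tab A N s sf 3 i = of_bool (i : cut N) mod A" "tab A N s sf 4 i = Wminus N (i div A) (i mod A) mod A" "tab A N s sf 5 i = Wplus N (i div A) (i mod A) mod A"
 "tab A N s sf 6 i = Omega N (i div A) (i mod A) mod A"
 "tab A N s sf 7 i = of_bool (i : threads s) mod A" "tab A N s sf 8 i = of_bool ((i div A, i mod A) : edges s) mod A"
 "tab A N s sf 9 i = marking_of s (i div A) (i mod A) mod A" "tab A N s sf 10 i = label s (i div A div A, i div A mod A) (i mod A) mod A"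
 "tab A N s sf 11 i = of_bool (i : threads sf) mod A" "tab A N s sf 12 i = of_bool ((i div A, i mod A) : edges sf) mod A"
 "tab A N s sf 13 i = marking_of sf (i div A) (i mod A) mod A" "tab A N s sf 14 i = label sf (i div A div A, i div A mod A) (i mod A) mod A"
 by (simp_all add: tab_def Let_def)

lemma rep_exists:
 assumes A: "2<=A" and N: "places N<={..<A}" "elementary N<={..<A}" "abstract N<={..<A}" "cut N<={..<A}"
  and W: "!!t p. p : places N ==> t : elementary N Un abstract N Un cut N ==> Wminus N t p<A" "!!t p. p : places N ==> t : elementary N Un abstract N ==> Wplus N t p<A"
   "!!t p. p : places N ==> t : abstract N ==> Omega N t p<A"
  and s: "!!s. s : {s0, sf} ==> threads s<={..<A} & edges s<={..<A} \<times> {..<A}"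
   "!!s v p. s : {s0, sf} ==> v : threads s ==> p : places N ==> marking_of s v p<A" "!!s u v p. s : {s0, sf} ==> (u, v) : edges s ==> p : places N ==> label s (u, v) p<A"
 shows "EX y<A^(15*A^3). nrep A y N & srep A y 0 N s0 & srep A y 1 N sf"
proof -
 let ?T = "%q. tab A N s0 sf (q div A^3) (q mod A^3)"
 define y where "y = nv A (15*A^3) ?T"
 have nv: "y<A^(15*A^3)" "!!q. q<15*A^3 ==> dg A y q = ?T q"
 proof -
  have "?T q<A" for q unfolding tab_def Let_def using A by (intro mod_less_divisor) simp
  thus "y<A^(15*A^3)" "!!q. q<15*A^3 ==> dg A y q = ?T q" using nv[of "15*A^3" ?T A] unfolding y_def by blast+
 qed
 have fl: "fl A y f i = tab A N s0 sf f i" if "f<15" "i<A^3" for f i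
 proof -
  have "f*A^3+i<Suc f*A^3" using that by simp
  also have "... <= 15*A^3" using that by (intro mult_le_mono1) simp
  finally show ?thesis using nv(2)[of "f*A^3+i"] that A unfolding fl_def by (simp add: mult.commute[of f])
 qed
 have i2: "t*A+p<A*A" if "t<A" "p<A" for t p
 proof -
  have "Suc t*A<=A*A" using that by (intro mult_le_mono1) simp
  thus ?thesis using that by simp
 qed
 have i3: "p<A^3" "t*A+p<A^3" "(u*A+t)*A+p<A^3" if "p<A" "t<A" "u<A" for u t p
 proof -
  have "A<=A^3" "A*A<=A^3" using A by (simp_all add: power3_eq_cube)
  thus "p<A^3" "t*A+p<A^3" using that i2[of t p] by linarith+
  have "Suc (u*A+t)*A<=A*A*A" by (rule mult_le_mono1) (use i2[of u t] that in simp)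
  thus "(u*A+t)*A+p<A^3" using that by (simp add: power3_eq_cube)
 qed
 have ob: "of_bool b mod A = of_bool b" for b using A by (cases b) simp_all
 have dm: "(v*A+p) div A = v" "(v*A+p) mod A = p" if "p<A" for v p using that A by simp_all
 have st: "srep A y j N (if j = 0 then s0 else sf)" if "j<2" for j
 proof -
  define S where "S = (if j = 0 then s0 else sf)"
  have S: "S : {s0, sf}" by (simp add: S_def)
  have j: "j = 0 & S = s0 \<or> j = 1 & S = sf" using that by (auto simp: S_def)
  have b: "v : threads S ==> v<A" "(u, v) : edges S ==> u<A & v<A" "p : places N ==> p<A" for u v p using s(1)[OF S] N(1) by auto
  have t: "i<A^3 ==> fl A y (7+4*j) i = of_bool (i : threads S)" "i<A^3 ==> fl A y (8+4*j) i = of_bool ((i div A, i mod A) : edges S)"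
   "i<A^3 ==> fl A y (9+4*j) i = marking_of S (i div A) (i mod A) mod A" "i<A^3 ==> fl A y (10+4*j) i = label S (i div A div A, i div A mod A) (i mod A) mod A" for i
   using j fl[of "7+4*j" i] fl[of "8+4*j" i] fl[of "9+4*j" i] fl[of "10+4*j" i] by (elim disjE; simp add: tab_simps ob)+
  show ?thesis unfolding S_def[symmetric] srep_def ed_def using s(1)[OF S]
  proof (intro conjI allI impI ballI; clarify?)
   fix v assume "v<A" thus "(fl A y (7+4*j) v = 1) = (v : threads S)" using t(1) i3(1) by simp
  next
   fix u v assume "u<A" "v<A" thus "(fl A y (8+4*j) (u*A+v) = 1) = ((u, v) : edges S)" using t(2)[of "u*A+v"] i3(2) by (simp add: dm)
  next
   fix v p assume "v : threads S" "p : places N" thus "fl A y (9+4*j) (v*A+p) = marking_of S v p"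
    using t(3)[of "v*A+p"] i3(2)[of p v v] b s(2)[OF S] by (simp add: dm)
  next
   fix u v p assume "(u, v) : edges S" "p : places N" thus "fl A y (10+4*j) ((u*A+v)*A+p) = label S (u, v) p"
    using t(4)[of "(u*A+v)*A+p"] i3(3)[of p v u] b(2)[of u v] b(3)[of p] s(3)[OF S] by (simp add: dm)
  qed auto
 qed
 have "nrep A y N" unfolding nrep_def
 proof (intro conjI N allI impI ballI)
  fix p assume p: "p<A"
  thus "(fl A y 0 p = 1) = (p : places N)" "(fl A y 1 p = 1) = (p : elementary N)" "(fl A y 2 p = 1) = (p : abstract N)" "(fl A y 3 p = 1) = (p : cut N)"
   using fl[of 0 p] fl[of 1 p] fl[of 2 p] fl[of 3 p] i3(1)[OF p p p] unfolding tab_simps ob by simp_all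
 next
  fix p t assume p: "p : places N" "t : elementary N Un abstract N Un cut N"
  hence "p<A" "t<A" using N by auto
  thus "fl A y 4 (t*A+p) = Wminus N t p" using fl[of 4 "t*A+p"] i3(2)[of p t t] W(1)[OF p] by (simp add: tab_simps dm)
 next
  fix p t assume p: "p : places N" "t : elementary N Un abstract N"
  hence "p<A" "t<A" using N by auto
  thus "fl A y 5 (t*A+p) = Wplus N t p" using fl[of 5 "t*A+p"] i3(2)[of p t t] W(2)[OF p] by (simp add: tab_simps dm)
 next
  fix p t assume p: "p : places N" "t : abstract N"
  hence "p<A" "t<A" using N by auto
  thus "fl A y 6 (t*A+p) = Omega N t p" using fl[of 6 "t*A+p"] i3(2)[of p t t] W(3)[OF p] by (simp add: tab_simps dm)
 qed
 thus ?thesis using nv(1) st[of 0] st[of 1] by auto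
qed

definition "nN A y = \<lparr>places = {p. p<A & fl A y 0 p = 1}, elementary = {t. t<A & fl A y 1 t = 1}, abstract = {t. t<A & fl A y 2 t = 1},
  cut = {t. t<A & fl A y 3 t = 1}, Wminus = (%t p. fl A y 4 (t*A+p)), Wplus = (%t p. fl A y 5 (t*A+p)), Omega = (%t p. fl A y 6 (t*A+p))\<rparr>"

definition "nS A y j = \<lparr>threads = {v. v<A & thr A y j v}, edges = {(u, v). u<A & v<A & ed A y j u v},
  marking_of = (%v p. fl A y (9+4*j) (v*A+p)), label = (%(u, v) p. fl A y (10+4*j) ((u*A+v)*A+p))\<rparr>"

lemma nN: "nrep A y (nN A y)"
 unfolding nrep_def nN_def by auto

lemma nS: "srep A y j N (nS A y j)"
 unfolding srep_def nS_def thr_def by auto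

lemma enc_nat_less: "length (enc_nat v)<=n ==> v<2^(n+1)"
 using less_le_trans[OF less_enc_nat[of v] power_increasing[of "length (enc_nat v)" "n+1" "2 :: nat"]] by simp

text \<open>A name or number inside a word of length \<open>n\<close> has at most \<open>n\<close>
  binary digits, so \<open>A = 2^(n+1)\<close> exceeds all of them.\<close>

lemma enc_bounds:
 assumes x: "length (enc_instance N s0 sf)<=n" and N: "is_rpn N" and s: "is_state N s0" "is_state N sf" and A: "A = 2^(n+1)"
 shows "EX y<A^(15*A^3). nrep A y N & srep A y 0 N s0 & srep A y 1 N sf"
proof (rule rep_exists)
 show "2<=A" by (simp add: A)
 have fin: "finite (places N)" "finite (elementary N)" "finite (abstract N)" "finite (cut N)" using N by (auto simp: is_rpn_def)
 have small: "length (enc_nat v)<=n ==> v<A" for v unfolding A by (rule enc_nat_less)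
 note S = enc_set_length(2)
 let ?W = "%t. enc_marking N (Wminus N t)" and ?V = "%t. enc_marking N (Wplus N t)" and ?O = "%t. enc_marking N (Omega N t)"
 have l: "length (enc_set (%_. []) (places N))<=n" "length (enc_set (%t. ?W t@?V t) (elementary N))<=n" "length (enc_set (%t. ?W t@?V t@?O t) (abstract N))<=n"
  "length (enc_set ?W (cut N))<=n" "length (enc_state N s0)<=n" "length (enc_state N sf)<=n"
  using x unfolding enc_instance_def enc_rpn_def by auto
 show "places N<={..<A}" using S[OF fin(1), of _ "%_. []"] l(1) by (fastforce intro: small)
 have el: "t<A & (p : places N --> Wminus N t p<A & Wplus N t p<A)" if t: "t : elementary N" for t p
  using S[OF fin(2) t, of "%t. ?W t@?V t"] l(2) enc_marking_length[OF fin(1), of p "Wminus N t"] enc_marking_length[OF fin(1), of p "Wplus N t"]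
  by (auto intro!: small)
 have ab: "t<A & (p : places N --> Wminus N t p<A & Wplus N t p<A & Omega N t p<A)" if t: "t : abstract N" for t p
  using S[OF fin(3) t, of "%t. ?W t@?V t@?O t"] l(3) enc_marking_length[OF fin(1), of p "Wminus N t"] enc_marking_length[OF fin(1), of p "Wplus N t"]
   enc_marking_length[OF fin(1), of p "Omega N t"] by (auto intro!: small)
 have cut: "t<A & (p : places N --> Wminus N t p<A)" if t: "t : cut N" for t p
  using S[OF fin(4) t, of ?W] l(4) enc_marking_length[OF fin(1), of p "Wminus N t"] by (auto intro!: small)
 show "elementary N<={..<A}" "abstract N<={..<A}" "cut N<={..<A}" using el ab cut by auto
 show "!!t p. p : places N ==> t : elementary N Un abstract N Un cut N ==> Wminus N t p<A" "!!t p. p : places N ==> t : elementary N Un abstract N ==> Wplus N t p<A"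
  "!!t p. p : places N ==> t : abstract N ==> Omega N t p<A" using el ab cut by auto
 fix s assume "s : {s0, sf}"
 hence st: "is_state N s" "length (enc_state N s)<=n" using s l by auto
 have fs: "finite (threads s)" "edges s<=threads s \<times> threads s" using st(1) by (auto simp: is_state_def is_empty_tree_def rooted_tree_def)
 have fe: "finite {w. (v, w) : edges s}" for v by (rule finite_subset[OF _ fs(1)]) (use fs(2) in auto)
 let ?e = "%v. enc_set (%w. enc_marking N (label s (v, w))) {w. (v, w) : edges s}"
 have th: "v<A & length (enc_marking N (marking_of s v))<=n & length (?e v)<=n" if "v : threads s" for v
  using S[OF fs(1) that, of "%v. enc_marking N (marking_of s v)@?e v"] st(2) unfolding enc_state_def by (auto intro!: small)
 show "threads s<={..<A} & edges s<={..<A} \<times> {..<A}" using th fs(2) by blast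
 show "marking_of s v p<A" if "v : threads s" "p : places N" for v p
  using th[OF that(1)] enc_marking_length[OF fin(1) that(2), of "marking_of s v"] by (auto intro!: small)
 show "label s (u, v) p<A" if "(u, v) : edges s" "p : places N" for u v p
 proof -
  have "u : threads s" using that(1) fs(2) by auto
  thus ?thesis using th[of u] S[OF fe, of v u "%w. enc_marking N (label s (u, w))"] that(1) enc_marking_length[OF fin(1) that(2), of "label s (u, v)"]
   by (auto intro!: small)
 qed
qed

lemma enc_cards:
 assumes N: "is_rpn N" and s: "is_state N s0" "is_state N sf"
 shows "card (places N)+card (threads s0)+card (threads sf)+1<=length (enc_instance N s0 sf)"
proof -
 have "finite (places N)" "finite (threads s0)" "finite (threads sf)" using N s by (auto simp: is_rpn_def is_state_def is_empty_tree_def rooted_tree_def)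
 thus ?thesis
  using enc_set_length(1)[of "places N" "%_. []"] enc_set_length(1)[of "threads s0" "%v. enc_marking N (marking_of s0 v)@enc_set (%w. enc_marking N (label s0 (v, w))) {w. (v, w) : edges s0}"]
   enc_set_length(1)[of "threads sf" "%v. enc_marking N (marking_of sf v)@enc_set (%w. enc_marking N (label sf (v, w))) {w. (v, w) : edges sf}"]
  unfolding enc_instance_def enc_rpn_def enc_state_def by simp
qed

lemma coverable_empty: "is_empty_tree sf ==> coverable N s0 sf" "is_empty_tree s0 ==> coverable N s0 sf ==> threads sf = {}"
proof -
 show "is_empty_tree sf ==> coverable N s0 sf" unfolding coverable_def state_le_def using firing_Nil by blast
 assume e: "is_empty_tree s0" and "coverable N s0 sf"
 then obtain sg U s where s: "firing_sequence N s0 sg U s" "state_le N sf s" by (auto simp: coverable_def)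
 from s(1) have "s = s0" by (induct rule: firing_sequence.induct) (use e in \<open>auto simp: is_empty_tree_def enabled_def elim!: fires.cases\<close>)
 thus "threads sf = {}" using s(2) e by (auto simp: state_le_def is_empty_tree_def)
qed

text \<open>The number of counters, hence the exponent in Rackoff's bound, is bounded by the length \<open>n\<close> of the
 input and not by the exponential bound \<open>A\<close> on the names.\<close>

definition pJ :: "nat => nat" where
 "pJ n = (4*n+8)^(n+3)"

lemma pJ: "2^(n+1)*ell (2^(n+1)) n+2^(n+1)<2^pJ n" "ell (2^(n+1)) n<=2^pJ n"
proof -
 define X where "X = (4*n+8)^Suc n"
 have X: "1<=X" by (simp add: X_def)
 have "ell (2^(n+1)) n+1<=(2^(n+1)+3)^X" using ell_bound[of n n "2^(n+1)"] by (simp add: X_def)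
 also have "... <= (2^(n+3))^X"
 proof (rule power_mono)
  have "(1::nat)<=2^n" by simp
  thus "(2::nat)^(n+1)+3<=2^(n+3)" by (simp add: power_add)
 qed simp
 also have "... = 2^((n+3)*X)" by (rule power_mult[symmetric])
 finally have l: "ell (2^(n+1)) n+1<=2^((n+3)*X)" .
 have "(2::nat)^(n+1)*(ell (2^(n+1)) n+1)<=2^(n+1)*2^((n+3)*X)" using l by (intro mult_le_mono2)
 also have "... = 2^(n+1+(n+3)*X)" by (simp add: power_add)
 also have "... < 2^pJ n"
 proof (rule power_strict_increasing)
  have "n+1+(n+3)*X<=(n+1)*X+(n+3)*X" using mult_le_mono2[OF X, of "n+1"] by simp
  also have "... = (2*n+4)*X" by (simp add: algebra_simps)
  also have "... < (4*n+8)*(4*n+8)*X" using X by (intro mult_less_mono1) (auto simp: algebra_simps)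
  also have "... = pJ n" by (simp only: pJ_def X_def numeral_3_eq_3 add_Suc_right add_0_right power_Suc mult.assoc)
  finally show "n+1+(n+3)*X<pJ n" .
 qed simp
 finally show a: "2^(n+1)*ell (2^(n+1)) n+2^(n+1)<2^pJ n" by simp
 have "ell (2^(n+1)) n<=2^(n+1)*ell (2^(n+1)) n" by simp
 thus "ell (2^(n+1)) n<=2^pJ n" using a by linarith
qed

text \<open>An empty target is covered trivially; otherwise an empty initial state makes the
  instance negative, so both roots are required to exist.\<close>

definition "npos A B D y H J = (nrpn A y & nst A B y 0 & nst A B y 1 &
  (nemp A y 1 \<or> (EX r<A. EX rf<A. ntree A B y 0 r & ntree A B y 1 rf & (ALL d<D. nclosed A y rf H J d --> nD A d (2*r+1) 1))))"

lemma npos: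
 assumes y: "nrep A y N" "srep A y 0 N s0" "srep A y 1 N sf" and n: "nword A y = x" "n = length x" and A: "A = 2^(n+1)"
 shows "npos A (2^A) (2^(2*A*(A+2))) y (2^pJ n) (pJ n) = (is_rpn N & is_state N s0 & is_state N sf & coverable N s0 sf)"
proof (cases "is_rpn N & is_state N s0 & is_state N sf & ~ is_empty_tree sf")
 case True
 have fl: "fl A y f i<=A" for f i using dg_less[of A y] by (simp add: fl_def A less_imp_le)
 have w: "Wminus N t p<=A" if "t : elementary N Un abstract N Un cut N" "p : places N" for t p
  using y(1) that fl[of 4 "t*A+p"] unfolding nrep_def by metis
 have w': "Wplus N t p<=A" if "t : elementary N Un abstract N" "p : places N" for t p
  using y(1) that fl[of 5 "t*A+p"] unfolding nrep_def by metis
 have w'': "Omega N t p<=A" if "t : abstract N" "p : places N" for t p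
  using y(1) that fl[of 6 "t*A+p"] unfolding nrep_def by metis
 have m: "marking_of s v p<=A" if "srep A y j N s" "v : threads s" "p : places N" for j s v p
 proof -
  have "fl A y (9+4*j) (v*A+p) = marking_of s v p" using that unfolding srep_def by blast
  thus ?thesis using fl[of "9+4*j" "v*A+p"] by simp
 qed
 have l: "label s e p<=A" if "srep A y j N s" "e : edges s" "p : places N" for j s e p
 proof (cases e)
  case (Pair u v)
  hence "fl A y (10+4*j) ((u*A+v)*A+p) = label s (u, v) p" using that unfolding srep_def by blast
  thus ?thesis using fl[of "10+4*j" "(u*A+v)*A+p"] Pair by simp
 qed
 have I: "inst N s0 sf r rf A" if "tree s0 r" "tree sf rf" for r rf
  using that y by unfold_locales (auto simp: nrep_def srep_def)
 have c: "card (places N)+card (threads s0)+card (threads sf)+1<=n" using True enc_cards nword[OF y] n by metis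
 have H: "A*ell A n+A<2^pJ n" "ell A n<=2^pJ n" using pJ by (simp_all only: A)
 have sm: "inst.small N s0 sf A" if "tree s0 r" "tree sf rf" for r rf
  unfolding inst.small_def[OF I[OF that]] using w w' w'' m[OF y(2)] m[OF y(3)] l[OF y(2)] l[OF y(3)] by (simp add: A)
 have R: "rinst N s0 sf r rf A y (2^pJ n) (pJ n) A n" if t: "tree s0 r" "tree sf rf" for r rf
  by (intro rinst.intro rinst_axioms.intro y I[OF t] sm[OF t] c H)
 have "coverable N s0 sf = (EX r<A. EX rf<A. tree s0 r & tree sf rf & (ALL d<2^(2*A*(A+2)). nclosed A y rf (2^pJ n) (pJ n) d --> nD A d (2*r+1) 1))" (is "_ = ?R")
 proof
  assume c: "coverable N s0 sf"
  obtain rf where rf: "tree sf rf" using True by (auto simp: is_state_def rooted_tree_iff)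
  have "~ is_empty_tree s0" using coverable_empty(2)[of s0 N sf] c rf by (auto simp: tree_def)
  then obtain r where r: "tree s0 r" using True by (auto simp: is_state_def rooted_tree_iff)
  have "r<A" "rf<A" using r rf y by (auto simp: tree_def srep_def)
  thus ?R using coverable_Rx[OF r rf c] rinst.Rx_iff_nclosed[OF R[OF r rf]] r rf by blast
 next
  assume ?R
  then obtain r rf where "tree s0 r" "tree sf rf" "Rx N sf rf s0 Sub (om N s0 r)" using rinst.Rx_iff_nclosed[OF R] by blast
  thus "coverable N s0 sf" unfolding Rx_def using R_coverable by blast
 qed
 thus ?thesis unfolding npos_def nrpn[OF y(1)] nst[OF y(1,2)] nst[OF y(1,3)] nemp[OF y(3)]
  using True ntree[OF y(2)] ntree[OF y(3)] by (simp cong: conj_cong)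
next
 case False
 thus ?thesis unfolding npos_def nrpn[OF y(1)] nst[OF y(1,2)] nst[OF y(1,3)] nemp[OF y(3)] using coverable_empty(1)[of sf N s0] by blast
qed

text \<open>Numbers that differ in irrelevant entries may give the same word. This does no harm,
  since \<open>nN\<close> and \<open>nS\<close> decode each of them to a genuine instance.\<close>

lemma problem_iff: "x : coverability_problem = (let n = length x; A = 2^(n+1) in
 EX y<A^(15*A^3). npos A (2^A) (2^(2*A*(A+2))) y (2^pJ n) (pJ n) & nword A y = x)" (is "_ = ?r")
proof
 define n A :: nat where "n = length x" and "A = 2^(n+1)"
 assume "x : coverability_problem"
 then obtain N s0 sf where x: "x = enc_instance N s0 sf" "is_rpn N" "is_state N s0" "is_state N sf" "coverable N s0 sf" by (auto simp: coverability_problem_def)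
 obtain y where y: "y<A^(15*A^3)" "nrep A y N" "srep A y 0 N s0" "srep A y 1 N sf"
  using enc_bounds[of N s0 sf n A] x unfolding n_def A_def by auto
 moreover have "nword A y = x" using nword[OF y(2-)] x(1) by simp
 ultimately show ?r using npos[OF y(2-) _ n_def A_def] x unfolding Let_def n_def A_def by blast
next
 assume ?r
 then obtain y where y: "npos (2^(length x+1)) (2^2^(length x+1)) (2^(2*2^(length x+1)*(2^(length x+1)+2))) y (2^pJ (length x)) (pJ (length x))"
  "nword (2^(length x+1)) y = x" unfolding Let_def by blast
 let ?N = "nN (2^(length x+1)) y" and ?s = "nS (2^(length x+1)) y"
 have "is_rpn ?N & is_state ?N (?s 0) & is_state ?N (?s 1) & coverable ?N (?s 0) (?s 1)" using npos[OF nN nS nS y(2) refl refl] y(1) by simp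
 moreover have "x = enc_instance ?N (?s 0) (?s 1)" using nword[OF nN nS nS] y(2) by metis
 ultimately show "x : coverability_problem" unfolding coverability_problem_def by blast
qed

lemma Comp_npos:
 assumes "Comp rho A" "Comp rho B" "Comp rho D" "Comp rho y" "Comp rho H" "Comp rho J"
  "Comp rho (%e. H e^(4*A e))" "!!e. 0<H e" "PB rho (%e. (H e^(4*A e)+J e+3)^(5*J e+5))"
 shows "CompB rho (%e. npos (A e) (B e) (D e) (y e) (H e) (J e))"
 unfolding npos_def nst_def
 by (rule Comp_rules Comp_nrpn Comp_nemp Comp_nlab Comp_ntree Comp_nclosed Comp_nD | rule assms | rule Comp_lift PB_lift)+

text \<open>Everything but the reachability search stays below \<open>2^(4*A*J)\<close>; the search
  needs \<open>2^(8*A*J*(10*J))\<close>. In both cases the exponent is at most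
  \<open>2^((n+2)^12)\<close>.\<close>

lemma param_bounds: assumes A: "A = 2^(n+1)" and J: "J = pJ n"
 shows "((2^J)^(4*A)+J+3)^(5*J+5)<=2^2^(n+2)^12" "A^(15*A^3)<=2^(4*A*J)" "2^(2*A*(A+2))<=(2::nat)^(4*A*J)"
  "2^A<=(2::nat)^(4*A*J)" "2^J<=(2::nat)^(4*A*J)" "J<=2^(4*A*J)" "A<=2^(4*A*J)" "(2::nat)^(4*A*J)<=2^2^(n+2)^12"
proof -
 define L where "L = n+10"
 have L10: "10<=L" by (simp add: L_def)
 have AJ: "64*A^3<=J"
 proof -
  have "64*A^3 = 2^(3*n+9)" unfolding A by (simp add: power_mult[symmetric] power_add power_mult_distrib mult.commute)
  also have "... = 8^(n+3)" by (simp add: power_mult power_add)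
  also have "... <= J" unfolding J pJ_def by (intro power_mono) auto
  finally show ?thesis .
 qed
 have A2: "2<=A" "n+1<=A" using less_exp[of "n+1"] by (auto simp: A simp del: less_exp)
 have p: "A<=A^3" "A*A<=A^3" using A2 by (simp_all add: power3_eq_cube)
 have "A^(15*A^3) = 2^((n+1)*(15*A^3))" unfolding A by (rule power_mult[symmetric])
 also have "... <= 2^(4*A*J)"
 proof (rule power_increasing)
  have "(n+1)*(15*A^3)<=A*J" using A2 AJ by (intro mult_le_mono) auto
  thus "(n+1)*(15*A^3)<=4*A*J" by simp
 qed simp
 finally show "A^(15*A^3)<=2^(4*A*J)" .
 have J1: "1<=J" "A<=J" "A+2<=J" using AJ p A2 by linarith+
 have "2*A*(A+2)<=4*A*J" using J1 by (intro mult_le_mono) auto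
 thus "2^(2*A*(A+2))<=(2::nat)^(4*A*J)" by (rule power_increasing) simp
 have "A<=4*A*J" "J<=4*A*J" using J1 A2 by simp_all
 thus e: "2^A<=(2::nat)^(4*A*J)" "2^J<=(2::nat)^(4*A*J)" by (auto intro!: power_increasing)
 show "J<=2^(4*A*J)" "A<=2^(4*A*J)" using e less_exp[of J] less_exp[of A] by linarith+
 have Jb: "J<=2^(L*L)"
 proof -
  have "4*n+8<=2^L" unfolding L_def by (induct n) (simp_all add: power_add)
  hence "J<=(2^L)^(n+3)" unfolding J pJ_def by (intro power_mono) auto
  also have "... = 2^(L*(n+3))" by (rule power_mult[symmetric])
  also have "... <= 2^(L*L)" by (intro power_increasing mult_le_mono2) (auto simp: L_def)
  finally show ?thesis .
 qed
 have Ab: "A<=2^L" unfolding A L_def by (intro power_increasing) auto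
 \<comment> \<open>With \<open>L = n+10\<close>, \<open>A <= 2^L\<close> and
   \<open>J <= 2^(L*L)\<close> the product is at most \<open>2^(L^3)\<close>, and
   \<open>L <= (n+2)^4\<close>; this is the origin of the 12.\<close>
 have Q: "8*A*J*(10*J)<=2^(n+2)^12"
 proof -
  have "8*A*J*(10*J)<=2^3*2^L*2^(L*L)*(2^4*2^(L*L))" using Ab Jb by (intro mult_le_mono) auto
  also have "... = 2^(7+L+2*(L*L))"
   by (simp only: power_add[symmetric], rule arg_cong[where f = "power 2"], simp)
  also have "... <= 2^(L*L*L)"
  proof (rule power_increasing)
   have "1*L<=L*L" "10*(L*L)<=L*(L*L)" by (intro mult_le_mono1; simp add: L_def)+
   thus "7+L+2*(L*L)<=L*L*L" unfolding mult.assoc using L10 by linarith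
  qed simp
  also have "... <= 2^(n+2)^12"
  proof (rule power_increasing)
   have "2^3<=(n+2)^3" by (intro power_mono) auto
   hence "(n+2)*2^3<=(n+2)*(n+2)^3" by (intro mult_le_mono2)
   hence "L<=(n+2)^4" by (simp add: L_def eval_nat_numeral)
   hence "L^3<=((n+2)^4)^3" by (intro power_mono) auto
   thus "L*L*L<=(n+2)^12" by (simp add: power_mult[symmetric] power3_eq_cube)
  qed simp
  finally show ?thesis .
 qed
 have E1: "J+3+4*A*J<=8*A*J" using mult_le_mono1[OF A2(1), of J] J1(1) by linarith
 have E2: "5*J+5<=10*J" using J1 by simp
 have q: "4*A*J<=8*A*J*(10*J)" using J1 mult_le_mono[of "4*A*J" "8*A*J" 1 "10*J"] by simp
 show "(2::nat)^(4*A*J)<=2^2^(n+2)^12" by (rule power_increasing[OF order_trans[OF q Q]]) simp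
 have "P+J+3<=P*(J+4)" if "1<=P" for P using mult_le_mono1[OF that, of "J+3"] by (simp add: algebra_simps)
 moreover have "(2^J)^(4*A) = (2::nat)^(4*A*J)" by (simp add: power_mult[symmetric] mult_ac)
 ultimately have "(2^J)^(4*A)+J+3<=(2::nat)^(4*A*J)*(J+4)" by simp
 also have "... <= 2^(4*A*J)*2^(J+3)"
 proof (intro mult_le_mono2)
  show "J+4<=2^(J+3)" by (induct J) (simp_all add: power_add)
 qed
 also have "... <= 2^(8*A*J)" unfolding power_add[symmetric] using E1 by (intro power_increasing) auto
 finally have "((2^J)^(4*A)+J+3)^(5*J+5)<=(2^(8*A*J))^(5*J+5)" by (rule power_mono) simp
 also have "... <= (2^(8*A*J))^(10*J)" using E2 by (intro power_increasing) auto
 also have "... = 2^(8*A*J*(10*J))" by (rule power_mult[symmetric])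
 also have "... <= 2^2^(n+2)^12" using Q by (intro power_increasing) auto
 finally show "((2^J)^(4*A)+J+3)^(5*J+5)<=2^2^(n+2)^12" .
qed

theorem coverability_EXPSPACE: "coverability_problem : EXPSPACE"
proof -
 obtain k0 where k0: "!!n. (n+2)^12<=n^k0+(k0::nat)" using poly_simple[of 12] by blast
 have k: "0<k0" using k0[of 0] by (cases "k0 = 0") (simp_all del: add_2_eq_Suc add_2_eq_Suc')
 let ?A = "%x::bool list. 2^(length x+1) :: nat" and ?J = "%x::bool list. pJ (length x)" and ?rho = "[length, num, Zf k0]"
 have Z: "2^2^(length x+2)^12<=Zf k0 x" for x unfolding Zf_def using k0 by (intro power_increasing) auto
 have le: "PB ?rho g" if "!!x. g x<=2^2^(length x+2)^12" for g
  by (rule PB_le[of _ "Zf k0"]) (auto intro!: PB_var le_trans[OF that Z])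
 note b = param_bounds[OF refl refl]
 have le': "PB ?rho g" if "!!x. g x<=2^(4*?A x*?J x)" for g
  by (rule le) (rule le_trans[OF that b(8)])
 have n: "Comp ?rho length" by (rule Comp_var) simp
 have A: "Comp ?rho ?A" by (rule Comp_power Comp_rules n le')+ (rule b)
 have J: "Comp ?rho ?J" unfolding pJ_def by (rule Comp_power Comp_rules n le')+ (fold pJ_def, rule b(6))
 have H: "Comp ?rho (%x. 2^?J x)" by (rule Comp_power Comp_rules J le')+ (rule b)
 have H4: "Comp ?rho (%x. (2^?J x)^(4*?A x))" by (rule Comp_power Comp_rules H A le')+ (simp add: power_mult[symmetric] mult_ac)
 have B: "Comp ?rho (%x. 2^?A x)" by (rule Comp_power Comp_const A le')+ (rule b)
 have D: "Comp ?rho (%x. 2^(2*?A x*(?A x+2)))" by (rule Comp_power Comp_const Comp_mult Comp_add A le')+ (rule b)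
 have Y: "Comp ?rho (%x. ?A x^(15*?A x^3))" by (rule Comp_power Comp_const Comp_mult Comp_add Comp_power_const A le')+ (rule b)
 have P: "PB ?rho (%x. ((2^?J x)^(4*?A x)+?J x+3)^(5*?J x+5))" by (rule le) (rule b)
 have "CompB (ext ?rho) (%e. npos (?A (fst e)) (2^?A (fst e)) (2^(2*?A (fst e)*(?A (fst e)+2))) (snd e) (2^?J (fst e)) (?J (fst e)))"
  by (rule Comp_npos[OF Comp_lift[OF A] Comp_lift[OF B] Comp_lift[OF D] Comp_snd Comp_lift[OF H] Comp_lift[OF J] Comp_lift[OF H4] _ PB_lift[OF P]]) simp
 moreover have "CompB (ext ?rho) (%e. nword (?A (fst e)) (snd e) = fst e)"
  by (rule CompB_eq_word CW_nword Comp_snd Comp_lift[OF A])+ (rule Comp_lift[OF Comp_var], simp)+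
 ultimately have "CompB ?rho (%x. x : coverability_problem)"
  unfolding problem_iff Let_def by (intro CompB_ex Y CompB_conj)
 thus ?thesis by (rule EXPSPACE_I[OF _ k])
qed

section \<open>Nondeterministic programs\<close>

text \<open>Regular expressions over atomic instructions. Nondeterminism is harmless: only the
  existence of a terminating run matters, and wrong guesses block.\<close>

datatype 'a re = At 'a | Sk | Fl | Sq "'a re" "'a re" | Ch "'a re" "'a re" | Lp "'a re"

fun den :: "('a => ('s * 's) set) => 'a re => ('s * 's) set" where
 "den P (At a) = P a" | "den P Sk = Id" | "den P Fl = {}" | "den P (Sq r r') = den P r O den P r'" | "den P (Ch r r') = den P r Un den P r'"
| "den P (Lp r) = (den P r)^*"

inductive trn :: "'a re list => 'a option => 'a re list => bool" where
 "trn (At a # k) (Some a) k" | "trn (Sk # k) None k" | "trn (Sq r r' # k) None (r # r' # k)" | "trn (Ch r r' # k) None (r # k)" | "trn (Ch r r' # k) None (r' # k)"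
| "trn (Lp r # k) None k" | "trn (Lp r # k) None (r # Lp r # k)"

inductive_cases trnE: "trn (r # k) a k'" and trnE0: "trn [] a k'"

fun osem :: "('a => ('s * 's) set) => 'a option => ('s * 's) set" where
 "osem P None = Id" | "osem P (Some a) = P a"

definition pst :: "('q * 'a option * 'q) set => ('a => ('s * 's) set) => (('q * 's)*('q * 's)) set" where
 "pst D P = {((q, s), (q', s')). EX a. (q, a, q') : D & (s, s') : osem P a}"

abbreviation tsr :: "('a re list * 'a option * 'a re list) set" where
 "tsr == {(k, a, k'). trn k a k'}"

lemma den_run: "(s, s') : den P r ==> ((r # k, s), (k, s')) : (pst tsr P)^*"
proof (induct r arbitrary: s s' k)
 case (At a)
 hence "((At a # k, s), (k, s')) : pst tsr P" by (auto simp: pst_def intro!: exI[of _ "Some a"] trn.intros)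
 thus ?case by blast
next
 case Sk
 hence "((Sk # k, s), (k, s')) : pst tsr P" by (auto simp: pst_def intro!: exI[of _ None] trn.intros)
 thus ?case by blast
next
 case (Sq r r')
 then obtain u where u: "(s, u) : den P r" "(u, s') : den P r'" by auto
 have "((Sq r r' # k, s), (r # r' # k, s)) : pst tsr P" by (auto simp: pst_def intro!: exI[of _ None] trn.intros)
 thus ?case using Sq(1)[OF u(1), of "r' # k"] Sq(2)[OF u(2), of k] by (meson converse_rtrancl_into_rtrancl rtrancl_trans)
next
 case (Ch r r')
 have "((Ch r r' # k, s), (r # k, s)) : pst tsr P" "((Ch r r' # k, s), (r' # k, s)) : pst tsr P"
  by (auto simp: pst_def intro!: exI[of _ None] trn.intros)
 thus ?case using Ch(1)[of s s' k] Ch(2)[of s s' k] Ch(3) by (auto intro: converse_rtrancl_into_rtrancl)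
next
 case (Lp r)
 have 1: "((Lp r # k, s), (k, s)) : pst tsr P" "((Lp r # k, s), (r # Lp r # k, s)) : pst tsr P" for s
  by (auto simp: pst_def intro!: exI[of _ None] trn.intros)
 from Lp(2) have "(s, s') : (den P r)^*" by simp
 thus ?case
 proof (induct rule: converse_rtrancl_induct)
  case base
  thus ?case using 1(1) by blast
 next
  case (step s u)
  thus ?case using 1(2)[of s] Lp(1)[of s u "Lp r # k"] by (meson converse_rtrancl_into_rtrancl rtrancl_trans)
 qed
qed simp

fun kden :: "('a => ('s * 's) set) => 'a re list => ('s * 's) set" where
 "kden P [] = Id" | "kden P (r # k) = den P r O kden P k"

lemma run_kden: "((k, s), ([], s')) : (pst tsr P)^* ==> (s, s') : kden P k"
proof (induct rule: converse_rtrancl_induct2)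
 case (step k s k' u)
 then obtain a where a: "trn k a k'" "(s, u) : osem P a" by (auto simp: pst_def)
 from a(1) show ?case
 proof cases
  case (7 r l)
  hence "(u, s') : den P r O (den P r)^* O kden P l" "u = s" using a(2) step(3) by auto
  moreover have "den P r O (den P r)^* <= (den P r)^*" by auto
  ultimately show ?thesis using 7 by auto
 qed (use a(2) step(3) in auto)
qed simp

fun cs :: "'a re => 'a re list => 'a re list set" where
 "cs (Sq r r') k = {Sq r r' # k} Un cs r (r' # k) Un cs r' k" | "cs (Ch r r') k = {Ch r r' # k} Un cs r k Un cs r' k"
| "cs (Lp r) k = {Lp r # k} Un cs r (Lp r # k)" | "cs r k = {r # k}"

lemma cs_self: "r # k : cs r k"
 by (cases r) auto

lemma cs_finite: "finite (cs r k)"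
 by (induct r arbitrary: k) auto

lemma cs_closed: "l : cs r k ==> trn l a l' ==> l' : insert k (cs r k) & set_option a<=set_re r"
proof (induct r arbitrary: k)
 case (Sq r r')
 from Sq(3) consider "l = Sq r r' # k" | "l : cs r (r' # k)" | "l : cs r' k" by auto
 thus ?case
 proof cases
  case 1
  thus ?thesis using cs_self[of r "r' # k"] Sq(4) by (auto elim!: trnE)
 next
  case 2
  thus ?thesis using cs_self[of r' k] Sq(1)[OF 2 Sq(4)] by auto
 next
  case 3
  thus ?thesis using Sq(2)[OF 3 Sq(4)] by auto
 qed
next
 case (Ch r r')
 from Ch(3) consider "l = Ch r r' # k" | "l : cs r k" | "l : cs r' k" by auto
 thus ?case
 proof cases
  case 1
  thus ?thesis using cs_self[of r k] cs_self[of r' k] Ch(4) by (auto elim!: trnE)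
 next
  case 2
  thus ?thesis using Ch(1)[OF 2 Ch(4)] by auto
 next
  case 3
  thus ?thesis using Ch(2)[OF 3 Ch(4)] by auto
 qed
next
 case (Lp r)
 thus ?case using cs_self[of r "Lp r # k"] by (auto elim!: trnE)
qed (auto elim!: trnE)

text \<open>The automaton depends on the program but not on the interpretation \<open>P\<close> of
  its atoms, so one control serves inputs of every length.\<close>

theorem compile:
 fixes r :: "'a re"
 shows "EX (D :: (nat * 'a option*nat) set) q0 q1. finite D & (ALL P (s :: 's) s'. ((s, s') : den P r) = (((q0, s), (q1, s')) : (pst D P)^*))"
proof -
 define X where "X = insert [] (cs r [])"
 have fin: "finite X" by (simp add: X_def cs_finite)
 then obtain f :: "'a re list => nat" where f: "inj_on f X" using finite_imp_inj_to_nat_seg by metis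
 have X: "l' : X" "set_option a<=set_re r" if "l : X" "trn l a l'" for l a l'
  using that cs_closed[of l r "[]"] by (auto simp: X_def elim: trnE0)
 have r: "[r] : X" "[] : X" by (auto simp: X_def cs_self)
 define D where "D = {(f k, a, f k') | k a k'. k : X & trn k a k'}"
 have "D<=f ` X \<times> insert None (Some ` set_re r) \<times> f ` X" using X by (auto simp: D_def) (metis imageI option.exhaust option.set_intros subsetD)
 moreover have "finite (set_re r)" by (induct r) auto
 hence "finite (f ` X \<times> insert None (Some ` set_re r) \<times> f ` X)" using fin by simp
 ultimately have "finite D" by (rule finite_subset)
 moreover have "((s, s') : den P r) = (((f [r], s), (f [], s')) : (pst D P)^*)" for P and s s' :: 's
 proof
  assume "(s, s') : den P r"
  hence "(([r], s), ([], s')) : (pst tsr P)^*" by (rule den_run)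
  moreover have "(([r], s), (k, u)) : (pst tsr P)^* ==> k : X & ((f [r], s), (f k, u)) : (pst D P)^*" for k u
  proof (induct rule: rtrancl_induct2)
   case (step k u k' u')
   then obtain a where "trn k a k'" "(u, u') : osem P a" by (auto simp: pst_def)
   moreover from this step(3) have "((f k, u), (f k', u')) : pst D P" by (auto simp: pst_def D_def)
   ultimately show ?case using step(3) X(1) by (meson rtrancl_into_rtrancl)
  qed (use r in simp)
  ultimately show "((f [r], s), (f [], s')) : (pst D P)^*" by blast
 next
  have "((f [r], s), (q, u)) : (pst D P)^* ==> EX k:X. q = f k & (([r], s), (k, u)) : (pst tsr P)^*" for q u
  proof (induct rule: rtrancl_induct2)
   case (step q u q' u')
   then obtain k where k: "k : X" "q = f k" "(([r], s), (k, u)) : (pst tsr P)^*" by blast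
   from step(2) obtain l a l' where l: "q = f l" "q' = f l'" "l : X" "trn l a l'" "(u, u') : osem P a" by (auto simp: pst_def D_def)
   have "l = k" using f k(1,2) l(1,3) by (auto dest: inj_onD)
   hence "((k, u), (l', u')) : pst tsr P" using l by (auto simp: pst_def)
   thus ?case using k(3) X(1)[OF l(3,4)] l(2) by (intro bexI[of _ l'] conjI rtrancl_into_rtrancl[OF k(3)])
  qed (use r in blast)
  moreover assume "((f [r], s), (f [], s')) : (pst D P)^*"
  ultimately obtain k where "k : X" "f [] = f k" "(([r], s), (k, s')) : (pst tsr P)^*" by blast
  moreover from this have "k = []" using f r by (auto dest: inj_onD)
  ultimately show "(s, s') : den P r" using run_kden[of "[r]" s s' P] by simp
 qed
 ultimately show ?thesis by blast
qed

datatype atom = Mv nat nat | Up nat | Down nat | Read bool | ReadEnd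

type_synonym cfg = "nat*(nat => nat)"

text \<open>\<open>Up\<close> and \<open>Down\<close> move \<open>E\<close> units at once; they
  stand for complete runs of the generator net, forwards and backwards.\<close>

fun asem :: "nat => bool list => atom => (cfg*cfg) set" where
 "asem E w (Mv c d) = {((i, v), (i', v')). i' = i & 0<v c & v' = (%r. v r-of_bool (r = c)+of_bool (r = d))}"
| "asem E w (Up c) = {((i, v), (i', v')). i' = i & v' = v(c := v c+E)}"
| "asem E w (Down c) = {((i, v), (i', v')). i' = i & E<=v c & v' = v(c := v c-E)}"
| "asem E w (Read b) = {((i, v), (i', v')). i' = Suc i & i<length w & w ! i = b & v' = v}"
| "asem E w ReadEnd = {((i, v), (i', v')). i' = i & i = length w & v' = v}"

text \<open>The value \<open>u c\<close> of a counter is kept in register \<open>2 c + 1\<close>, its complement \<open>E - u c\<close> in register \<open>2 c\<close>.\<close>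

definition rg :: "nat => nat => (nat => nat) => nat => nat" where
 "rg N E u r = (if r<2*N then if odd r then u (r div 2) else E-u (r div 2) else 0)"

definition dec_c :: "nat => atom re" where "dec_c c = At (Mv (2*c+1) (2*c))"
definition inc_c :: "nat => atom re" where "inc_c c = At (Mv (2*c) (2*c+1))"
definition zero_c :: "nat => atom re" where "zero_c c = Sq (At (Down (2*c))) (At (Up (2*c)))"

fun pw :: "'a re => nat => 'a re" where
 "pw r 0 = Sk" | "pw r (Suc k) = Sq r (pw r k)"

text \<open>\<open>xfer c d p q\<close> adds \<open>q / p\<close> times counter \<open>c\<close> to \<open>d\<close> and clears \<open>c\<close>. A stack is a number in base \<open>B\<close>, with the top
 as its lowest digit; \<open>x\<close> is an auxiliary counter.\<close>

definition xfer :: "nat => nat => nat => nat => atom re" where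
 "xfer c d p q = Sq (Lp (Sq (pw (dec_c c) p) (pw (inc_c d) q))) (zero_c c)"

definition pop :: "nat => nat => nat => nat => atom re" where
 "pop x B c a = Sq (pw (dec_c c) a) (Sq (xfer c x B 1) (xfer x c 1 1))"

definition push :: "nat => nat => nat => nat => atom re" where
 "push x B c a = Sq (xfer c x 1 1) (Sq (xfer x c 1 B) (pw (inc_c c) a))"

locale counters =
 fixes N E :: nat and w :: "bool list"
begin

text \<open>The set of results treats success, blocking and guessing alike; most programs below turn
  out to have at most one result.\<close>

definition out :: "atom re => cfg => cfg set" where
 "out r s = den (asem E w) r `` {s}"

abbreviation st :: "nat => (nat => nat) => cfg" where
 "st i u == (i, rg N E u)"

definition bnd :: "(nat => nat) => bool" where
 "bnd u = (ALL c. u c<=E)"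

lemma out_Sq: "out a s = (if P then {s'} else {}) ==> out (Sq a b) s = (if P then out b s' else {})"
 unfolding out_def by (simp add: relcomp_Image)

lemma out_Sq1: "out a s = {s'} ==> out (Sq a b) s = out b s'"
 unfolding out_def by (simp add: relcomp_Image)

lemma out_Sk: "out Sk s = {s}"
 by (auto simp: out_def)

lemma rg_upd: "c<N ==> rg N E (u(c := a)) = (rg N E u)(2*c+1 := a, 2*c := E-a)"
 by (auto simp: rg_def fun_eq_iff elim!: oddE evenE)

lemma rg_c: "c<N ==> rg N E u (2*c) = E-u c" "c<N ==> rg N E u (Suc (2*c)) = u c"
 by (auto simp: rg_def)

lemma out_dec: assumes "c<N" "bnd u" shows "out (dec_c c) (st i u) = (if 0<u c then {st i (u(c := u c-1))} else {})"
proof -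
 have "(%r. rg N E u r-of_bool (r = 2*c+1)+of_bool (r = 2*c)) = rg N E (u(c := u c-1))" if "0<u c"
  using that assms by (auto simp: rg_upd fun_eq_iff rg_c bnd_def Suc_diff_le)
 thus ?thesis using rg_c[OF assms(1)] by (auto simp: out_def dec_c_def)
qed

lemma out_inc: assumes "c<N" "bnd u" shows "out (inc_c c) (st i u) = (if u c<E then {st i (u(c := u c+1))} else {})"
proof -
 have "(%r. rg N E u r-of_bool (r = 2*c)+of_bool (r = 2*c+1)) = rg N E (u(c := u c+1))"
  using assms by (auto simp: rg_upd fun_eq_iff rg_c bnd_def)
 thus ?thesis using rg_c[OF assms(1)] by (auto simp: out_def inc_c_def)
qed

lemma out_zero: assumes "c<N" "bnd u" "0<E" shows "out (zero_c c) (st i u) = (if u c = 0 then {st i u} else {})"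
proof -
 have "u c<=E" using assms by (auto simp: bnd_def)
 hence "(E<=E-u c) = (u c = 0)" using assms(3) by auto
 moreover have "E<=v a ==> v(a := v a-E, a := (v(a := v a-E)) a+E) = v" for v and a :: nat by auto
 ultimately show ?thesis using rg_c(1)[OF assms(1), of u] by (auto simp: out_def zero_c_def relcomp_Image)
qed

lemma bnd_upd: "bnd u ==> a<=E ==> bnd (u(c := a))"
 by (auto simp: bnd_def)

lemma out_decs: "c<N ==> bnd u ==> out (pw (dec_c c) k) (st i u) = (if k<=u c then {st i (u(c := u c-k))} else {})"
proof (induct k arbitrary: u)
 case (Suc k)
 define V where "V = u(c := u c-1)"
 have "u c-1<=E" using Suc(3) by (metis bnd_def diff_le_self le_trans)
 hence "bnd V" unfolding V_def by (rule bnd_upd[OF Suc(3)])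
 moreover have "V c = u c-1" "V(c := V c-k) = u(c := u c-Suc k)" by (auto simp: V_def fun_eq_iff)
 ultimately show ?case unfolding pw.simps out_Sq[OF out_dec[OF Suc(2,3)]] V_def[symmetric] using Suc(1)[OF Suc(2), of V] by (auto simp: fun_upd_def)
qed (simp add: out_Sk)

lemma out_incs: "c<N ==> bnd u ==> out (pw (inc_c c) k) (st i u) = (if u c+k<=E then {st i (u(c := u c+k))} else {})"
proof (induct k arbitrary: u)
 case (Suc k)
 define V where "V = u(c := u c+1)"
 have "u c<E ==> bnd V" unfolding V_def using Suc(3) by (intro bnd_upd) auto
 moreover have "V c = u c+1" "V(c := V c+k) = u(c := u c+Suc k)" by (auto simp: V_def fun_eq_iff)
 ultimately show ?case unfolding pw.simps out_Sq[OF out_inc[OF Suc(2,3)]] V_def[symmetric] using Suc(1)[OF Suc(2), of V] by (auto simp: fun_upd_def)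
qed (simp add: out_Sk bnd_def)

text \<open>The loop may stop after any number of rounds, but the zero test at the end passes only
  after exactly \<open>u c div p\<close> of them, and only if \<open>p dvd u c\<close>.\<close>

lemma out_xfer:
 assumes c: "c<N" "d<N" "c ~= d" and u: "bnd u" and p: "0<p" and E: "0<E"
 shows "out (xfer c d p q) (st i u) = (if p dvd u c & u d+q*(u c div p)<=E then {st i (u(c := 0, d := u d+q*(u c div p)))} else {})"
proof -
 let ?r = "Sq (pw (dec_c c) p) (pw (inc_c d) q)"
 define U where "U j = u(c := u c-p*j, d := u d+q*j)" for j
 have b: "bnd (U j)" if "u d+q*j<=E" for j using u that unfolding U_def by (intro bnd_upd) (auto simp: bnd_def intro: le_trans[OF diff_le_self])
 have body: "out ?r (st i (U j)) = (if p*Suc j<=u c & u d+q*Suc j<=E then {st i (U (Suc j))} else {})"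
  if j: "p*j<=u c" "u d+q*j<=E" for j
 proof -
  let ?V = "(U j)(c := U j c-p)"
  have "U j c-p<=E" using b[OF j(2)] by (metis bnd_def diff_le_self le_trans)
  hence V: "bnd ?V" using b[OF j(2)] by (intro bnd_upd)
  have "(p<=U j c) = (p*Suc j<=u c)" "(?V d+q<=E) = (u d+q*Suc j<=E)" "?V(d := ?V d+q) = U (Suc j)"
   using c j by (auto simp: U_def fun_eq_iff)
  thus ?thesis using out_Sq[OF out_decs[OF c(1) b[OF j(2)], of p i], of "pw (inc_c d) q"] out_incs[OF c(2) V, of q i] by auto
 qed
 have U0: "U 0 = u" using c by (auto simp: U_def)
 let ?J = "{j. p*j<=u c & u d+q*j<=E}"
 have ud: "u d<=E" using u by (simp add: bnd_def)
 have stp: "((st i (U j), s) : den (asem E w) ?r) = (p*Suc j<=u c & u d+q*Suc j<=E & s = st i (U (Suc j)))" if "p*j<=u c" "u d+q*j<=E" for j s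
  using body[OF that] unfolding out_def by (auto split: if_splits)
 have "out (Lp ?r) (st i u) = (%j. st i (U j)) ` ?J"
 proof
  have "(st i u, s) : (den (asem E w) ?r)^* ==> s : (%j. st i (U j)) ` ?J" for s
  proof (induct rule: rtrancl_induct)
   case base
   have "st i u = st i (U 0)" "0 : ?J" using ud by (simp_all add: U0)
   thus ?case by blast
  next
   case (step s s')
   then obtain j where j: "s = st i (U j)" "p*j<=u c" "u d+q*j<=E" by blast
   hence "Suc j : ?J" "s' = st i (U (Suc j))" using step(2) stp by simp_all
   thus ?case by blast
  qed
  thus "out (Lp ?r) (st i u)<=(%j. st i (U j)) ` ?J" by (auto simp: out_def)
  have "p*j<=u c ==> u d+q*j<=E ==> (st i u, st i (U j)) : (den (asem E w) ?r)^*" for j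
  proof (induct j)
   case (Suc j)
   have "p*j<=u c" "u d+q*j<=E" using Suc(2,3) by auto
   moreover from this have "(st i (U j), st i (U (Suc j))) : den (asem E w) ?r" using stp[of j] Suc(2,3) by simp
   ultimately show ?case using Suc(1) by (meson rtrancl_into_rtrancl)
  qed (simp add: U0)
  thus "(%j. st i (U j)) ` ?J<=out (Lp ?r) (st i u)" by (auto simp: out_def)
 qed
 hence "out (xfer c d p q) (st i u) = (\<Union>j\<in>?J. out (zero_c c) (st i (U j)))"
  unfolding out_def xfer_def by (auto simp: relcomp_Image)
 also have "... = (\<Union>j\<in>?J. if u c-p*j = 0 then {st i (U j)} else {})"
  using out_zero[OF c(1) b E] c(3) by (intro SUP_cong) (auto simp: U_def)
 also have "... = (if p dvd u c & u d+q*(u c div p)<=E then {st i (U (u c div p))} else {})"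
 proof -
  have "(j : ?J & u c-p*j = 0) = (p dvd u c & u d+q*(u c div p)<=E & j = u c div p)" for j
  proof -
   have "(p*j = u c) = (p dvd u c & j = u c div p)" using p by (metis dvd_mult_div_cancel dvd_triv_left nonzero_mult_div_cancel_left neq0_conv)
   thus ?thesis by auto
  qed
  moreover have "(\<Union>j\<in>?J. if u c-p*j = 0 then {st i (U j)} else {}) = (%j. st i (U j)) ` {j. j : ?J & u c-p*j = 0}" by (auto split: if_splits)
  ultimately show ?thesis by auto
 qed
 also have "u c-p*(u c div p) = 0" if "p dvd u c" using that by simp
 hence "p dvd u c ==> U (u c div p) = u(c := 0, d := u d+q*(u c div p))" by (simp add: U_def)
 hence "(if p dvd u c & u d+q*(u c div p)<=E then {st i (U (u c div p))} else {}) =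
  (if p dvd u c & u d+q*(u c div p)<=E then {st i (u(c := 0, d := u d+q*(u c div p)))} else {})" by auto
 finally show ?thesis .
qed

text \<open>Subtracting \<open>a\<close> leaves a multiple of \<open>B\<close> iff \<open>a\<close>
  is the lowest digit; otherwise the subtraction or the division blocks. So \<open>pop\<close> also
  serves as a test of the top symbol.\<close>

lemma out_pop:
 assumes c: "c<N" "x<N" "c ~= x" and u: "bnd u" "u x = 0" and B: "a<B" and E: "0<E"
 shows "out (pop x B c a) (st i u) = (if u c mod B = a then {st i (u(c := u c div B))} else {})"
proof -
 have le: "u c<=E" using u by (simp add: bnd_def)
 have b1: "bnd (u(c := u c-a))" using u le by (intro bnd_upd) auto
 have d: "(u c-a) div B<=E" using le by (meson diff_le_self div_le_dividend le_trans)
 have b2: "bnd (u(c := 0, x := (u c-a) div B))" using u d by (intro bnd_upd) auto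
 have x1: "out (xfer c x B 1) (st i (u(c := u c-a))) = (if B dvd u c-a then {st i (u(c := 0, x := (u c-a) div B))} else {})"
  using out_xfer[OF c b1 _ E, of B 1 i] B c u d by simp
 have x2: "out (xfer x c 1 1) (st i (u(c := 0, x := (u c-a) div B))) = {st i (u(c := (u c-a) div B))}"
  using out_xfer[OF c(2,1) c(3)[symmetric] b2 _ E, of 1 1 i] c u d by (simp add: fun_upd_twist fun_upd_idem)
 have "(a<=u c & B dvd u c-a) = (u c mod B = a)" using B by (auto simp: mod_eq_dvd_iff_nat[symmetric] dvd_minus_mod)
 moreover have "(u c-a) div B = u c div B" if "u c mod B = a" using that by (metis minus_mod_eq_mult_div nonzero_mult_div_cancel_left mult_0 div_by_0)
 ultimately show ?thesis unfolding pop_def out_Sq[OF out_decs[OF c(1) u(1), of a i]] out_Sq[OF x1] x2 by auto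
qed

lemma out_push:
 assumes c: "c<N" "x<N" "c ~= x" and u: "bnd u" "u x = 0" and B: "B*u c+a<=E" and E: "0<E"
 shows "out (push x B c a) (st i u) = {st i (u(c := B*u c+a))}"
proof -
 have le: "u c<=E" using u by (simp add: bnd_def)
 have b1: "bnd (u(c := 0, x := u c))" "bnd (u(c := B*u c))" using u le B by (auto intro!: bnd_upd)
 have x1: "out (xfer c x 1 1) (st i u) = {st i (u(c := 0, x := u c))}"
  using out_xfer[OF c u(1) _ E, of 1 1 i] u le by simp
 have x2: "out (xfer x c 1 B) (st i (u(c := 0, x := u c))) = {st i (u(c := B*u c))}"
  using out_xfer[OF c(2,1) c(3)[symmetric] b1(1) _ E, of 1 B i] c u B by (simp add: fun_upd_twist fun_upd_idem)
 show ?thesis unfolding push_def out_Sq1[OF x1] out_Sq1[OF x2] using out_incs[OF c(1) b1(2), of a i] B by simp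
qed

end

section \<open>Simulation of Turing machines by counters\<close>

fun seqs :: "'a re list => 'a re" where
 "seqs [] = Sk" | "seqs (r # rs) = Sq r (seqs rs)"

fun chs :: "'a re list => 'a re" where
 "chs [] = Fl" | "chs (r # rs) = Ch r (chs rs)"

lemma den_seqs_snoc: "den P (seqs (rs@[r])) = den P (seqs rs) O den P r"
 by (induct rs) auto

lemma den_chs: "den P (chs rs) = \<Union> (den P ` set rs)"
 by (induct rs) auto

lemma nv_Suc: "nv B (Suc n) f = f 0+B*nv B n (%i. f (Suc i))" "nv B (Suc n) f = nv B n f+f n*B^n"
proof -
 show "nv B (Suc n) f = f 0+B*nv B n (%i. f (Suc i))" unfolding nv_def sum.lessThan_Suc_shift sum_distrib_left by (simp add: mult_ac)
qed (simp add: nv_def)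

lemma nv_cong: "(!!i. i<n ==> f i = g i) ==> nv B n f = nv B n g"
 by (auto simp: nv_def)

lemma nv_zero: "n<=n' ==> (!!i. n<=i ==> f i = 0) ==> nv B n' f = nv B n f"
proof (induct n')
 case (Suc n')
 thus ?case by (cases "n = Suc n'") (auto simp: nv_Suc(2))
qed (simp add: nv_def)

definition "tok B b = (%(z, h). \<bar>h\<bar> <= b & (ALL p. z p<B) & (ALL p. z p ~= 0 --> \<bar>p\<bar> <= b))"

text \<open>The head divides a tape into two stacks of \<open>W\<close> digits.\<close>

definition "vr B W z h = nv B W (%j. z (h+int j))"

definition "vl B W z h = nv B W (%j. z (h-1-int j))"

text \<open>From every head position \<open>2*b+2\<close> cells reach beyond the nonblank part of
  the tape, so the digit that drops out when the head moves is 0.\<close>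

lemma v_rec:
 assumes "tok B (int b) (z, h)" "W = 2*b+2"
 shows "vr B W z h = z h+B*vr B W z (h+1)" "vl B W z h = z (h-1)+B*vl B W z (h-1)"
proof -
 let ?n = "2*b+1"
 have z: "z p = 0" if "int b < \<bar>p\<bar>" for p using assms(1) that unfolding tok_def by force
 have W: "W = Suc ?n" using assms(2) by simp
 have h: "\<bar>h\<bar> <= int b" using assms(1) by (simp add: tok_def)
 have "vr B W z (h+1) = nv B ?n (%j. z (h+int (Suc j)))" "vl B W z (h-1) = nv B ?n (%j. z (h-1-int (Suc j)))"
  unfolding vr_def vl_def W nv_Suc(2) using z[of "h+1+int ?n"] z[of "h-1-1-int ?n"] h by (simp_all add: algebra_simps)
 thus "vr B W z h = z h+B*vr B W z (h+1)" "vl B W z h = z (h-1)+B*vl B W z (h-1)"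
  using nv_Suc(1)[of B ?n "%j. z (h+int j)"] nv_Suc(1)[of B ?n "%j. z (h-1-int j)"] by (simp_all add: vr_def vl_def W)
qed

lemma v_upd: "vr B W (z(h := a)) (h+1) = vr B W z (h+1)" "vl B W (z(h := a)) h = vl B W z h"
 unfolding vr_def vl_def by (auto intro!: nv_cong)

lemma v_less: "ALL p. z p<B ==> vr B W z h<B^W" "ALL p. z p<B ==> vl B W z h<B^W"
 unfolding vr_def vl_def using nv[of W "%j. z (h+int j)" B] nv[of W "%j. z (h-1-int j)" B] by simp_all

text \<open>On a left move the symbol that passes from one stack to the other is not known. It is
  guessed, and a wrong guess blocks in \<open>pop\<close>.\<close>

definition "tapeop x B t a = (%(a', d). Sq (pop x B (2*t+1) a) (case d of Stay => push x B (2*t+1) a' | Right => push x B (2*t) a'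
   | Left => Sq (push x B (2*t+1) a') (chs (map (%b. Sq (pop x B (2*t) b) (push x B (2*t+1) b)) [0..<B]))))"

context counters
begin

lemma out_chs: "out (chs rs) s = (\<Union>r\<in>set rs. out r s)"
 by (auto simp: out_def den_chs)

lemma out_tapeop:
 assumes x: "2*t+1<N" "x<N" "2*t+1<x" and u: "bnd u" "u x = 0" "u (2*t+1) = vr B W z h" "u (2*t) = vl B W z h"
  and W: "W = 2*b+2" "B^W<=E" and ok: "tok B (int b) (z, h)" "tok B (int b) (act (a', d) (z, h))" and a: "a<B" "a'<B"
 shows "out (tapeop x B t a (a', d)) (st i u) = (if z h = a then {st i (case act (a', d) (z, h) of (z', h') => u(2*t+1 := vr B W z' h', 2*t := vl B W z' h'))} else {})"
proof -
 let ?R = "2*t+1" and ?L = "2*t"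
 have E: "0<E" using W a by (metis less_le_trans less_nat_zero_code neq0_conv power_not_zero)
 have zl: "ALL p. z p<B" using ok(1) by (simp add: tok_def)
 have R: "vr B W z h mod B = z h" "vr B W z h div B = vr B W z (h+1)" using zl a unfolding v_rec(1)[OF ok(1) W(1)] by simp_all
 have p: "out (pop x B ?R a) (st i u) = (if z h = a then {st i (u(?R := vr B W z (h+1)))} else {})"
  using out_pop[OF x(1,2) _ u(1,2) a(1) E, of i] x R u(3) by simp
 define V where "V = u(?R := vr B W z (h+1))"
 have le: "f<B^W ==> f<=E" for f using W(2) by simp
 have V: "bnd V" "V x = 0" "V ?R = vr B W z (h+1)" "V ?L = vl B W z h"
  unfolding V_def using bnd_upd[OF u(1) le[OF v_less(1)[OF zl]]] u x by auto
 define y where "y = z(h := a')"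
 have v_upd: "vr B W y (h+1) = vr B W z (h+1)" "vl B W y h = vl B W z h" by (simp_all add: y_def v_upd)
 have z'l: "ALL p. y p<B" using zl a by (simp add: y_def)
 have ok': "tok B (int b) (y, h)" using ok(1) a by (auto simp: tok_def y_def)
 have R': "a'+B*vr B W z (h+1) = vr B W y h" using v_rec(1)[OF ok' W(1)] v_upd by (simp add: y_def)
 have pR: "out (push x B ?R a') (st i V) = {st i (V(?R := vr B W y h))}"
  using out_push[OF x(1,2) _ V(1,2) _ E, of B a' i] x R' le[OF v_less(1)[OF z'l]] V(3) by (simp add: add.commute)
 have "out (case d of Stay => push x B ?R a' | Right => push x B ?L a'
   | Left => Sq (push x B ?R a') (chs (map (%b. Sq (pop x B ?L b) (push x B ?R b)) [0..<B]))) (st i V) =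
  {st i (case act (a', d) (z, h) of (z', h') => u(?R := vr B W z' h', ?L := vl B W z' h'))}"
 proof (cases d)
  case Stay
  have "V(?R := vr B W y h) = u(?R := vr B W y h, ?L := vl B W y h)" using u(4) by (auto simp: V_def v_upd fun_eq_iff)
  thus ?thesis using pR Stay by (simp add: y_def)
 next
  case Right
  have ok2: "tok B (int b) (y, h+1)" using ok(2) Right by (simp add: y_def)
  have L': "a'+B*vl B W z h = vl B W y (h+1)" using v_rec(2)[OF ok2 W(1)] v_upd by (simp add: y_def)
  have "out (push x B ?L a') (st i V) = {st i (V(?L := vl B W y (h+1)))}"
   using out_push[OF _ x(2) _ V(1,2) _ E, of ?L B a' i] x L' le[OF v_less(2)[OF z'l]] V(4) by (simp add: add.commute)
  moreover have "V(?L := vl B W y (h+1)) = u(?R := vr B W y (h+1), ?L := vl B W y (h+1))" by (auto simp: V_def v_upd fun_eq_iff)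
  ultimately show ?thesis using Right by (simp add: y_def)
 next
  case Left
  have ok2: "tok B (int b) (y, h-1)" using ok(2) Left by (simp add: y_def)
  let ?c = "z (h-1)"
  have cB: "?c<B" using zl by simp
  have L: "vl B W z h mod B = ?c" "vl B W z h div B = vl B W z (h-1)" using zl a unfolding v_rec(2)[OF ok(1) W(1)] by simp_all
  define V' where "V' = V(?R := vr B W y h)"
  have V': "bnd V'" "V' x = 0" "V' ?L = vl B W z h" unfolding V'_def using bnd_upd[OF V(1) le[OF v_less(1)[OF z'l]]] V x by auto
  define V'' where "V'' = V'(?L := vl B W z (h-1))"
  have V'': "bnd V''" "V'' x = 0" "V'' ?R = vr B W y h" unfolding V''_def using bnd_upd[OF V'(1) le[OF v_less(2)[OF zl]]] V' x by (auto simp: V'_def)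
  have p2: "out (pop x B ?L c) (st i V') = (if ?c = c then {st i V''} else {})" if "c<B" for c
   using out_pop[OF _ x(2) _ V'(1,2) that E, of ?L i] x L V'(3) by (simp add: V''_def)
  have R2: "?c+B*vr B W y h = vr B W y (h-1)" using v_rec(1)[OF ok2 W(1)] by (simp add: y_def)
  have p3: "out (push x B ?R ?c) (st i V'') = {st i (V''(?R := vr B W y (h-1)))}"
   using out_push[OF x(1,2) _ V''(1,2) _ E, of B ?c i] x R2 le[OF v_less(1)[OF z'l]] V''(3) by (simp add: add.commute)
  have "vl B W y (h-1) = vl B W z (h-1)" unfolding vl_def y_def by (auto intro!: nv_cong)
  hence e: "V''(?R := vr B W y (h-1)) = u(?R := vr B W y (h-1), ?L := vl B W y (h-1))" by (auto simp: V''_def V'_def V_def fun_eq_iff)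
  have "out (chs (map (%b. Sq (pop x B ?L b) (push x B ?R b)) [0..<B])) (st i V') = (\<Union>c\<in>{..<B}. if ?c = c then {st i (V''(?R := vr B W y (h-1)))} else {})"
   unfolding out_chs using p3 by (auto simp: out_Sq[OF p2])
  also have "... = {st i (V''(?R := vr B W y (h-1)))}" using cB by auto
  finally show ?thesis unfolding Left move.case e out_Sq1[OF pR] V'_def[symmetric] by (simp add: y_def)
 qed
 thus ?thesis unfolding tapeop_def prod.case out_Sq[OF p] V_def[symmetric] by simp
qed

end

text \<open>Counters \<open>2*t\<close> and \<open>2*t+1\<close> hold the stacks of tape
  \<open>t\<close>, \<open>2*T\<close> is the auxiliary counter and \<open>2*T+1\<close> holds the
  state.\<close>

definition "cv T B W C c = (if c<2*T then (case snd C ! (c div 2) of (z, h) => if even c then vl B W z h else vr B W z h) else if c = 2*T+1 then fst C else 0)"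

text \<open>All scanned symbols are tested first, by popping them and pushing them back; the updates
  then run on a configuration that is known to fit.\<close>

definition "branch T M = (%(q, as). Sq (pw (dec_c (2*T+1)) q) (Sq (zero_c (2*T+1)) (Sq
  (seqs (map (%t. Sq (pop (2*T) (num_symbols M) (2*t+1) (as ! t)) (push (2*T) (num_symbols M) (2*t+1) (as ! t))) [0..<T])) (Sq (seqs (map (%t. tapeop (2*T) (num_symbols M) t (as ! t) (snd (delta M q as) ! t)) [0..<T])) (pw (inc_c (2*T+1)) (fst (delta M q as)))))))"

definition "stepP T M = chs (map (branch T M) (List.product (filter (%q. q ~= 1 & q ~= 2) [0..<num_states M]) (List.n_lists T [0..<num_symbols M])))"

locale tm_sim = counters +
 fixes M :: tm and T B b b0 W :: nat and x :: "bool list"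
 assumes M: "is_tm M" and T: "T = num_tapes M" and B: "B = num_symbols M" and N: "N = 2*T+2" and W: "W = 2*b+2" "B^W<=E" "num_states M<=E"
  and sp: "within_space M x b0" and b: "b0+length x<=b" and w: "w = rev x"
begin

definition cok :: "config => bool" where
 "cok C = (fst C<num_states M & length (snd C) = T & (ALL t:set (snd C). tok B (int b) t))"

lemma E_pos: "0<E"
 using W(3) M unfolding is_tm_def by simp

lemma head: "(z, h) : set (snd (run M x n)) ==> \<bar>h\<bar> <= int b"
 using sp b unfolding within_space_def by fastforce

lemma delta_ok: "q<num_states M ==> length as = T ==> ALL a:set as. a<B ==>
  fst (delta M q as)<num_states M & length (snd (delta M q as)) = T & (ALL a:set (snd (delta M q as)). fst a<B)"
 using M unfolding is_tm_def T B by (cases "delta M q as") fastforce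

lemma run_ok: "cok (run M x n)"
proof (induct n)
 case 0
 have "3<=B" "0<num_states M" "0<T" using M unfolding is_tm_def B T by auto
 thus ?case using b unfolding cok_def tok_def run_def initial_config_def T[symmetric] by (auto simp: contents_def)
next
 case (Suc n)
 obtain q ts where C: "run M x n = (q, ts)" by (cases "run M x n")
 have S: "run M x (Suc n) = step M (q, ts)" using C by (simp add: run_def)
 show ?case
 proof (cases "is_final (q, ts)")
  case True
  thus ?thesis using Suc C S by (simp add: step_def)
 next
  case False
  let ?as = "map (%(z, h). z h) ts" and ?d = "delta M q (map (%(z, h). z h) ts)"
  have r: "run M x (Suc n) = (fst ?d, map2 act (snd ?d) ts)" using S False by (simp add: step_def split: prod.splits)
  have ok: "q<num_states M" "length ts = T" "!!z h. (z, h) : set ts ==> tok B (int b) (z, h)" using Suc C by (auto simp: cok_def)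
  hence d: "fst ?d<num_states M" "length (snd ?d) = T" "!!a. a : set (snd ?d) ==> fst a<B"
  proof -
   have "ALL a:set ?as. a<B" using ok(3) by (auto simp: tok_def)
   thus "fst ?d<num_states M" "length (snd ?d) = T" "!!a. a : set (snd ?d) ==> fst a<B" using delta_ok[OF ok(1), of ?as] ok(2) by auto
  qed
  have "tok B (int b) t" if "t : set (map2 act (snd ?d) ts)" for t
  proof -
   have "EX pu:set (zip (snd ?d) ts). t = act (fst pu) (snd pu)" using that by (auto simp del: act.simps simp: image_iff case_prod_beta)
   then obtain p u where "t = act p u" "(p, u) : set (zip (snd ?d) ts)" by auto
   then obtain a m z h where *: "t = act (a, m) (z, h)" "(a, m) : set (snd ?d)" "(z, h) : set ts"
    using set_zip_leftD[of p u] set_zip_rightD[of p u] by (metis surj_pair)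
   have "t : set (snd (run M x (Suc n)))" using that r by simp
   hence "\<bar>snd t\<bar> <= int b" using head[of "fst t" "snd t"] by simp
   thus ?thesis using * ok(3)[OF *(3)] d(3)[OF *(2)] by (auto simp: tok_def)
  qed
  thus ?thesis using r d ok by (simp add: cok_def)
 qed
qed

lemma cv_bnd: assumes "cok C" shows "bnd (cv T B W C)"
proof -
 have "vl B W z h<=E & vr B W z h<=E" if "t<T" "snd C ! t = (z, h)" for t z h
 proof -
  have "tok B (int b) (z, h)" using that assms unfolding cok_def by (metis nth_mem)
  hence "ALL p. z p<B" by (simp add: tok_def)
  thus ?thesis using v_less[of z B W h] W(2) by simp
 qed
 moreover have "c div 2<T" if "c<2*T" for c using that by simp
 ultimately show ?thesis using assms W(3) unfolding bnd_def cv_def cok_def by (auto split: prod.splits)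
qed

lemma out_ops:
 assumes C: "cok (q, ts)" "cok (q, map2 act acts ts)" and l: "length acts = T" and a: "ALL a:set acts. fst a<B"
  and k: "k<=T"
 shows "out (seqs (map (%t. tapeop (2*T) B t (case ts ! t of (z, h) => z h) (acts ! t)) [0..<k])) (st i (cv T B W (0, ts))) =
{st i (cv T B W (0, map2 act (take k acts) (take k ts)@drop k ts))}"
 using k
proof (induct k)
 case (Suc k)
 let ?ts = "%k. map2 act (take k acts) (take k ts)@drop k ts"
 obtain z h where zh: "ts ! k = (z, h)" by (cases "ts ! k")
 obtain a' d where ad: "acts ! k = (a', d)" by (cases "acts ! k")
 have lt: "length ts = T" "k<T" using C Suc(2) by (auto simp: cok_def)
 have tn: "?ts k ! t = (if t<k then act (acts ! t) (ts ! t) else ts ! t)" if "t<T" for k t using that lt(1) l by (auto simp: nth_append)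
 have ok: "tok B (int b) (z, h)" "tok B (int b) (act (a', d) (z, h))"
 proof -
  have "ts ! k : set ts" "map2 act acts ts ! k : set (map2 act acts ts)" using lt l by (intro nth_mem; simp)+
  thus "tok B (int b) (z, h)" "tok B (int b) (act (a', d) (z, h))" using C zh ad lt l unfolding cok_def by auto
 qed
 have "tok B (int b) (?ts k ! t)" if "t<T" for t
 proof -
  have "ts ! t : set ts" "map2 act acts ts ! t : set (map2 act acts ts)" using lt l that by (intro nth_mem; simp)+
  thus ?thesis using C lt l that unfolding tn[OF that] cok_def by auto
 qed
 moreover have "0<num_states M" "length (?ts k) = T" using M lt l by (auto simp: is_tm_def)
 ultimately have "cok (0, ?ts k)" unfolding cok_def fst_conv snd_conv by (metis in_set_conv_nth)
 hence b: "bnd (cv T B W (0, ?ts k))" by (rule cv_bnd)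
 have kT: "?ts k ! k = (z, h)" using tn[OF lt(2), of k] zh by simp
 have lts: "2*k+1<N" "2*T<N" "2*k+1<2*T" "z h<B" "a'<B" using N lt a l ad ok(1) by (auto simp: all_set_conv_all_nth tok_def)
 have v: "cv T B W (0, ?ts k) (2*T) = 0" "cv T B W (0, ?ts k) (2*k+1) = vr B W z h" "cv T B W (0, ?ts k) (2*k) = vl B W z h"
  using lt kT by (simp_all add: cv_def)
 have "(case act (a', d) (z, h) of (z', h') => (cv T B W (0, ?ts k))(2*k+1 := vr B W z' h', 2*k := vl B W z' h')) = cv T B W (0, ?ts (Suc k))" (is "?l = ?r")
 proof
  fix c
  obtain z' h' where z': "act (a', d) (z, h) = (z', h')" by (cases "act (a', d) (z, h)")
  consider "c = 2*k" | "c = 2*k+1" | "c<2*T" "c div 2 ~= k" | "2*T<=c" using lt by linarith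
  thus "?l c = ?r c"
  proof cases
   case 3
   hence "c div 2<T" "c ~= 2*k" "c ~= 2*k+1" by auto
   thus ?thesis using 3 z' tn[of "c div 2" k] tn[of "c div 2" "Suc k"] by (simp add: cv_def)
  qed (use z' tn[OF lt(2), of "Suc k"] zh ad lt in \<open>auto simp: cv_def\<close>)
 qed
 hence op: "out (tapeop (2*T) B k (case ts ! k of (z, h) => z h) (acts ! k)) (st i (cv T B W (0, ?ts k))) = {st i (cv T B W (0, ?ts (Suc k)))}"
  unfolding ad zh prod.case using out_tapeop[OF lts(1-3) b v W(1,2) ok lts(4,5), of i] by simp
 have "out (seqs (map (%t. tapeop (2*T) B t (case ts ! t of (z, h) => z h) (acts ! t)) [0..<Suc k])) s = (\<Union>s'\<in>out (seqs (map (%t. tapeop (2*T) B t (case ts ! t of (z, h) => z h) (acts ! t)) [0..<k])) s. out (tapeop (2*T) B k (case ts ! k of (z, h) => z h) (acts ! k)) s')" for s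
  unfolding out_def by (auto simp: den_seqs_snoc)
 thus ?case using Suc(1) Suc(2) op by simp
qed (simp add: out_Sk)

lemma out_tests:
 assumes C: "cok (0, ts)" and a: "length as = T" "ALL a:set as. a<B" and k: "k<=T"
 shows "out (seqs (map (%t. Sq (pop (2*T) B (2*t+1) (as ! t)) (push (2*T) B (2*t+1) (as ! t))) [0..<k])) (st i (cv T B W (0, ts))) =
  (if (ALL t<k. (case ts ! t of (z, h) => z h) = as ! t) then {st i (cv T B W (0, ts))} else {})"
 using k
proof (induct k)
 case (Suc k)
 obtain z h where zh: "ts ! k = (z, h)" by (cases "ts ! k")
 let ?u = "cv T B W (0, ts)" and ?R = "2*k+1"
 have lt: "length ts = T" "k<T" using C Suc(2) by (auto simp: cok_def)
 have ok: "tok B (int b) (z, h)" using C zh lt unfolding cok_def by (metis nth_mem snd_conv)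
 hence z: "ALL p. z p<B" by (simp add: tok_def)
 note bu = cv_bnd[OF C]
 have v: "?u (2*T) = 0" "?u ?R = vr B W z h" using lt zh by (simp_all add: cv_def)
 have l: "?R<N" "2*T<N" "?R ~= 2*T" "as ! k<B" using N lt a by (auto simp: all_set_conv_all_nth)
 have R: "vr B W z h mod B = z h" "vr B W z h div B = vr B W z (h+1)" using z l(4) unfolding v_rec(1)[OF ok W(1)] by simp_all
 define V where "V = ?u(?R := vr B W z (h+1))"
 have p: "out (pop (2*T) B ?R (as ! k)) (st i ?u) = (if z h = as ! k then {st i V} else {})"
  using out_pop[OF l(1-3) bu v(1) l(4) E_pos, of i] R v(2) by (simp add: V_def)
 have "vr B W z (h+1)<=E" using v_less(1)[OF z, of W "h+1"] W(2) by simp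
 hence V: "bnd V" "V (2*T) = 0" "V ?R = vr B W z (h+1)" unfolding V_def using bnd_upd[OF bu] v l(3) by auto
 have e: "V(?R := vr B W z h) = ?u" using v(2) by (auto simp: V_def fun_eq_iff)
 have "B*V ?R+z h = vr B W z h" using v_rec(1)[OF ok W(1)] V(3) by simp
 moreover have "vr B W z h<=E" using v_less(1)[OF z, of W h] W(2) by simp
 ultimately have "out (push (2*T) B ?R (z h)) (st i V) = {st i ?u}" using out_push[OF l(1-3) V(1,2) _ E_pos, of B "z h" i] e by simp
 hence "z h = as ! k ==> out (push (2*T) B ?R (as ! k)) (st i V) = {st i ?u}" by simp
 hence op: "out (Sq (pop (2*T) B ?R (as ! k)) (push (2*T) B ?R (as ! k))) (st i ?u) = (if z h = as ! k then {st i ?u} else {})"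
  unfolding out_Sq[OF p] by (cases "z h = as ! k") simp_all
 have "out (seqs (map (%t. Sq (pop (2*T) B (2*t+1) (as ! t)) (push (2*T) B (2*t+1) (as ! t))) [0..<Suc k])) s =
  (\<Union>s'\<in>out (seqs (map (%t. Sq (pop (2*T) B (2*t+1) (as ! t)) (push (2*T) B (2*t+1) (as ! t))) [0..<k])) s. out (Sq (pop (2*T) B ?R (as ! k)) (push (2*T) B ?R (as ! k))) s')" for s
  unfolding out_def by (auto simp: den_seqs_snoc)
 thus ?case using Suc(1) Suc(2) op zh by (auto simp: less_Suc_eq)
qed (simp add: out_Sk)

lemma cv_q: "(cv T B W (q, ts))(2*T+1 := q') = cv T B W (q', ts)"
 by (auto simp: cv_def fun_eq_iff)

lemma out_test: assumes "cok C" shows "out (Sq (pw (dec_c (2*T+1)) q) (Sq (zero_c (2*T+1)) r)) (st i (cv T B W C)) =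
  (if fst C = q then out r (st i (cv T B W (0, snd C))) else {})"
proof -
 obtain q0 ts where C: "C = (q0, ts)" by (cases C)
 have c: "2*T+1<N" using N by simp
 have v: "cv T B W (q0, ts) (2*T+1) = q0" for q0 by (simp add: cv_def)
 have "cok (q0-q, ts)" using assms C by (auto simp: cok_def)
 hence b: "bnd (cv T B W (q0-q, ts))" by (rule cv_bnd)
 show ?thesis unfolding C out_Sq[OF out_decs[OF c cv_bnd[OF assms[unfolded C]]]] v cv_q out_Sq[OF out_zero[OF c b E_pos]] by auto
qed

lemma out_branch:
 assumes C: "run M x n = (q, ts)" and nf: "~ is_final (q, ts)" and as: "length as = T" "ALL a:set as. a<B"
 shows "out (branch T M (q', as)) (st i (cv T B W (q, ts))) = (if q' = q & as = map (%(z, h). z h) ts then {st i (cv T B W (run M x (Suc n)))} else {})"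
proof -
 have ok: "cok (q, ts)" using run_ok[of n] C by simp
 hence ok0: "cok (0, ts)" using M by (auto simp: cok_def is_tm_def)
 let ?as = "map (%(z, h). z h) ts"
 have "(ALL t<T. (case ts ! t of (z, h) => z h) = as ! t) = (as = ?as)" using as(1) ok by (auto simp: list_eq_iff_nth_eq cok_def)
 hence t: "out (seqs (map (%t. Sq (pop (2*T) B (2*t+1) (as ! t)) (push (2*T) B (2*t+1) (as ! t))) [0..<T])) (st i (cv T B W (0, ts))) =
   (if as = ?as then {st i (cv T B W (0, ts))} else {})" using out_tests[OF ok0 as order_refl, of i] by simp
 show ?thesis
 proof (cases "q' = q & as = ?as")
  case True
  let ?d = "delta M q ?as"
  have d: "fst ?d<num_states M" "length (snd ?d) = T" "ALL a:set (snd ?d). fst a<B" using delta_ok[of q ?as] as True ok by (auto simp: cok_def)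
  have r: "run M x (Suc n) = (fst ?d, map2 act (snd ?d) ts)" using C nf by (simp add: run_def step_def split: prod.splits)
  have l: "length ts = T" using ok by (simp add: cok_def)
  have ok2: "cok (q, map2 act (snd ?d) ts)" using run_ok[of "Suc n"] r ok by (auto simp: cok_def)
  have mp: "map (%t. tapeop (2*T) B t (?as ! t) (snd ?d ! t)) [0..<T] = map (%t. tapeop (2*T) B t (case ts ! t of (z, h) => z h) (snd ?d ! t)) [0..<T]"
   using l by (intro map_cong) auto
  have o: "out (seqs (map (%t. tapeop (2*T) B t (?as ! t) (snd ?d ! t)) [0..<T])) (st i (cv T B W (0, ts))) = {st i (cv T B W (0, map2 act (snd ?d) ts))}"
   unfolding mp using out_ops[OF ok ok2 d(2,3) order_refl, of i] l d(2) by simp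
  have "cok (0, map2 act (snd ?d) ts)" using ok2 M by (auto simp: cok_def is_tm_def)
  hence b0: "bnd (cv T B W (0, map2 act (snd ?d) ts))" by (rule cv_bnd)
  have "cv T B W (0, map2 act (snd ?d) ts) (2*T+1) = 0" "2*T+1<N" "fst ?d<=E" using N d(1) W(3) by (auto simp: cv_def)
  hence "out (pw (inc_c (2*T+1)) (fst ?d)) (st i (cv T B W (0, map2 act (snd ?d) ts))) = {st i (cv T B W (run M x (Suc n)))}"
   using out_incs[OF _ b0, of "2*T+1" "fst ?d" i] r cv_q by simp
  hence "out (Sq (seqs (map (%t. tapeop (2*T) B t (?as ! t) (snd ?d ! t)) [0..<T])) (pw (inc_c (2*T+1)) (fst ?d))) (st i (cv T B W (0, ts))) =
   {st i (cv T B W (run M x (Suc n)))}" unfolding out_Sq1[OF o] .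
  thus ?thesis unfolding branch_def prod.case B[symmetric] out_test[OF ok] fst_conv snd_conv out_Sq[OF t] using True by simp
 next
  case False
  thus ?thesis unfolding branch_def prod.case B[symmetric] out_test[OF ok] fst_conv snd_conv out_Sq[OF t] by auto
 qed
qed

lemma out_step: "out (stepP T M) (st i (cv T B W (run M x n))) = (if is_final (run M x n) then {} else {st i (cv T B W (run M x (Suc n)))})"
proof -
 obtain q ts where C: "run M x n = (q, ts)" by (cases "run M x n")
 let ?as = "map (%(z, h). z h) ts"
 let ?I = "set (filter (%q. q ~= 1 & q ~= 2) [0..<num_states M]) \<times> {as. length as = T & set as<={..<B}}"
 have ok: "cok (q, ts)" using run_ok[of n] C by simp
 have "set (List.n_lists T [0..<B]) = {as. length as = T & set as<={..<B}}" by (auto simp: set_n_lists)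
 hence s: "out (stepP T M) (st i (cv T B W (q, ts))) = (\<Union>p\<in>?I. out (branch T M p) (st i (cv T B W (q, ts))))"
  unfolding stepP_def out_chs B[symmetric] by simp
 show ?thesis
 proof (cases "is_final (q, ts)")
  case True
  have "out (branch T M (q', as)) (st i (cv T B W (q, ts))) = {}" if "q' ~= q" for q' as
   unfolding branch_def prod.case out_test[OF ok] using that by simp
  hence "(\<Union>p\<in>?I. out (branch T M p) (st i (cv T B W (q, ts)))) = {}" using True by (fastforce simp: is_final_def)
  thus ?thesis using True C s by simp
 next
  case False
  have "(q, ?as) : ?I" using ok False by (auto simp: cok_def tok_def is_final_def)
  moreover have "out (branch T M p) (st i (cv T B W (q, ts))) = (if p = (q, ?as) then {st i (cv T B W (run M x (Suc n)))} else {})" if "p : ?I" for p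
  proof (cases p)
   case (Pair q' as)
   hence "length as = T" "ALL a:set as. a<B" using that by auto
   thus ?thesis using out_branch[OF C False, of as q' i] Pair by simp
  qed
  ultimately have "(\<Union>p\<in>?I. out (branch T M p) (st i (cv T B W (q, ts)))) = {st i (cv T B W (run M x (Suc n)))}" by (auto split: if_splits)
  thus ?thesis using False C s by simp
 qed
qed

end

section \<open>Loading the input and running the machine\<close>

definition "loadP T B = Sq (Lp (Ch (Sq (At (Read False)) (push (2*T) B 1 1)) (Sq (At (Read True)) (push (2*T) B 1 2)))) (At ReadEnd)"

definition "tmP T M = Sq (seqs (map (%c. At (Up (2*c))) [0..<2*T+2])) (Sq (loadP T (num_symbols M))
  (Sq (Lp (stepP T M)) (Sq (pw (dec_c (2*T+1)) 1) (Sq (zero_c (2*T+1)) Sk))))"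

context tm_sim
begin

lemma out_init: "out (seqs (map (%c. At (Up (2*c))) [0..<N])) (0, %_. 0) = {st 0 (%_. 0)}"
proof -
 have "k<=N ==> den (asem E w) (seqs (map (%c. At (Up (2*c))) [0..<k])) `` {(0, %_. 0)} = {(0, %r. if r<2*k & even r then E else 0)}" for k
 proof (induct k)
  case (Suc k)
  have "(%r. if r<2*k & even r then E else 0)(2*k := E) = (%r. if r<2*Suc k & even r then E else 0)"
   by (auto simp: fun_eq_iff less_Suc_eq)
  thus ?case using Suc by (simp add: den_seqs_snoc relcomp_Image)
 qed simp
 moreover have "(%r. if r<2*N & even r then E else 0) = rg N E (%_. 0)" by (auto simp: rg_def fun_eq_iff)
 ultimately show ?thesis by (simp add: out_def)
qed

text \<open>The input arrives in reverse, so the first letter of \<open>x\<close> is pushed last and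
  ends up on top of the right stack of tape 0.\<close>

definition lo :: "nat => nat => nat" where
 "lo i = (%_. 0)(1 := nv B i (%j. contents x (int (length x-i+j))))"

lemma lo: "i<=length x ==> bnd (lo i)" "lo i (2*T) = 0" "i<length x ==> B*lo i 1+(if w ! i then 2 else 1) = lo (Suc i) 1"
proof -
 have B3: "3<=B" using M by (auto simp: is_tm_def B)
 have T0: "0<T" using M by (auto simp: is_tm_def T)
 show "bnd (lo i)" if "i<=length x"
 proof -
  have "contents x p<B" for p using B3 by (auto simp: contents_def)
  hence "nv B i (%j. contents x (int (length x-i+j)))<B^i" using nv[of i "%j. contents x (int (length x-i+j))" B] by simp
  also have "... <= B^W" using that b W B3 by (intro power_increasing) auto
  finally show ?thesis using W(2) by (auto simp: bnd_def lo_def)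
 qed
 show "lo i (2*T) = 0" using T0 by (simp add: lo_def)
 assume i: "i<length x"
 have "contents x (int (length x-Suc i)) = (if w ! i then 2 else 1)" using i w by (simp add: contents_def rev_nth nat_diff_distrib' del: of_nat_diff)
 moreover have "length x-Suc i+Suc j = length x-i+j" for j using i by simp
 moreover have "lo (Suc i) 1 = contents x (int (length x-Suc i))+B*nv B i (%j. contents x (int (length x-Suc i+Suc j)))"
  by (simp only: lo_def fun_upd_same nv_Suc(1) add_0_right)
 ultimately show "B*lo i 1+(if w ! i then 2 else 1) = lo (Suc i) 1" by (simp only: lo_def fun_upd_same add.commute)
qed

lemma lo_end: "lo (length x) = cv T B W (initial_config M x)"
proof
 fix c
 have T0: "0<T" using M by (auto simp: is_tm_def T)
 have "length x<=W" using b W(1) by simp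
 hence "nv B (length x) (%j. contents x (int j)) = vr B W (contents x) 0" unfolding vr_def
  by (simp, intro nv_zero[symmetric]) (auto simp: contents_def)
 moreover have "vl B W (contents x) 0 = 0" "vl B W (%_. 0) 0 = 0" "vr B W (%_. 0) 0 = 0" by (simp_all add: vl_def vr_def nv_def contents_def)
 moreover have "snd (initial_config M x) ! t = (if t = 0 then (contents x, 0) else (%_. 0, 0))" if "t<T" for t
  using that by (auto simp: initial_config_def T nth_Cons' )
 moreover have "fst (initial_config M x) = 0" by (simp add: initial_config_def)
 moreover have "c<2*T ==> c div 2<T" "c div 2 = 0 ==> c = 0 \<or> c = 1" by auto
 ultimately show "lo (length x) c = cv T B W (initial_config M x) c"
  using T0 by (cases "c<2*T"; cases "c div 2 = 0") (auto simp: lo_def cv_def)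
qed

lemma out_load: "out (loadP T B) (st 0 (%_. 0)) = {st (length x) (cv T B W (run M x 0))}"
proof -
 let ?r = "Ch (Sq (At (Read False)) (push (2*T) B 1 1)) (Sq (At (Read True)) (push (2*T) B 1 2))"
 have T0: "0<T" using M by (auto simp: is_tm_def T)
 have lw: "length w = length x" by (simp add: w)
 have body: "out ?r (st i (lo i)) = (if i<length x then {st (Suc i) (lo (Suc i))} else {})" if "i<=length x" for i
 proof (cases "i<length x")
  case True
  have "lo (Suc i) 1<=E" using lo(1)[of "Suc i"] True by (simp add: bnd_def)
  hence p: "out (push (2*T) B 1 (if w ! i then 2 else 1)) (st (Suc i) (lo i)) = {st (Suc i) ((lo i)(1 := lo (Suc i) 1))}"
   using out_push[OF _ _ _ lo(1)[OF that] lo(2) _ E_pos, of 1 B "if w ! i then 2 else 1" "Suc i"] lo(3)[OF True] N T0 by simp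
  have e: "(lo i)(1 := lo (Suc i) 1) = lo (Suc i)" by (auto simp: lo_def)
  have "out ?r s = out (Sq (At (Read False)) (push (2*T) B 1 1)) s Un out (Sq (At (Read True)) (push (2*T) B 1 2)) s" for s by (auto simp: out_def)
  moreover have "out (At (Read c)) (st i u) = (if w ! i = c then {st (Suc i) u} else {})" for c u using True lw by (auto simp: out_def)
  hence "out (Sq (At (Read c)) r) (st i u) = (if w ! i = c then out r (st (Suc i) u) else {})" for c u r by (rule out_Sq)
  ultimately show ?thesis using p True unfolding e by (cases "w ! i") simp_all
 next
  case False
  thus ?thesis using lw by (auto simp: out_def relcomp_Image)
 qed
 have "out (Lp ?r) (st 0 (lo 0)) = (%i. st i (lo i)) ` {..length x}"
 proof
  have "(st 0 (lo 0), s) : (den (asem E w) ?r)^* ==> s : (%i. st i (lo i)) ` {..length x}" for s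
  proof (induct rule: rtrancl_induct)
   case (step s s')
   then obtain i where i: "i<=length x" "s = st i (lo i)" by auto
   hence "s' : out ?r (st i (lo i))" using step(2) by (simp add: out_def)
   thus ?case using body[OF i(1)] by (auto split: if_splits)
  qed simp
  thus "out (Lp ?r) (st 0 (lo 0))<=(%i. st i (lo i)) ` {..length x}" unfolding out_def by auto
  have "i<=length x ==> (st 0 (lo 0), st i (lo i)) : (den (asem E w) ?r)^*" for i
  proof (induct i)
   case (Suc i)
   hence "st (Suc i) (lo (Suc i)) : out ?r (st i (lo i))" using body[of i] by simp
   thus ?case using Suc unfolding out_def by (auto intro: rtrancl_into_rtrancl)
  qed simp
  thus "(%i. st i (lo i)) ` {..length x}<=out (Lp ?r) (st 0 (lo 0))" unfolding out_def by auto
 qed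
 hence "out (loadP T B) (st 0 (lo 0)) = {st (length x) (lo (length x))}"
  unfolding loadP_def out_def den.simps(4) relcomp_Image using lw by auto
 moreover have "lo 0 = (%_. 0)" by (auto simp: lo_def nv_def)
 ultimately show ?thesis by (simp add: lo_end run_def)
qed

lemma tmP_correct: "(EX s. ((0, %_. 0), s) : den (asem E w) (tmP T M)) = (EX n. fst (run M x n) = 1)"
proof -
 let ?c = "%n. st (length x) (cv T B W (run M x n))" and ?acc = "Sq (pw (dec_c (2*T+1)) 1) (Sq (zero_c (2*T+1)) Sk)"
 have "out (Lp (stepP T M)) (?c 0) = range ?c"
 proof
  have "(?c 0, s) : (den (asem E w) (stepP T M))^* ==> s : range ?c" for s
  proof (induct rule: rtrancl_induct)
   case (step s s')
   then obtain n where n: "s = ?c n" by auto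
   hence "s' : out (stepP T M) (?c n)" using step(2) by (simp add: out_def)
   thus ?case unfolding out_step by (auto split: if_splits)
  qed simp
  thus "out (Lp (stepP T M)) (?c 0)<=range ?c" unfolding out_def by auto
  have "(?c 0, ?c n) : (den (asem E w) (stepP T M))^*" for n
  proof (induct n)
   case (Suc n)
   show ?case
   proof (cases "is_final (run M x n)")
    case True
    hence "run M x (Suc n) = run M x n" by (simp add: run_def step_def)
    thus ?thesis using Suc by simp
   next
    case False
    hence "?c (Suc n) : out (stepP T M) (?c n)" unfolding out_step by simp
    thus ?thesis using Suc unfolding out_def by (auto intro: rtrancl_into_rtrancl)
   qed
  qed simp
  thus "range ?c<=out (Lp (stepP T M)) (?c 0)" unfolding out_def by auto
 qed
 moreover have "out (Sq r r') s = (\<Union>s'\<in>out r s. out r' s')" for r r' s by (auto simp: out_def)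
 ultimately have "out (tmP T M) (0, %_. 0) = (\<Union>n. out ?acc (?c n))"
  unfolding tmP_def N[symmetric] B[symmetric] out_Sq1[OF out_init] out_Sq1[OF out_load] by (simp only: image_image)
 also have "out ?acc (?c n) = (if fst (run M x n) = 1 then {st (length x) (cv T B W (0, snd (run M x n)))} else {})" for n
  using out_test[OF run_ok[of n], of 1 Sk "length x"] unfolding out_Sk .
 hence "((\<Union>n. out ?acc (?c n)) = {}) = (ALL n. fst (run M x n) ~= 1)" by auto
 finally show ?thesis unfolding out_def by blast
qed

end

theorem EXPSPACE_program:
 assumes "L : EXPSPACE"
 obtains r :: "atom re" and k c where "!!x. (x : L) = (EX s. ((0, %_. 0), s) : den (asem (2^2^(length x^k+length x+c)) (rev x)) r)"
proof -
 obtain M k where M: "is_tm M" "decides M L" "!!x. within_space M x (2^(length x^k+k))" using assms unfolding EXPSPACE_def by blast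
 let ?T = "num_tapes M" and ?B = "num_symbols M"
 \<comment> \<open>Large enough that \<open>2^2^(n^k+n+c)\<close> is at least the bound
   \<open>?B^?W\<close> on stack codes and the number of states.\<close>
 define c where "c = k+?B+2+num_states M"
 show ?thesis
 proof (rule that)
  fix x :: "bool list"
  define n m b where "n = length x" and "m = n^k+n+c" and "b = 2^(n^k+k)+n"
  let ?E = "2^2^m :: nat" and ?W = "2*b+2"
  have "?B^?W<=(2^?B)^?W" by (intro power_mono) (auto intro: less_imp_le)
  also have "... = 2^(?B*?W)" by (rule power_mult[symmetric])
  also have "... <= ?E"
  proof (rule power_increasing)
   have "n<2^n" by simp
   hence "Suc n<=2^n" by (rule Suc_leI)
   hence "2^(n^k+k)*Suc n<=2^(n^k+k)*(2^n :: nat)" by (rule mult_le_mono2)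
   moreover have "1*n<=2^(n^k+k)*n" by (intro mult_le_mono1) simp
   ultimately have "b<=2^(n^k+k)*2^n" unfolding b_def mult_Suc_right by linarith
   hence "b<=2^(n^k+k+n)" unfolding power_add[of 2 "n^k+k" n] .
   moreover have "(1::nat)<=2^(n^k+k+n)" by simp
   ultimately have "?W<=4*2^(n^k+k+n)" by linarith
   hence "?B*?W<=2^?B*(4*2^(n^k+k+n))" by (intro mult_le_mono less_imp_le[OF less_exp])
   also have "... = 2^(?B+(2+(n^k+k+n)))" by (simp add: power_add)
   also have "... <= 2^m" by (intro power_increasing) (auto simp: m_def c_def)
   finally show "?B*?W<=2^m" .
  qed simp
  finally have W: "?B^?W<=?E" .
  have "num_states M<=m" by (simp add: m_def c_def)
  hence "num_states M<=?E" using less_exp[of m] less_exp[of "2^m"] by linarith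
  hence "tm_sim (2*?T+2) ?E (rev x) M ?T ?B b (2^(n^k+k)) ?W x"
   by unfold_locales (use M W in \<open>auto simp: b_def n_def\<close>)
  hence "(EX s. ((0, %_. 0), s) : den (asem ?E (rev x)) (tmP ?T M)) = (EX n. fst (run M x n) = 1)" by (rule tm_sim.tmP_correct)
  also have "... = (x : L)"
  proof
   assume "x : L"
   thus "EX n. fst (run M x n) = 1" using M(2) unfolding decides_def by metis
  next
   assume "EX n. fst (run M x n) = 1"
   then obtain i where i: "fst (run M x i) = 1" by blast
   obtain j where j: "fst (run M x j) = (if x : L then 1 else 2)" using M(2) unfolding decides_def by metis
   have fin: "run M x (n+d) = run M x n" if "is_final (run M x n)" for n d
    using that by (induct d) (auto simp: run_def step_def)
   have "run M x i = run M x j"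
    using fin[of i "j-i"] fin[of j "i-j"] i j by (cases "i<=j") (auto simp: is_final_def split: if_splits)
   thus "x : L" using i j by (cases "x : L") simp_all
  qed
  finally show "(x : L) = (EX s. ((0, %_. 0), s) : den (asem (2^2^(length x^k+length x+c)) (rev x)) (tmP ?T M))"
   by (simp add: m_def n_def)
 qed
qed

section \<open>Petri nets with doubly exponential counters\<close>

text \<open>The gadget of depth \<open>l\<close> at level \<open>g\<close> turns \<open>oS\<close> into \<open>oF\<close> and, in the presence of the selector
 \<open>oC j\<close>, adds \<open>E = 2 ^ 2 ^ l\<close> tokens to \<open>oB j\<close>; all its rules are reversible. It squares the effect of the gadget
 of level \<open>g + 1\<close>, which it calls with the selectors 0 to 3 (the four phases).\<close>

datatype off = oS | oF | oC nat | oB nat | oQ nat | oU bool nat | oL | oI bool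

type_synonym pl = "nat*off"

abbreviation E2 :: "nat => int" where "E2 l == 2^2^l"

definition mk :: "bool => off" where "mk b = (if b then oF else oS)"

lemma mk_simps [simp]: "mk True = oF" "mk False = oS" "mk b ~= oC i" "mk b ~= oB i" "oC i ~= mk b" "oB i ~= mk b"
 by (auto simp: mk_def)

definition gof :: "off => bool" where
 "gof o' = (o' = oS \<or> o' = oF \<or> o' : range oC \<or> o' : range oB)"

definition Z :: "nat => pl multiset => bool" where
 "Z g m = (ALL g' o'. g<=g' --> gof o' --> (g', o') ~:# m)"

definition HH :: "nat => (off => int) => pl multiset => bool" where
 "HH g f m = (ALL o'. gof o' --> int (count m (g, o')) = f o')"

text \<open>\<open>b\<close> tells which of the control tokens \<open>oS\<close> and
  \<open>oF\<close> is present; \<open>None\<close> means that control is at a deeper level.\<close>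

fun tg :: "bool option => nat => (nat => int) => off => int" where
 "tg b j v oS = of_bool (b = Some False)" | "tg b j v oF = of_bool (b = Some True)" | "tg b j v (oC q) = of_bool (q = j)" | "tg b j v (oB q) = v q" | "tg b j v _ = 0"

abbreviation H :: "nat => nat => bool option => (nat => int) => pl multiset => bool" where
 "H g j b v == HH g (tg b j v)"

fun Dv :: "nat => nat => int => int => int" where
 "Dv l p a c = (if p = 0 then E2 l*a else if p = 1 then E2 l*a+c else if p = 2 then E2 l*a+E2 l-c else E2 l*(E2 l-a))"

text \<open>The contents of \<open>oB q\<close> normalised to the start of the current inner call,
  that is, without the \<open>E2 l\<close> tokens which a completed call adds. Such values may be
  negative while the call is not undone, hence integers.\<close>

fun Vv :: "nat => nat => int => int => nat => int" where
 "Vv l p a c q = (if p = 0 then of_bool (q = 3)*a-of_bool (q = 0)*a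
  else if p = 1 then of_bool (q = 0)*(E2 l-a-1)-of_bool (q = 1)*c+of_bool (q = 2)*c+of_bool (q = 3)*a
  else if p = 2 then of_bool (q = 0)*(E2 l-a-1)+of_bool (q = 1)*c-of_bool (q = 2)*c+of_bool (q = 3)*a
  else of_bool (q = 0)*a-of_bool (q = 3)*a)"

definition bump :: "nat => int => (nat => int) => nat => int" where
 "bump j e v q = v q+of_bool (q = j)*e"

text \<open>The invariant of the gadget called with selector \<open>j\<close> when \<open>v q\<close> tokens were on \<open>oB q\<close>: in phase \<open>p\<close>, it has put
 \<open>Dv l p a c\<close> tokens on \<open>oB j\<close> so far and has called the next level with \<open>Vv l p a c\<close>, where \<open>a\<close> counts rounds and \<open>c\<close> the tokens
 of the current round.\<close>

fun J :: "nat => nat => nat => (nat => int) => pl multiset => bool" where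
 "J 0 g j v m = ((H g j (Some False) v m \<or> H g j (Some True) (bump j 2 v) m) & Z (Suc g) m)"
| "J (Suc l) g j v m = ((H g j (Some False) v m \<or> H g j (Some True) (bump j (E2 (Suc l)) v) m) & Z (Suc g) m \<or>
  (EX p<4. EX a c. H g j None (bump j (Dv l p a c) v) m & J l (Suc g) p (Vv l p a c) m))"

definition "T b l g j v m = (H g j (Some b) (if b then bump j (E2 l) v else v) m & Z (Suc g) m)"

lemma gof_simps [simp]: "gof oS" "gof oF" "gof (oC q)" "gof (oB q)" "~ gof (oQ q)" "~ gof (oU b q)" "~ gof oL" "~ gof (oI b)" "gof (mk b)"
 by (auto simp: gof_def mk_def)

lemma gofE: "gof o' ==> (o' = oS ==> P) ==> (o' = oF ==> P) ==> (!!q. o' = oC q ==> P) ==> (!!q. o' = oB q ==> P) ==> P"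
 by (auto simp: gof_def)

lemma T_J: "T b l g j v m ==> J l g j v m"
 by (cases l; cases b) (auto simp: T_def)

lemma HH_D: "HH g f m ==> gof o' ==> (g, o') :# m ==> 0<f o'"
 unfolding HH_def by (metis count_greater_zero_iff of_nat_0_less_iff)

text \<open>A control token on level \<open>g\<close> itself excludes the running case and decides
  between the two resting ones.\<close>

lemma J_T: assumes "J l g j v m" "(g, mk b) :# m" shows "T b l g j v m"
proof -
 have "H g j b' v m ==> b' = Some b" for b' v using HH_D[OF _ gof_simps(9) assms(2)] by (cases b; force)
 thus ?thesis using assms(1) by (cases l; cases b) (auto simp: T_def)
qed

abbreviation "PH b l g j v p a c m == H g j None (bump j (Dv l p a c) v) m & T b l (Suc g) p (Vv l p a c) m"

text \<open>A rule that needs a control token of level \<open>Suc g\<close> and the selector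
  \<open>p\<close> meets the invariant in phase \<open>p\<close>, with the inner gadget at
  rest.\<close>

lemma phase: assumes "J (Suc l) g j v m" "(Suc g, mk b) :# m" "(Suc g, oC p) :# m"
 obtains a c where "p<4" "PH b l g j v p a c m"
proof -
 have "~ Z (Suc g) m" using assms(2) gof_simps(9)[of b] unfolding Z_def by blast
 then obtain p' a c where p: "p'<4" "H g j None (bump j (Dv l p' a c) v) m" "J l (Suc g) p' (Vv l p' a c) m" using assms(1) by auto
 have t: "T b l (Suc g) p' (Vv l p' a c) m" by (rule J_T[OF p(3) assms(2)])
 have "0<tg (Some b) p' (if b then bump p' (E2 l) (Vv l p' a c) else Vv l p' a c) (oC p)"
  using t HH_D[OF _ gof_simps(3) assms(3)] unfolding T_def by blast
 hence "p' = p" by (cases "p = p'") auto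
 thus ?thesis using that p t by blast
qed

lemma Z_add: "Z g (m+m') = (Z g m & Z g m')" "Z g (add_mset p m) = (~ (g<=fst p & gof (snd p)) & Z g m)" "Z g {#}"
 by (cases p; auto simp: Z_def)+

lemma Z_HH: "Z g m = (HH g (%_. 0) m & Z (Suc g) m)"
proof -
 have "(ALL g'. g<=g' --> P g') = (P g & (ALL g'. Suc g<=g' --> P g'))" for P by (metis Suc_leD Suc_leI le_neq_implies_less le_refl)
 from this[of "%g'. ALL o'. gof o' --> (g', o') ~:# m"] show ?thesis by (auto simp: Z_def HH_def not_in_iff)
qed

lemma HH_step: assumes "HH g f (a+z)" "!!o'. gof o' ==> f' o' = f o'-int (count a (g, o'))+int (count b (g, o'))" shows "HH g f' (b+z)"
 unfolding HH_def
proof (intro allI impI)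
 fix o' assume o: "gof o'"
 hence "int (count (a+z) (g, o')) = f o'" using assms(1) unfolding HH_def by blast
 thus "int (count (b+z) (g, o')) = f' o'" using assms(2)[OF o] by simp
qed

lemma phase_step:
 assumes x: "H g j None (bump j e v) (a+z) & T b1 l (Suc g) p1 v1 (a+z)" and p: "p<4" and Z: "Z (Suc (Suc g)) b"
  and 1: "!!o'. gof o' ==> tg None j (bump j (Dv l p x c) v) o' = tg None j (bump j e v) o'-int (count a (g, o'))+int (count b (g, o'))"
  and 2: "!!o'. gof o' ==> tg (Some b2) p (if b2 then bump p (E2 l) (Vv l p x c) else Vv l p x c) o' =
   tg (Some b1) p1 (if b1 then bump p1 (E2 l) v1 else v1) o'-int (count a (Suc g, o'))+int (count b (Suc g, o'))"
 shows "J (Suc l) g j v (b+z)"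
proof -
 have "T b2 l (Suc g) p (Vv l p x c) (b+z)" unfolding T_def using HH_step[OF _ 2] x Z by (simp add: T_def Z_add)
 hence "J l (Suc g) p (Vv l p x c) (b+z)" by (rule T_J)
 thus ?thesis using HH_step[OF conjunct1[OF x] 1] p unfolding J.simps(2) by blast
qed

text \<open>With \<open>E\<close> the effect of the inner gadget, selector 0 provides
  \<open>E\<close> round tokens. Each round makes \<open>E\<close> tokens on \<open>oB 1\<close>,
  shifts them to \<open>oB 2\<close> while emitting one output token each, and removes them there by
  an inner run backwards. Used rounds gather on \<open>oB 3\<close> and are removed likewise at the
  end.\<close>

definition ups :: "nat => nat => (pl multiset*pl multiset) set" where
 "ups K g = {({#(g, oS)#}, {#(Suc g, oS), (Suc g, oC 0)#}), ({#(Suc g, oF), (Suc g, oC 0), (Suc g, oB 0)#}, {#(Suc g, oS), (Suc g, oC 1)#}),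
   ({#(Suc g, oF), (Suc g, oC 1)#}, {#(Suc g, oF), (Suc g, oC 2)#}), ({#(Suc g, oS), (Suc g, oC 2)#}, {#(Suc g, oF), (Suc g, oC 0), (Suc g, oB 3)#}),
   ({#(Suc g, oF), (Suc g, oC 0)#}, {#(Suc g, oF), (Suc g, oC 3)#}), ({#(Suc g, oS), (Suc g, oC 3)#}, {#(g, oF)#})} Un
  {({#(Suc g, oF), (Suc g, oC 1), (Suc g, oB 1), (g, oC i)#}, {#(Suc g, oF), (Suc g, oC 1), (Suc g, oB 2), (g, oC i), (g, oB i)#}) | i. i<K}"

definition bot :: "nat => nat => (pl multiset*pl multiset) set" where
 "bot K g = {({#(g, oS), (g, oC i)#}, {#(g, oF), (g, oC i), (g, oB i), (g, oB i)#}) | i. i<K}"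

definition gr :: "nat => nat => nat => (pl multiset*pl multiset) set" where
 "gr K m g = (if g<m then ups K g Un (ups K g)\<inverse> else bot K g Un (bot K g)\<inverse>)"

definition fire :: "('p multiset * 'p multiset) set => ('p multiset * 'p multiset) set" where
 "fire r = {(a+z, b+z) | a b z. (a, b) : r}"

lemma E2_Suc [simp]: "(2::int)^(2*2^l) = E2 l*E2 l"
 by (simp add: mult_2 power_add)

text \<open>Where two entries of \<open>Vv\<close> are opposite, such as \<open>c\<close> and
  \<open>-c\<close>, this forces them to be 0: the inner gadget can rest at its start only if the
  transfer is complete or has not begun.\<close>

lemma T_nonneg: "T b l g j v m ==> 0<=(if b then bump j (E2 l) v else v) q"
 unfolding T_def HH_def by (metis gof_simps(4) of_nat_0_le_iff tg.simps(4))

lemma T_start: assumes "T False (Suc l) g j v (a+z)" "a = {#(g, oS)#}" "b = {#(Suc g, oS), (Suc g, oC 0)#}"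
 shows "J (Suc l) g j v (b+z)"
proof -
 have "HH (Suc g) (%_. 0) (a+z)" "Z (Suc (Suc g)) (a+z)" "H g j (Some False) v (a+z)" using assms(1) Z_HH[of "Suc g" "a+z"] by (auto simp: T_def)
 note h = this
 have "H (Suc g) 0 (Some False) (Vv l 0 0 0) (b+z)" by (rule HH_step[OF h(1)]) (use assms in \<open>auto elim!: gofE\<close>)
 moreover have "H g j None (bump j (Dv l 0 0 0) v) (b+z)" by (rule HH_step[OF h(3)]) (use assms in \<open>auto elim!: gofE simp: bump_def\<close>)
 moreover have "Z (Suc (Suc g)) (b+z)" using h(2) assms by (simp add: Z_add)
 ultimately have "T False l (Suc g) 0 (Vv l 0 0 0) (b+z)" "H g j None (bump j (Dv l 0 0 0) v) (b+z)" by (simp_all add: T_def)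
 thus ?thesis by (intro J.simps(2)[THEN iffD2] disjI2 exI[of _ 0] conjI T_J) auto
qed

text \<open>Each rule changes the phase or the parameters \<open>a\<close> and \<open>c\<close> of
  the invariant. Both directions are needed because every rule also occurs reversed.\<close>

lemma J_ups:
 assumes "(a, b) : ups K g"
 shows "J (Suc l) g j v (a+z) = J (Suc l) g j v (b+z)"
proof -
 let ?U = "Suc g"
 note [elim!] = gofE and [simp] = bump_def Z_add
 consider "a = {#(g, oS)#} & b = {#(?U, oS), (?U, oC 0)#}" | "a = {#(?U, oF), (?U, oC 0), (?U, oB 0)#} & b = {#(?U, oS), (?U, oC 1)#}"
  | "a = {#(?U, oF), (?U, oC 1)#} & b = {#(?U, oF), (?U, oC 2)#}" | "a = {#(?U, oS), (?U, oC 2)#} & b = {#(?U, oF), (?U, oC 0), (?U, oB 3)#}"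
  | "a = {#(?U, oF), (?U, oC 0)#} & b = {#(?U, oF), (?U, oC 3)#}" | "a = {#(?U, oS), (?U, oC 3)#} & b = {#(g, oF)#}"
  | i where "a = {#(?U, oF), (?U, oC 1), (?U, oB 1), (g, oC i)#} & b = {#(?U, oF), (?U, oC 1), (?U, oB 2), (g, oC i), (g, oB i)#}"
  using assms unfolding ups_def by blast
 thus ?thesis
 proof cases
  case 1
  show ?thesis
  proof
   assume J: "J (Suc l) g j v (a+z)"
   have "T False (Suc l) g j v (a+z)" using J_T[OF J, of False] 1 by simp
   thus "J (Suc l) g j v (b+z)" using T_start 1 by blast
  next
   assume J: "J (Suc l) g j v (b+z)"
   then obtain x c where x: "PH False l g j v 0 x c (b+z)" using phase[OF J, of False 0] 1 by auto
   hence x0: "x = 0" using T_nonneg[OF conjunct2[OF x], of 0] T_nonneg[OF conjunct2[OF x], of 3] by simp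
   have "HH ?U (%_. 0) (a+z)" by (rule HH_step[OF x[unfolded T_def, THEN conjunct2, THEN conjunct1]]) (auto simp: 1 x0)
   moreover have "H g j (Some False) v (a+z)" by (rule HH_step[OF conjunct1[OF x]]) (auto simp: 1 x0)
   ultimately have "T False (Suc l) g j v (a+z)" unfolding T_def Z_HH[of ?U] using x 1 by (auto simp: T_def Z_add)
   thus "J (Suc l) g j v (a+z)" by (rule T_J)
  qed
 next
  case 2
  show ?thesis
  proof
   assume J: "J (Suc l) g j v (a+z)"
   then obtain x c where x: "PH True l g j v 0 x c (a+z)" using phase[OF J, of True 0] 2 by auto
   show "J (Suc l) g j v (b+z)"
    by (rule phase_step[OF x, of 1 _ x 0 False]) (use 2 in \<open>auto simp: algebra_simps\<close>)
  next
   assume J: "J (Suc l) g j v (b+z)"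
   then obtain x c where x: "PH False l g j v 1 x c (b+z)" using phase[OF J, of False 1] 2 by auto
   have *: "c = 0" using T_nonneg[OF conjunct2[OF x], of 1] T_nonneg[OF conjunct2[OF x], of 2] by simp
   show "J (Suc l) g j v (a+z)"
    by (rule phase_step[OF x, of 0 _ x 0 True]) (use * 2 in \<open>auto simp: algebra_simps\<close>)
  qed
 next
  case 3
  show ?thesis
  proof
   assume J: "J (Suc l) g j v (a+z)"
   then obtain x c where x: "PH True l g j v 1 x c (a+z)" using phase[OF J, of True 1] 3 by auto
   \<comment> \<open>The parameter changes its meaning: in phase 1 it counts the tokens already
     shifted, in phase 2 those not yet shifted.\<close>
   show "J (Suc l) g j v (b+z)"
    by (rule phase_step[OF x, of 2 _ x "E2 l-c" True]) (use 3 in \<open>auto simp: algebra_simps\<close>)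
  next
   assume J: "J (Suc l) g j v (b+z)"
   then obtain x c where x: "PH True l g j v 2 x c (b+z)" using phase[OF J, of True 2] 3 by auto
   show "J (Suc l) g j v (a+z)"
    by (rule phase_step[OF x, of 1 _ x "E2 l-c" True]) (use 3 in \<open>auto simp: algebra_simps\<close>)
  qed
 next
  case 4
  show ?thesis
  proof
   assume J: "J (Suc l) g j v (a+z)"
   then obtain x c where x: "PH False l g j v 2 x c (a+z)" using phase[OF J, of False 2] 4 by auto
   have *: "c = 0" using T_nonneg[OF conjunct2[OF x], of 1] T_nonneg[OF conjunct2[OF x], of 2] by simp
   show "J (Suc l) g j v (b+z)"
    by (rule phase_step[OF x, of 0 _ "x+1" 0 True]) (use * 4 in \<open>auto simp: algebra_simps\<close>)
  next
   assume J: "J (Suc l) g j v (b+z)"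
   then obtain x c where x: "PH True l g j v 0 x c (b+z)" using phase[OF J, of True 0] 4 by auto
   show "J (Suc l) g j v (a+z)"
    by (rule phase_step[OF x, of 2 _ "x-1" 0 False]) (use 4 in \<open>auto simp: algebra_simps\<close>)
  qed
 next
  case 5
  show ?thesis
  proof
   assume J: "J (Suc l) g j v (a+z)"
   then obtain x c where x: "PH True l g j v 0 x c (a+z)" using phase[OF J, of True 0] 5 by auto
   show "J (Suc l) g j v (b+z)"
    by (rule phase_step[OF x, of 3 _ "E2 l-x" 0 True]) (use 5 in \<open>auto simp: algebra_simps\<close>)
  next
   assume J: "J (Suc l) g j v (b+z)"
   then obtain x c where x: "PH True l g j v 3 x c (b+z)" using phase[OF J, of True 3] 5 by auto
   show "J (Suc l) g j v (a+z)"
    by (rule phase_step[OF x, of 0 _ "E2 l-x" 0 True]) (use 5 in \<open>auto simp: algebra_simps\<close>)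
  qed
 next
  case 6
  show ?thesis
  proof
   assume J: "J (Suc l) g j v (a+z)"
   then obtain x c where x: "PH False l g j v 3 x c (a+z)" using phase[OF J, of False 3] 6 by auto
   hence x0: "x = 0" using T_nonneg[OF conjunct2[OF x], of 0] T_nonneg[OF conjunct2[OF x], of 3] by simp
   have "HH ?U (%_. 0) (b+z)" by (rule HH_step[OF x[unfolded T_def, THEN conjunct2, THEN conjunct1]]) (auto simp: 6 x0)
   moreover have "H g j (Some True) (bump j (E2 (Suc l)) v) (b+z)" by (rule HH_step[OF conjunct1[OF x]]) (auto simp: 6 x0)
   ultimately have "T True (Suc l) g j v (b+z)" unfolding T_def Z_HH[of ?U] using x 6 by (auto simp: T_def Z_add)
   thus "J (Suc l) g j v (b+z)" by (rule T_J)
  next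
   assume J: "J (Suc l) g j v (b+z)"
   have t: "T True (Suc l) g j v (b+z)" using J_T[OF J, of True] 6 by simp
   hence "HH ?U (%_. 0) (b+z)" "Z (Suc ?U) (b+z)" "H g j (Some True) (bump j (E2 (Suc l)) v) (b+z)" using Z_HH[of ?U "b+z"] by (auto simp: T_def)
   note h = this
   have "H ?U 3 (Some False) (Vv l 3 0 0) (a+z)" by (rule HH_step[OF h(1)]) (auto simp: 6)
   moreover have "H g j None (bump j (Dv l 3 0 0) v) (a+z)" by (rule HH_step[OF h(3)]) (auto simp: 6)
   moreover have "Z (Suc ?U) (a+z)" using h(2) 6 by (simp add: Z_add)
   ultimately have "T False l ?U 3 (Vv l 3 0 0) (a+z)" "H g j None (bump j (Dv l 3 0 0) v) (a+z)" by (simp_all add: T_def)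
   thus "J (Suc l) g j v (a+z)" by (intro J.simps(2)[THEN iffD2] disjI2 exI[of _ 3] conjI exI[of _ 0] T_J) auto
  qed
 next
  case (7 i)
  show ?thesis
  proof
   assume J: "J (Suc l) g j v (a+z)"
   then obtain x c where x: "PH True l g j v 1 x c (a+z)" using phase[OF J, of True 1] 7 by auto
   have *: "i = j" using HH_D[OF conjunct1[OF x], of "oC i"] 7 by (cases "i = j") auto
   show "J (Suc l) g j v (b+z)"
    by (rule phase_step[OF x, of 1 _ x "c+1" True]) (use * 7 in \<open>auto simp: algebra_simps\<close>)
  next
   assume J: "J (Suc l) g j v (b+z)"
   then obtain x c where x: "PH True l g j v 1 x c (b+z)" using phase[OF J, of True 1] 7 by auto
   have *: "i = j" using HH_D[OF conjunct1[OF x], of "oC i"] 7 by (cases "i = j") auto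
   show "J (Suc l) g j v (a+z)"
    by (rule phase_step[OF x, of 1 _ x "c-1" True]) (use * 7 in \<open>auto simp: algebra_simps\<close>)
  qed
 qed
qed

lemma gr_sym: "(a, b) : gr K m g ==> (b, a) : gr K m g"
 by (auto simp: gr_def split: if_splits)

lemma gr_gof: "(a, b) : gr K m g ==> p :# a+b ==> g<=fst p & gof (snd p)"
 by (auto simp: gr_def ups_def bot_def split: if_splits)

lemma gr_mk: "(a, b) : gr K m g ==> EX g' c. g<=g' & (g', mk c) :# a"
proof -
 assume "(a, b) : gr K m g"
 hence "(g, mk False) :# a \<or> (g, mk True) :# a \<or> (Suc g, mk False) :# a \<or> (Suc g, mk True) :# a"
  by (auto simp: gr_def ups_def bot_def split: if_splits)
 thus ?thesis using le_SucI by blast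
qed

text \<open>A rule of a deeper level needs a control token there, which forces the running case, and
  it touches nothing on level \<open>g\<close>; so induction on the depth applies.\<close>

lemma J_gr:
 assumes "l+g = m" "g<=g'" "g'<=m" "(a, b) : gr K m g'" "J l g j v (a+z)"
 shows "J l g j v (b+z)"
 using assms(1,2,5)
proof (induct l arbitrary: g j v)
 case 0
 hence "(a, b) : bot K g Un (bot K g)\<inverse>" using assms(3,4) by (auto simp: gr_def)
 then obtain i where "a = {#(g, oS), (g, oC i)#} & b = {#(g, oF), (g, oC i), (g, oB i), (g, oB i)#} \<or> b = {#(g, oS), (g, oC i)#} & a = {#(g, oF), (g, oC i), (g, oB i), (g, oB i)#}"
  by (auto simp: bot_def)
 thus ?case
 proof (elim disjE conjE)
  assume e: "a = {#(g, oS), (g, oC i)#}" "b = {#(g, oF), (g, oC i), (g, oB i), (g, oB i)#}"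
  have t: "H g j (Some False) v (a+z)" "Z (Suc g) (a+z)" using J_T[OF 0(3), of False] e by (auto simp: T_def)
  have "i = j" using HH_D[OF t(1), of "oC i"] e by (cases "i = j") auto
  hence "H g j (Some True) (bump j 2 v) (b+z)" by (intro HH_step[OF t(1)]) (auto elim!: gofE simp: e bump_def)
  thus ?thesis using t(2) e by (simp add: Z_add)
 next
  assume e: "b = {#(g, oS), (g, oC i)#}" "a = {#(g, oF), (g, oC i), (g, oB i), (g, oB i)#}"
  have t: "H g j (Some True) (bump j 2 v) (a+z)" "Z (Suc g) (a+z)" using J_T[OF 0(3), of True] e by (auto simp: T_def)
  have "i = j" using HH_D[OF t(1), of "oC i"] e by (cases "i = j") auto
  hence "H g j (Some False) v (b+z)" by (intro HH_step[OF t(1)]) (auto elim!: gofE simp: e bump_def)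
  thus ?thesis using t(2) e by (simp add: Z_add)
 qed
next
 case (Suc l)
 show ?case
 proof (cases "g' = g")
  case True
  hence "(a, b) : ups K g \<or> (b, a) : ups K g" using assms(4) Suc(2) by (auto simp: gr_def)
  thus ?thesis using J_ups Suc(4) by blast
 next
  case False
  hence g: "Suc g<=g'" using Suc(3) by simp
  obtain g2 c where "g'<=g2" "(g2, mk c) :# a" using gr_mk[OF assms(4)] by blast
  hence "~ Z (Suc g) (a+z)" using g gof_simps(9)[of c] unfolding Z_def by (meson le_trans union_iff)
  then obtain p x c where p: "p<4" "H g j None (bump j (Dv l p x c) v) (a+z)" "J l (Suc g) p (Vv l p x c) (a+z)" using Suc(4) by auto
  have "count a (g, o') = 0" "count b (g, o') = 0" for o' using gr_gof[OF assms(4), of "(g, o')"] g by (auto simp: not_in_iff[symmetric])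
  hence "H g j None (bump j (Dv l p x c) v) (b+z)" by (intro HH_step[OF p(2)]) simp
  moreover have "J l (Suc g) p (Vv l p x c) (b+z)" by (rule Suc(1)[OF _ g p(3)]) (use Suc(2) in simp)
  ultimately show ?thesis using p(1) unfolding J.simps(2) by blast
 qed
qed

section \<open>Runs of the gadget and the net of a program\<close>

definition rch :: "('p multiset * 'p multiset) set => 'p multiset => 'p multiset => bool" where
 "rch r x y = ((x, y) : (fire r)^*)"

lemma rch_trans [trans]: "rch r x y ==> rch r y z ==> rch r x z"
 by (simp add: rch_def)

lemma rch_refl [simp]: "rch r x x"
 by (simp add: rch_def)

lemma fire_frame: "rch r x y ==> a = x+z ==> b = y+z ==> rch r a b"
 unfolding rch_def
proof (induct arbitrary: b rule: rtrancl_induct)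
 case (step y y')
 then obtain c d u where "(c, d) : r" "y = c+u" "y' = d+u" by (auto simp: fire_def)
 hence "(y+z, y'+z) : fire r" by (auto simp: fire_def add.assoc)
 thus ?case using step by (meson rtrancl_into_rtrancl)
qed simp

lemma fire_rule: "(x, y) : r ==> a = x+z ==> b = y+z ==> rch r a b"
 unfolding rch_def fire_def by (rule r_into_rtrancl) blast

definition gad :: "nat => nat => nat => (pl multiset*pl multiset) set" where
 "gad K m g = (\<Union>g'\<in>{g..m}. gr K m g')"

lemma gad_sym: "rch (gad K m g) x y ==> rch (gad K m g) y x"
 unfolding rch_def
proof (induct rule: rtrancl_induct)
 case (step y z)
 hence "(z, y) : fire (gad K m g)" unfolding fire_def gad_def using gr_sym by blast
 thus ?case using step(3) by (rule converse_rtrancl_into_rtrancl)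
qed simp

lemma fire_mono: "r<=r' ==> rch r x y ==> rch r' x y"
 unfolding rch_def
 by (erule rtrancl_mono[THEN subsetD, rotated]) (auto simp: fire_def)

text \<open>The intended run. Wherever the inner gadget removes tokens, its own forward run is read
  backwards by \<open>gad_sym\<close>. The inner calls use the selectors 0 to 3, hence
  \<open>4<=K\<close>.\<close>

lemma gadget_run:
 assumes K: "4<=K" and i: "i<K"
 shows "l+g = m ==> rch (gad K m g) {#(g, oS), (g, oC i)#} ({#(g, oF), (g, oC i)#}+replicate_mset (2^2^l) (g, oB i))"
 using i
proof (induct l arbitrary: g i)
 case 0
 hence "({#(g, oS), (g, oC i)#}, {#(g, oF), (g, oC i), (g, oB i), (g, oB i)#}) : gad K m g" by (auto simp: gad_def gr_def bot_def)
 thus ?case by (rule fire_rule[where z = "{#}"]) (simp_all add: numeral_2_eq_2)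
next
 case (Suc l)
 define E :: nat where "E = 2^2^l"
 let ?U = "Suc g" and ?R = "rch (gad K m g)" and ?c = "(g, oC i)"
 let ?B = "%j n. replicate_mset n (?U, oB j)" and ?b = "%n. replicate_mset n (g, oB i)"
 have up: "(a, b) : ups K g ==> (a, b) : gad K m g & (b, a) : gad K m g" for a b using Suc(2) by (auto simp: gad_def gr_def intro!: bexI[of _ g])
 note ru = up[THEN conjunct1, THEN fire_rule]
 have "gad K m ?U<=gad K m g" unfolding gad_def by (intro UN_mono) auto
 hence U: "?R ({#(?U, oS), (?U, oC j)#}) ({#(?U, oF), (?U, oC j)#}+?B j E)" if "j<4" for j
  using Suc(1)[of ?U j] Suc(2) that K fire_mono unfolding E_def by simp
 have inner: "?R ({#(?U, oF), (?U, oC 1), ?c#}+?B 1 n) ({#(?U, oF), (?U, oC 1), ?c#}+?B 2 n+?b n)" for n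
 proof (induct n)
  case (Suc n)
  have "?R ({#(?U, oF), (?U, oC 1), ?c#}+?B 1 (Suc n)) ({#(?U, oF), (?U, oC 1), ?c#}+?B 1 n+{#(?U, oB 2), (g, oB i)#})"
   by (rule ru[of "{#(?U, oF), (?U, oC 1), (?U, oB 1), ?c#}" "{#(?U, oF), (?U, oC 1), (?U, oB 2), ?c, (g, oB i)#}" _ "?B 1 n"])
    (use \<open>i < K\<close> in \<open>auto simp: ups_def add_mset_commute\<close>)
  moreover have "?R ({#(?U, oF), (?U, oC 1), ?c#}+?B 1 n+{#(?U, oB 2), (g, oB i)#}) ({#(?U, oF), (?U, oC 1), ?c#}+?B 2 (Suc n)+?b (Suc n))"
   by (rule fire_frame[OF Suc]) (auto simp: add_mset_commute)
  ultimately show ?case by (rule rch_trans)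
 qed simp
 have mid: "?R ({#(?U, oS), (?U, oC 1), ?c#}) ({#(?U, oF), (?U, oC 0), (?U, oB 3), ?c#}+?b E)"
 proof -
  have "?R ({#(?U, oS), (?U, oC 1), ?c#}) ({#(?U, oF), (?U, oC 1), ?c#}+?B 1 E)" by (rule fire_frame[OF U[of 1], where z = "{#?c#}"]) auto
  also note inner[of E]
  also have "?R ({#(?U, oF), (?U, oC 1), ?c#}+?B 2 E+?b E) ({#(?U, oF), (?U, oC 2), ?c#}+?B 2 E+?b E)"
   by (rule ru[of "{#(?U, oF), (?U, oC 1)#}" "{#(?U, oF), (?U, oC 2)#}" _ "{#?c#}+?B 2 E+?b E"]) (auto simp: ups_def)
  also have "?R ({#(?U, oF), (?U, oC 2), ?c#}+?B 2 E+?b E) ({#(?U, oS), (?U, oC 2), ?c#}+?b E)"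
   by (rule fire_frame[OF gad_sym[OF U[of 2]], where z = "{#?c#}+?b E"]) (auto simp: ac_simps)
  also have "?R ({#(?U, oS), (?U, oC 2), ?c#}+?b E) ({#(?U, oF), (?U, oC 0), (?U, oB 3), ?c#}+?b E)"
   by (rule ru[of "{#(?U, oS), (?U, oC 2)#}" "{#(?U, oF), (?U, oC 0), (?U, oB 3)#}" _ "{#?c#}+?b E"]) (auto simp: ups_def)
  finally show ?thesis .
 qed
 have outer: "?R ({#(?U, oF), (?U, oC 0), ?c#}+?B 0 n) ({#(?U, oF), (?U, oC 0), ?c#}+?B 3 n+?b (n*E))" for n
 proof (induct n)
  case (Suc n)
  have "?R ({#(?U, oF), (?U, oC 0), ?c#}+?B 0 (Suc n)) ({#(?U, oS), (?U, oC 1), ?c#}+?B 0 n)"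
   by (rule ru[of "{#(?U, oF), (?U, oC 0), (?U, oB 0)#}" "{#(?U, oS), (?U, oC 1)#}" _ "{#?c#}+?B 0 n"]) (auto simp: ups_def add_mset_commute)
  also have "?R ... ({#(?U, oF), (?U, oC 0), (?U, oB 3), ?c#}+?b E+?B 0 n)" by (rule fire_frame[OF mid]) auto
  also have "?R ... ({#(?U, oF), (?U, oC 0), ?c#}+?B 3 (Suc n)+?b (Suc n*E))"
   by (rule fire_frame[OF Suc, where z = "{#(?U, oB 3)#}+?b E"]) (auto simp: multiset_eq_iff)
  finally show ?case .
 qed simp
 have "?R ({#(g, oS), ?c#}) ({#(?U, oS), (?U, oC 0), ?c#})"
  by (rule ru[of "{#(g, oS)#}" "{#(?U, oS), (?U, oC 0)#}" _ "{#?c#}"]) (auto simp: ups_def)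
 also have "?R ... ({#(?U, oF), (?U, oC 0), ?c#}+?B 0 E)" by (rule fire_frame[OF U[of 0], where z = "{#?c#}"]) auto
 also note outer[of E]
 also have "?R ({#(?U, oF), (?U, oC 0), ?c#}+?B 3 E+?b (E*E)) ({#(?U, oF), (?U, oC 3), ?c#}+?B 3 E+?b (E*E))"
  by (rule ru[of "{#(?U, oF), (?U, oC 0)#}" "{#(?U, oF), (?U, oC 3)#}" _ "{#?c#}+?B 3 E+?b (E*E)"]) (auto simp: ups_def)
 also have "?R ... ({#(?U, oS), (?U, oC 3), ?c#}+?b (E*E))"
  by (rule fire_frame[OF gad_sym[OF U[of 3]], where z = "{#?c#}+?b (E*E)"]) (auto simp: ac_simps)
 also have "?R ... ({#(g, oF), ?c#}+?b (E*E))"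
  by (rule ru[of "{#(?U, oS), (?U, oC 3)#}" "{#(g, oF)#}" _ "{#?c#}+?b (E*E)"]) (auto simp: ups_def)
 finally show ?case by (simp add: E_def mult_2 power_add)
qed

text \<open>\<open>Up\<close> enters the outermost gadget at its start and leaves it at its end,
  \<open>Down\<close> does the converse. Meanwhile \<open>oU\<close> remembers the direction and the
  state to continue with.\<close>

fun er :: "nat => nat*atom option*nat => (pl multiset*pl multiset) set" where
 "er n (q, None, q') = {({#(0, oQ q)#}, {#(0, oQ q')#})}"
| "er n (q, Some (Mv c d), q') = {({#(0, oQ q), (0, oB c)#}, {#(0, oQ q'), (0, oB d)#})}"
| "er n (q, Some (Up c), q') = {({#(0, oQ q)#}, {#(0, oU True q'), (0, oS), (0, oC c)#}), ({#(0, oU True q'), (0, oF), (0, oC c)#}, {#(0, oQ q')#})}"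
| "er n (q, Some (Down c), q') = {({#(0, oQ q)#}, {#(0, oU False q'), (0, oF), (0, oC c)#}), ({#(0, oU False q'), (0, oS), (0, oC c)#}, {#(0, oQ q')#})}"
| "er n (q, Some (Read b), q') = {({#(0, oQ q), (i, oL), (i, oI b)#}, {#(0, oQ q'), (Suc i, oL), (i, oI b)#}) | i. i<n}"
| "er n (q, Some ReadEnd, q') = {({#(0, oQ q), (n, oL)#}, {#(0, oQ q'), (n, oL)#})}"

definition "NR D K n m = gad K m 0 Un \<Union> (er n ` D)"

fun areg :: "atom => nat set" where
 "areg (Mv c d) = {c, d}" | "areg (Up c) = {c}" | "areg (Down c) = {c}" | "areg _ = {}"

definition Inp :: "bool list => pl multiset" where
 "Inp w = mset (map (%j. (j, oI (w ! j))) [0..<length w])"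

definition Bm :: "nat => (nat => nat) => pl multiset" where
 "Bm K v = (\<Sum>c<K. replicate_mset (v c) (0, oB c))"

text \<open>The token \<open>oL\<close> marks the position \<open>i\<close> on the input \<open>w\<close>.\<close>

definition "Mk K w q i v = {#(0, oQ q), (i, oL)#}+Inp w+Bm K v"

lemma count_Bm: "count (Bm K v) p = (case p of (g, oB c) => if g = 0 & c<K then v c else 0 | _ => 0)"
proof -
 have "count (Bm K v) p = (\<Sum>c<K. if p = (0, oB c) then v c else 0)" by (simp add: Bm_def count_sum)
 also have "... = (case p of (g, oB c) => if g = 0 & c<K then v c else 0 | _ => 0)"
  by (cases p; cases "snd p") (auto simp: if_distrib cong: if_cong)
 finally show ?thesis .
qed

lemma in_Inp: "(p :# Inp w) = (EX j<length w. p = (j, oI (w ! j)))"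
 by (auto simp: Inp_def)

lemma in_Bm: "(p :# Bm K v) = (EX c<K. p = (0, oB c) & 0<v c)"
 by (cases p; cases "snd p") (auto simp: count_greater_zero_iff[symmetric] count_Bm simp del: count_greater_zero_iff)

lemma Bm_upd: "c<K ==> Bm K (v(c := v c+k)) = Bm K v+replicate_mset k (0, oB c)"
 by (rule multiset_eqI) (auto simp: count_Bm split: prod.splits off.splits)

definition vk :: "nat => (nat => nat) => nat => int" where
 "vk K v q = (if q<K then int (v q) else 0)"

lemma T_Bm: "T b m 0 c v ({#(0, mk b), (0, oC c)#}+Bm K v') = (ALL q. vk K v' q = (if b then bump c (E2 m) v else v) q)"
proof -
 have "Z (Suc 0) ({#(0, mk b), (0, oC c)#}+Bm K v')" by (auto simp: Z_def in_Bm)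
 moreover have "H 0 c (Some b) u ({#(0, mk b), (0, oC c)#}+Bm K v') = (ALL q. vk K v' q = u q)" for u
 proof
  assume h: "H 0 c (Some b) u ({#(0, mk b), (0, oC c)#}+Bm K v')"
  have "int (count ({#(0, mk b), (0, oC c)#}+Bm K v') (0, oB q)) = u q" for q using h gof_simps(4)[of q] unfolding HH_def by (metis tg.simps(4))
  moreover have "int (count ({#(0, mk b), (0, oC c)#}+Bm K v') (0, oB q)) = vk K v' q" for q by (simp add: count_Bm vk_def)
  ultimately show "ALL q. vk K v' q = u q" by metis
 next
  assume h: "ALL q. vk K v' q = u q"
  show "H 0 c (Some b) u ({#(0, mk b), (0, oC c)#}+Bm K v')" unfolding HH_def
  proof (intro allI impI)
   fix o' assume "gof o'"
   thus "int (count ({#(0, mk b), (0, oC c)#}+Bm K v') (0, o')) = tg (Some b) c u o'"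
    by (rule gofE) (use h[rule_format, symmetric] in \<open>auto simp: count_Bm vk_def mk_def\<close>)
  qed
 qed
 ultimately show ?thesis by (simp add: T_def)
qed

text \<open>A gadget at rest determines all of its tokens, so a call leaves no residue on deeper
  levels.\<close>

lemma T_Bm_eq:
 assumes t: "T b m 0 c v z" and z: "\<forall>p\<in>#z. gof (snd p)" and v: "!!q. vk K v' q = (if b then bump c (E2 m) v else v) q"
 shows "z = {#(0, mk b), (0, oC c)#}+Bm K v'"
proof (rule multiset_eqI)
 fix p :: pl
 have t': "T b m 0 c v ({#(0, mk b), (0, oC c)#}+Bm K v')" unfolding T_Bm using v by simp
 obtain g o' where p: "p = (g, o')" by (cases p)
 show "count z p = count ({#(0, mk b), (0, oC c)#}+Bm K v') p"
 proof (cases "g = 0 & gof o'")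
  case True
  thus ?thesis using t t' unfolding T_def HH_def p by (metis of_nat_eq_iff)
 next
  case False
  have "p ~:# x" if "T b m 0 c v x" "\<forall>p\<in>#x. gof (snd p)" for x using that False p unfolding T_def Z_def by (auto simp: Suc_le_eq)
  moreover have "\<forall>p\<in>#{#(0, mk b), (0, oC c)#}+Bm K v'. gof (snd p)" by (auto simp: in_Bm)
  ultimately show ?thesis using t t' z by (metis not_in_iff)
 qed
qed

locale pnet =
 fixes D :: "(nat*atom option*nat) set" and K m :: nat and w :: "bool list" and q0 :: nat
 assumes K: "4<=K" and D: "!!q a q'. (q, Some a, q') : D ==> areg a<={..<K}"
begin

abbreviation "Ru == NR D K (length w) m"
abbreviation "M == Mk K w"
abbreviation "P == pst D (asem (2^2^m) w)"

definition "RC q i v = (((q0, 0, %_. 0), (q, i, v)) : P^*)"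

text \<open>Either the marking represents a reachable configuration, or a call is in progress.
  \<open>Down\<close> enters the gadget at its end, so there \<open>J\<close> speaks of the contents
  diminished by \<open>E\<close>, which may be negative until the call can finish.\<close>

definition ivr :: "pl multiset => bool" where
 "ivr x = ((EX q i v. RC q i v & x = M q i v) \<or>
  (EX q i v b c q' z. RC q i v & (q, Some (if b then Up c else Down c), q') : D & x = {#(0, oU b q'), (i, oL)#}+Inp w+z &
   J m 0 c (if b then vk K v else bump c (- E2 m) (vk K v)) z & (\<forall>p\<in>#z. gof (snd p))))"

lemma er_run: "er (length w) e<=Ru" if "e : D" using that by (auto simp: NR_def)

lemma complete: "RC q' i' v' ==> rch Ru (M q0 0 (%_. 0)) (M q' i' v')"
 unfolding RC_def
proof (induct "(q', i', v')" arbitrary: q' i' v' rule: rtrancl_induct)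
 case (step y)
 obtain q i v where y: "y = (q, i, v)" by (cases y)
 obtain a where a: "(q, a, q') : D" "((i, v), (i', v')) : osem (asem (2^2^m) w) a" using step(2) y by (auto simp: pst_def)
 note fr = fire_rule[OF subsetD[OF er_run[OF a(1)]]]
 let ?E = "2^2^m :: nat"
 have gad: "rch Ru {#(0, oS), (0, oC c)#} ({#(0, oF), (0, oC c)#}+replicate_mset ?E (0, oB c))"
  "rch Ru ({#(0, oF), (0, oC c)#}+replicate_mset ?E (0, oB c)) {#(0, oS), (0, oC c)#}" if "c<K" for c
  using fire_mono[of "gad K m 0" Ru] gadget_run[OF K that, of m 0 m] gad_sym[OF gadget_run[OF K that, of m 0 m]] by (auto simp: NR_def)
 have "rch Ru (M q i v) (M q' i' v')"
 proof (cases a)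
  case None
  thus ?thesis using a(2) by (intro fr[of "{#(0, oQ q)#}" "{#(0, oQ q')#}" _ "{#(i, oL)#}+Inp w+Bm K v"]) (auto simp: Mk_def)
 next
  case (Some a')
  have cK: "areg a'<={..<K}" using D a(1) Some by blast
  show ?thesis
  proof (cases a')
   case (Mv c d)
   define u where "u = v(c := v c-1)"
   have *: "v = u(c := u c+1)" "v' = u(d := u d+1)" "i' = i" using a(2) Some Mv by (auto simp: u_def fun_eq_iff)
   have "Bm K v = Bm K u+{#(0, oB c)#}" "Bm K v' = Bm K u+{#(0, oB d)#}" unfolding * using Bm_upd[of _ K u 1] cK Mv by simp_all
   thus ?thesis using Some Mv *(3) by (intro fr[of "{#(0, oQ q), (0, oB c)#}" "{#(0, oQ q'), (0, oB d)#}" _ "{#(i, oL)#}+Inp w+Bm K u"]) (auto simp: Mk_def)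
  next
   case (Up c)
   have c: "c<K" "i' = i" "Bm K v' = Bm K v+replicate_mset ?E (0, oB c)" using cK Up a(2) Some Bm_upd[of c K v ?E] by auto
   let ?z = "{#(i, oL)#}+Inp w+Bm K v"
   have "rch Ru (M q i v) ({#(0, oU True q'), (0, oS), (0, oC c)#}+?z)" using Some Up by (intro fr[of "{#(0, oQ q)#}" _ _ ?z]) (auto simp: Mk_def)
   also have "rch Ru ... ({#(0, oU True q'), (0, oF), (0, oC c)#}+replicate_mset ?E (0, oB c)+?z)"
    by (rule fire_frame[OF gad(1)[OF c(1)], where z = "{#(0, oU True q')#}+?z"]) auto
   also have "rch Ru ... (M q' i' v')" using Some Up c
    by (intro fr[of "{#(0, oU True q'), (0, oF), (0, oC c)#}" "{#(0, oQ q')#}" _ "replicate_mset ?E (0, oB c)+?z"]) (auto simp: Mk_def)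
   finally show ?thesis .
  next
   case (Down c)
   have v': "v = v'(c := v' c+?E)" "i' = i" using Down a(2) Some by (auto simp: fun_eq_iff)
   have c: "c<K" "Bm K v = Bm K v'+replicate_mset ?E (0, oB c)" using cK Down Bm_upd[of c K v' ?E] v'(1) by auto
   let ?z = "{#(i, oL)#}+Inp w+Bm K v'"
   have "rch Ru (M q i v) ({#(0, oU False q'), (0, oF), (0, oC c)#}+replicate_mset ?E (0, oB c)+?z)"
    using Some Down c by (intro fr[of "{#(0, oQ q)#}" "{#(0, oU False q'), (0, oF), (0, oC c)#}" _ "replicate_mset ?E (0, oB c)+?z"]) (auto simp: Mk_def)
   also have "rch Ru ... ({#(0, oU False q'), (0, oS), (0, oC c)#}+?z)"
    by (rule fire_frame[OF gad(2)[OF c(1)], where z = "{#(0, oU False q')#}+?z"]) auto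
   also have "rch Ru ... (M q' i' v')" using Some Down v'(2) by (intro fr[of "{#(0, oU False q'), (0, oS), (0, oC c)#}" "{#(0, oQ q')#}" _ ?z]) (auto simp: Mk_def)
   finally show ?thesis .
  next
   case (Read b)
   have i: "i<length w" "i' = Suc i" "v' = v" "(i, oI b) :# Inp w" using a(2) Some Read by (auto simp: in_Inp)
   show ?thesis using Some Read i
    by (intro fr[of "{#(0, oQ q), (i, oL), (i, oI b)#}" "{#(0, oQ q'), (Suc i, oL), (i, oI b)#}" _ "Inp w-{#(i, oI b)#}+Bm K v"]) (auto simp: Mk_def)
  next
   case ReadEnd
   thus ?thesis using Some a(2) by (intro fr[of "{#(0, oQ q), (length w, oL)#}" "{#(0, oQ q'), (length w, oL)#}" _ "Inp w+Bm K v"]) (auto simp: Mk_def)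
  qed
 qed
 thus ?case using step(3)[OF y] rch_trans by blast
qed simp

lemma RC_step: "RC q i v ==> (q, a, q') : D ==> ((i, v), (i', v')) : osem (asem (2^2^m) w) a ==> RC q' i' v'"
 unfolding RC_def by (erule rtrancl_into_rtrancl) (auto simp: pst_def)

lemma ivrI: "RC q i v ==> (q, Some (if b then Up c else Down c), q') : D ==> J m 0 c (if b then vk K v else bump c (- E2 m) (vk K v)) z ==>
  \<forall>p\<in>#z. gof (snd p) ==> ivr ({#(0, oU b q'), (i, oL)#}+Inp w+z)"
 unfolding ivr_def by blast

text \<open>Every gadget rule consumes a token \<open>oS\<close> or \<open>oF\<close>, and none is
  present here.\<close>

lemma inv_idle:
 assumes x: "RC q i v" "a+z = M q i v" and r: "(a, b) : Ru"
 shows "ivr (b+z)"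
proof -
 have mem: "(p :# a) ==> p = (0, oQ q) \<or> p = (i, oL) \<or> p :# Inp w \<or> p :# Bm K v" for p using arg_cong[OF x(2), of "%x. p :# x"] by (auto simp: Mk_def)
 have "(a, b) ~: gad K m 0"
 proof
  assume "(a, b) : gad K m 0"
  then obtain g c where "(g, mk c) :# a" unfolding gad_def using gr_mk by blast
  thus False using mem[of "(g, mk c)"] by (cases c) (auto simp: in_Inp in_Bm)
 qed
 then obtain p e p' where e: "(p, e, p') : D" "(a, b) : er (length w) (p, e, p')" using r by (auto simp: NR_def)
 have fin: "b+z = M q' i' v' ==> ((i, v), (i', v')) : osem (asem (2^2^m) w) e ==> p = q ==> q' = p' ==> ivr (b+z)" for q' i' v'
  using RC_step[OF x(1), of e q' i' v'] e(1) unfolding ivr_def by blast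
 show ?thesis
 proof (cases e)
  case None
  thus ?thesis using e mem[of "(0, oQ p)"] x(2) by (intro fin[of p' i v]) (auto simp: in_Inp in_Bm Mk_def)
 next
  case (Some e')
  have cK: "areg e'<={..<K}" using D e(1) Some by blast
  have U: "(0, oU c q') ~:# a" for c q' using mem[of "(0, oU c q')"] by (auto simp: in_Inp in_Bm)
  have pq: "p = q" using e(2) U[of True p'] U[of False p'] mem[of "(0, oQ p)"] Some by (cases e') (auto simp: in_Inp in_Bm)
  show ?thesis
  proof (cases e')
   case (Mv c d)
   have ab: "a = {#(0, oQ p), (0, oB c)#}" "b = {#(0, oQ p'), (0, oB d)#}" using e(2) Some Mv by auto
   define u where "u = v(c := v c-1)"
   have "0<v c" using mem[of "(0, oB c)"] ab by (auto simp: in_Inp in_Bm)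
   hence *: "v = u(c := u c+1)" "(%r. v r-of_bool (r = c)+of_bool (r = d)) = u(d := u d+1)" by (auto simp: u_def fun_eq_iff)
   have B: "Bm K (u(c := u c+1)) = Bm K u+{#(0, oB c)#}" "Bm K (u(d := u d+1)) = Bm K u+{#(0, oB d)#}" using Bm_upd[of _ K u 1] cK Mv by simp_all
   have "z = {#(i, oL)#}+Inp w+Bm K u" using x(2) B(1) unfolding ab pq Mk_def *(1)[symmetric] by auto
   hence "b+z = M p' i (u(d := u d+1))" by (simp add: ab Mk_def B(2)[simplified])
   moreover have "((i, v), (i, u(d := u d+1))) : osem (asem (2^2^m) w) e" using Some Mv \<open>0 < v c\<close> *(2) by simp
   ultimately show ?thesis using fin pq by blast
  next
   case (Up c)
   have ab: "a = {#(0, oQ p)#}" "b = {#(0, oU True p'), (0, oS), (0, oC c)#}" using e(2) Some Up U[of True p'] by auto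
   have z: "z = {#(i, oL)#}+Inp w+Bm K v" using x(2) unfolding ab pq Mk_def by auto
   have "J m 0 c (vk K v) ({#(0, mk False), (0, oC c)#}+Bm K v)" by (rule T_J[OF T_Bm[of False, THEN iffD2]]) simp
   hence "ivr ({#(0, oU True p'), (i, oL)#}+Inp w+({#(0, mk False), (0, oC c)#}+Bm K v))"
    by (intro ivrI[OF x(1)]) (use e(1) Some Up pq in \<open>auto simp: in_Bm\<close>)
   thus ?thesis by (simp add: z ab add_mset_commute)
  next
   case (Down c)
   have ab: "a = {#(0, oQ p)#}" "b = {#(0, oU False p'), (0, oF), (0, oC c)#}" using e(2) Some Down U[of False p'] by auto
   have z: "z = {#(i, oL)#}+Inp w+Bm K v" using x(2) unfolding ab pq Mk_def by auto
   have "J m 0 c (bump c (- E2 m) (vk K v)) ({#(0, mk True), (0, oC c)#}+Bm K v)" by (rule T_J[OF T_Bm[of True, THEN iffD2]]) (simp add: bump_def)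
   hence "ivr ({#(0, oU False p'), (i, oL)#}+Inp w+({#(0, mk True), (0, oC c)#}+Bm K v))"
    by (intro ivrI[OF x(1)]) (use e(1) Some Down pq in \<open>auto simp: in_Bm\<close>)
   thus ?thesis by (simp add: z ab add_mset_commute)
  next
   case (Read c)
   obtain j where ab: "a = {#(0, oQ p), (j, oL), (j, oI c)#}" "b = {#(0, oQ p'), (Suc j, oL), (j, oI c)#}" "j<length w" using e(2) Some Read by auto
   have j: "j = i" "w ! i = c" "(i, oI c) :# Inp w" using mem[of "(j, oL)"] mem[of "(j, oI c)"] ab by (auto simp: in_Inp in_Bm)
   obtain I where I: "Inp w = add_mset (i, oI c) I" using j(3) by (metis insert_DiffM)
   have z: "z = I+Bm K v" using x(2) unfolding ab(1) pq Mk_def I j(1) by auto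
   show ?thesis using Some Read pq j ab z I by (intro fin[of p' "Suc i" v]) (auto simp: Mk_def)
  next
   case ReadEnd
   have ab: "a = {#(0, oQ p), (length w, oL)#}" "b = {#(0, oQ p'), (length w, oL)#}" using e(2) Some ReadEnd by auto
   have "i = length w" using mem[of "(length w, oL)"] ab by (auto simp: in_Inp in_Bm)
   thus ?thesis using Some ReadEnd pq ab x(2) by (intro fin[of p' i v]) (auto simp: Mk_def)
  qed
 qed
qed

text \<open>During a call there is no token \<open>oQ\<close>, so apart from gadget rules only the
  rule that ends the call can fire, and it finds the gadget at rest.\<close>

lemma inv_busy:
 assumes x: "RC q i v" "(q, Some (if c' then Up c else Down c), q') : D" "a+y = {#(0, oU c' q'), (i, oL)#}+Inp w+z"
  and J: "J m 0 c (if c' then vk K v else bump c (- E2 m) (vk K v)) z" and z: "\<forall>p\<in>#z. gof (snd p)" and r: "(a, b) : Ru"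
 shows "ivr (b+y)"
proof -
 have cK: "c<K" using D[OF x(2)] by (cases c') auto
 have mem: "(p :# a) ==> p = (0, oU c' q') \<or> p = (i, oL) \<or> p :# Inp w \<or> p :# z" for p using arg_cong[OF x(3), of "%x. p :# x"] by auto
 show ?thesis
 proof (cases "(a, b) : gad K m 0")
  case True
  then obtain g where g: "g<=m" "(a, b) : gr K m g" by (auto simp: gad_def)
  have ag: "gof (snd p)" if "p :# a+b" for p using gr_gof[OF g(2) that] by simp
  let ?r = "{#(0, oU c' q'), (i, oL)#}+Inp w"
  have nr: "~ gof (snd p)" if "p :# ?r" for p using that by (auto simp: in_Inp)
  have "a <=# z"
  proof (rule mset_subset_eqI)
   fix p show "count a p<=count z p"
   proof (cases "p :# a")
    case True
    hence "count ?r p = 0" using nr ag by (metis not_in_iff union_iff)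
    moreover have "count a p+count y p = count ?r p+count z p" using arg_cong[OF x(3), of "%x. count x p"] by (simp only: count_union)
    ultimately show ?thesis by linarith
   qed (simp add: not_in_iff)
  qed
  then obtain u where u: "z = a+u" by (metis subset_mset.le_iff_add)
  hence "y = ?r+u" using x(3) by (simp add: ac_simps)
  moreover have "J m 0 c (if c' then vk K v else bump c (- E2 m) (vk K v)) (b+u)" using J_gr[of m 0 m g a b] g J u by simp
  moreover have "\<forall>p\<in>#b+u. gof (snd p)" using ag z u by auto
  moreover have "b+(?r+u) = ?r+(b+u)" by (simp add: ac_simps)
  ultimately show ?thesis using ivrI[OF x(1,2)] by metis
 next
  case False
  then obtain p e p' where e: "(p, e, p') : D" "(a, b) : er (length w) (p, e, p')" using r by (auto simp: NR_def)
  have Q: "(0, oQ p) ~:# a" using mem[of "(0, oQ p)"] z[rule_format, of "(0, oQ p)"] by (auto simp: in_Inp)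
  have "EX d f. a = {#(0, oU d p'), (0, mk d), (0, oC f)#} & b = {#(0, oQ p')#}" using e(2) Q
   by (cases e; cases "the e") (auto simp: mk_def)
  then obtain d f where ab: "a = {#(0, oU d p'), (0, mk d), (0, oC f)#}" "b = {#(0, oQ p')#}" by blast
  have d: "d = c'" "p' = q'" using mem[of "(0, oU d p')"] ab z by (auto simp: in_Inp)
  have mz: "(0, mk c') :# z" "(0, oC f) :# z" using mem[of "(0, mk c')"] mem[of "(0, oC f)"] ab d by (auto simp: in_Inp mk_def)
  let ?v = "if c' then vk K v else bump c (- E2 m) (vk K v)"
  have t: "T c' m 0 c ?v z" by (rule J_T[OF J mz(1)])
  hence fc: "f = c" using HH_D[OF _ _ mz(2)] by (cases "f = c") (force simp: T_def)+
  define v' where "v' = (if c' then v(c := v c+2^2^m) else v(c := v c-2^2^m))"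
  have le: "~ c' ==> 2^2^m<=v c"
  proof -
   assume "~ c'"
   hence "0<=vk K v c-E2 m" using T_nonneg[OF t, of c] by (simp add: bump_def)
   thus "2^2^m<=v c" using cK of_nat_le_iff[of "2^2^m" "v c", where 'a = int] by (simp add: vk_def)
  qed
  have "z = {#(0, mk c'), (0, oC c)#}+Bm K v'"
   by (rule T_Bm_eq[OF t z]) (use cK le in \<open>auto simp: v'_def vk_def bump_def of_nat_diff\<close>)
  hence "b+y = M q' i v'" using x(3) unfolding ab d fc by (auto simp: Mk_def)
  moreover have "RC q' i v'" using RC_step[OF x(1,2), of i v'] le by (cases c') (auto simp: v'_def)
  ultimately show ?thesis unfolding ivr_def by blast
 qed
qed

theorem program_net: "(EX s. ((q0, 0, %_. 0), (q1, s)) : P^*) = (EX x. rch Ru (M q0 0 (%_. 0)) x & (0, oQ q1) :# x)"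
proof
 assume "EX s. ((q0, 0, %_. 0), (q1, s)) : P^*"
 then obtain i v where "RC q1 i v" unfolding RC_def by auto
 thus "EX x. rch Ru (M q0 0 (%_. 0)) x & (0, oQ q1) :# x" using complete by (auto simp: Mk_def intro!: exI[of _ "M q1 i v"])
next
 assume "EX x. rch Ru (M q0 0 (%_. 0)) x & (0, oQ q1) :# x"
 then obtain x where x: "(M q0 0 (%_. 0), x) : (fire Ru)^*" "(0, oQ q1) :# x" by (auto simp: rch_def)
 from x(1) have "ivr x"
 proof (induct rule: rtrancl_induct)
  case base
  have "RC q0 0 (%_. 0)" by (simp add: RC_def)
  thus ?case unfolding ivr_def by blast
 next
  case (step x y)
  then obtain a b z where e: "(a, b) : Ru" "x = a+z" "y = b+z" by (auto simp: fire_def)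
  from step(3) show ?case unfolding ivr_def[of x] using inv_idle inv_busy e by (elim disjE exE conjE) metis+
 qed
 thus "EX s. ((q0, 0, %_. 0), (q1, s)) : P^*" unfolding ivr_def
 proof (elim disjE exE conjE)
  fix q i v assume "RC q i v" "x = M q i v"
  thus ?thesis using x(2) unfolding RC_def by (cases "q = q1") (auto simp: Mk_def in_Inp in_Bm)
 next
  fix q' i b z assume "x = {#(0, oU b q'), (i, oL)#}+Inp w+z" "\<forall>p\<in>#z. gof (snd p)"
  thus ?thesis using x(2) by (auto simp: in_Inp)
 qed
qed

end

section \<open>Hardness\<close>

text \<open>A rule scheme \<open>(h, a, b)\<close> is instantiated at the levels \<open>g\<close> that satisfy the guard \<open>h\<close>; the place \<open>(c, d, o')\<close>
 of a scheme stands for \<open>(c * g + d, o')\<close>.\<close>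

type_synonym scheme = "nat*(nat*nat*off) list*(nat*nat*off) list"

fun ins :: "nat => nat*nat*off => pl" where
 "ins g (c, d, o') = (c*g+d, o')"

text \<open>The input length \<open>n\<close> and the depth \<open>m\<close> select instances
  through these guards, while the list of schemes is fixed by the program.\<close>

definition grd :: "nat => nat => nat => nat => bool" where
 "grd h n m g = (if h = 0 then g<m else if h = 1 then g = m else if h = 2 then g = 0 else if h = 3 then g<n else g = n)"

definition "RS ks n m = (\<Union>(h, a, b)\<in>set ks. {(mset (map (ins g) a), mset (map (ins g) b)) | g. g<=m & grd h n m g})"

lemma RSI: "g<=m ==> (h, a, b) : set ks ==> grd h n m g ==> (mset (map (ins g) a), mset (map (ins g) b)) : RS ks n m"
 unfolding RS_def by blast

lemma RS_simps: "RS [] n m = {}" "RS ((h, a, b) # ks) n m = {(mset (map (ins g) a), mset (map (ins g) b)) | g. g<=m & grd h n m g} Un RS ks n m"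
 "RS (ks@ks') n m = RS ks n m Un RS ks' n m" "RS (map f xs) n m = (\<Union>x\<in>set xs. RS [f x] n m)" "RS (concat (map F xs)) n m = (\<Union>x\<in>set xs. RS (F x) n m)"
 unfolding RS_def by auto

definition gu :: "nat => scheme list" where
 "gu K = [(0, [(1, 0, oS)], [(1, 1, oS), (1, 1, oC 0)]), (0, [(1, 1, oF), (1, 1, oC 0), (1, 1, oB 0)], [(1, 1, oS), (1, 1, oC 1)]),
  (0, [(1, 1, oF), (1, 1, oC 1)], [(1, 1, oF), (1, 1, oC 2)]), (0, [(1, 1, oS), (1, 1, oC 2)], [(1, 1, oF), (1, 1, oC 0), (1, 1, oB 3)]),
  (0, [(1, 1, oF), (1, 1, oC 0)], [(1, 1, oF), (1, 1, oC 3)]), (0, [(1, 1, oS), (1, 1, oC 3)], [(1, 0, oF)])] @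
  map (%i. (0, [(1, 1, oF), (1, 1, oC 1), (1, 1, oB 1), (1, 0, oC i)], [(1, 1, oF), (1, 1, oC 1), (1, 1, oB 2), (1, 0, oC i), (1, 0, oB i)])) [0..<K]"

definition gb :: "nat => scheme list" where
 "gb K = map (%i. (1, [(1, 0, oS), (1, 0, oC i)], [(1, 0, oF), (1, 0, oC i), (1, 0, oB i), (1, 0, oB i)])) [0..<K]"

definition gk :: "nat => scheme list" where
 "gk K = gu K@gb K"

definition inst2 :: "nat => scheme => pl multiset*pl multiset" where
 "inst2 g = (%(h, a, b). (mset (map (ins g) a), mset (map (ins g) b)))"

lemma RS_inst2: assumes "!!s. s : set ks ==> fst s = h" shows "RS ks n m = (\<Union>g\<in>{g. g<=m & grd h n m g}. inst2 g ` set ks)"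
proof -
 have "RS ks n m = (\<Union>s\<in>set ks. {inst2 g s | g. g<=m & grd (fst s) n m g})" unfolding RS_def inst2_def by (intro SUP_cong refl) auto
 also have "... = (\<Union>s\<in>set ks. {inst2 g s | g. g<=m & grd h n m g})" using assms by (intro SUP_cong refl) simp
 finally show ?thesis by auto
qed

lemma RS_gk: "RS (gk K) n m = (\<Union>g<m. ups K g) Un bot K m"
proof -
 have "inst2 g ` set (gu K) = ups K g" for g
  by (simp add: gu_def ups_def inst2_def image_image image_Un setcompr_eq_image atLeast0LessThan lessThan_def)
 moreover have "inst2 g ` set (gb K) = bot K g" for g
  by (simp add: gb_def bot_def inst2_def image_image setcompr_eq_image atLeast0LessThan lessThan_def)
 moreover have "{g. g<=m & grd 0 n m g} = {..<m}" "{g. g<=m & grd 1 n m g} = {m}" by (auto simp: grd_def)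
 moreover have "s : set (gu K) ==> fst s = 0" "s : set (gb K) ==> fst s = 1" for s by (auto simp: gu_def gb_def)
 ultimately show ?thesis using RS_inst2[of "gu K" 0 n m] RS_inst2[of "gb K" 1 n m] by (simp add: gk_def RS_simps)
qed

definition swp :: "scheme => scheme" where
 "swp = (%(h, a, b). (h, b, a))"

lemma RS_swp: "RS (map swp ks) n m = (RS ks n m)\<inverse>"
 unfolding RS_def swp_def by auto

fun ek :: "nat*atom option*nat => scheme list" where
 "ek (q, None, q') = [(2, [(0, 0, oQ q)], [(0, 0, oQ q')])]"
| "ek (q, Some (Mv c d), q') = [(2, [(0, 0, oQ q), (0, 0, oB c)], [(0, 0, oQ q'), (0, 0, oB d)])]"
| "ek (q, Some (Up c), q') = [(2, [(0, 0, oQ q)], [(0, 0, oU True q'), (0, 0, oS), (0, 0, oC c)]), (2, [(0, 0, oU True q'), (0, 0, oF), (0, 0, oC c)], [(0, 0, oQ q')])]"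
| "ek (q, Some (Down c), q') = [(2, [(0, 0, oQ q)], [(0, 0, oU False q'), (0, 0, oF), (0, 0, oC c)]), (2, [(0, 0, oU False q'), (0, 0, oS), (0, 0, oC c)], [(0, 0, oQ q')])]"
| "ek (q, Some (Read b), q') = [(3, [(0, 0, oQ q), (1, 0, oL), (1, 0, oI b)], [(0, 0, oQ q'), (1, 1, oL), (1, 0, oI b)])]"
| "ek (q, Some ReadEnd, q') = [(4, [(0, 0, oQ q), (1, 0, oL)], [(0, 0, oQ q'), (1, 0, oL)])]"

lemma RS_ek: "n<=m ==> RS (ek e) n m = er n e"
 by (cases e rule: ek.cases) (auto simp: RS_simps grd_def)

lemma NR_RS: assumes "n<=m" "set Dl = D" shows "NR D K n m = RS (gk K@map swp (gk K)@concat (map ek Dl)) n m"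
proof -
 have "gad K m 0 = (\<Union>g<m. ups K g) Un bot K m Un ((\<Union>g<m. ups K g) Un bot K m)\<inverse>"
 proof -
  have "{0..m} = insert m {..<m}" by auto
  thus ?thesis unfolding gad_def gr_def by (auto split: if_splits)
 qed
 thus ?thesis unfolding NR_def RS_simps(3,5) RS_swp RS_gk using RS_ek[OF assms(1)] assms(2) by auto
qed

fun oc :: "nat => nat => off => nat" where
 "oc K Q oS = 0" | "oc K Q oF = 1" | "oc K Q (oC j) = 2+j" | "oc K Q (oB j) = 2+K+j" | "oc K Q (oQ q) = 2+2*K+q"
| "oc K Q (oU b q) = 2+2*K+Q+2*q+of_bool b" | "oc K Q oL = 2+2*K+3*Q" | "oc K Q (oI b) = 3+2*K+3*Q+of_bool b"

fun okp :: "nat => nat => off => bool" where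
 "okp K Q (oC j) = (j<K)" | "okp K Q (oB j) = (j<K)" | "okp K Q (oQ q) = (q<Q)" | "okp K Q (oU b q) = (q<Q)" | "okp K Q _ = True"

lemma oc_inj: "okp K Q p ==> okp K Q p' ==> oc K Q p = oc K Q p' ==> p = p'"
 by (cases p; cases p') (auto simp: of_bool_def split: if_splits, presburger+)

lemma oc_less: "okp K Q p ==> oc K Q p<2*K+3*Q+5"
 by (cases p) (auto simp: of_bool_def)

locale net_code =
 fixes ks :: "scheme list" and K Q q0 q1 :: nat
 assumes ks: "ks ~= []" "!!h a b c d p. (h, a, b) : set ks ==> (c, d, p) : set a Un set b ==> c<=1 & d<=1 & okp K Q p"
  and q: "q0<Q" "q1<Q"
begin

abbreviation "St == 2*K+3*Q+5"
abbreviation "Kn == length ks"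

definition code :: "pl => nat" where
 "code p = fst p*St+oc K Q (snd p)"

definition wt :: "(nat*nat*off) list => nat => nat => nat" where
 "wt a g p = sum_list (map (%s. of_bool (code (ins g s) = p)) a)"

text \<open>Transition \<open>t\<close> is scheme \<open>t mod Kn\<close> at level
  \<open>t div Kn\<close>. Where the guard fails both weights are 0 and the transition does nothing;
  this keeps the set of transitions an interval.\<close>

definition Wm :: "bool => nat => nat => nat => nat => nat" where
 "Wm f n m t p = (case ks ! (t mod Kn) of (h, a, b) => if grd h n m (t div Kn) then wt (if f then a else b) (t div Kn) p else 0)"

definition "net n m = \<lparr>places = {..<(m+2)*St}, elementary = {..<(m+1)*Kn}, abstract = {}, cut = {}, Wminus = Wm True n m, Wplus = Wm False n m, Omega = (%_ _. 0)\<rparr>"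

definition sng :: "nat marking => nat state" where
 "sng f = \<lparr>threads = {0}, edges = {}, marking_of = (%_. f), label = (%_ _. 0)\<rparr>"

text \<open>Instances at levels up to \<open>m\<close> refer to places up to level
  \<open>Suc m\<close>.\<close>

definition sim :: "nat => nat marking => pl multiset => bool" where
 "sim m f x = (ALL g o'. g<=Suc m --> okp K Q o' --> f (code (g, o')) = count x (g, o'))"

lemma code_inj: "okp K Q (snd p) ==> okp K Q (snd p') ==> code p = code p' ==> p = p'"
proof -
 assume o: "okp K Q (snd p)" "okp K Q (snd p')" "code p = code p'"
 have dm: "code x div St = fst x & code x mod St = oc K Q (snd x)" if "okp K Q (snd x)" for x
  using oc_less[OF that] by (simp add: code_def div_mult_self3)
 show "p = p'" using dm[OF o(1)] dm[OF o(2)] o oc_inj[OF o(1,2)] by (simp add: prod_eq_iff)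
qed

lemma code_less: "okp K Q (snd p) ==> fst p<=Suc m ==> code p<(m+2)*St"
proof -
 assume "okp K Q (snd p)" "fst p<=Suc m"
 hence "code p<Suc (fst p)*St" "Suc (fst p)*St<=(m+2)*St" using oc_less[of K Q "snd p"] by (simp_all add: code_def del: mult_Suc, simp)
 thus ?thesis by (rule less_le_trans)
qed

lemma wt_count: assumes "!!c d p. (c, d, p) : set a ==> okp K Q p" "okp K Q o'" shows "wt a g (code (g', o')) = count (mset (map (ins g) a)) (g', o')"
 using assms(1)
proof (induct a)
 case (Cons s a)
 obtain c d p where s: "s = (c, d, p)" by (cases s)
 have "(code (ins g s) = code (g', o')) = (ins g s = (g', o'))" using code_inj[of "ins g s" "(g', o')"] Cons(2)[of c d p] assms(2) s by auto
 thus ?case using Cons by (auto simp: wt_def)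
qed (simp add: wt_def)

lemma wt_zero: assumes "!!c d p. (c, d, p) : set a ==> c<=1 & d<=1 & okp K Q p" "g<=m" "!!g' o'. g'<=Suc m ==> okp K Q o' ==> p0 ~= code (g', o')"
 shows "wt a g p0 = 0"
proof -
 have "code (ins g s) ~= p0" if "s : set a" for s
 proof -
  obtain c d p where s: "s = (c, d, p)" by (cases s)
  hence p: "c<=1" "d<=1" "okp K Q p" using assms(1) that by auto
  have "c*g+d<=Suc m" using p assms(2) by (cases "c = 0") (auto simp: le_Suc_eq)
  thus ?thesis using assms(3)[of "c*g+d" p] p s by auto
 qed
 thus ?thesis by (simp add: wt_def)
qed

lemma fire_sim:
 assumes x: "sim m f x"
 shows "(t<(m+1)*Kn & (ALL p<(m+2)*St. Wm True n m t p<=f p) ==> EX y. rch (RS ks n m) x y & sim m (%p. f p-Wm True n m t p+Wm False n m t p) y)"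
  and "(x, y) : fire (RS ks n m) ==> EX t<(m+1)*Kn. (ALL p<(m+2)*St. Wm True n m t p<=f p) & sim m (%p. f p-Wm True n m t p+Wm False n m t p) y"
proof -
 have Kn: "0<Kn" using ks(1) by simp
 assume t: "t<(m+1)*Kn & (ALL p<(m+2)*St. Wm True n m t p<=f p)"
 obtain h a b where k: "ks ! (t mod Kn) = (h, a, b)" by (cases "ks ! (t mod Kn)")
 hence ab: "(h, a, b) : set ks" using Kn by (metis mod_less_divisor nth_mem)
 let ?g = "t div Kn"
 have g: "?g<=m" using t less_mult_imp_div_less[of t "m+1" Kn] by simp
 show "EX y. rch (RS ks n m) x y & sim m (%p. f p-Wm True n m t p+Wm False n m t p) y"
 proof (cases "grd h n m ?g")
  case True
  let ?a = "mset (map (ins ?g) a)" and ?b = "mset (map (ins ?g) b)"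
  have W: "Wm True n m t (code (g, o')) = count ?a (g, o')" "Wm False n m t (code (g, o')) = count ?b (g, o')" if "okp K Q o'" for g o'
   using wt_count[of a o' ?g g] wt_count[of b o' ?g g] ks(2)[OF ab] that True k by (auto simp: Wm_def)
  have "?a <=# x"
  proof (rule mset_subset_eqI)
   fix p :: pl
   show "count ?a p<=count x p"
   proof (cases "p :# ?a")
    case True
    then obtain c d o' where p: "p = (c*?g+d, o')" "(c, d, o') : set a" by auto
    hence o: "c<=1" "d<=1" "okp K Q o'" using ks(2)[OF ab] by auto
    hence "fst p<=Suc m" using g p by (cases "c = 0") (auto simp: le_Suc_eq)
    thus ?thesis using t W(1)[OF o(3), of "fst p"] code_less[of p m] x o p unfolding sim_def by (cases p) fastforce
   qed (metis count_eq_zero_iff zero_le)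
  qed
  then obtain z where z: "x = ?a+z" unfolding mset_subset_eq_exists_conv by blast
  have "rch (RS ks n m) x (?b+z)" by (rule fire_rule[OF RSI[OF g ab True] z refl])
  moreover have "sim m (%p. f p-Wm True n m t p+Wm False n m t p) (?b+z)" using x W z by (auto simp: sim_def)
  ultimately show ?thesis by blast
 next
  case False
  thus ?thesis using x k by (intro exI[of _ x]) (auto simp: Wm_def)
 qed
next
 have Kn: "0<Kn" using ks(1) by simp
 assume "(x, y) : fire (RS ks n m)"
 then obtain g h a b z where r: "g<=m" "(h, a, b) : set ks" "grd h n m g" "x = mset (map (ins g) a)+z" "y = mset (map (ins g) b)+z"
  unfolding fire_def RS_def by auto
 then obtain k where k: "k<Kn" "ks ! k = (h, a, b)" by (metis in_set_conv_nth)
 define t where "t = g*Kn+k"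
 have t: "t div Kn = g" "t mod Kn = k" using k ks(1) by (simp_all add: t_def div_mult_self3)
 have "t<Suc g*Kn" using k by (simp add: t_def)
 also have "... <= (m+1)*Kn" using r by (intro mult_le_mono1) simp
 finally have tl: "t<(m+1)*Kn" .
 have W: "Wm True n m t (code (g', o')) = count (mset (map (ins g) a)) (g', o')" "Wm False n m t (code (g', o')) = count (mset (map (ins g) b)) (g', o')" if "okp K Q o'" for g' o'
  using wt_count[of a o' g g'] wt_count[of b o' g g'] ks(2)[OF r(2)] that r(3) k by (auto simp: Wm_def t)
 have "Wm True n m t p<=f p" for p
 proof (cases "EX g' o'. g'<=Suc m & okp K Q o' & p = code (g', o')")
  case True
  thus ?thesis using W x r(4) by (auto simp: sim_def)
 next
  case False
  hence "wt a g p = 0" using ks(2)[OF r(2) UnI1] by (intro wt_zero[OF _ r(1)]) blast+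
  thus ?thesis by (simp add: Wm_def t k)
 qed
 moreover have "sim m (%p. f p-Wm True n m t p+Wm False n m t p) y" using x W r(4,5) by (auto simp: sim_def)
 ultimately show "EX t<(m+1)*Kn. (ALL p<(m+2)*St. Wm True n m t p<=f p) & sim m (%p. f p-Wm True n m t p+Wm False n m t p) y" using tl by blast
qed

text \<open>Without abstract and cut transitions the state remains the single thread 0, so covering
  the target is a statement about one place.\<close>

lemma coverable_net:
 assumes "sim m f x0"
 shows "coverable (net n m) (sng f) (sng (%p. of_bool (p = code (0, oQ q1)))) = (EX x. rch (RS ks n m) x0 x & (0, oQ q1) :# x)" (is "coverable ?N ?s ?f = _")
proof -
 have le: "state_le ?N ?f s = ((0, oQ q1) :# x)" if s: "threads s = {0}" "edges s = {}" "sim m (marking_of s 0) x" for s x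
 proof -
  have "marking_of s 0 (code (0, oQ q1)) = count x (0, oQ q1)" "code (0, oQ q1)<(m+2)*St" using s(3) q code_less[of "(0, oQ q1)" m] by (auto simp: sim_def)
  moreover have "state_le ?N ?f s = marking_le ?N (marking_of ?f 0) (marking_of s 0)"
   using s(1,2) unfolding state_le_def is_empty_tree_def by (auto simp: sng_def)
  ultimately show ?thesis by (auto simp: marking_le_def sng_def net_def of_bool_def)
 qed
 have 1: "firing_sequence ?N ?s sg U s ==> threads s = {0} & edges s = {} & (EX x. rch (RS ks n m) x0 x & sim m (marking_of s 0) x)" for sg U s
 proof (induct rule: firing_sequence.induct)
  case firing_Nil
  thus ?case using assms by (auto simp: sng_def intro!: exI[of _ x0])
 next
  case (firing_snoc sg U s a s')
  then obtain x where x: "threads s = {0}" "edges s = {}" "rch (RS ks n m) x0 x" "sim m (marking_of s 0) x" by blast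
  from firing_snoc(3) show ?case
  proof cases
   case (fire_elementary t v)
   hence t: "v = 0" "t<(m+1)*Kn & (ALL p<(m+2)*St. Wm True n m t p<=marking_of s 0 p)" using x(1) by (auto simp: net_def enabled_def marking_le_def)
   obtain y where "rch (RS ks n m) x y" "sim m (%p. marking_of s 0 p-Wm True n m t p+Wm False n m t p) y" using fire_sim(1)[OF x(4) t(2)] by blast
   moreover have "marking_of s' 0 = (%p. marking_of s 0 p-Wm True n m t p+Wm False n m t p)" "threads s' = {0}" "edges s' = {}"
    using fire_elementary(2) t(1) x by (simp_all add: net_def)
   ultimately show ?thesis using x(3) rch_trans by metis
  qed (auto simp: net_def)
 qed
 have 2: "rch (RS ks n m) x0 x ==> EX sg U s. firing_sequence ?N ?s sg U s & threads s = {0} & edges s = {} & sim m (marking_of s 0) x" for x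
  unfolding rch_def
 proof (induct rule: rtrancl_induct)
  case base
  show ?case using firing_Nil[of ?N ?s] assms by (intro exI conjI) (auto simp: sng_def)
 next
  case (step x y)
  then obtain sg U s where s: "firing_sequence ?N ?s sg U s" "threads s = {0}" "edges s = {}" "sim m (marking_of s 0) x" by blast
  obtain t where t: "t<(m+1)*Kn" "ALL p<(m+2)*St. Wm True n m t p<=marking_of s 0 p" "sim m (%p. marking_of s 0 p-Wm True n m t p+Wm False n m t p) y"
   using fire_sim(2)[OF s(4) step(2)] by blast
  let ?s' = "s\<lparr>marking_of := (marking_of s)(0 := %p. marking_of s 0 p-Wminus ?N t p+Wplus ?N t p)\<rparr>"
  have "fires ?N U s (0, t) ?s'"
   using t s(2) by (intro fires.intros) (auto simp: net_def enabled_def marking_le_def)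
  from firing_snoc[OF s(1) this] have "firing_sequence ?N ?s (sg@[(0, t)]) (U Un threads ?s') ?s'" .
  moreover have "threads ?s' = {0}" "edges ?s' = {}" "sim m (marking_of ?s' 0) y" using s(2,3) t(3) by (simp_all add: net_def)
  ultimately show ?case by blast
 qed
 show ?thesis unfolding coverable_def using 1 2 le by metis
qed

end

text \<open>A fixed finite table is unrolled into nested conditionals.\<close>

lemma Comp_nth: "(!!k. k : set ks ==> Comp rho (F k)) ==> Comp rho i ==> Comp rho (%e. if i e<length ks then F (ks ! i e) e else 0)"
proof (induct ks arbitrary: i)
 case (Cons k ks)
 have eq: "(if i e<length (k # ks) then F ((k # ks) ! i e) e else 0) = (if i e = 0 then F k e else if i e-1<length ks then F (ks ! (i e-1)) e else 0)" for e
  by (cases "i e") auto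
 have 1: "Comp rho (%e. if i e-1<length ks then F (ks ! (i e-1)) e else 0)" using Cons by (intro Cons(1) Comp_minus Comp_const) auto
 have 2: "Comp rho (F k)" using Cons(2) by simp
 show ?case unfolding eq by (intro Comp_if CompB_eq Comp_const Cons(3) 2 1)
qed (simp add: Comp_const)

lemma Comp_sum_list: "(!!x. x : set xs ==> Comp rho (f x)) ==> Comp rho (%e. sum_list (map (%x. f x e) xs))"
 by (induct xs) (auto intro: Comp_const Comp_add)

lemma Comp_grd: "Comp rho n ==> Comp rho m ==> Comp rho g ==> CompB rho (%e. grd h (n e) (m e) (g e))"
 unfolding grd_def by (rule Comp_rules | assumption)+

text \<open>Unique readability; the remainders \<open>u\<close> and \<open>v\<close> are carried
  along so that concatenated codes can be taken apart from the left.\<close>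

lemma enc_list_inj:
 assumes "!!x y u v. x : set xs ==> y : set ys ==> e x@u = e' y@v ==> P x y & u = v" "enc_list e xs@u = enc_list e' ys@v"
 shows "list_all2 P xs ys & u = v"
 using assms
proof (induct xs arbitrary: ys)
 case Nil
 thus ?case by (cases ys) (auto simp: enc_list_def)
next
 case (Cons x xs)
 then obtain y zs where ys: "ys = y # zs" by (cases ys) (auto simp: enc_list_def)
 have "e x@(enc_list e xs@u) = e' y@(enc_list e' zs@v)" using Cons(3) by (simp add: ys enc_list_def)
 hence "P x y & enc_list e xs@u = enc_list e' zs@v" by (intro Cons(2)) (simp_all add: ys)
 thus ?case using Cons(1)[of zs] Cons(2) ys by auto
qed

lemma bits_inj: "bits a = bits b ==> a = b"
proof (induct a arbitrary: b rule: less_induct)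
 case (less a)
 show ?case
 proof (cases "a = 0 \<or> b = 0")
  case True
  thus ?thesis using less(2) bits.simps[of a] bits.simps[of b] by (auto split: if_splits)
 next
  case False
  hence "odd a = odd b" "bits (a div 2) = bits (b div 2)" using less(2) bits_rec[of a] bits_rec[of b] by auto
  thus ?thesis using less(1)[of "a div 2" "b div 2"] False by (metis bot_nat_0.not_eq_extremum dvd_mult_div_cancel div_less_dividend odd_two_times_div_two_succ one_less_numeral_iff semiring_norm(76))
 qed
qed

lemma enc_nat_inj: "enc_nat a@u = enc_nat b@v ==> a = b & u = v"
 unfolding enc_nat_def using enc_list_inj[of "bits a" "bits b" "%b. [b]" "%b. [b]" "(=)" u v] bits_inj by (auto simp: list.rel_eq)

lemma enc_set_inj:
 assumes "finite S" "finite S'" "enc_set e S@u = enc_set e' S'@v" "!!a u v. a : S ==> a : S' ==> e a@u = e' a@v ==> P a & u = v"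
 shows "S = S' & (ALL a:S. P a) & u = v"
proof -
 have "list_all2 (%a b. a = b & P a) (sorted_list_of_set S) (sorted_list_of_set S') & u = v"
 proof (rule enc_list_inj[OF _ assms(3)[unfolded enc_set_def]])
  fix a b u v assume ab: "a : set (sorted_list_of_set S)" "b : set (sorted_list_of_set S')" "(enc_nat a@e a)@u = (enc_nat b@e' b)@v"
  hence "a = b & e a@u = e' b@v" using enc_nat_inj[of a "e a@u" b "e' b@v"] by simp
  thus "(a = b & P a) & u = v" using assms(4)[of a u v] ab(1,2) assms(1,2) by auto
 qed
 moreover from this have "sorted_list_of_set S = sorted_list_of_set S'" by (auto simp: list_all2_conv_all_nth list_eq_iff_nth_eq)
 ultimately show ?thesis using assms(1,2) by (metis (mono_tags, lifting) list_all2_conv_all_nth in_set_conv_nth set_sorted_list_of_set)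
qed

lemma enc_marking_inj:
 assumes "finite (places N)" "places N' = places N" "enc_marking N f@u = enc_marking N' f'@v"
 shows "(ALL p:places N. f p = f' p) & u = v"
proof -
 have "list_all2 (%p p'. f p = f' p') (sorted_list_of_set (places N)) (sorted_list_of_set (places N)) & u = v"
  by (rule enc_list_inj[OF _ assms(3)[unfolded enc_marking_def assms(2)]]) (auto dest: enc_nat_inj)
 thus ?thesis using assms(1) by (simp add: list_all2_same)
qed

lemma enc_state_inj:
 assumes N: "is_rpn N" "places N' = places N" and s: "is_state N s" "is_state N' s'" and e: "enc_state N s@u = enc_state N' s'@v" and r: "srep A y j N s"
 shows "srep A y j N' s' & u = v"
proof -
 have fin: "finite (threads s) & edges s<=threads s \<times> threads s" "finite (threads s') & edges s'<=threads s' \<times> threads s'"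
  using s by (auto simp: is_state_def is_empty_tree_def rooted_tree_def)
 have fp: "finite (places N)" using N by (simp add: is_rpn_def)
 have fe: "finite {w. (a, w) : edges s}" "finite {w. (a, w) : edges s'}" for a
  using fin by (auto intro: finite_subset[of _ "threads s"] finite_subset[of _ "threads s'"])
 let ?P = "%a. (ALL p:places N. marking_of s a p = marking_of s' a p) & {w. (a, w) : edges s} = {w. (a, w) : edges s'} & (ALL w:{w. (a, w) : edges s}. ALL p:places N. label s (a, w) p = label s' (a, w) p)"
 have "threads s = threads s' & (ALL a:threads s. ?P a) & u = v"
 proof (rule enc_set_inj[OF _ _ e[unfolded enc_state_def]])
  fix a u v assume "(enc_marking N (marking_of s a)@enc_set (%w. enc_marking N (label s (a, w))) {w. (a, w) : edges s})@u =
   (enc_marking N' (marking_of s' a)@enc_set (%w. enc_marking N' (label s' (a, w))) {w. (a, w) : edges s'})@v"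
  hence 1: "(ALL p:places N. marking_of s a p = marking_of s' a p) & enc_set (%w. enc_marking N (label s (a, w))) {w. (a, w) : edges s}@u = enc_set (%w. enc_marking N' (label s' (a, w))) {w. (a, w) : edges s'}@v"
   unfolding append.assoc by (rule enc_marking_inj[OF fp N(2)])
  from enc_set_inj[OF fe 1[THEN conjunct2], of "%w. ALL p:places N. label s (a, w) p = label s' (a, w) p"] 1
  show "?P a & u = v" using enc_marking_inj[OF fp N(2)] by blast
 qed (use fin in auto)
 hence t: "threads s = threads s'" "!!a. a : threads s ==> ?P a" "u = v" by blast+
 have "((a, w) : edges s) = ((a, w) : edges s')" for a w using t(1) t(2)[of a] fin by blast
 hence ed: "edges s = edges s'" by auto
 have "ALL (a, w):edges s. ALL p:places N. label s (a, w) p = label s' (a, w) p" using t(2) fin(1) by blast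
 thus ?thesis using r t unfolding srep_def N(2) ed[symmetric] t(1)[symmetric] by (auto simp: split_beta)
qed

text \<open>The code forgets irrelevant values, so equal words do not give equal instances. But both
  instances are represented by the same number \<open>y\<close>, and \<open>npos\<close> determines
  coverability from \<open>y\<close> alone.\<close>

lemma problem_enc:
 assumes "is_rpn N" "is_state N s0" "is_state N sf"
 shows "(enc_instance N s0 sf : coverability_problem) = coverable N s0 sf"
proof
 assume "coverable N s0 sf"
 thus "enc_instance N s0 sf : coverability_problem" using assms by (auto simp: coverability_problem_def)
next
 assume "enc_instance N s0 sf : coverability_problem"
 then obtain N' s0' sf' where x: "enc_instance N s0 sf = enc_instance N' s0' sf'" "is_rpn N'" "is_state N' s0'" "is_state N' sf'" "coverable N' s0' sf'"
  by (auto simp: coverability_problem_def)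
 define n where "n = length (enc_instance N s0 sf)"
 define A :: nat where "A = 2^(n+1)"
 obtain y where y: "nrep A y N" "srep A y 0 N s0" "srep A y 1 N sf" using enc_bounds[OF _ assms A_def] n_def by auto
 have fin: "finite (places N)" "finite (places N')" "finite (elementary N)" "finite (elementary N')" "finite (abstract N)" "finite (abstract N')"
  "finite (cut N)" "finite (cut N')" using assms(1) x(2) by (auto simp: is_rpn_def)
 let ?C = "%N s0 sf. enc_set (%t. enc_marking N (Wminus N t)) (cut N)@enc_state N s0@enc_state N sf"
 let ?A = "%N s0 sf. enc_set (%t. enc_marking N (Wminus N t)@enc_marking N (Wplus N t)@enc_marking N (Omega N t)) (abstract N)@?C N s0 sf"
 note x1 = x(1)[unfolded enc_instance_def enc_rpn_def append.assoc]
 from enc_set_inj[OF fin(1,2) x1, of "%_. True"] have pl: "places N' = places N" and x2: "enc_set (%t. enc_marking N (Wminus N t)@enc_marking N (Wplus N t)) (elementary N) @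
  ?A N s0 sf =
  enc_set (%t. enc_marking N' (Wminus N' t)@enc_marking N' (Wplus N' t)) (elementary N') @
  ?A N' s0' sf'"
  by simp_all
 let ?m = "%f f'. ALL p:places N. f p = f' p"
 note mi = enc_marking_inj[OF fin(1) pl]
 have el: "elementary N = elementary N' & (ALL t:elementary N. ?m (Wminus N t) (Wminus N' t) & ?m (Wplus N t) (Wplus N' t)) &
  ?A N s0 sf =
  ?A N' s0' sf'"
  by (rule enc_set_inj[OF fin(3,4) x2]) (metis append.assoc mi)
 have ab: "abstract N = abstract N' & (ALL t:abstract N. ?m (Wminus N t) (Wminus N' t) & ?m (Wplus N t) (Wplus N' t) & ?m (Omega N t) (Omega N' t)) &
  ?C N s0 sf = ?C N' s0' sf'"
 proof (rule enc_set_inj[OF fin(5,6) el[THEN conjunct2, THEN conjunct2]])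
  fix t u v assume h: "(enc_marking N (Wminus N t)@enc_marking N (Wplus N t)@enc_marking N (Omega N t))@u = (enc_marking N' (Wminus N' t)@enc_marking N' (Wplus N' t)@enc_marking N' (Omega N' t))@v"
  note h1 = mi[OF h[unfolded append.assoc]]
  note h2 = mi[OF h1[THEN conjunct2]]
  show "(?m (Wminus N t) (Wminus N' t) & ?m (Wplus N t) (Wplus N' t) & ?m (Omega N t) (Omega N' t)) & u = v"
   using h1 h2 mi[OF h2[THEN conjunct2]] by blast
 qed
 have cu: "cut N = cut N' & (ALL t:cut N. ?m (Wminus N t) (Wminus N' t)) & enc_state N s0@enc_state N sf = enc_state N' s0'@enc_state N' sf'"
  by (rule enc_set_inj[OF fin(7,8) ab[THEN conjunct2, THEN conjunct2]]) (rule mi)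
 have s0: "srep A y 0 N' s0' & enc_state N sf = enc_state N' sf'" by (rule enc_state_inj[OF assms(1) pl assms(2) x(3) _ y(2)]) (use cu in blast)
 have "srep A y 1 N' sf' & [] = ([] :: bool list)" by (rule enc_state_inj[OF assms(1) pl assms(3) x(4) _ y(3)]) (use s0 in simp)
 moreover have "nrep A y N'" using y(1) el ab cu unfolding nrep_def pl by auto
 ultimately have y': "nrep A y N'" "srep A y 0 N' s0'" "srep A y 1 N' sf'" using s0 by blast+
 have w: "nword A y = enc_instance N s0 sf" by (rule nword[OF y])
 show "coverable N s0 sf" using npos[OF y w n_def A_def] npos[OF y' w n_def A_def] x(2-5) by simp
qed

section \<open>The reduction and its computation in polynomial time\<close>

context net_code
begin

lemma Comp_wt: "Comp rho g ==> Comp rho p ==> Comp rho (%e. wt a (g e) (p e))"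
proof -
 assume g: "Comp rho g" "Comp rho p"
 have "Comp rho (%e. of_bool (code (ins (g e) s) = p e))" for s
  by (cases s) (auto simp: code_def intro!: Comp_rules g)
 thus ?thesis unfolding wt_def by (intro Comp_sum_list)
qed

lemma Comp_Wm: assumes "Comp rho n" "Comp rho m" "Comp rho t" "Comp rho p" shows "Comp rho (%e. Wm f (n e) (m e) (t e) (p e))"
proof -
 have "Comp rho (%e. case k of (h, a, b) => if grd h (n e) (m e) (t e div Kn) then wt (if f then a else b) (t e div Kn) (p e) else 0)" for k :: scheme
 proof -
  obtain h a b where k: "k = (h, a, b)" by (cases k)
  show ?thesis unfolding k prod.case by (intro Comp_if Comp_grd Comp_wt Comp_div Comp_const assms)
 qed
 moreover have "0<Kn" using ks(1) by simp
 ultimately show ?thesis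
  using Comp_nth[of ks rho "%k e. case k of (h, a, b) => if grd h (n e) (m e) (t e div Kn) then wt (if f then a else b) (t e div Kn) (p e) else 0" "%e. t e mod Kn"]
   Comp_mod[OF assms(3) Comp_const[of rho Kn]] by (simp add: Wm_def)
qed

text \<open>Initial content of the place with offset \<open>i\<close> on level \<open>g\<close>,
  where \<open>c\<close> is the input letter placed on that level, if any.\<close>

definition ent :: "bool option => nat => nat => nat" where
 "ent c g i = of_bool (g = 0 & (i = oc K Q (oQ q0) \<or> i = oc K Q oL))+(case c of None => 0 | Some b => of_bool (i = oc K Q (oI b)))"

definition blk :: "bool option => nat => bool list" where
 "blk c g = concat (map (%i. True # enc_nat (ent c g i)) [0..<St])"

definition mword :: "nat => (nat => nat) => bool list" where
 "mword m f = concat (map (%p. True # enc_nat (f p)) [0..<(m+2)*St])@[False]"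

definition nword :: "nat => nat => bool list" where
 "nword n m = concat (map (%p. True # enc_nat p) [0..<(m+2)*St])@[False] @
  concat (map (%t. True # enc_nat t@mword m (Wm True n m t)@mword m (Wm False n m t)) [0..<(m+1)*Kn])@[False, False, False]"

definition f0 :: "bool list => nat => nat" where
 "f0 x p = ent (if p div St<length x then Some (x ! (length x-Suc (p div St))) else None) (p div St) (p mod St)"

definition red :: "nat => bool list => bool list" where
 "red m x = enc_instance (net (length x) m) (sng (f0 x)) (sng (%p. of_bool (p = code (0, oQ q1))))"

lemma enc_net: "enc_rpn (net n m) = nword n m" "enc_state (net n m) (sng f) = [True]@enc_nat 0@mword m f@[False, False]"
proof -
 have m: "enc_marking (net n m) f = mword m f" for f
  unfolding mword_def by (subst enc_marking_eq[of _ "(m+2)*St"]) (auto simp: net_def intro!: arg_cong[where f = concat])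
 have e: "enc_set e {} = [False]" for e by (simp add: enc_set_def enc_list_def)
 have s: "enc_set e {0} = True # enc_nat 0@e 0@[False]" for e by (simp add: enc_set_def enc_list_def)
 have a: "enc_set e {..<k} = concat (map (%a. True # enc_nat a@e a) [0..<k])@[False]" for e k
  by (subst enc_set_eq[of _ k]) (auto intro!: arg_cong[where f = concat])
 show "enc_rpn (net n m) = nword n m" unfolding enc_rpn_def m by (simp add: net_def a e nword_def)
 show "enc_state (net n m) (sng f) = [True]@enc_nat 0@mword m f@[False, False]" unfolding enc_state_def m by (simp add: sng_def s e)
qed

lemma concat_blocks: "concat (map f [0..<k*B]) = concat (map (%g. concat (map (%i. f (g*B+i)) [0..<B])) [0..<k])"
proof (induct k)
 case (Suc k)
 have "[0..<Suc k*B] = [0..<k*B]@map (%i. k*B+i) [0..<B]" using upt_add_eq_append[of 0 "k*B" B] by (simp add: add.commute map_add_upt)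
 thus ?case using Suc by (simp add: comp_def)
qed simp

text \<open>Each input letter affects only the block of its own level, and the blocks come in the
  order of \<open>rev\<close>; this is the shape of output that \<open>polytime_I\<close>
  admits.\<close>

lemma word_f0: assumes "length x<=k"
 shows "concat (map (%p. True # enc_nat (f0 x p)) [0..<k*St]) =
  concat (map (%j. blk (Some (x ! j)) (length x-Suc j)) (rev [0..<length x]))@concat (map (%i. blk None (length x+i)) [0..<k-length x])"
proof -
 let ?n = "length x"
 have "f0 x (g*St+i) = ent (if g<?n then Some (x ! (?n-Suc g)) else None) g i" if "i<St" for g i
  using that by (simp add: f0_def div_mult_self3)
 hence "concat (map (%p. True # enc_nat (f0 x p)) [0..<k*St]) = concat (map (%g. blk (if g<?n then Some (x ! (?n-Suc g)) else None) g) [0..<k])"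
  unfolding concat_blocks blk_def by (auto intro!: arg_cong[where f = concat])
 moreover have "[0..<k] = [0..<?n]@map (%i. ?n+i) [0..<k-?n]" using upt_add_eq_append[of 0 ?n "k-?n"] assms by (simp add: map_add_upt add.commute)
 moreover have "map (%g. blk (if g<?n then Some (x ! (?n-Suc g)) else None) g) [0..<?n] = map (%j. blk (Some (x ! j)) (?n-Suc j)) (rev [0..<?n])"
  by (rule nth_equalityI) (auto simp: rev_nth Suc_diff_Suc)
 ultimately show ?thesis by (simp add: comp_def)
qed

lemma CW_mword: "Comp rho m ==> Comp (ext rho) (%e. f (fst e) (snd e)) ==> CW rho (%e. mword (m e) (f e))"
 unfolding mword_def by (rule CW_rules Comp_rules | assumption | rule Comp_lift)+

lemma CW_blk: "Comp rho g ==> CW rho (%e. blk c (g e))"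
 unfolding blk_def ent_def by (cases c; simp only: option.case; (rule CW_rules Comp_rules | assumption | rule Comp_lift)+)

lemma red_polytime:
 assumes "!!n. n<=m n" "Comp [%n. n] m"
 shows "polytime_computable (%x. red (m (length x)) x)"
proof (rule polytime_I)
 let ?F1 = "%n. nword n (m n)@[True]@enc_nat 0"
 let ?F2 = "%n. concat (map (%i. blk None (n+i)) [0..<m n+2-n])@[False, False, False, True]@enc_nat 0@mword (m n) (%p. of_bool (p = code (0, oQ q1)))@[False, False]"
 let ?G = "%b (n, j). blk (Some b) (n-Suc j)"
 have n: "Comp [%n::nat. n] (%n. n)" by (rule Comp_var) simp
 show "CW [%n. n] ?F1" unfolding nword_def
  by (rule CW_rules CW_mword Comp_rules Comp_Wm | rule n assms(2) | rule Comp_lift)+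
 show "CW [%n. n] ?F2"
  by (rule CW_rules CW_mword CW_blk Comp_rules | rule n assms(2) | rule Comp_lift)+
 have "Comp [fst, snd :: nat*nat => nat] (%p. fst p-Suc (snd p))" by (intro Comp_minus Comp_Suc Comp_var) auto
 moreover have "?G b = (%p. blk (Some b) (fst p-Suc (snd p)))" for b by auto
 ultimately have G: "CW [fst, snd] (?G b)" for b using CW_blk[of "[fst, snd]" "%p. fst p-Suc (snd p)" "Some b"] by simp
 show "CW [fst, snd] (?G False)" by (rule G)
 show "CW [fst, snd] (?G True)" by (rule G)
 fix x :: "bool list"
 have "(%j. blk (Some (x ! j)) (length x-Suc j)) = (%j. if x ! j then ?G True (length x, j) else ?G False (length x, j))" by auto
 thus "red (m (length x)) x = ?F1 (length x)@concat (map (%j. if x ! j then ?G True (length x, j) else ?G False (length x, j)) (rev [0..<length x]))@?F2 (length x)"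
  using word_f0[of x "m (length x)+2"] le_SucI[OF le_SucI[OF assms(1)[of "length x"]]] by (simp only: red_def enc_instance_def enc_net mword_def) simp
qed

lemma f0_sim: "length x<=m ==> sim m (f0 x) (Mk K (rev x) q0 0 (%_. 0))"
 unfolding sim_def
proof (intro allI impI)
 fix g o' assume o: "okp K Q o'"
 have inj: "okp K Q p ==> (oc K Q o' = oc K Q p) = (o' = p)" for p using oc_inj[OF o] by auto
 have "code (g, o') div St = g" "code (g, o') mod St = oc K Q o'" using oc_less[OF o] by (simp_all add: code_def div_mult_self3)
 hence "f0 x (code (g, o')) = of_bool (g = 0 & (o' = oQ q0 \<or> o' = oL))+of_bool (g<length x & o' = oI (x ! (length x-Suc g)))"
  using inj[of "oQ q0"] inj[of oL] inj[of "oI b" for b] q by (simp add: f0_def ent_def)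
 moreover have "count (Inp (rev x)) (g, o') = of_bool (g<length x & o' = oI (rev x ! g))"
 proof -
  have "distinct (map (%j. (j, oI (rev x ! j))) [0..<length x])" by (simp add: distinct_map inj_on_def)
  thus ?thesis unfolding Inp_def using distinct_count_atmost_1 by (auto simp: distinct_count_atmost_1)
 qed
 moreover have "Bm K (%_. 0) = {#}" by (simp add: Bm_def)
 hence "count (Mk K (rev x) q0 0 (%_. 0)) (g, o') = of_bool (g = 0 & o' = oQ q0)+of_bool (g = 0 & o' = oL)+count (Inp (rev x)) (g, o')" by (simp add: Mk_def)
 ultimately show "f0 x (code (g, o')) = count (Mk K (rev x) q0 0 (%_. 0)) (g, o')" by (cases o') (auto simp: rev_nth of_bool_def)
qed

lemma red_correct:
 assumes "length x<=m"
 shows "(red m x : coverability_problem) = (EX y. rch (RS ks (length x) m) (Mk K (rev x) q0 0 (%_. 0)) y & (0, oQ q1) :# y)"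
proof -
 have st: "is_rpn (net (length x) m)" "is_state (net (length x) m) (sng f)" for f
  by (auto simp: is_rpn_def net_def is_state_def rooted_tree_def is_root_def sng_def)
 show ?thesis unfolding coverable_net[OF f0_sim[OF assms], symmetric] red_def by (rule problem_enc) (rule st)+
qed

end

text \<open>The program, its automaton and the schemes are fixed before the input; only the length,
  the depth \<open>n^k+n+c\<close> and the initial marking vary with \<open>x\<close>.\<close>

theorem coverability_hard: "EXPSPACE_hard coverability_problem"
 unfolding EXPSPACE_hard_def
proof
 fix L assume "L : EXPSPACE"
 then obtain r k c where r: "!!x. (x : L) = (EX s. ((0, %_. 0), s) : den (asem (2^2^(length x^k+length x+c)) (rev x)) r)" by (rule EXPSPACE_program) blast
 obtain D :: "(nat*atom option*nat) set" and q0 q1 where D: "finite D" "ALL P (s :: cfg) s'. ((s, s') : den P r) = (((q0, s), (q1, s')) : (pst D P)^*)"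
  using compile[of r, where 's = cfg] by (elim exE conjE)
 obtain Dl where Dl: "set Dl = D" using D(1) finite_list by blast
 let ?R = "(\<Union>(q, a, q')\<in>D. case a of None => {} | Some a => areg a)" and ?S = "insert q0 (insert q1 ((\<Union>(q, a, q')\<in>D. {q, q'})))"
 have "finite (areg a)" for a by (cases a) auto
 hence "finite ?R" "finite ?S" using D(1) by (auto split: option.splits)
 then obtain K0 Q where KQ': "ALL i:?R. i<K0" "ALL q:?S. q<Q" unfolding finite_nat_set_iff_bounded by (elim exE)
 note KQ = KQ'[THEN bspec]
 \<comment> \<open>The inner gadgets need the selectors 0 to 3, whatever registers the program
   has.\<close>
 define K where "K = K0+4"
 let ?ks = "gk K@map swp (gk K)@concat (map ek Dl)" and ?m = "%n. n^k+n+c"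
 have reg: "areg a<={..<K}" if "(q, Some a, q') : D" for q a q' using KQ(1) that by (fastforce simp: K_def)
 interpret net_code ?ks K Q q0 q1
 proof
  show "?ks ~= []" by (simp add: gk_def gu_def)
  show "q0<Q" "q1<Q" using KQ(2) by auto
  fix h a b c d p assume s: "(h, a, b) : set ?ks" "(c, d, p) : set a Un set b"
  have g: "c<=1 & d<=1 & okp K Q p" if "(h, a, b) : set (gk K)" "(c, d, p) : set a Un set b" for h a b c d p
   using that unfolding gk_def gu_def gb_def by (auto simp: K_def)
  have e: "c<=1 & d<=1 & okp K Q p" if "e : D" "(h, a, b) : set (ek e)"  "(c, d, p) : set a Un set b" for h a b c d p e
  proof -
   obtain q z q' where e: "e = (q, z, q')" by (cases e)
   have "q<Q" "q'<Q" using KQ(2) that(1) e by auto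
   moreover have "areg w<={..<K}" if "z = Some w" for w using reg \<open>e : D\<close> e that by blast
   ultimately show ?thesis using that(2,3) unfolding e by (cases z; cases "the z") auto
  qed
  from s(1) consider "(h, a, b) : set (gk K)" | "(h, b, a) : set (gk K)" | e where "e : D" "(h, a, b) : set (ek e)" using Dl by (auto simp: swp_def)
  thus "c<=1 & d<=1 & okp K Q p" using g s(2) e by cases blast+
 qed
 have "(x : L) = (red (?m (length x)) x : coverability_problem)" for x
 proof -
  interpret p: pnet D K "?m (length x)" "rev x" q0 using reg by unfold_locales (auto simp: K_def)
  have "(x : L) = (EX s. ((q0, 0, %_. 0), (q1, s)) : (pst D (asem (2^2^?m (length x)) (rev x)))^*)" unfolding r using D(2) by simp
  also have "... = (red (?m (length x)) x : coverability_problem)" unfolding p.program_net by (subst red_correct) (simp_all add: NR_RS[OF _ Dl])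
  finally show ?thesis .
 qed
 moreover have "polytime_computable (%x. red (?m (length x)) x)"
  by (rule red_polytime) (simp, intro Comp_add Comp_power_const Comp_const Comp_var, simp_all)
 ultimately show "polytime_reducible L coverability_problem" unfolding polytime_reducible_def by blast
qed

theorem theorem6:
 shows "EXPSPACE_complete coverability_problem"
 unfolding EXPSPACE_complete_def using coverability_EXPSPACE coverability_hard by blast

end
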